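(* Let $\xi \in \mathcal{D}_1$ and let $N$, $M$ be arbitrary non-negative integers. Let $\mu$ and $\nu$ be complex numbers satisfying $|\Re\mu | <\min \left( N + \frac{1}{2},M + \frac{1}{2} \right)$ and $\Re\nu > \max \left( N - \frac{1}{2},M - \frac{1}{2} \right)$. Then there exist remainder terms $R_N^{(P1)} (\xi ,\mu ,\nu )$ and $R_M^{(P2)} (\xi ,\mu ,\nu )$ such that $$\begin{aligned} P_\nu ^\mu (\cosh \xi ) =\; & \frac{e^{ \left(\nu+\frac{1}{2} \right)\xi}}{\Gamma (\nu - \mu + 1)\sqrt{2\pi \sinh \xi}} \left( \sum_{n = 0}^{N - 1} a_n (\mu ) \Gamma \left( \nu - n + \tfrac{1}{2} \right) \left( \frac{-e^{ - \xi } }{\sinh \xi } \right)^n + R_N^{(P1)} (\xi ,\mu ,\nu ) \right)\\ & + \frac{C(\xi ,\mu ) e^{- \left(\nu+\frac{1}{2} \right)\xi}}{\Gamma (\nu - \mu + 1)\sqrt{2\pi \sinh \xi}} \left( \sum_{m = 0}^{M - 1} a_m (\mu ) \Gamma \left( \nu - m + \tfrac{1}{2} \right)\left( \frac{e^\xi }{\sinh \xi} \right)^m + R_M^{(P2)} (\xi ,\mu ,\nu ) \right),\end{aligned}$$ and the remainder terms satisfy the estimates $$\begin{aligned}\left| R_N^{(P1)} (\xi ,\mu ,\nu ) \right| \le \; & \left|\frac{ \cos (\pi \mu ) }{ \cos (\pi \Re\mu ) }\right|\left| a_N (\Re\mu ) \right| \Gamma \left( \Re\nu - N + \tfrac{1}{2}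 \right) \left| \frac{e^{ - \xi } }{\sinh \xi } \right|^N \\ & \times \begin{cases} 1 & \text{if } \Re (e^{2\xi } ) \le 1, \\ \min\left(\left| 1 - e^{ - 2\xi } \right|\left| \csc (2\Im\xi ) \right|,\,1 + \chi\left(N+\tfrac{1}{2}\right)\right) & \text{if } \Re (e^{2\xi } ) > 1, \end{cases}\end{aligned}$$ and $$\left| R_M^{(P2)} (\xi ,\mu ,\nu ) \right| \le \left|\frac{\cos (\pi \mu )}{\cos (\pi \Re\mu )}\right|\left|a_M (\Re\mu )\right|\Gamma \left( \Re\nu - M + \tfrac{1}{2} \right)\left| \frac{e^\xi}{\sinh \xi } \right|^M .$$ If $2\Re\mu $ is an odd integer, then the limiting values have to be taken in these bounds. The square roots are positive for positive real $\xi$ and are defined by continuity elsewhere. In addition, $R_M^{(P2)} (\xi ,\mu ,\nu )$ does not exceed the corresponding first neglected term $a_M(\mu)\Gamma(\nu-M+\frac12)\left(\frac{e^\xi}{\sinh\xi}\right)^M$ in absolute value and has the same sign, provided that $\xi$ is positive, $\mu$ and $\nu$ are real, $|\mu| <M + \frac{1}{2}$ and $\nu > M - \frac{1}{2}$.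
   Context: $\mathcal{D}_1=\{\xi\in\mathbb{C} : \Re \xi>0,\ |\Im \xi |<\pi\}$; $\cosh$ maps $\mathcal{D}_1$ biholomorphically onto $\mathbb{C}\setminus(-\infty,1]$. The associated Legendre function of the first kind is $P_\nu ^\mu (z) = \left(\frac{z + 1}{z - 1}\right)^{\mu /2}\mathbf{F}\left(\nu+1,-\nu;1-\mu;\frac{1-z}{2}\right)$ for $z\in\mathbb{C}\setminus(-\infty,1]$, where the power has its principal branch (positive base for $z>1$) and $\mathbf{F}(a,b;c;w)$ is the regularised hypergeometric function, $\mathbf{F}(a,b;c;w)=\sum_{n\ge 0}\frac{(a)_n(b)_n}{\Gamma(c+n)\,n!}w^n$ for $|w|<1$, continued analytically to $w\in\mathbb{C}\setminus[1,+\infty)$. $a_n (\mu ) = \frac{(4\mu ^2 - 1^2 )(4\mu ^2 - 3^2 ) \cdots (4\mu ^2 - (2n - 1)^2 )}{8^n n!}=\frac{(\frac12-\mu)_n(\frac12+\mu)_n}{(-2)^n n!}$, with $(\cdot)_n$ the Pochhammer symbol. $C(\xi ,\mu ) = \sin (\pi \mu )$ if $\xi > 0$, and $C(\xi,\mu)=\pm i\, e^{ \mp \pi i\mu }$ if $0<\pm \Im\xi < \pi$. $\chi(p)= \frac{\sqrt\pi\,\Gamma\left(\frac{p}{2}+1\right)}{\Gamma\left(\frac{p}{2}+\frac{1}{2}\right)}$ for $p>0$. "Limiting value" means that $|a_N(\Re\mu)|/|\cos(\pi\Re\mu)|$ is replaced by $\lim_{x\to\Re\mu}|a_N(x)|/|\cos(\pi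 x)|$. When $\sin(2\Im\xi)=0$, $|\csc(2\Im\xi)|$ is read as $+\infty$. *)

theory Defs
  imports "HOL-Complex_Analysis.Complex_Analysis"
begin

definition D1 :: "complex set" where
  "D1 = {\<xi>. Re \<xi> > 0 \<and> \<bar>Im \<xi>\<bar> < pi}"

definition slit_plane :: "complex set" where
  "slit_plane = - (complex_of_real ` {1..})"

text \<open>
  \<open>hyp2F1_reg\<close> is the analytic continuation of the regularised hypergeometric series
  from the unit disc to the plane cut along \<open>[1, \<infinity>)\<close>. By the lemma
  \<open>slit_plane_continuation_unique\<close> below, the choice operator only affects
  values on the cut.
\<close>

definition hyp2F1_reg_series :: "complex \<Rightarrow> complex \<Rightarrow> complex \<Rightarrow> complex \<Rightarrow> complex" where
  "hyp2F1_reg_series a b c w =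
     (\<Sum>n. pochhammer a n * pochhammer b n / fact n * rGamma (c + of_nat n) * w ^ n)"

definition hyp2F1_reg :: "complex \<Rightarrow> complex \<Rightarrow> complex \<Rightarrow> complex \<Rightarrow> complex" where
  "hyp2F1_reg a b c =
     (SOME F. F holomorphic_on slit_plane \<and> (\<forall>w. norm w < 1 \<longrightarrow> F w = hyp2F1_reg_series a b c w))"

text \<open>For \<open>z\<close> off the cut \<open>(-\<infinity>, 1]\<close> the base of the power is off \<open>(-\<infinity>, 0]\<close>.\<close>

definition legendre_P :: "complex \<Rightarrow> complex \<Rightarrow> complex \<Rightarrow> complex" where
  "legendre_P \<nu> \<mu> z =
     ((z + 1) / (z - 1)) powr (\<mu> / 2) * hyp2F1_reg (\<nu> + 1) (- \<nu>) (1 - \<mu>) ((1 - z) / 2)"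

definition a_coeff :: "nat \<Rightarrow> 'a :: field_char_0 \<Rightarrow> 'a" where
  "a_coeff n \<mu> = (\<Prod>k=1..n. 4 * \<mu>\<^sup>2 - (2 * of_nat k - 1)\<^sup>2) / (8 ^ n * fact n)"

text \<open>On \<open>D1\<close>, \<open>Im \<xi> = 0\<close> means that \<open>\<xi>\<close> is a positive real.\<close>

definition C_coeff :: "complex \<Rightarrow> complex \<Rightarrow> complex" where
  "C_coeff \<xi> \<mu> =
     (if Im \<xi> = 0 then sin (of_real pi * \<mu>)
      else if Im \<xi> > 0 then \<i> * exp (- (of_real pi * \<i> * \<mu>))
      else - \<i> * exp (of_real pi * \<i> * \<mu>))"

definition chi :: "real \<Rightarrow> real" where
  "chi p = sqrt pi * Gamma (p / 2 + 1) / Gamma (p / 2 + 1 / 2)"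

text \<open>\<open>|a\<^sub>N(x)| / |cos(\<pi> x)|\<close>, with its limiting value where the cosine vanishes.\<close>

definition a_cos_ratio :: "nat \<Rightarrow> real \<Rightarrow> real" where
  "a_cos_ratio N x =
     (if \<exists>k::int. odd k \<and> 2 * x = of_int k
      then Lim (at x) (\<lambda>t. \<bar>a_coeff N t\<bar> / \<bar>cos (pi * t)\<bar>)
      else \<bar>a_coeff N x\<bar> / \<bar>cos (pi * x)\<bar>)"

text \<open>The innermost case is the minimum with \<open>|csc (2 Im \<xi>)| = +\<infinity>\<close>.\<close>

definition P1_factor :: "nat \<Rightarrow> complex \<Rightarrow> real" where
  "P1_factor N \<xi> =
     (if Re (exp (2 * \<xi>)) \<le> 1 then 1
      else if sin (2 * Im \<xi>) = 0 then 1 + chi (real N + 1 / 2)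
      else min (norm (1 - exp (- 2 * \<xi>)) * \<bar>1 / sin (2 * Im \<xi>)\<bar>) (1 + chi (real N + 1 / 2)))"

definition P1_term :: "nat \<Rightarrow> complex \<Rightarrow> complex \<Rightarrow> complex \<Rightarrow> complex" where
  "P1_term n \<xi> \<mu> \<nu> = a_coeff n \<mu> * Gamma (\<nu> - of_nat n + 1 / 2) * (- exp (- \<xi>) / sinh \<xi>) ^ n"

definition P2_term :: "nat \<Rightarrow> complex \<Rightarrow> complex \<Rightarrow> complex \<Rightarrow> complex" where
  "P2_term n \<xi> \<mu> \<nu> = a_coeff n \<mu> * Gamma (\<nu> - of_nat n + 1 / 2) * (exp \<xi> / sinh \<xi>) ^ n"

lemma open_slit_plane: "open slit_plane"
proof -
  have "closed (complex_of_real ` {1..})"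
  proof -
    have "complex_of_real ` {1..} = {z. Re z \<ge> 1} \<inter> \<real>"
    proof (intro equalityI subsetI)
      fix z assume "z \<in> {z. Re z \<ge> 1} \<inter> \<real>"
      then show "z \<in> complex_of_real ` {1..}"
        by (intro image_eqI[of _ _ "Re z"]) (simp_all add: of_real_Re)
    qed auto
    then show ?thesis
      by (simp add: closed_Int closed_halfspace_Re_ge closed_complex_Reals)
  qed
  then show ?thesis
    by (simp add: slit_plane_def open_Compl)
qed

lemma connected_slit_plane: "connected slit_plane"
proof (rule starlike_imp_connected)
  have "closed_segment 0 z \<subseteq> slit_plane" if z: "z \<in> slit_plane" for z
  proof
    fix w assume "w \<in> closed_segment 0 z"
    then obtain u where u: "0 \<le> u" "u \<le> 1" "w = of_real u * z"
      by (auto simp: in_segment scaleR_conv_of_real)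
    show "w \<in> slit_plane"
    proof (rule ccontr)
      assume "w \<notin> slit_plane"
      then obtain t where t: "t \<ge> 1" "of_real u * z = of_real t"
        using u by (auto simp: slit_plane_def)
      then have "u > 0" using u by (cases "u = 0") auto
      then have "z = of_real (t / u)" "t / u \<ge> 1"
        using t u by (auto simp: field_simps)
      then have "z \<in> complex_of_real ` {1..}"
        by (intro image_eqI[of _ _ "t / u"]) simp_all
      then show False using z by (simp add: slit_plane_def)
    qed
  qed
  moreover have "0 \<in> slit_plane"
    by (auto simp: slit_plane_def)
  ultimately show "starlike slit_plane"
    unfolding starlike_def by blast
qed

lemma ball_subset_slit_plane: "ball 0 1 \<subseteq> slit_plane"
  by (auto simp: slit_plane_def)

lemma slit_plane_continuation_unique:
  assumes "F holomorphic_on slit_plane" "G holomorphic_on slit_plane"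
    and "\<And>w. norm w < 1 \<Longrightarrow> F w = G w" and "w \<in> slit_plane"
  shows "F w = G w"
proof (rule analytic_continuation_open[OF open_ball open_slit_plane _ connected_slit_plane
        ball_subset_slit_plane assms(1,2) _ assms(4)])
  show "F z = G z" if "z \<in> ball 0 1" for z
    using that assms(3) by simp
qed simp

text \<open>
  The principal square root is the branch of \<open>sqrt (2 \<pi> sinh \<xi>)\<close> on \<open>D1\<close> that is
  continuous and positive for positive \<open>\<xi>\<close>.
\<close>

lemma sinh_D1_notin_nonpos_Reals:
  assumes "\<xi> \<in> D1"
  shows "2 * of_real pi * sinh \<xi> \<notin> \<real>\<^sub>\<le>\<^sub>0"
proof
  assume *: "2 * of_real pi * sinh \<xi> \<in> \<real>\<^sub>\<le>\<^sub>0"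
  have \<xi>: "Re \<xi> > 0" "\<bar>Im \<xi>\<bar> < pi" using assms by (auto simp: D1_def)
  have Re: "Re (sinh \<xi>) = sinh (Re \<xi>) * cos (Im \<xi>)"
    and Im: "Im (sinh \<xi>) = cosh (Re \<xi>) * sin (Im \<xi>)"
    by (simp_all add: sinh_def cosh_def Re_exp Im_exp algebra_simps)
  have "2 * pi * Re (sinh \<xi>) \<le> 0" "2 * pi * Im (sinh \<xi>) = 0"
    using * by (simp_all add: complex_nonpos_Reals_iff)
  then have "sinh (Re \<xi>) * cos (Im \<xi>) \<le> 0" "cosh (Re \<xi>) * sin (Im \<xi>) = 0"
    unfolding Re Im using pi_gt_zero by (simp_all add: mult_le_0_iff)
  moreover have "sinh (Re \<xi>) > 0" "cosh (Re \<xi>) > 0"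
    using \<xi> by simp_all
  ultimately have "cos (Im \<xi>) \<le> 0" "sin (Im \<xi>) = 0"
    by (simp_all add: mult_le_0_iff)
  moreover have "Im \<xi> = 0"
    by (rule sin_eq_0_pi) (use \<xi> \<open>sin (Im \<xi>) = 0\<close> in linarith)+
  ultimately show False by simp
qed

lemma continuous_on_sqrt_sinh: "continuous_on D1 (\<lambda>\<xi>. csqrt (2 * of_real pi * sinh \<xi>))"
proof (rule holomorphic_on_imp_continuous_on, rule holomorphic_on_csqrt')
  show "(\<lambda>\<xi>. 2 * of_real pi * sinh \<xi>) holomorphic_on D1"
    unfolding sinh_field_def by (intro holomorphic_intros) simp
qed (rule sinh_D1_notin_nonpos_Reals)

lemma csqrt_sinh_of_real:
  assumes "x > 0"
  shows "csqrt (2 * of_real pi * sinh (of_real x)) = of_real (sqrt (2 * pi * sinh x))"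
proof -
  have "2 * of_real pi * sinh (complex_of_real x) = of_real (2 * pi * sinh x)"
    by (simp add: sinh_def exp_of_real scaleR_conv_of_real flip: of_real_minus)
  moreover have "2 * pi * sinh x \<ge> 0"
    using assms by simp
  ultimately show ?thesis
    by (metis Im_complex_of_real Re_complex_of_real csqrt_of_real_nonneg)
qed

end

theory Submission
  imports Defs "HOL-Real_Asymp.Real_Asymp"
begin

text \<open>
  The remainders are iterated Laplace and beta integrals of the terminant
  \<open>q \<mapsto> \<integral> u powr (N - 1/2) * exp (- u) / (1 + u * q) du\<close>. Expanding the geometric kernel gives
  the finite sums; elementary lower bounds for \<open>|1 + u q|\<close>, or near the cut a Laplace
  representation of the kernel, give the error bounds. For \<open>N = 0\<close> and small real \<open>\<mu>\<close>
  the remainder collapses to an Euler integral along a ray, and Cauchy's theorem in the half strip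
  \<open>Re t < 0\<close>, \<open>|Im t| < b\<close> expresses Mehler's integral for the hypergeometric function at
  \<open>\<xi> = \<plusminus>ib\<close> as the difference of two such rays. Analytic continuation in \<open>\<mu>\<close> and then
  in \<open>\<xi>\<close> yields the expansion off the real axis; on the positive axis one averages the two
  boundary values.
\<close>

section \<open>Parameter integrals\<close>

text \<open>The integral form of the remainders is forced by the coefficients:
  \<open>a_coeff n \<mu> * Gamma (\<nu> - n + 1/2)\<close> is, up to
  \<open>(-2)^n * cos (pi * \<mu>) / pi powr (3/2)\<close>, the product of the integrals for
  \<open>Gamma (n + 1/2)\<close>, \<open>Beta (n + 1/2 + \<mu>) (n + 1/2 - \<mu>)\<close> and
  \<open>Gamma (\<nu> - n + 1/2)\<close>. Under the integral signs the expansion is therefore a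
  geometric progression with ratio \<open>- 2 * u * r * (1 - r) * x / t\<close>, and its tail is the
  remainder. Every bound becomes a bound of one kernel along a ray. The points at which the
  expansion is first proved lie outside \<open>D1\<close>: at purely imaginary \<open>\<xi>\<close>
  the arguments \<open>x\<close> are \<open>1 \<plusminus> \<i> cot b\<close>, off the cut. The half
  strips \<open>0 < \<plusminus>Im \<xi> < pi\<close> contain these points as well as the two halves
  of \<open>D1\<close> off the real axis. The contour argument is restricted to
  \<open>-1/2 < \<mu> < 0\<close>, where the corner singularities have an integrable majorant
  independent of the height, and its evaluation to small \<open>b\<close>, where a power series
  identifies the integrand; continuation removes both restrictions.\<close>

lemma set_integrable_lborel_iff_absolutely_integrable:
  fixes f :: "real \<Rightarrow> 'b::euclidean_space"
  assumes "A \<in> sets borel" "continuous_on A f"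
  shows "set_integrable lborel A f \<longleftrightarrow> f absolutely_integrable_on A"
proof -
  have "(\<lambda>x. indicator A x *\<^sub>R f x) \<in> borel_measurable lborel"
    using borel_measurable_continuous_on_indicator[OF assms] by simp
  then show ?thesis
    unfolding set_integrable_def by (rule integrable_completion[symmetric])
qed

text \<open>The change-of-variables theorem speaks of absolute integrability for the completed
  measure; continuity makes both integrands Borel measurable on their sets, and for such functions
  completion changes nothing. The absolute value of \<open>h\<close> admits decreasing substitutions
  such as \<open>\<theta> \<mapsto> exp (- \<theta>) - 1\<close>.\<close>

lemma set_integral_substitution:
  fixes f :: "real \<Rightarrow> 'b::euclidean_space" and g :: "real \<Rightarrow> real"
  assumes S: "S \<in> sets borel" and T: "T \<in> sets borel" and im: "g ` S = T"
    and f: "continuous_on T f" and h: "continuous_on S h"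
    and der: "\<And>x. x \<in> S \<Longrightarrow> (g has_field_derivative h x) (at x)" and inj: "inj_on g S"
    and int: "set_integrable lborel T f"
  shows "set_integrable lborel S (\<lambda>x. \<bar>h x\<bar> *\<^sub>R f (g x))"
    and "(LINT x:S|lborel. \<bar>h x\<bar> *\<^sub>R f (g x)) = (LINT y:T|lborel. f y)"
proof -
  have cg: "continuous_on S g"
    using der by (meson DERIV_isCont continuous_at_imp_continuous_on)
  have cf: "continuous_on S (\<lambda>x. \<bar>h x\<bar> *\<^sub>R f (g x))"
    by (intro continuous_intros h continuous_on_compose2[OF f cg]) (use im in auto)
  have "f absolutely_integrable_on g ` S \<and> integral (g ` S) f = integral T f"
    using int im set_integrable_lborel_iff_absolutely_integrable[OF T f] by simp
  then have *: "(\<lambda>x. \<bar>h x\<bar> *\<^sub>R f (g x)) absolutely_integrable_on S \<and>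
      integral S (\<lambda>x. \<bar>h x\<bar> *\<^sub>R f (g x)) = integral T f"
    by (subst has_absolute_integral_change_of_variables_real)
       (use S inj der in \<open>auto intro: has_field_derivative_at_within\<close>)
  then show 1: "set_integrable lborel S (\<lambda>x. \<bar>h x\<bar> *\<^sub>R f (g x))"
    using set_integrable_lborel_iff_absolutely_integrable[OF S cf] by simp
  show "(LINT x:S|lborel. \<bar>h x\<bar> *\<^sub>R f (g x)) = (LINT y:T|lborel. f y)"
    using * set_borel_integral_eq_integral(2)[OF 1] set_borel_integral_eq_integral(2)[OF int] by simp
qed

lemma set_integrable_bound_continuous:
  fixes f :: "real \<Rightarrow> 'b::euclidean_space"
  assumes "A \<in> sets borel" "continuous_on A f" "set_integrable lborel A g"
    and "\<And>x. x \<in> A \<Longrightarrow> norm (f x) \<le> (g x :: real)"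
  shows "set_integrable lborel A f"
proof (rule set_integrable_bound[OF assms(3)])
  show "set_borel_measurable lborel A f"
    using borel_measurable_continuous_on_indicator[OF assms(1,2)] by (simp add: set_borel_measurable_def)
  show "AE x in lborel. x \<in> A \<longrightarrow> norm (f x) \<le> norm (g x)"
    using assms(4) by (intro AE_I2) force
qed

lemma set_integral_norm_bound_le:
  fixes f :: "real \<Rightarrow> 'b::euclidean_space"
  assumes "set_integrable lborel A g" and "\<And>x. x \<in> A \<Longrightarrow> norm (f x) \<le> g x"
  shows "norm (LINT x:A|lborel. f x) \<le> (LINT x:A|lborel. g x)"
proof -
  have "norm (LINT x:A|lborel. f x) \<le> (\<integral>x. norm (indicator A x *\<^sub>R f x) \<partial>lborel)"
    unfolding set_lebesgue_integral_def by (rule integral_norm_bound)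
  also have "\<dots> \<le> (LINT x:A|lborel. g x)"
    unfolding set_lebesgue_integral_def
  proof (rule integral_mono')
    show "integrable lborel (\<lambda>x. indicator A x *\<^sub>R g x)"
      using assms(1) by (simp add: set_integrable_def)
    show "norm (indicator A x *\<^sub>R f x) \<le> indicator A x *\<^sub>R g x" for x
      using assms(2)[of x] by (auto simp: indicator_def)
    show "0 \<le> indicator A x *\<^sub>R g x" for x
      using assms(2)[of x] order_trans[OF norm_ge_zero[of "f x"]] by (auto simp: indicator_def)
  qed
  finally show ?thesis .
qed

lemma set_integral_dominated_convergence:
  fixes f :: "real \<Rightarrow> 'b::euclidean_space"
  assumes A: "A \<in> sets borel" and g: "set_integrable lborel A g"
    and s: "\<And>n. set_borel_measurable lborel A (s n)"
    and b: "\<And>n x. x \<in> A \<Longrightarrow> norm (s n x) \<le> g x"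
    and l: "\<And>x. x \<in> A \<Longrightarrow> (\<lambda>n. s n x) \<longlonglongrightarrow> f x"
  shows "(\<lambda>n. LINT x:A|lborel. s n x) \<longlonglongrightarrow> (LINT x:A|lborel. f x)"
  unfolding set_lebesgue_integral_def
proof (rule integral_dominated_convergence[where w = "\<lambda>x. indicator A x *\<^sub>R g x"])
  have lim: "(\<lambda>n. indicator A x *\<^sub>R s n x) \<longlonglongrightarrow> indicator A x *\<^sub>R f x" for x
    using l[of x] by (auto simp: indicator_def)
  show "(\<lambda>x. indicator A x *\<^sub>R f x) \<in> borel_measurable lborel"
    using lim by (rule borel_measurable_LIMSEQ_metric[rotated]) (use s in \<open>simp add: set_borel_measurable_def\<close>)
  show "AE x in lborel. (\<lambda>n. indicator A x *\<^sub>R s n x) \<longlonglongrightarrow> indicator A x *\<^sub>R f x"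
    using lim by simp
  show "AE x in lborel. norm (indicator A x *\<^sub>R s n x) \<le> indicator A x *\<^sub>R g x" for n
    using b by (intro AE_I2) (auto simp: indicator_def)
qed (use g s in \<open>simp_all add: set_integrable_def set_borel_measurable_def\<close>)

text \<open>A locally uniform majorant of \<open>f\<close> itself is enough: Cauchy's inequality
  bounds the derivative in \<open>z\<close> by \<open>2 * g / r\<close> on a smaller disc, hence
  also the difference quotients, and dominated convergence yields the derivative. The holomorphy of
  all parameter integrals below rests on this.\<close>

lemma holomorphic_on_set_lebesgue_integral:
  fixes f :: "complex \<Rightarrow> real \<Rightarrow> complex"
  assumes U: "open U" and A: "A \<in> sets borel"
    and hol: "\<And>t. t \<in> A \<Longrightarrow> (\<lambda>z. f z t) holomorphic_on U"
    and meas: "\<And>z. z \<in> U \<Longrightarrow> set_borel_measurable lborel A (f z)"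
    and dom: "\<And>z. z \<in> U \<Longrightarrow> \<exists>e>0. \<exists>g. set_integrable lborel A g \<and>
                (\<forall>w\<in>ball z e \<inter> U. \<forall>t\<in>A. norm (f w t) \<le> (g t :: real))"
  shows "(\<lambda>z. LINT t:A|lborel. f z t) holomorphic_on U"
proof (subst holomorphic_on_open[OF U], intro ballI)
  fix z assume z: "z \<in> U"
  obtain e g where e: "e > 0" and g: "set_integrable lborel A g"
    and bd: "\<And>w t. w \<in> ball z e \<Longrightarrow> w \<in> U \<Longrightarrow> t \<in> A \<Longrightarrow> norm (f w t) \<le> g t"
    using dom[OF z] by auto
  obtain r0 where r0: "r0 > 0" "cball z r0 \<subseteq> U"
    using U z open_contains_cball by blast
  \<comment> \<open>Halving \<open>e\<close> keeps the closed disc of radius \<open>r\<close> inside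
    the open ball on which \<open>g\<close> dominates; Cauchy's inequality is then used on discs of
    radius \<open>r / 2\<close> centred in \<open>ball z (r / 2)\<close>.\<close>
  define r where "r = min r0 (e / 2)"
  have r: "r > 0" "cball z r \<subseteq> U" "cball z r \<subseteq> ball z e"
    using e r0 by (auto simp: r_def)
  have lip: "norm (f w t - f z t) \<le> (g t * 2 / r) * norm (w - z)" if w: "w \<in> ball z (r / 2)" and t: "t \<in> A" for w t
  proof -
    have g0: "g t \<ge> 0"
      using bd[of z t] z e t order_trans[OF norm_ge_zero[of "f z t"]] by auto
    have "norm (f w t - f z t) \<le> (g t * 2 / r) * norm (w - z)"
    proof (rule field_differentiable_bound[where S = "ball z (r / 2)" and f' = "deriv (\<lambda>z. f z t)"])
      fix y assume y: "y \<in> ball z (r / 2)"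
      have sub: "cball y (r / 2) \<subseteq> cball z r"
      proof
        fix v assume "v \<in> cball y (r / 2)"
        then show "v \<in> cball z r"
          using y dist_triangle[of z v y] by (simp add: dist_commute)
      qed
      have hb: "(\<lambda>z. f z t) holomorphic_on cball y (r / 2)"
        using hol[OF t] sub r(2) by (meson holomorphic_on_subset order_trans)
      have "norm ((deriv ^^ 1) (\<lambda>z. f z t) y) \<le> fact 1 * g t / (r / 2) ^ 1"
      proof (rule Cauchy_inequality)
        show "(\<lambda>z. f z t) holomorphic_on ball y (r / 2)"
          using hb by (meson ball_subset_cball holomorphic_on_subset)
        show "continuous_on (cball y (r / 2)) (\<lambda>z. f z t)"
          using hb by (rule holomorphic_on_imp_continuous_on)
        fix v assume "norm (y - v) = r / 2"
        then have "v \<in> cball y (r / 2)" by (simp add: dist_norm)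
        then show "norm (f v t) \<le> g t"
          using bd[of v t] t sub r(2,3) by (meson subsetD)
      qed (use r in simp)
      then show "norm (deriv (\<lambda>z. f z t) y) \<le> g t * 2 / r" by (simp add: field_simps)
      have "y \<in> ball z r" using y r by auto
      then have "((\<lambda>z. f z t) has_field_derivative deriv (\<lambda>z. f z t) y) (at y)"
        using holomorphic_derivI[OF hol[OF t] U] r(2) ball_subset_cball by blast
      then show "((\<lambda>z. f z t) has_field_derivative deriv (\<lambda>z. f z t) y) (at y within ball z (r / 2))"
        by (rule has_field_derivative_at_within)
    qed (use w r in auto)
    then show ?thesis .
  qed
  have intf: "set_integrable lborel A (f w)" if "w \<in> ball z (r / 2)" for w
  proof (rule set_integrable_bound[OF g])
    have w: "w \<in> U" "w \<in> ball z e" using that r by (auto simp: subset_iff)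
    show "set_borel_measurable lborel A (f w)" using meas w by blast
    show "AE x in lborel. x \<in> A \<longrightarrow> norm (f w x) \<le> norm (g x)"
      using bd w by (intro AE_I2) force
  qed
  define D where "D = (LINT t:A|lborel. deriv (\<lambda>z. f z t) z)"
  have "((\<lambda>w. ((LINT t:A|lborel. f w t) - (LINT t:A|lborel. f z t)) / (w - z)) \<longlongrightarrow> D) (at z)"
  proof (subst tendsto_at_iff_sequentially, intro allI impI)
    fix X :: "nat \<Rightarrow> complex"
    assume X: "\<forall>i. X i \<in> UNIV - {z}" and Xz: "X \<longlonglongrightarrow> z"
    have "\<forall>\<^sub>F n in sequentially. X n \<in> ball z (r / 2)"
      using Xz r by (intro topological_tendstoD) auto
    then obtain n0 where n0: "\<And>n. n \<ge> n0 \<Longrightarrow> X n \<in> ball z (r / 2)"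
      by (auto simp: eventually_sequentially)
    \<comment> \<open>Dominated convergence asks for bounds at every index, so the terms of
      \<open>X\<close> before it enters the ball are cut off; \<open>LIMSEQ_offset\<close> restores
      them at the end.\<close>
    define Y where "Y n = X (n + n0)" for n
    have Y: "Y n \<in> ball z (r / 2)" "Y n \<noteq> z" for n
      using n0 X by (auto simp: Y_def)
    have Yz: "Y \<longlonglongrightarrow> z"
      unfolding Y_def using Xz by (rule LIMSEQ_ignore_initial_segment)
    have "(\<lambda>n. LINT t:A|lborel. (f (Y n) t - f z t) / (Y n - z)) \<longlonglongrightarrow> D"
      unfolding D_def
    proof (rule set_integral_dominated_convergence[OF A])
      show "set_integrable lborel A (\<lambda>t. g t * 2 / r)" using g by simp
      show "set_borel_measurable lborel A (\<lambda>t. (f (Y n) t - f z t) / (Y n - z))" for n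
      proof -
        have "Y n \<in> U" using Y[of n] r by (auto simp: subset_iff)
        then have [measurable]: "(\<lambda>t. indicator A t *\<^sub>R f (Y n) t) \<in> borel_measurable lborel"
            "(\<lambda>t. indicator A t *\<^sub>R f z t) \<in> borel_measurable lborel"
          using meas z by (auto simp: set_borel_measurable_def)
        have "(\<lambda>t. indicator A t *\<^sub>R ((f (Y n) t - f z t) / (Y n - z))) =
              (\<lambda>t. (indicator A t *\<^sub>R f (Y n) t - indicator A t *\<^sub>R f z t) / (Y n - z))"
          by (auto simp: indicator_def)
        then show ?thesis unfolding set_borel_measurable_def by simp
      qed
      show "norm ((f (Y n) t - f z t) / (Y n - z)) \<le> g t * 2 / r" if "t \<in> A" for n t
        using lip[OF Y(1) that, of n] Y(2)[of n] by (simp add: norm_divide field_simps)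
      show "(\<lambda>n. (f (Y n) t - f z t) / (Y n - z)) \<longlonglongrightarrow> deriv (\<lambda>z. f z t) z" if t: "t \<in> A" for t
      proof -
        have "((\<lambda>z. f z t) has_field_derivative deriv (\<lambda>z. f z t) z) (at z)"
          using holomorphic_derivI[OF hol[OF t] U z] .
        then have "((\<lambda>w. (f w t - f z t) / (w - z)) \<longlongrightarrow> deriv (\<lambda>z. f z t) z) (at z)"
          by (simp add: has_field_derivative_iff)
        then show ?thesis
          using Y(2) Yz unfolding tendsto_at_iff_sequentially by (auto simp: o_def)
      qed
    qed
    moreover have "(LINT t:A|lborel. (f (Y n) t - f z t) / (Y n - z)) =
        ((LINT t:A|lborel. f (Y n) t) - (LINT t:A|lborel. f z t)) / (Y n - z)" for n
      using intf[OF Y(1)] intf[of z] r by simp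
    ultimately have "(\<lambda>n. ((LINT t:A|lborel. f (X (n + n0)) t) - (LINT t:A|lborel. f z t)) / (X (n + n0) - z)) \<longlonglongrightarrow> D"
      by (simp only: Y_def)
    then show "((\<lambda>w. ((LINT t:A|lborel. f w t) - (LINT t:A|lborel. f z t)) / (w - z)) \<circ> X) \<longlonglongrightarrow> D"
      unfolding o_def by (rule LIMSEQ_offset)
  qed
  then show "\<exists>f'. ((\<lambda>z. LINT t:A|lborel. f z t) has_field_derivative f') (at z)"
    by (auto simp: has_field_derivative_iff)
qed

section \<open>Gamma and beta integrals\<close>

lemma set_integrable_Gamma_real:
  assumes "x > (0::real)"
  shows "set_integrable lborel {0<..} (\<lambda>t. t powr (x - 1) * exp (- t))"
    and "(LINT t:{0<..}|lborel. t powr (x - 1) * exp (- t)) = Gamma x"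
proof -
  have c: "continuous_on {0<..} (\<lambda>t::real. t powr (x - 1) * exp (- t))"
    by (intro continuous_intros) auto
  have "(\<lambda>t. complex_of_real t powr (of_real x - 1) / of_real (exp t)) absolutely_integrable_on {0<..}"
    by (rule absolutely_integrable_Gamma_integral') (use assms in simp)
  then have "(\<lambda>t. norm (complex_of_real t powr (of_real x - 1) / of_real (exp t))) absolutely_integrable_on {0<..}"
    by (rule absolutely_integrable_norm[unfolded o_def])
  then have "(\<lambda>t. t powr (x - 1) * exp (- t)) absolutely_integrable_on {0<..}"
    by (rule set_integrable_cong[THEN iffD1, rotated 3])
       (auto simp: norm_divide norm_powr_real_powr exp_minus field_simps)
  then show 1: "set_integrable lborel {0<..} (\<lambda>t. t powr (x - 1) * exp (- t))"
    using set_integrable_lborel_iff_absolutely_integrable[OF _ c] by simp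
  have "((\<lambda>t. t powr (x - 1) / exp t) has_integral Gamma x) {0..}"
    using assms by (rule Gamma_integral_real)
  then have "((\<lambda>t. t powr (x - 1) * exp (- t)) has_integral Gamma x) {0..}"
    by (simp add: exp_minus field_simps)
  then have "((\<lambda>t. t powr (x - 1) * exp (- t)) has_integral Gamma x) {0<..}"
    by (rule has_integral_spike_set_eq[THEN iffD1, rotated 2])
       (auto intro: negligible_subset[of "{0}"])
  then show "(LINT t:{0<..}|lborel. t powr (x - 1) * exp (- t)) = Gamma x"
    using set_borel_integral_eq_integral(2)[OF 1] by (simp add: integral_unique)
qed

lemma norm_of_real_powr: "t > 0 \<Longrightarrow> norm (complex_of_real t powr z) = t powr Re z"
  by (simp add: norm_powr_real_powr)

lemma set_integral_Gamma_complex: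
  assumes "Re z > 0"
  shows "set_integrable lborel {0<..} (\<lambda>t. complex_of_real t powr (z - 1) * of_real (exp (- t)))"
    and "(LINT t:{0<..}|lborel. complex_of_real t powr (z - 1) * of_real (exp (- t))) = Gamma z"
proof -
  have c: "continuous_on {0<..} (\<lambda>t. complex_of_real t powr (z - 1) * of_real (exp (- t)))"
    by (intro continuous_intros) (auto simp: complex_nonpos_Reals_iff)
  show 1: "set_integrable lborel {0<..} (\<lambda>t. complex_of_real t powr (z - 1) * of_real (exp (- t)))"
    by (rule set_integrable_bound_continuous[OF _ c set_integrable_Gamma_real(1)[OF assms]])
       (auto simp: norm_mult norm_of_real_powr simp flip: of_real_exp)
  have "((\<lambda>t. of_real t powr (z - 1) / of_real (exp t)) has_integral Gamma z) {0<..}"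
    using assms by (rule Gamma_integral_complex')
  then have "((\<lambda>t. of_real t powr (z - 1) * of_real (exp (- t))) has_integral Gamma z) {0<..}"
    by (simp add: exp_minus field_simps)
  then show "(LINT t:{0<..}|lborel. complex_of_real t powr (z - 1) * of_real (exp (- t))) = Gamma z"
    using set_borel_integral_eq_integral(2)[OF 1] by (simp add: integral_unique)
qed

lemma set_integrable_Gamma_scaled:
  assumes x: "x > (0::real)" and a: "a > 0"
  shows "set_integrable lborel {0<..} (\<lambda>t. t powr (x - 1) * exp (- (a * t)))"
    and "(LINT t:{0<..}|lborel. t powr (x - 1) * exp (- (a * t))) = Gamma x * a powr (- x)"
proof -
  let ?f = "\<lambda>t::real. t powr (x - 1) * exp (- t)"
  have im: "(\<lambda>t. a * t) ` {0<..} = {0<..}"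
    using a by (auto simp: image_iff intro!: bexI[of _ "_ / a"])
  note sub = set_integral_substitution[of "{0<..}" "{0<..}" "\<lambda>t. a * t" ?f "\<lambda>_. a",
      OF _ _ im _ _ _ _ set_integrable_Gamma_real(1)[OF x]]
  have c: "continuous_on {0<..} ?f" by (intro continuous_intros) auto
  have inj: "inj_on (\<lambda>t. a * t) {0<..}" using a by (auto intro!: inj_onI)
  have 1: "\<bar>a\<bar> *\<^sub>R ?f (a * t) = a powr x * (t powr (x - 1) * exp (- (a * t)))" if "t \<in> {0<..}" for t
    using a that by (simp add: powr_mult powr_diff)
  have A: "set_integrable lborel {0<..} (\<lambda>t. \<bar>a\<bar> *\<^sub>R ?f (a * t))"
    and B: "(LINT t:{0<..}|lborel. \<bar>a\<bar> *\<^sub>R ?f (a * t)) = Gamma x"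
    using sub set_integrable_Gamma_real(2)[OF x] c a inj
    by (auto intro!: derivative_eq_intros)
  have "set_integrable lborel {0<..} (\<lambda>t. a powr x * (t powr (x - 1) * exp (- (a * t))))"
    using A by (rule set_integrable_cong[THEN iffD1, rotated 3]) (use 1 in auto)
  then show "set_integrable lborel {0<..} (\<lambda>t. t powr (x - 1) * exp (- (a * t)))"
    using a by (subst (asm) set_integrable_mult_right_iff) auto
  have "(LINT t:{0<..}|lborel. a powr x * (t powr (x - 1) * exp (- (a * t)))) = Gamma x"
    unfolding B[symmetric] by (rule set_lebesgue_integral_cong) (use 1 in auto)
  then show "(LINT t:{0<..}|lborel. t powr (x - 1) * exp (- (a * t))) = Gamma x * a powr (- x)"
    using a by (simp add: powr_minus field_simps)
qed

text \<open>For complex \<open>a\<close> no real substitution absorbs the factor. Both sides are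
  holomorphic in \<open>a\<close> on the right half plane and agree for positive \<open>a\<close>,
  where \<open>t \<mapsto> a * t\<close> reduces the claim to the gamma integral.\<close>

lemma set_integral_Gamma_complex_scaled:
  assumes z: "Re z > 0" and a: "Re a > 0"
  shows "set_integrable lborel {0<..} (\<lambda>t. complex_of_real t powr (z - 1) * exp (- (a * of_real t)))"
    and "(LINT t:{0<..}|lborel. complex_of_real t powr (z - 1) * exp (- (a * of_real t))) = Gamma z * a powr (- z)"
proof -
  let ?f = "\<lambda>a t. complex_of_real t powr (z - 1) * exp (- (a * of_real t))"
  have c: "continuous_on {0<..} (?f a)" for a
    by (intro continuous_intros) (auto simp: complex_nonpos_Reals_iff)
  have n: "norm (?f a t) = t powr (Re z - 1) * exp (- (Re a * t))" if "t \<in> {0<..}" for t a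
    using that by (simp add: norm_mult norm_of_real_powr)
  show int: "set_integrable lborel {0<..} (?f a)"
    by (rule set_integrable_bound_continuous[OF _ c set_integrable_Gamma_scaled(1)[OF z a]]) (use n in auto)
  let ?U = "{a. Re a > 0}"
  have "(LINT t:{0<..}|lborel. ?f a t) - Gamma z * a powr (- z) = 0"
  proof (rule analytic_continuation[where S = ?U and U = "of_real ` {0<..}" and \<xi> = 1
        and f = "\<lambda>a. (LINT t:{0<..}|lborel. ?f a t) - Gamma z * a powr (- z)"])
    have "(\<lambda>a. LINT t:{0<..}|lborel. ?f a t) holomorphic_on ?U"
    proof (rule holomorphic_on_set_lebesgue_integral)
      fix a :: complex assume "a \<in> ?U"
      then have a: "Re a > 0" by simp
      show "set_borel_measurable lborel {0<..} (?f a)"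
        using set_measurable_continuous_on[OF _ c[of a]] by (simp add: set_borel_measurable_def)
      \<comment> \<open>On the ball of radius \<open>Re a / 2\<close> real parts stay above
        \<open>Re a / 2\<close>, so one exponential dominates the whole ball.\<close>
      have "norm (?f w t) \<le> t powr (Re z - 1) * exp (- (Re a / 2 * t))" if "w \<in> ball a (Re a / 2)" "t \<in> {0<..}" for w t
      proof -
        have "\<bar>Re (a - w)\<bar> \<le> norm (a - w)" by (rule abs_Re_le_cmod)
        then have "Re w \<ge> Re a / 2" using that by (simp add: dist_norm)
        then show ?thesis unfolding n[OF that(2)] using that by (intro mult_left_mono) auto
      qed
      then show "\<exists>e>0. \<exists>g. set_integrable lborel {0<..} g \<and> (\<forall>w\<in>ball a e \<inter> ?U. \<forall>t\<in>{0<..}. norm (?f w t) \<le> g t)"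
        using a set_integrable_Gamma_scaled(1)[OF z, of "Re a / 2"]
        by (intro exI[of _ "Re a / 2"] conjI exI[of _ "\<lambda>t. t powr (Re z - 1) * exp (- (Re a / 2 * t))"]) auto
    qed (auto intro!: holomorphic_intros open_halfspace_Re_gt)
    then show "(\<lambda>a. (LINT t:{0<..}|lborel. ?f a t) - Gamma z * a powr (- z)) holomorphic_on ?U"
      by (intro holomorphic_intros) (auto simp: complex_nonpos_Reals_iff)
    show "1 islimpt complex_of_real ` {0<..}"
    proof (subst islimpt_sequential, intro exI[of _ "\<lambda>n. of_real (1 + 1 / real (Suc n))"] conjI allI)
      have "(\<lambda>n. complex_of_real (1 + 1 / real (Suc n))) \<longlonglongrightarrow> of_real (1 + 0)"
        by (intro tendsto_of_real tendsto_add tendsto_const LIMSEQ_Suc[OF lim_1_over_n])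
      then show "(\<lambda>n. complex_of_real (1 + 1 / real (Suc n))) \<longlonglongrightarrow> 1" by simp
      show "complex_of_real (1 + 1 / real (Suc n)) \<in> complex_of_real ` {0<..} - {1}" for n
      proof -
        have "1 + 1 / real (Suc n) > 0" "1 + 1 / real (Suc n) \<noteq> 1" by (auto simp: field_simps)
        then show ?thesis by (metis Diff_iff greaterThan_iff imageI of_real_eq_1_iff singletonD)
      qed
    qed
    fix b assume "b \<in> complex_of_real ` {0<..}"
    then obtain r where r: "r > 0" "b = of_real r" by auto
    let ?g = "\<lambda>t. complex_of_real t powr (z - 1) * of_real (exp (- t))"
    have im: "(\<lambda>t. r * t) ` {0<..} = {0<..}"
      using r by (auto simp: image_iff intro!: bexI[of _ "_ / r"])
    have inj: "inj_on (\<lambda>t. r * t) {0<..}" using r by (auto intro!: inj_onI)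
    have cg: "continuous_on {0<..} ?g"
      by (intro continuous_intros) (auto simp: complex_nonpos_Reals_iff)
    have "Gamma z = (LINT t:{0<..}|lborel. \<bar>r\<bar> *\<^sub>R ?g (r * t))"
      using set_integral_substitution(2)[of "{0<..}" "{0<..}" "\<lambda>t. r * t" ?g "\<lambda>_. r",
          OF _ _ im cg _ _ _ set_integral_Gamma_complex(1)[OF z]] set_integral_Gamma_complex(2)[OF z] r inj
      by (auto intro!: derivative_eq_intros)
    also have "\<dots> = (LINT t:{0<..}|lborel. b powr z * ?f b t)"
    proof (rule set_lebesgue_integral_cong, simp, intro allI impI)
      fix t :: real assume "t \<in> {0<..}"
      then show "\<bar>r\<bar> *\<^sub>R ?g (r * t) = b powr z * ?f b t"
        using r by (simp add: powr_times_real powr_diff scaleR_conv_of_real exp_of_real[symmetric])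
    qed
    finally show "(LINT t:{0<..}|lborel. ?f b t) - Gamma z * b powr (- z) = 0"
      using r by (simp add: powr_minus field_simps)
  qed (use a in \<open>auto intro!: convex_connected convex_halfspace_Re_gt open_halfspace_Re_gt\<close>)
  then show "(LINT t:{0<..}|lborel. ?f a t) = Gamma z * a powr (- z)" by simp
qed

lemma set_integrable_Beta_Ioo:
  assumes "a > 0" "b > (0::real)"
  shows "set_integrable lborel {0<..<1} (\<lambda>t. t powr (a - 1) * (1 - t) powr (b - 1))"
    and "(LINT t:{0<..<1}|lborel. t powr (a - 1) * (1 - t) powr (b - 1)) = Beta a b"
proof -
  show 1: "set_integrable lborel {0<..<1} (\<lambda>t. t powr (a - 1) * (1 - t) powr (b - 1))"
    by (rule set_integrable_subset[OF integrable_Beta[OF assms]]) auto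
  have "((\<lambda>t. t powr (a - 1) * (1 - t) powr (b - 1)) has_integral Beta a b) {0<..<1}"
    using has_integral_Beta_real[OF assms] by (simp add: has_integral_Icc_iff_Ioo)
  then show "(LINT t:{0<..<1}|lborel. t powr (a - 1) * (1 - t) powr (b - 1)) = Beta a b"
    using set_borel_integral_eq_integral(2)[OF 1] by (simp add: integral_unique)
qed

text \<open>Joint continuity supplies measurability on the product, so only iterated absolute
  integrability remains to be checked in applications.\<close>

lemma set_integral_Fubini:
  fixes f :: "real \<Rightarrow> real \<Rightarrow> 'b::euclidean_space"
  assumes A: "A \<in> sets borel" and B: "B \<in> sets borel"
    and cont: "continuous_on (A \<times> B) (\<lambda>p. f (fst p) (snd p))"
    and i1: "\<And>x. x \<in> A \<Longrightarrow> set_integrable lborel B (f x)"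
    and i2: "set_integrable lborel A (\<lambda>x. LINT y:B|lborel. norm (f x y))"
  shows "(LINT x:A|lborel. LINT y:B|lborel. f x y) = (LINT y:B|lborel. LINT x:A|lborel. f x y)"
proof -
  let ?F = "\<lambda>p. indicator (A \<times> B) p *\<^sub>R f (fst p) (snd p)"
  have eq: "?F (x, y) = indicator A x *\<^sub>R (indicator B y *\<^sub>R f x y)" for x y
    by (auto simp: indicator_def)
  have eq': "?F (x, y) = indicator B y *\<^sub>R (indicator A x *\<^sub>R f x y)" for x y
    by (auto simp: indicator_def)
  have "?F \<in> borel_measurable borel"
    by (rule borel_measurable_continuous_on_indicator[OF _ cont]) (use A B in \<open>auto simp: borel_prod[symmetric]\<close>)
  then have meas: "?F \<in> borel_measurable (lborel \<Otimes>\<^sub>M lborel)"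
    by (simp add: lborel_prod)
  have "integrable (lborel \<Otimes>\<^sub>M lborel) ?F"
  proof (rule lborel_pair.Fubini_integrable[OF meas])
    have "(\<lambda>x. \<integral>y. norm (?F (x, y)) \<partial>lborel) = (\<lambda>x. indicator A x *\<^sub>R (LINT y:B|lborel. norm (f x y)))"
      by (auto simp: set_lebesgue_integral_def indicator_def fun_eq_iff intro!: Bochner_Integration.integral_cong)
    then show "integrable lborel (\<lambda>x. \<integral>y. norm (?F (x, y)) \<partial>lborel)"
      using i2 by (simp add: set_integrable_def)
    show "AE x in lborel. integrable lborel (\<lambda>y. ?F (x, y))"
    proof (intro AE_I2)
      fix x :: real
      show "integrable lborel (\<lambda>y. ?F (x, y))"
        unfolding eq using i1[of x] by (cases "x \<in> A") (auto simp: set_integrable_def)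
    qed
  qed
  then have "integrable (lborel \<Otimes>\<^sub>M lborel) (case_prod (\<lambda>x y. ?F (x, y)))"
    by (simp add: case_prod_beta')
  from lborel_pair.Fubini_integral[OF this]
  have "(\<integral>y. (\<integral>x. ?F (x, y) \<partial>lborel) \<partial>lborel) = (\<integral>x. (\<integral>y. ?F (x, y) \<partial>lborel) \<partial>lborel)" .
  moreover have "(\<integral>x. (\<integral>y. ?F (x, y) \<partial>lborel) \<partial>lborel) = (LINT x:A|lborel. LINT y:B|lborel. f x y)"
    by (simp only: eq set_lebesgue_integral_def integral_scaleR_right)
  moreover have "(\<integral>y. (\<integral>x. ?F (x, y) \<partial>lborel) \<partial>lborel) = (LINT y:B|lborel. LINT x:A|lborel. f x y)"
    by (simp only: eq' set_lebesgue_integral_def integral_scaleR_right)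
  ultimately show ?thesis by simp
qed

section \<open>The basic terminant\<close>

text \<open>The origin of \<open>chi\<close>: with \<open>v = y\<^sup>2 / (1 + y\<^sup>2)\<close>
  the integral becomes \<open>Beta (1/2) (p/2) / 2\<close>, and
  \<open>Gamma (p/2 + 1) = p/2 * Gamma (p/2)\<close> turns this into \<open>chi p / p\<close>. It
  will bound the terminant uniformly up to its cut.\<close>

lemma chi_integral:
  assumes p: "p > 0"
  shows "set_integrable lborel {0<..} (\<lambda>y. (1 + y\<^sup>2) powr (- ((p + 1) / 2)))"
    and "(LINT y:{0<..}|lborel. (1 + y\<^sup>2) powr (- ((p + 1) / 2))) = chi p / p"
proof -
  let ?f = "\<lambda>v::real. v powr (1 / 2 - 1) * (1 - v) powr (p / 2 - 1)"
  let ?g = "\<lambda>y::real. y\<^sup>2 / (1 + y\<^sup>2)"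
  let ?h = "\<lambda>y::real. 2 * y / (1 + y\<^sup>2)\<^sup>2"
  have pos: "1 + y\<^sup>2 > 0" for y :: real by (simp add: add_pos_nonneg)
  have one: "1 - ?g y = 1 / (1 + y\<^sup>2)" for y :: real
    using pos[of y] by (simp add: field_simps)
  have im: "?g ` {0<..} = {0<..<1}"
  proof (intro equalityI subsetI)
    fix v :: real assume "v \<in> {0<..<1}"
    then show "v \<in> ?g ` {0<..}"
      by (intro image_eqI[of _ _ "sqrt (v / (1 - v))"]) (auto simp: field_simps)
  qed (use pos in \<open>auto simp: field_simps\<close>)
  have inj: "inj_on ?g {0<..}"
  proof (rule inj_onI)
    fix x y :: real assume xy: "x \<in> {0<..}" "y \<in> {0<..}" "?g x = ?g y"
    then have "1 / (1 + x\<^sup>2) = 1 / (1 + y\<^sup>2)" using one by metis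
    then have "x\<^sup>2 = y\<^sup>2" using pos[of x] pos[of y] by (simp add: field_simps)
    then show "x = y" using xy by (simp add: power2_eq_iff)
  qed
  have der: "(?g has_field_derivative ?h x) (at x)" for x :: real
    by (rule derivative_eq_intros refl)+ (use pos[of x] in \<open>auto simp: field_simps power2_eq_square\<close>)
  have cf: "continuous_on {0<..<1} ?f" by (intro continuous_intros) auto
  have ch: "continuous_on {0<..} ?h" by (intro continuous_intros) (use pos in \<open>auto simp: less_imp_neq[symmetric]\<close>)
  have int: "set_integrable lborel {0<..<1} ?f"
    and val: "(LINT v:{0<..<1}|lborel. ?f v) = Beta (1/2) (p/2)"
    using set_integrable_Beta_Ioo[of "1/2" "p/2"] p by auto
  have eq: "\<bar>?h y\<bar> *\<^sub>R ?f (?g y) = 2 * (1 + y\<^sup>2) powr (- ((p + 1) / 2))" if "y \<in> {0<..}" for y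
  proof -
    have y: "y > 0" using that by simp
    define S where "S = 1 + y\<^sup>2"
    have S: "S > 0" using pos by (simp add: S_def)
    have "?g y powr (1/2 - 1) = S powr (1/2) / y"
      using y S by (simp add: S_def[symmetric] powr_minus powr_divide powr_half_sqrt field_simps)
    moreover have "(1 - ?g y) powr (p / 2 - 1) = S powr (1 - p / 2)"
      using one[of y] S by (simp add: S_def[symmetric] powr_divide powr_diff)
    moreover have "\<bar>?h y\<bar> = 2 * y / S\<^sup>2" using y by (simp add: S_def)
    ultimately have "\<bar>?h y\<bar> *\<^sub>R ?f (?g y) = 2 * y / S\<^sup>2 * (S powr (1/2) / y * S powr (1 - p / 2))"
      by (simp only: real_scaleR_def)
    also have "\<dots> = 2 * (S powr (1/2) * S powr (1 - p / 2) / S\<^sup>2)" using y S by simp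
    also have "\<dots> = 2 * S powr (1/2 + (1 - p / 2) - 2)"
      using S by (simp only: powr_add powr_diff) (simp add: powr_numeral)
    also have "1/2 + (1 - p / 2) - 2 = - ((p + 1) / 2)" by (simp add: field_simps)
    finally show ?thesis by (simp add: S_def)
  qed
  note sub = set_integral_substitution[of "{0<..}" "{0<..<1}" ?g ?f ?h, OF _ _ im cf ch der inj int]
  have "set_integrable lborel {0<..} (\<lambda>y. 2 * (1 + y\<^sup>2) powr (- ((p + 1) / 2)))"
    using sub(1) by (rule set_integrable_cong[THEN iffD1, rotated 3]) (use eq in auto)
  then show "set_integrable lborel {0<..} (\<lambda>y. (1 + y\<^sup>2) powr (- ((p + 1) / 2)))"
    by (subst (asm) set_integrable_mult_right_iff) auto
  have "(LINT y:{0<..}|lborel. 2 * (1 + y\<^sup>2) powr (- ((p + 1) / 2))) = Beta (1/2) (p/2)"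
    unfolding val[symmetric]
    by (subst sub(2)[symmetric], simp, simp, rule set_lebesgue_integral_cong) (use eq in auto)
  then have "(LINT y:{0<..}|lborel. (1 + y\<^sup>2) powr (- ((p + 1) / 2))) = Beta (1/2) (p/2) / 2" by simp
  also have "\<dots> = chi p / p"
  proof -
    have "p / 2 \<notin> \<int>\<^sub>\<le>\<^sub>0" using p by (auto elim!: nonpos_Ints_cases)
    then have e: "Gamma (p / 2 + 1) = p / 2 * Gamma (p / 2)" by (rule Gamma_plus1)
    show ?thesis unfolding Beta_def chi_def e using p by (simp add: Gamma_one_half_real add.commute[of "1/2"])
  qed
  finally show "(LINT y:{0<..}|lborel. (1 + y\<^sup>2) powr (- ((p + 1) / 2))) = chi p / p" .
qed

text \<open>With \<open>a = N + 1/2\<close> and \<open>z = 1 / q\<close> this is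
  \<open>Gamma a * z powr a * exp z\<close> times the incomplete gamma function of order
  \<open>1 - a\<close> at \<open>z\<close>: the classical terminant. The denominator vanishes on the
  path exactly when \<open>q\<close> is a negative real, whence the cut.\<close>

definition terminant :: "nat \<Rightarrow> complex \<Rightarrow> complex" where
  "terminant N q = (LINT u:{0<..}|lborel. of_real (u powr (real N - 1/2) * exp (- u)) / (1 + of_real u * q))"

lemma Gamma_half_integral:
  shows "set_integrable lborel {0<..} (\<lambda>u. u powr (real N - 1/2) * exp (- u))"
    and "(LINT u:{0<..}|lborel. u powr (real N - 1/2) * exp (- u)) = Gamma (real N + 1/2)"
  using set_integrable_Gamma_real[of "real N + 1/2"] by (simp_all add: algebra_simps)

lemma terminant_denom_ge_1:
  assumes "Re q \<ge> 0" "u \<ge> 0"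
  shows "norm (1 + of_real u * q) \<ge> 1"
proof -
  have "1 \<le> Re (1 + of_real u * q)" using assms by simp
  also have "\<dots> \<le> norm (1 + of_real u * q)" by (rule complex_Re_le_cmod)
  finally show ?thesis .
qed

text \<open>Multiplication by \<open>cnj q\<close> makes the part with \<open>u\<close> real:
  \<open>(1 + u * q) * cnj q\<close> has imaginary part \<open>- Im q\<close> for every
  \<open>u\<close>. The resulting bound is the sine of the angle between \<open>q\<close> and the
  real axis.\<close>

lemma terminant_denom_ge_Im:
  assumes "Im q \<noteq> 0"
  shows "norm (1 + of_real u * q) \<ge> \<bar>Im q\<bar> / norm q"
proof -
  have q: "q \<noteq> 0" using assms by auto
  have "\<bar>Im q\<bar> = \<bar>Im ((1 + of_real u * q) * cnj q)\<bar>"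
    by (simp add: algebra_simps)
  also have "\<dots> \<le> norm ((1 + of_real u * q) * cnj q)" by (rule abs_Im_le_cmod)
  finally have "\<bar>Im q\<bar> \<le> norm (1 + of_real u * q) * norm q" by (simp only: norm_mult complex_mod_cnj)
  then show ?thesis using q by (simp add: pos_divide_le_eq)
qed

lemma terminant_denom_nonzero:
  fixes q :: complex
  assumes "q \<notin> \<real>\<^sub>\<le>\<^sub>0" "u \<ge> 0"
  shows "1 + of_real u * q \<noteq> 0"
proof (cases "Im q = 0")
  case True
  then have "Re q > 0" using assms by (auto simp: complex_nonpos_Reals_iff)
  then show ?thesis using terminant_denom_ge_1[of q u] assms by force
next
  case False
  then have "q \<noteq> 0" by auto
  with False have "\<bar>Im q\<bar> / norm q > 0" by simp
  then show ?thesis using terminant_denom_ge_Im[OF False, of u] by force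
qed

text \<open>A dominating function needs a lower bound uniform both in \<open>u\<close> and in a
  neighbourhood of \<open>q\<close>. For positive \<open>q\<close> the ball stays in the right half
  plane; otherwise it stays away from the real axis and the angle bound applies.\<close>

lemma terminant_denom_locally_bounded:
  fixes q :: complex
  assumes "q \<notin> \<real>\<^sub>\<le>\<^sub>0"
  obtains e d where "e > 0" "d > 0" "\<And>w u. w \<in> ball q e \<Longrightarrow> u \<ge> 0 \<Longrightarrow> norm (1 + of_real u * w) \<ge> d"
proof (cases "Im q = 0")
  case True
  then have "Re q > 0" using assms by (auto simp: complex_nonpos_Reals_iff)
  moreover have "Re w \<ge> 0" if "w \<in> ball q (Re q)" for w
    using that abs_Re_le_cmod[of "q - w"] by (simp add: dist_norm)
  ultimately show ?thesis
    using that[of "Re q" 1] terminant_denom_ge_1 by auto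
next
  case False
  let ?e = "\<bar>Im q\<bar> / 2"
  have "norm (1 + of_real u * w) \<ge> ?e / (norm q + ?e)" if "w \<in> ball q ?e" for w u
  proof -
    have n: "norm (q - w) < ?e" using that by (simp add: dist_norm)
    have "\<bar>Im w\<bar> \<ge> ?e" using n abs_Im_le_cmod[of "q - w"] by simp
    moreover from this False have w: "Im w \<noteq> 0" by auto
    moreover have "norm w \<le> norm q + ?e" using n norm_triangle_ineq3[of q w] by simp
    ultimately have "?e / (norm q + ?e) \<le> \<bar>Im w\<bar> / norm w"
      by (intro frac_le) auto
    also have "\<dots> \<le> norm (1 + of_real u * w)" by (rule terminant_denom_ge_Im[OF w])
    finally show ?thesis .
  qed
  then show ?thesis using that[of ?e "?e / (norm q + ?e)"] False by (auto simp: add_nonneg_pos)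
qed

lemma terminant_integrand_continuous:
  assumes "q \<notin> \<real>\<^sub>\<le>\<^sub>0"
  shows "continuous_on {0<..} (\<lambda>u. complex_of_real (u powr (real N - 1/2) * exp (- u)) / (1 + of_real u * q))"
  by (intro continuous_intros) (use terminant_denom_nonzero[OF assms] in auto)

lemma terminant_integrand_bound:
  assumes "d > 0" "norm (1 + of_real u * q) \<ge> d"
  shows "norm (complex_of_real (u powr (real N - 1/2) * exp (- u)) / (1 + of_real u * q))
           \<le> (1 / d) * (u powr (real N - 1/2) * exp (- u))"
proof -
  have "norm (complex_of_real (u powr (real N - 1/2) * exp (- u)) / (1 + of_real u * q))
      = (u powr (real N - 1/2) * exp (- u)) / norm (1 + of_real u * q)"
    by (simp only: norm_divide norm_of_real abs_mult abs_exp_cancel abs_of_nonneg[OF powr_ge_zero])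
  also have "\<dots> \<le> (u powr (real N - 1/2) * exp (- u)) / d"
    using assms by (intro divide_left_mono mult_pos_pos) auto
  finally show ?thesis by simp
qed

lemma terminant_integrable:
  assumes "q \<notin> \<real>\<^sub>\<le>\<^sub>0"
  shows "set_integrable lborel {0<..} (\<lambda>u. complex_of_real (u powr (real N - 1/2) * exp (- u)) / (1 + of_real u * q))"
proof -
  obtain e d where *: "e > 0" "d > 0" "\<And>w u. w \<in> ball q e \<Longrightarrow> u \<ge> 0 \<Longrightarrow> norm (1 + of_real u * w) \<ge> d"
    by (rule terminant_denom_locally_bounded[OF assms]) blast
  show ?thesis
  proof (rule set_integrable_bound_continuous[OF _ terminant_integrand_continuous[OF assms]])
    show "set_integrable lborel {0<..} (\<lambda>u. (1 / d) * (u powr (real N - 1/2) * exp (- u)))"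
      using Gamma_half_integral(1) by (rule set_integrable_mult_right)
    fix u :: real assume "u \<in> {0<..}"
    then show "norm (complex_of_real (u powr (real N - 1/2) * exp (- u)) / (1 + of_real u * q))
        \<le> (1 / d) * (u powr (real N - 1/2) * exp (- u))"
      using * by (intro terminant_integrand_bound) auto
  qed simp
qed

lemma norm_terminant_le:
  assumes d: "d > 0" "\<And>u. u > 0 \<Longrightarrow> norm (1 + of_real u * q) \<ge> d"
  shows "norm (terminant N q) \<le> Gamma (real N + 1/2) / d"
proof -
  have "norm (terminant N q) \<le> (LINT u:{0<..}|lborel. (1 / d) * (u powr (real N - 1/2) * exp (- u)))"
    unfolding terminant_def
  proof (rule set_integral_norm_bound_le)
    show "set_integrable lborel {0<..} (\<lambda>u. (1 / d) * (u powr (real N - 1/2) * exp (- u)))"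
      using Gamma_half_integral(1) by (rule set_integrable_mult_right)
    fix u :: real assume "u \<in> {0<..}"
    then show "norm (complex_of_real (u powr (real N - 1/2) * exp (- u)) / (1 + of_real u * q))
        \<le> (1 / d) * (u powr (real N - 1/2) * exp (- u))"
      using d by (intro terminant_integrand_bound) auto
  qed
  also have "\<dots> = Gamma (real N + 1/2) / d"
    by (simp only: set_integral_mult_right Gamma_half_integral(2)) simp
  finally show ?thesis .
qed

lemma norm_terminant_le_Re:
  assumes "Re q \<ge> 0"
  shows "norm (terminant N q) \<le> Gamma (real N + 1/2)"
  using norm_terminant_le[of 1 q N] terminant_denom_ge_1[OF assms] by simp

lemma norm_terminant_le_Im:
  assumes "Im q \<noteq> 0"
  shows "norm (terminant N q) \<le> Gamma (real N + 1/2) * (norm q / \<bar>Im q\<bar>)"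
proof -
  have "q \<noteq> 0" using assms by auto
  then have "\<bar>Im q\<bar> / norm q > 0" using assms by simp
  from norm_terminant_le[OF this, of q N] terminant_denom_ge_Im[OF assms] show ?thesis by simp
qed

lemma terminant_holomorphic: "terminant N holomorphic_on - \<real>\<^sub>\<le>\<^sub>0"
proof -
  have "(\<lambda>q. LINT u:{0<..}|lborel. of_real (u powr (real N - 1/2) * exp (- u)) / (1 + of_real u * q)) holomorphic_on - \<real>\<^sub>\<le>\<^sub>0"
  proof (rule holomorphic_on_set_lebesgue_integral)
    fix q :: complex assume "q \<in> - \<real>\<^sub>\<le>\<^sub>0"
    then have q: "q \<notin> \<real>\<^sub>\<le>\<^sub>0" by simp
    show "set_borel_measurable lborel {0<..} (\<lambda>u. complex_of_real (u powr (real N - 1/2) * exp (- u)) / (1 + of_real u * q))"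
      using terminant_integrable[OF q, of N] by (simp add: set_integrable_def set_borel_measurable_def)
    obtain e d where *: "e > 0" "d > 0" "\<And>w u. w \<in> ball q e \<Longrightarrow> u \<ge> 0 \<Longrightarrow> norm (1 + of_real u * w) \<ge> d"
      by (rule terminant_denom_locally_bounded[OF q]) blast
    have "set_integrable lborel {0<..} (\<lambda>u. (1 / d) * (u powr (real N - 1/2) * exp (- u)))"
      using Gamma_half_integral(1) by (rule set_integrable_mult_right)
    moreover have "\<forall>w\<in>ball q e \<inter> - \<real>\<^sub>\<le>\<^sub>0. \<forall>u\<in>{0<..}. norm (complex_of_real (u powr (real N - 1/2) * exp (- u)) / (1 + of_real u * w))
         \<le> (1 / d) * (u powr (real N - 1/2) * exp (- u))"
      using * by (intro ballI terminant_integrand_bound) auto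
    ultimately show "\<exists>e>0. \<exists>g. set_integrable lborel {0<..} g \<and> (\<forall>w\<in>ball q e \<inter> - \<real>\<^sub>\<le>\<^sub>0. \<forall>u\<in>{0<..}.
        norm (complex_of_real (u powr (real N - 1/2) * exp (- u)) / (1 + of_real u * w)) \<le> g u)"
      using \<open>e > 0\<close> by blast
  next
    fix u :: real assume "u \<in> {0<..}"
    then show "(\<lambda>q. of_real (u powr (real N - 1/2) * exp (- u)) / (1 + of_real u * q)) holomorphic_on - \<real>\<^sub>\<le>\<^sub>0"
      by (intro holomorphic_on_divide holomorphic_intros) (use terminant_denom_nonzero[of _ u] in auto)
  qed auto
  then show ?thesis unfolding terminant_def .
qed

text \<open>One step of the geometric progression:
  \<open>1 / (1 + u * q) = 1 - u * q / (1 + u * q)\<close>, where the factor \<open>u\<close> raises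
  the weight to that of \<open>Suc N\<close>.\<close>

lemma terminant_Suc:
  assumes "q \<notin> \<real>\<^sub>\<le>\<^sub>0"
  shows "terminant N q = of_real (Gamma (real N + 1/2)) - q * terminant (Suc N) q"
proof -
  let ?w = "\<lambda>N u. complex_of_real (u powr (real N - 1/2) * exp (- u))"
  have 1: "set_integrable lborel {0<..} (?w N)"
    using Gamma_half_integral(1)[of N] unfolding set_integrable_def
    by (subst (asm) complex_of_real_integrable_eq[symmetric]) (simp add: scaleR_conv_of_real)
  have 2: "(LINT u:{0<..}|lborel. ?w N u) = of_real (Gamma (real N + 1/2))"
    by (subst set_integral_complex_of_real) (simp only: Gamma_half_integral(2))
  have "terminant N q = (LINT u:{0<..}|lborel. ?w N u - q * (?w (Suc N) u / (1 + of_real u * q)))"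
    unfolding terminant_def
  proof (rule set_lebesgue_integral_cong, simp, intro allI impI)
    fix u :: real assume u: "u \<in> {0<..}"
    have w: "?w (Suc N) u = of_real u * ?w N u"
      using u powr_add[of u 1 "real N - 1/2"] by (simp add: algebra_simps)
    show "?w N u / (1 + of_real u * q) = ?w N u - q * (?w (Suc N) u / (1 + of_real u * q))"
      unfolding w using terminant_denom_nonzero[OF assms, of u] u by (simp add: field_simps)
  qed
  also have "\<dots> = (LINT u:{0<..}|lborel. ?w N u) - (LINT u:{0<..}|lborel. q * (?w (Suc N) u / (1 + of_real u * q)))"
    by (intro set_integral_diff(2) 1 set_integrable_mult_right terminant_integrable assms)
  also have "\<dots> = of_real (Gamma (real N + 1/2)) - q * terminant (Suc N) q"
    by (simp only: set_integral_mult_right 2 terminant_def)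
  finally show ?thesis .
qed

lemma terminant_cnj: "terminant N (cnj q) = cnj (terminant N q)"
  unfolding terminant_def set_lebesgue_integral_def
  by (subst Bochner_Integration.integral_cnj[symmetric]) simp

text \<open>Writing \<open>1 / (1/q + u)\<close> as a Laplace integral and integrating over \<open>u\<close> first leaves
  an integrand of modulus at most \<open>(1 + y\<^sup>2) powr (- (p + 1) / 2)\<close>, uniformly in \<open>q\<close>.\<close>

lemma norm_terminant_le_chi_aux:
  assumes "Im q < 0"
  shows "norm (terminant N q) \<le> Gamma (real N + 1/2) * (1 + chi (real N + 1/2))"
proof -
  define p where "p = real N + 1/2"
  \<comment> \<open>\<open>Im q < 0\<close> puts \<open>z\<close> in the upper half plane, so
    \<open>exp (\<i> * (z + u) * y)\<close> decays in \<open>y\<close> for all real \<open>u\<close>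
    at once.\<close>
  define z where "z = 1 / q"
  have p: "p > 0" by (simp add: p_def)
  have q: "q \<notin> \<real>\<^sub>\<le>\<^sub>0" using assms by (auto simp: complex_nonpos_Reals_iff)
  then have q0: "q \<noteq> 0" by auto
  have z: "Im z > 0" using assms by (simp add: z_def Im_divide field_simps sum_power2_gt_zero_iff)
  let ?W = "\<lambda>u. complex_of_real u powr (of_real p) * exp (- of_real u)"
  let ?f = "\<lambda>u y. ?W u * exp (\<i> * (z + of_real u) * of_real y)"
  have int_y: "set_integrable lborel {0<..} (\<lambda>y. exp (\<i> * (z + of_real u) * of_real y))"
    "(LINT y:{0<..}|lborel. exp (\<i> * (z + of_real u) * of_real y)) = \<i> / (z + of_real u)" for u
  proof -
    have a: "Re (- \<i> * (z + of_real u)) > 0" using z by simp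
    have zu: "z + of_real u \<noteq> 0" using z by (auto simp: complex_eq_iff)
    have e: "(\<lambda>t. complex_of_real t powr (1 - 1) * exp (- ((- \<i> * (z + of_real u)) * of_real t))) t =
        exp (\<i> * (z + of_real u) * of_real t)" if "t \<in> {0<..}" for t
      using that by simp
    show "set_integrable lborel {0<..} (\<lambda>y. exp (\<i> * (z + of_real u) * of_real y))"
      using set_integral_Gamma_complex_scaled(1)[of 1, OF _ a]
      by (rule set_integrable_cong[THEN iffD1, rotated 3, OF _ refl]) (use e in auto)
    have "(LINT y:{0<..}|lborel. exp (\<i> * (z + of_real u) * of_real y)) =
      (LINT t:{0<..}|lborel. complex_of_real t powr (1 - 1) * exp (- ((- \<i> * (z + of_real u)) * of_real t)))"
      by (rule set_lebesgue_integral_cong) (use e in auto)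
    also have "\<dots> = Gamma 1 * (- \<i> * (z + of_real u)) powr (- 1)"
      by (rule set_integral_Gamma_complex_scaled(2)[OF _ a]) simp
    also have "\<dots> = \<i> / (z + of_real u)"
      using zu by (simp add: powr_minus divide_inverse)
    finally show "(LINT y:{0<..}|lborel. exp (\<i> * (z + of_real u) * of_real y)) = \<i> / (z + of_real u)" .
  qed
  have nW: "norm (?W u) = u powr p * exp (- u)" if "u > 0" for u
    by (simp only: norm_mult norm_of_real_powr[OF that] norm_exp_eq_Re) simp
  have nf: "norm (?f u y) = (u powr p * exp (- u)) * exp (- (Im z * y))" if "u > 0" for u y
    using nW[OF that] norm_mult[of "?W u" "exp (\<i> * (z + of_real u) * of_real y)"] by simp
  have int_exp: "(LINT y:{0<..}|lborel. exp (- (Im z * y))) = 1 / Im z"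
  proof -
    have "(LINT y:{0<..}|lborel. exp (- (Im z * y))) = (LINT y:{0<..}|lborel. y powr (1 - 1) * exp (- (Im z * y)))"
      by (rule set_lebesgue_integral_cong) auto
    then show ?thesis using set_integrable_Gamma_scaled(2)[of 1 "Im z"] z by (simp add: powr_minus field_simps)
  qed
  have int_W: "set_integrable lborel {0<..} (\<lambda>u. u powr p * exp (- u))"
    using set_integrable_Gamma_real(1)[of "p + 1"] p by simp
  have swap: "(LINT u:{0<..}|lborel. LINT y:{0<..}|lborel. ?f u y) = (LINT y:{0<..}|lborel. LINT u:{0<..}|lborel. ?f u y)"
  proof (rule set_integral_Fubini)
    show "continuous_on ({0<..} \<times> {0<..}) (\<lambda>p. ?f (fst p) (snd p))"
      by (intro continuous_intros) (auto simp: complex_nonpos_Reals_iff)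
    show "set_integrable lborel {0<..} (?f u)" for u
      using int_y(1) by (rule set_integrable_mult_right)
    have "(LINT y:{0<..}|lborel. norm (?f u y)) = (u powr p * exp (- u)) * (1 / Im z)" if "u \<in> {0<..}" for u
    proof -
      have "(LINT y:{0<..}|lborel. norm (?f u y)) = (LINT y:{0<..}|lborel. (u powr p * exp (- u)) * exp (- (Im z * y)))"
        by (rule set_lebesgue_integral_cong) (use nf that in auto)
      then show ?thesis by (simp only: set_integral_mult_right int_exp)
    qed
    moreover have "set_integrable lborel {0<..} (\<lambda>u. (u powr p * exp (- u)) * (1 / Im z))"
      using int_W by (rule set_integrable_mult_left)
    ultimately show "set_integrable lborel {0<..} (\<lambda>u. LINT y:{0<..}|lborel. norm (?f u y))"
      by (subst set_integrable_cong[OF refl refl]) auto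
  qed auto
  have inner: "norm (LINT u:{0<..}|lborel. ?f u y) \<le> Gamma (p + 1) * (1 + y\<^sup>2) powr (- ((p + 1) / 2))" if y: "y \<in> {0<..}" for y
  proof -
    have "(LINT u:{0<..}|lborel. ?f u y) = (LINT u:{0<..}|lborel. exp (\<i> * z * of_real y) * 
        (complex_of_real u powr (of_real (p + 1) - 1) * exp (- ((1 - \<i> * of_real y) * of_real u))))"
      by (rule set_lebesgue_integral_cong) (auto simp: exp_add[symmetric] exp_diff[symmetric] algebra_simps)
    also have "\<dots> = exp (\<i> * z * of_real y) * (Gamma (of_real (p + 1)) * (1 - \<i> * of_real y) powr (- of_real (p + 1)))"
      by (subst set_integral_mult_right, subst set_integral_Gamma_complex_scaled(2)) (use p in auto)
    also have "norm \<dots> = exp (- (Im z * y)) * (Gamma (p + 1) * norm (1 - \<i> * of_real y) powr (- (p + 1)))"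
    proof -
      have "norm (Gamma (complex_of_real (p + 1))) = Gamma (p + 1)"
        using p by (subst Gamma_complex_of_real) (simp add: Gamma_real_pos less_imp_le)
      moreover have "norm ((1 - \<i> * of_real y) powr (- complex_of_real (p + 1))) = norm (1 - \<i> * of_real y) powr (- (p + 1))"
        by (subst norm_powr_real_powr') auto
      ultimately show ?thesis by (simp only: norm_mult norm_exp_eq_Re) simp
    qed
    also have "norm (1 - \<i> * of_real y) powr (- (p + 1)) = (1 + y\<^sup>2) powr (- ((p + 1) / 2))"
      by (simp add: cmod_def powr_half_sqrt[symmetric] powr_powr minus_divide_left)
    also have "exp (- (Im z * y)) * (Gamma (p + 1) * (1 + y\<^sup>2) powr (- ((p + 1) / 2)))
        \<le> 1 * (Gamma (p + 1) * (1 + y\<^sup>2) powr (- ((p + 1) / 2)))"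
      using y z p by (intro mult_right_mono mult_nonneg_nonneg) (auto simp: Gamma_real_pos less_imp_le)
    finally show ?thesis by simp
  qed
  \<comment> \<open>The representation is applied to \<open>Suc N\<close> rather than
    \<open>N\<close>: the additional factor \<open>u\<close> improves the decay in \<open>y\<close>
    from \<open>y powr (- p)\<close> to \<open>y powr (- (p + 1))\<close>, which is integrable even
    for \<open>p = 1/2\<close>. The term split off by \<open>terminant_Suc\<close> becomes the
    \<open>1\<close> in \<open>1 + chi\<close>.\<close>
  have "terminant (Suc N) q * q = (LINT u:{0<..}|lborel. ?W u / (z + of_real u))"
  proof -
    have "terminant (Suc N) q * q = (LINT u:{0<..}|lborel. of_real (u powr (real (Suc N) - 1/2) * exp (- u)) / (1 + of_real u * q) * q)"
      unfolding terminant_def by (rule set_integral_mult_left[symmetric])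
    also have "\<dots> = (LINT u:{0<..}|lborel. ?W u / (z + of_real u))"
    proof (rule set_lebesgue_integral_cong, simp, intro allI impI)
      fix u :: real assume u: "u \<in> {0<..}"
      have "complex_of_real (u powr (real (Suc N) - 1/2) * exp (- u)) = ?W u"
      proof -
        have "real (Suc N) - 1/2 = p" by (simp add: p_def)
        then show ?thesis using u by (simp add: powr_of_real exp_of_real[symmetric])
      qed
      moreover have "1 + of_real u * q = q * (z + of_real u)"
        using q0 by (simp add: z_def field_simps)
      ultimately show "of_real (u powr (real (Suc N) - 1/2) * exp (- u)) / (1 + of_real u * q) * q = ?W u / (z + of_real u)"
        using q0 by simp
    qed
    finally show ?thesis .
  qed
  also have "\<dots> = (LINT u:{0<..}|lborel. - \<i> * (LINT y:{0<..}|lborel. ?f u y))"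
  proof (rule set_lebesgue_integral_cong, simp, intro allI impI)
    fix u :: real
    have "- \<i> * (LINT y:{0<..}|lborel. ?f u y) = - (\<i> * \<i>) * (?W u / (z + of_real u))"
      by (simp only: set_integral_mult_right int_y(2)) (simp only: times_divide_eq_right mult_minus_left mult_minus_right mult_ac)
    then show "?W u / (z + of_real u) = - \<i> * (LINT y:{0<..}|lborel. ?f u y)" by simp
  qed
  also have "\<dots> = - \<i> * (LINT y:{0<..}|lborel. LINT u:{0<..}|lborel. ?f u y)"
    by (subst set_integral_mult_right) (simp only: swap)
  finally have "norm (terminant (Suc N) q * q) = norm (LINT y:{0<..}|lborel. LINT u:{0<..}|lborel. ?f u y)"
    by (simp add: norm_mult)
  also have "\<dots> \<le> (LINT y:{0<..}|lborel. Gamma (p + 1) * (1 + y\<^sup>2) powr (- ((p + 1) / 2)))"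
    by (rule set_integral_norm_bound_le[OF _ inner])
       (intro set_integrable_mult_right chi_integral(1) p)
  also have "\<dots> = Gamma (p + 1) * (chi p / p)"
    by (simp only: set_integral_mult_right chi_integral(2)[OF p])
  also have "\<dots> = Gamma p * chi p"
  proof -
    have "p \<notin> \<int>\<^sub>\<le>\<^sub>0" using p by (auto elim!: nonpos_Ints_cases)
    then show ?thesis using p by (simp add: Gamma_plus1)
  qed
  finally have 1: "norm (terminant (Suc N) q * q) \<le> Gamma p * chi p" .
  have "norm (terminant N q) \<le> norm (complex_of_real (Gamma p)) + norm (q * terminant (Suc N) q)"
    unfolding terminant_Suc[OF q, of N] p_def by (rule norm_triangle_ineq4)
  also have "\<dots> \<le> Gamma p + Gamma p * chi p"
    using 1 p by (simp add: mult.commute Gamma_real_pos less_imp_le)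
  finally show ?thesis by (simp add: p_def algebra_simps)
qed

lemma chi_nonneg: "p > 0 \<Longrightarrow> chi p \<ge> 0"
  unfolding chi_def by (simp add: Gamma_real_pos less_imp_le)

text \<open>The Laplace representation was set up for the lower half plane; conjugation covers the
  upper one, and for positive \<open>q\<close> the elementary bound is already smaller.\<close>

lemma norm_terminant_le_chi:
  assumes "q \<notin> \<real>\<^sub>\<le>\<^sub>0"
  shows "norm (terminant N q) \<le> Gamma (real N + 1/2) * (1 + chi (real N + 1/2))"
proof -
  consider "Im q < 0" | "Im q > 0" | "Im q = 0" "Re q > 0"
    using assms by (force simp: complex_nonpos_Reals_iff)
  then show ?thesis
  proof cases
    case 2
    then show ?thesis
      using norm_terminant_le_chi_aux[of "cnj q" N] by (simp add: terminant_cnj)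
  next
    case 3
    then have "norm (terminant N q) \<le> Gamma (real N + 1/2)" by (intro norm_terminant_le_Re) simp
    also have "\<dots> \<le> Gamma (real N + 1/2) * (1 + chi (real N + 1/2))"
      using chi_nonneg[of "real N + 1/2"] by (simp add: algebra_simps Gamma_real_pos less_imp_le)
    finally show ?thesis .
  qed (rule norm_terminant_le_chi_aux)
qed

section \<open>The remainder function\<close>

lemma of_real_mult_notin_nonpos_Reals:
  assumes "y \<notin> \<real>\<^sub>\<le>\<^sub>0" "c > 0"
  shows "complex_of_real c * y \<notin> \<real>\<^sub>\<le>\<^sub>0"
  using assms by (auto simp: complex_nonpos_Reals_iff mult_le_0_iff)

definition terminant_beta :: "nat \<Rightarrow> complex \<Rightarrow> complex \<Rightarrow> complex" where
  "terminant_beta N \<mu> y = (LINT r:{0<..<1}|lborel. of_real r powr (of_nat N + \<mu> - 1/2) *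
     of_real (1 - r) powr (of_nat N - \<mu> - 1/2) * terminant N (of_real (2 * r * (1 - r)) * y))"

lemma beta_weight_integrable:
  assumes "\<bar>m\<bar> < real N + 1/2"
  shows "set_integrable lborel {0<..<1} (\<lambda>r. r powr (real N + m - 1/2) * (1 - r) powr (real N - m - 1/2))"
    and "(LINT r:{0<..<1}|lborel. r powr (real N + m - 1/2) * (1 - r) powr (real N - m - 1/2))
           = Beta (real N + 1/2 + m) (real N + 1/2 - m)"
  using set_integrable_Beta_Ioo[of "real N + 1/2 + m" "real N + 1/2 - m"] assms
  by (simp_all add: algebra_simps abs_less_iff)

lemma terminant_beta_integrand_continuous:
  assumes "y \<notin> \<real>\<^sub>\<le>\<^sub>0"
  shows "continuous_on {0<..<1} (\<lambda>r. of_real r powr (of_nat N + \<mu> - 1/2) *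
     of_real (1 - r) powr (of_nat N - \<mu> - 1/2) * terminant N (of_real (2 * r * (1 - r)) * y))"
proof -
  have "continuous_on {0<..<1} (\<lambda>r. terminant N (of_real (2 * r * (1 - r)) * y))"
    by (rule continuous_on_compose2[OF holomorphic_on_imp_continuous_on[OF terminant_holomorphic]])
       (use of_real_mult_notin_nonpos_Reals[OF assms, of "2 * _ * (1 - _)"] in \<open>auto intro!: continuous_intros\<close>)
  then show ?thesis
    by (intro continuous_intros) (auto simp: complex_nonpos_Reals_iff)
qed

lemma norm_terminant_beta_integrand:
  assumes r: "r \<in> {0<..<1}" and B: "norm (terminant N (of_real (2 * r * (1 - r)) * y)) \<le> B"
  shows "norm (of_real r powr (of_nat N + \<mu> - 1/2) *
     of_real (1 - r) powr (of_nat N - \<mu> - 1/2) * terminant N (of_real (2 * r * (1 - r)) * y))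
     \<le> B * (r powr (real N + Re \<mu> - 1/2) * (1 - r) powr (real N - Re \<mu> - 1/2))"
proof -
  have "norm (complex_of_real r powr (of_nat N + \<mu> - 1/2)) = r powr (real N + Re \<mu> - 1/2)"
    using r by (subst norm_of_real_powr) auto
  moreover have "norm (complex_of_real (1 - r) powr (of_nat N - \<mu> - 1/2)) = (1 - r) powr (real N - Re \<mu> - 1/2)"
    using r by (subst norm_of_real_powr) auto
  ultimately show ?thesis
    using B by (simp only: norm_mult) (subst mult.commute, intro mult_right_mono, auto)
qed

text \<open>The arguments met under the integral are positive multiples of \<open>y\<close>, so a
  bound along the ray through \<open>y\<close> suffices. Each bound of the terminant used later is
  of this kind: none of them depends on the modulus of the argument.\<close>

lemma norm_terminant_beta_le:
  assumes "\<bar>Re \<mu>\<bar> < real N + 1/2" and B: "\<And>c. c > 0 \<Longrightarrow> norm (terminant N (of_real c * y)) \<le> B"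
  shows "norm (terminant_beta N \<mu> y) \<le> B * Beta (real N + 1/2 + Re \<mu>) (real N + 1/2 - Re \<mu>)"
proof -
  have "norm (terminant_beta N \<mu> y) \<le>
      (LINT r:{0<..<1}|lborel. B * (r powr (real N + Re \<mu> - 1/2) * (1 - r) powr (real N - Re \<mu> - 1/2)))"
    unfolding terminant_beta_def
    by (rule set_integral_norm_bound_le, intro set_integrable_mult_right beta_weight_integrable assms,
        rule norm_terminant_beta_integrand, simp, rule B) auto
  also have "\<dots> = B * Beta (real N + 1/2 + Re \<mu>) (real N + 1/2 - Re \<mu>)"
    by (simp only: set_integral_mult_right beta_weight_integrable(2)[OF assms(1)])
  finally show ?thesis .
qed

definition terminant_bound :: "nat \<Rightarrow> real" where
  "terminant_bound N = Gamma (real N + 1/2) * (1 + chi (real N + 1/2))"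

lemma terminant_bound_nonneg: "terminant_bound N \<ge> 0"
  unfolding terminant_bound_def using chi_nonneg[of "real N + 1/2"]
  by (intro mult_nonneg_nonneg) (auto simp: Gamma_real_pos less_imp_le)

lemma norm_terminant_ray_le:
  assumes "y \<notin> \<real>\<^sub>\<le>\<^sub>0" "c > 0"
  shows "norm (terminant N (of_real c * y)) \<le> terminant_bound N"
  unfolding terminant_bound_def
  by (intro norm_terminant_le_chi of_real_mult_notin_nonpos_Reals assms)

lemma terminant_beta_integrable:
  assumes "\<bar>Re \<mu>\<bar> < real N + 1/2" "y \<notin> \<real>\<^sub>\<le>\<^sub>0"
  shows "set_integrable lborel {0<..<1} (\<lambda>r. of_real r powr (of_nat N + \<mu> - 1/2) *
     of_real (1 - r) powr (of_nat N - \<mu> - 1/2) * terminant N (of_real (2 * r * (1 - r)) * y))"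
  by (rule set_integrable_bound_continuous[OF _ terminant_beta_integrand_continuous[OF assms(2)]
        set_integrable_mult_right[OF beta_weight_integrable(1)[OF assms(1)]]
        norm_terminant_beta_integrand[OF _ norm_terminant_ray_le[OF assms(2)]]]) auto

lemma terminant_beta_holomorphic:
  assumes "\<bar>Re \<mu>\<bar> < real N + 1/2"
  shows "terminant_beta N \<mu> holomorphic_on - \<real>\<^sub>\<le>\<^sub>0"
proof -
  have "(\<lambda>y. LINT r:{0<..<1}|lborel. of_real r powr (of_nat N + \<mu> - 1/2) *
     of_real (1 - r) powr (of_nat N - \<mu> - 1/2) * terminant N (of_real (2 * r * (1 - r)) * y)) holomorphic_on - \<real>\<^sub>\<le>\<^sub>0"
    (is "(\<lambda>y. LINT r:_|_. ?f y r) holomorphic_on _")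
  proof (rule holomorphic_on_set_lebesgue_integral)
    fix r :: real assume r: "r \<in> {0<..<1}"
    have "(\<lambda>y. terminant N (of_real (2 * r * (1 - r)) * y)) holomorphic_on - \<real>\<^sub>\<le>\<^sub>0"
      by (rule holomorphic_on_compose_gen[OF _ terminant_holomorphic, unfolded o_def])
         (use of_real_mult_notin_nonpos_Reals[of _ "2 * r * (1 - r)"] r in \<open>auto intro!: holomorphic_intros\<close>)
    then show "(\<lambda>y. ?f y r) holomorphic_on - \<real>\<^sub>\<le>\<^sub>0" by (intro holomorphic_intros)
  next
    fix y :: complex assume y: "y \<in> - \<real>\<^sub>\<le>\<^sub>0"
    show "set_borel_measurable lborel {0<..<1} (?f y)"
      using terminant_beta_integrable[OF assms, of y] y by (simp add: set_integrable_def set_borel_measurable_def)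
    have "\<forall>w\<in>ball y 1 \<inter> - \<real>\<^sub>\<le>\<^sub>0. \<forall>r\<in>{0<..<1}. norm (?f w r) \<le>
        terminant_bound N * (r powr (real N + Re \<mu> - 1/2) * (1 - r) powr (real N - Re \<mu> - 1/2))"
      by (intro ballI norm_terminant_beta_integrand norm_terminant_ray_le) auto
    then show "\<exists>e>0. \<exists>g. set_integrable lborel {0<..<1} g \<and> (\<forall>w\<in>ball y e \<inter> - \<real>\<^sub>\<le>\<^sub>0. \<forall>r\<in>{0<..<1}. norm (?f w r) \<le> g r)"
      using set_integrable_mult_right[OF beta_weight_integrable(1)[OF assms]] zero_less_one by blast
  qed auto
  then show ?thesis unfolding terminant_beta_def .
qed

lemma open_Re_strip: "open {\<mu>. \<bar>Re \<mu>\<bar> < b}"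
  by (intro open_Collect_less continuous_intros)

lemma convex_Re_strip: "convex {\<mu>. \<bar>Re \<mu>\<bar> < b}"
proof -
  have "{\<mu>. \<bar>Re \<mu>\<bar> < b} = {\<mu>. Re \<mu> < b} \<inter> {\<mu>. Re \<mu> > - b}" by auto
  then show ?thesis by (simp add: convex_Int convex_halfspace_Re_lt convex_halfspace_Re_gt)
qed

lemma terminant_beta_holomorphic_mu:
  assumes y: "y \<notin> \<real>\<^sub>\<le>\<^sub>0"
  shows "(\<lambda>\<mu>. terminant_beta N \<mu> y) holomorphic_on {\<mu>. \<bar>Re \<mu>\<bar> < real N + 1/2}"
proof -
  let ?U = "{\<mu>. \<bar>Re \<mu>\<bar> < real N + 1/2}"
  have "(\<lambda>\<mu>. LINT r:{0<..<1}|lborel. of_real r powr (of_nat N + \<mu> - 1/2) *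
     of_real (1 - r) powr (of_nat N - \<mu> - 1/2) * terminant N (of_real (2 * r * (1 - r)) * y)) holomorphic_on ?U"
    (is "(\<lambda>\<mu>. LINT r:_|_. ?f \<mu> r) holomorphic_on _")
  proof (rule holomorphic_on_set_lebesgue_integral)
    fix \<mu> assume "\<mu> \<in> ?U"
    then have \<mu>: "\<bar>Re \<mu>\<bar> < real N + 1/2" by simp
    show "set_borel_measurable lborel {0<..<1} (?f \<mu>)"
      using terminant_beta_integrable[OF \<mu> y] by (simp add: set_integrable_def set_borel_measurable_def)
    \<comment> \<open>Half the distance to the edge of the strip: both exponents, lowered by
      \<open>e\<close>, still exceed \<open>-1\<close>, and they dominate every exponent occurring
      in the ball because the bases are at most 1.\<close>
    define e where "e = (real N + 1/2 - \<bar>Re \<mu>\<bar>) / 2"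
    have e: "e > 0" using \<mu> by (simp add: e_def)
    let ?g = "\<lambda>r. terminant_bound N * (r powr (real N + 1/2 + Re \<mu> - e - 1) * (1 - r) powr (real N + 1/2 - Re \<mu> - e - 1))"
    have int: "set_integrable lborel {0<..<1} ?g"
      by (intro set_integrable_mult_right set_integrable_Beta_Ioo) (use \<mu> in \<open>auto simp: e_def\<close>)
    have "norm (?f w r) \<le> ?g r" if w: "w \<in> ball \<mu> e" and r: "r \<in> {0<..<1}" for w r
    proof -
      have Rew: "\<bar>Re (\<mu> - w)\<bar> < e" using w abs_Re_le_cmod[of "\<mu> - w"] by (simp add: dist_norm)
      have "norm (?f w r) \<le> terminant_bound N * (r powr (real N + Re w - 1/2) * (1 - r) powr (real N - Re w - 1/2))"
        by (intro norm_terminant_beta_integrand norm_terminant_ray_le y r) (use r in auto)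
      also have "\<dots> \<le> ?g r"
        using r Rew by (intro mult_left_mono mult_mono powr_mono') (auto simp: terminant_bound_nonneg)
      finally show ?thesis .
    qed
    then show "\<exists>e>0. \<exists>g. set_integrable lborel {0<..<1} g \<and> (\<forall>w\<in>ball \<mu> e \<inter> ?U. \<forall>r\<in>{0<..<1}. norm (?f w r) \<le> g r)"
      using e int by (intro exI[of _ e] conjI exI[of _ ?g]) auto
  qed (auto intro!: holomorphic_intros open_Re_strip)
  then show ?thesis unfolding terminant_beta_def .
qed

text \<open>\<open>terminant_Suc\<close> at \<open>q = 2 * r * (1 - r) * y\<close>: the factor
  \<open>r * (1 - r)\<close> raises both beta exponents to those of \<open>Suc N\<close>, and the
  \<open>2\<close> stays in front. Real order is enough, since complex \<open>\<mu>\<close> is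
  reached by continuation.\<close>

lemma terminant_beta_Suc:
  fixes m :: real
  assumes m: "\<bar>m\<bar> < real N + 1/2" and y: "y \<notin> \<real>\<^sub>\<le>\<^sub>0"
  shows "terminant_beta N (of_real m) y =
     of_real (Gamma (real N + 1/2) * Beta (real N + 1/2 + m) (real N + 1/2 - m)) - 2 * y * terminant_beta (Suc N) (of_real m) y"
proof -
  let ?w = "\<lambda>r. r powr (real N + m - 1/2) * (1 - r) powr (real N - m - 1/2)"
  let ?f = "\<lambda>N r. complex_of_real r powr (of_nat N + of_real m - 1/2) *
     of_real (1 - r) powr (of_nat N - of_real m - 1/2) * terminant N (of_real (2 * r * (1 - r)) * y)"
  have int: "set_integrable lborel {0<..<1} (\<lambda>r. complex_of_real (?w r))"
    using beta_weight_integrable(1)[OF m] unfolding set_integrable_def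
    by (subst (asm) complex_of_real_integrable_eq[symmetric]) (simp add: scaleR_conv_of_real)
  have val: "(LINT r:{0<..<1}|lborel. complex_of_real (?w r)) = of_real (Beta (real N + 1/2 + m) (real N + 1/2 - m))"
    by (subst set_integral_complex_of_real) (simp only: beta_weight_integrable(2)[OF m])
  have "terminant_beta N (of_real m) y = (LINT r:{0<..<1}|lborel. of_real (Gamma (real N + 1/2)) * of_real (?w r) - 2 * y * ?f (Suc N) r)"
    unfolding terminant_beta_def
  proof (rule set_lebesgue_integral_cong, simp, intro allI impI)
    fix r :: real assume r: "r \<in> {0<..<1}"
    have q: "complex_of_real (2 * r * (1 - r)) * y \<notin> \<real>\<^sub>\<le>\<^sub>0"
      using r by (intro of_real_mult_notin_nonpos_Reals y) auto
    have 1: "complex_of_real r powr (of_nat N + of_real m - 1/2) = of_real (r powr (real N + m - 1/2))"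
      using r by (simp add: powr_of_real[symmetric])
    have 2: "complex_of_real (1 - r) powr (of_nat N - of_real m - 1/2) = of_real ((1 - r) powr (real N - m - 1/2))"
      using r powr_of_real[of "1 - r" "real N - m - 1/2"] by simp
    have 3: "complex_of_real r powr (of_nat (Suc N) + of_real m - 1/2) = of_real (r * r powr (real N + m - 1/2))"
      using r powr_of_real[of "r" "real (Suc N) + m - 1/2"] powr_add[of r 1 "real N + m - 1/2"] by (simp add: algebra_simps)
    have 4: "complex_of_real (1 - r) powr (of_nat (Suc N) - of_real m - 1/2) = of_real ((1 - r) * (1 - r) powr (real N - m - 1/2))"
    proof -
      have "(1 - r) powr (real (Suc N) - m - 1/2) = (1 - r) powr (1 + (real N - m - 1/2))" by (simp add: algebra_simps)
      also have "\<dots> = (1 - r) * (1 - r) powr (real N - m - 1/2)" using r by (subst powr_add) simp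
      finally show ?thesis using r powr_of_real[of "1 - r" "real (Suc N) - m - 1/2"] by simp
    qed
    show "?f N r = of_real (Gamma (real N + 1/2)) * of_real (?w r) - 2 * y * ?f (Suc N) r"
      unfolding 1 2 3 4 terminant_Suc[OF q, of N] by (simp add: algebra_simps)
  qed
  also have "\<dots> = (LINT r:{0<..<1}|lborel. of_real (Gamma (real N + 1/2)) * of_real (?w r)) - (LINT r:{0<..<1}|lborel. 2 * y * ?f (Suc N) r)"
    by (intro set_integral_diff(2) set_integrable_mult_right int terminant_beta_integrable y) (use m in auto)
  also have "\<dots> = of_real (Gamma (real N + 1/2) * Beta (real N + 1/2 + m) (real N + 1/2 - m)) - 2 * y * terminant_beta (Suc N) (of_real m) y"
    by (simp only: set_integral_mult_right val terminant_beta_def of_real_mult[of "Gamma (real N + 1/2)"])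
  finally show ?thesis .
qed

text \<open>Off the real axis both remainders are values of this one function, at
  \<open>x = - exp (- \<xi>) / sinh \<xi>\<close> and at \<open>x = exp \<xi> / sinh \<xi>\<close>.
  The prefactor is the one that makes the terms split off equal to
  \<open>a_coeff n \<mu> * Gamma (\<nu> - n + 1/2) * x ^ n\<close>; this is
  \<open>remainder_constant\<close>.\<close>

definition legendre_rem :: "nat \<Rightarrow> complex \<Rightarrow> complex \<Rightarrow> complex \<Rightarrow> complex" where
  "legendre_rem N x \<mu> \<nu> = (-1) ^ N * (2 ^ N * cos (of_real pi * \<mu>) / of_real (pi powr (3/2))) * x ^ N *
     (LINT t:{0<..}|lborel. of_real t powr (\<nu> - of_nat N - 1/2) * of_real (exp (- t)) * terminant_beta N \<mu> (x / of_real t))"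

lemma divide_of_real_notin_nonpos_Reals:
  assumes "x \<notin> \<real>\<^sub>\<le>\<^sub>0" "t > 0"
  shows "x / complex_of_real t \<notin> \<real>\<^sub>\<le>\<^sub>0"
  using of_real_mult_notin_nonpos_Reals[OF assms(1), of "1 / t"] assms(2) by simp

lemma legendre_rem_integrand_continuous:
  assumes \<mu>: "\<bar>Re \<mu>\<bar> < real N + 1/2" and x: "x \<notin> \<real>\<^sub>\<le>\<^sub>0"
  shows "continuous_on {0<..} (\<lambda>t. of_real t powr (\<nu> - of_nat N - 1/2) * of_real (exp (- t)) * terminant_beta N \<mu> (x / of_real t))"
proof -
  have "continuous_on {0<..} (\<lambda>t. terminant_beta N \<mu> (x / of_real t))"
    by (rule continuous_on_compose2[OF holomorphic_on_imp_continuous_on[OF terminant_beta_holomorphic[OF \<mu>]]])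
       (use divide_of_real_notin_nonpos_Reals[OF x] in \<open>auto intro!: continuous_intros\<close>)
  then show ?thesis
    by (intro continuous_intros) (auto simp: complex_nonpos_Reals_iff)
qed

lemma legendre_rem_weight:
  assumes "Re \<nu> > real N - 1/2"
  shows "set_integrable lborel {0<..} (\<lambda>t. t powr (Re \<nu> - real N - 1/2) * exp (- t))"
    and "(LINT t:{0<..}|lborel. t powr (Re \<nu> - real N - 1/2) * exp (- t)) = Gamma (Re \<nu> - real N + 1/2)"
  using set_integrable_Gamma_real[of "Re \<nu> - real N + 1/2"] assms by (simp_all add: algebra_simps)

lemma norm_legendre_rem_integrand:
  assumes t: "t \<in> {0<..}" and C: "norm (terminant_beta N \<mu> (x / of_real t)) \<le> C"
  shows "norm (of_real t powr (\<nu> - of_nat N - 1/2) * of_real (exp (- t)) * terminant_beta N \<mu> (x / of_real t))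
           \<le> C * (t powr (Re \<nu> - real N - 1/2) * exp (- t))"
proof -
  have "norm (complex_of_real t powr (\<nu> - of_nat N - 1/2)) = t powr (Re \<nu> - real N - 1/2)"
    using t by (subst norm_of_real_powr) auto
  moreover have "norm (complex_of_real (exp (- t))) = exp (- t)" by (simp only: norm_of_real abs_exp_cancel)
  ultimately show ?thesis
    using C by (simp only: norm_mult) (subst mult.commute, intro mult_right_mono, auto)
qed

lemma norm_terminant_beta_ray_le:
  assumes \<mu>: "\<bar>Re \<mu>\<bar> < real N + 1/2" and B: "\<And>c. c > 0 \<Longrightarrow> norm (terminant N (of_real c * x)) \<le> B" and t: "t \<in> {0<..}"
  shows "norm (terminant_beta N \<mu> (x / of_real t)) \<le> B * Beta (real N + 1/2 + Re \<mu>) (real N + 1/2 - Re \<mu>)"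
proof (rule norm_terminant_beta_le[OF \<mu>])
  fix c :: real assume "c > 0"
  then show "norm (terminant N (of_real c * (x / of_real t))) \<le> B"
    using B[of "c / t"] t by simp
qed

lemma legendre_rem_integrable:
  assumes \<mu>: "\<bar>Re \<mu>\<bar> < real N + 1/2" and x: "x \<notin> \<real>\<^sub>\<le>\<^sub>0" and \<nu>: "Re \<nu> > real N - 1/2"
  shows "set_integrable lborel {0<..} (\<lambda>t. of_real t powr (\<nu> - of_nat N - 1/2) * of_real (exp (- t)) * terminant_beta N \<mu> (x / of_real t))"
  by (rule set_integrable_bound_continuous[OF _ legendre_rem_integrand_continuous[OF \<mu> x]
       set_integrable_mult_right[OF legendre_rem_weight(1)[OF \<nu>]]
       norm_legendre_rem_integrand[OF _ norm_terminant_beta_ray_le[OF \<mu> norm_terminant_ray_le[OF x]]]]) auto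

lemma norm_legendre_rem_le_aux:
  assumes \<mu>: "\<bar>Re \<mu>\<bar> < real N + 1/2" and \<nu>: "Re \<nu> > real N - 1/2"
    and B: "\<And>c. c > 0 \<Longrightarrow> norm (terminant N (of_real c * x)) \<le> B"
  shows "norm (legendre_rem N x \<mu> \<nu>) \<le> (2 ^ N * norm (cos (of_real pi * \<mu>)) / pi powr (3/2)) * norm x ^ N *
     (B * Beta (real N + 1/2 + Re \<mu>) (real N + 1/2 - Re \<mu>) * Gamma (Re \<nu> - real N + 1/2))"
proof -
  let ?C = "B * Beta (real N + 1/2 + Re \<mu>) (real N + 1/2 - Re \<mu>)"
  have "norm (LINT t:{0<..}|lborel. of_real t powr (\<nu> - of_nat N - 1/2) * of_real (exp (- t)) * terminant_beta N \<mu> (x / of_real t))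
      \<le> (LINT t:{0<..}|lborel. ?C * (t powr (Re \<nu> - real N - 1/2) * exp (- t)))"
    by (rule set_integral_norm_bound_le[OF set_integrable_mult_right[OF legendre_rem_weight(1)[OF \<nu>]]
       norm_legendre_rem_integrand[OF _ norm_terminant_beta_ray_le[OF \<mu> B]]])
  also have "\<dots> = ?C * Gamma (Re \<nu> - real N + 1/2)"
    by (simp only: set_integral_mult_right legendre_rem_weight(2)[OF \<nu>])
  finally have le: "norm (LINT t:{0<..}|lborel. of_real t powr (\<nu> - of_nat N - 1/2) * of_real (exp (- t)) * terminant_beta N \<mu> (x / of_real t))
      \<le> ?C * Gamma (Re \<nu> - real N + 1/2)" .
  have "norm (legendre_rem N x \<mu> \<nu>) = (2 ^ N * norm (cos (of_real pi * \<mu>)) / pi powr (3/2)) * norm x ^ N *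
     norm (LINT t:{0<..}|lborel. of_real t powr (\<nu> - of_nat N - 1/2) * of_real (exp (- t)) * terminant_beta N \<mu> (x / of_real t))"
    unfolding legendre_rem_def by (simp only: norm_mult norm_divide norm_power norm_of_real norm_numeral norm_minus_cancel norm_one power_one abs_of_nonneg[OF powr_ge_zero] mult_1_left)
  also have "\<dots> \<le> (2 ^ N * norm (cos (of_real pi * \<mu>)) / pi powr (3/2)) * norm x ^ N * (?C * Gamma (Re \<nu> - real N + 1/2))"
    by (rule mult_left_mono[OF le]) auto
  finally show ?thesis .
qed

lemma legendre_rem_holomorphic:
  assumes \<mu>: "\<bar>Re \<mu>\<bar> < real N + 1/2" and \<nu>: "Re \<nu> > real N - 1/2"
  shows "(\<lambda>x. legendre_rem N x \<mu> \<nu>) holomorphic_on - \<real>\<^sub>\<le>\<^sub>0"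
proof -
  have "(\<lambda>x. LINT t:{0<..}|lborel. of_real t powr (\<nu> - of_nat N - 1/2) * of_real (exp (- t)) * terminant_beta N \<mu> (x / of_real t))
     holomorphic_on - \<real>\<^sub>\<le>\<^sub>0" (is "(\<lambda>x. LINT t:_|_. ?f x t) holomorphic_on _")
  proof (rule holomorphic_on_set_lebesgue_integral)
    fix t :: real assume t: "t \<in> {0<..}"
    have "(\<lambda>x. terminant_beta N \<mu> (x / of_real t)) holomorphic_on - \<real>\<^sub>\<le>\<^sub>0"
      by (rule holomorphic_on_compose_gen[OF _ terminant_beta_holomorphic[OF \<mu>], unfolded o_def])
         (use divide_of_real_notin_nonpos_Reals[of _ t] t in \<open>auto intro!: holomorphic_intros\<close>)
    then show "(\<lambda>x. ?f x t) holomorphic_on - \<real>\<^sub>\<le>\<^sub>0" by (intro holomorphic_intros)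
  next
    fix x :: complex assume x: "x \<in> - \<real>\<^sub>\<le>\<^sub>0"
    show "set_borel_measurable lborel {0<..} (?f x)"
      using legendre_rem_integrable[OF \<mu> _ \<nu>, of x] x by (simp add: set_integrable_def set_borel_measurable_def)
    let ?C = "terminant_bound N * Beta (real N + 1/2 + Re \<mu>) (real N + 1/2 - Re \<mu>)"
    have "\<forall>w\<in>ball x 1 \<inter> - \<real>\<^sub>\<le>\<^sub>0. \<forall>t\<in>{0<..}. norm (?f w t) \<le> ?C * (t powr (Re \<nu> - real N - 1/2) * exp (- t))"
      by (intro ballI norm_legendre_rem_integrand norm_terminant_beta_ray_le \<mu> norm_terminant_ray_le) auto
    then show "\<exists>e>0. \<exists>g. set_integrable lborel {0<..} g \<and> (\<forall>w\<in>ball x e \<inter> - \<real>\<^sub>\<le>\<^sub>0. \<forall>t\<in>{0<..}. norm (?f w t) \<le> g t)"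
      using set_integrable_mult_right[OF legendre_rem_weight(1)[OF \<nu>]] zero_less_one by blast
  qed auto
  then show ?thesis unfolding legendre_rem_def by (intro holomorphic_intros)
qed

lemma legendre_rem_holomorphic_mu:
  assumes x: "x \<notin> \<real>\<^sub>\<le>\<^sub>0" and \<nu>: "Re \<nu> > real N - 1/2"
  shows "(\<lambda>\<mu>. legendre_rem N x \<mu> \<nu>) holomorphic_on {\<mu>. \<bar>Re \<mu>\<bar> < real N + 1/2}"
proof -
  let ?U = "{\<mu>. \<bar>Re \<mu>\<bar> < real N + 1/2}"
  have "(\<lambda>\<mu>. LINT t:{0<..}|lborel. of_real t powr (\<nu> - of_nat N - 1/2) * of_real (exp (- t)) * terminant_beta N \<mu> (x / of_real t))
     holomorphic_on ?U" (is "(\<lambda>\<mu>. LINT t:_|_. ?f \<mu> t) holomorphic_on _")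
  proof (rule holomorphic_on_set_lebesgue_integral)
    fix t :: real assume t: "t \<in> {0<..}"
    have "(\<lambda>\<mu>. terminant_beta N \<mu> (x / of_real t)) holomorphic_on ?U"
      by (rule terminant_beta_holomorphic_mu) (use t divide_of_real_notin_nonpos_Reals[OF x] in auto)
    then show "(\<lambda>\<mu>. ?f \<mu> t) holomorphic_on ?U" by (intro holomorphic_intros)
  next
    fix \<mu> :: complex assume "\<mu> \<in> ?U"
    then have \<mu>: "\<bar>Re \<mu>\<bar> < real N + 1/2" by simp
    show "set_borel_measurable lborel {0<..} (?f \<mu>)"
      using legendre_rem_integrable[OF \<mu> x \<nu>] by (simp add: set_integrable_def set_borel_measurable_def)
    let ?b = "\<lambda>w. Beta (real N + 1/2 + Re w) (real N + 1/2 - Re w)"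
    have nz: "real N + 1/2 + Re \<mu> \<notin> \<int>\<^sub>\<le>\<^sub>0" "real N + 1/2 - Re \<mu> \<notin> \<int>\<^sub>\<le>\<^sub>0"
      using \<mu> by (auto elim!: nonpos_Ints_cases)
    \<comment> \<open>The bound of \<open>terminant_beta\<close> contains a beta value that moves
      with \<open>w\<close>; continuity replaces it by the constant \<open>?b \<mu> + 1\<close> near
      \<open>\<mu>\<close>.\<close>
    have "isCont ?b \<mu>"
      unfolding Beta_def by (intro continuous_intros) (use nz in \<open>auto simp: Gamma_eq_zero_iff elim!: nonpos_Ints_cases\<close>)
    then have "(?b \<longlongrightarrow> ?b \<mu>) (nhds \<mu>)" using tendsto_at_iff_tendsto_nhds[of ?b \<mu>] by (simp only: isCont_def)
    then have "\<forall>\<^sub>F w in nhds \<mu>. ?b w < ?b \<mu> + 1"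
      by (rule order_tendstoD(2)) simp
    then obtain e where e: "e > 0" "\<And>w. w \<in> ball \<mu> e \<Longrightarrow> ?b w < ?b \<mu> + 1"
      by (auto simp: eventually_nhds_metric dist_commute)
    let ?C = "terminant_bound N * (?b \<mu> + 1)"
    have "norm (?f w t) \<le> ?C * (t powr (Re \<nu> - real N - 1/2) * exp (- t))" if w: "w \<in> ball \<mu> e" "w \<in> ?U" and t: "t \<in> {0<..}" for w t
    proof (rule norm_legendre_rem_integrand[OF t])
      have "norm (terminant_beta N w (x / of_real t)) \<le> terminant_bound N * ?b w"
        by (rule norm_terminant_beta_ray_le[OF _ norm_terminant_ray_le[OF x] t]) (use w in auto)
      also have "\<dots> \<le> ?C"
        using e(2)[OF w(1)] by (intro mult_left_mono) (auto simp: terminant_bound_nonneg)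
      finally show "norm (terminant_beta N w (x / of_real t)) \<le> ?C" .
    qed
    then have "\<forall>w\<in>ball \<mu> e \<inter> ?U. \<forall>t\<in>{0<..}. norm (?f w t) \<le> ?C * (t powr (Re \<nu> - real N - 1/2) * exp (- t))" by blast
    then show "\<exists>e>0. \<exists>g. set_integrable lborel {0<..} g \<and> (\<forall>w\<in>ball \<mu> e \<inter> ?U. \<forall>t\<in>{0<..}. norm (?f w t) \<le> g t)"
      using set_integrable_mult_right[OF legendre_rem_weight(1)[OF \<nu>]] e(1) by blast
  qed (auto intro!: open_Re_strip)
  then show ?thesis unfolding legendre_rem_def by (intro holomorphic_intros) auto
qed

section \<open>Gamma-function form of the coefficients and of the normalising constant\<close>

lemma Gamma_half_nat: "Gamma (real N + 1/2) = fact (2 * N) * sqrt pi / (4 ^ N * fact N)"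
proof (induction N)
  case 0
  then show ?case by (simp add: Gamma_one_half_real)
next
  case (Suc N)
  have "real N + 1/2 \<notin> \<int>\<^sub>\<le>\<^sub>0" by (auto elim!: nonpos_Ints_cases)
  then have "Gamma (real N + 1/2 + 1) = (real N + 1/2) * Gamma (real N + 1/2)" by (rule Gamma_plus1)
  then have "Gamma (real (Suc N) + 1/2) = (real N + 1/2) * (fact (2 * N) * sqrt pi / (4 ^ N * fact N))"
    using Suc by (simp add: add_ac)
  also have "\<dots> = fact (2 * Suc N) * sqrt pi / (4 ^ Suc N * fact (Suc N))"
  proof -
    have "(fact (2 * Suc N) :: real) = (2 * real N + 2) * (2 * real N + 1) * fact (2 * N)"
      by (simp add: algebra_simps)
    moreover have "(fact (Suc N) :: real) = (real N + 1) * fact N" by (simp add: algebra_simps)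
    ultimately show ?thesis by (simp only:) (simp add: divide_simps, simp add: algebra_simps)
  qed
  finally show ?case .
qed

text \<open>Each factor splits as \<open>4 * \<mu>\<^sup>2 - (2 * k - 1)\<^sup>2 = - 4 * (1/2 -
  \<mu> + (k - 1)) * (1/2 + \<mu> + (k - 1))\<close>.\<close>

lemma a_coeff_pochhammer:
  fixes \<mu> :: "'a :: field_char_0"
  shows "a_coeff N \<mu> = (-1) ^ N * pochhammer (1/2 - \<mu>) N * pochhammer (1/2 + \<mu>) N / (2 ^ N * fact N)"
proof -
  have "(\<Prod>k=1..N. 4 * \<mu>\<^sup>2 - (2 * of_nat k - 1)\<^sup>2) = (-4) ^ N * pochhammer (1/2 - \<mu>) N * pochhammer (1/2 + \<mu>) N"
  proof (induction N)
    case (Suc N)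
    have e: "4 * \<mu>\<^sup>2 - (2 * of_nat (Suc N) - 1)\<^sup>2 = (-4) * (1/2 - \<mu> + of_nat N) * (1/2 + \<mu> + of_nat N)"
      by (simp add: field_simps power2_eq_square)
    have "(\<Prod>k=1..Suc N. 4 * \<mu>\<^sup>2 - (2 * of_nat k - 1)\<^sup>2) =
        (\<Prod>k=1..N. 4 * \<mu>\<^sup>2 - (2 * of_nat k - 1)\<^sup>2) * (4 * \<mu>\<^sup>2 - (2 * of_nat (Suc N) - 1)\<^sup>2)" by simp
    also have "\<dots> = (-4) ^ Suc N * pochhammer (1/2 - \<mu>) (Suc N) * pochhammer (1/2 + \<mu>) (Suc N)"
      unfolding Suc e pochhammer_Suc power_Suc by (simp only: mult_ac)
    finally show ?case .
  qed simp
  moreover have "(8::'a) ^ N = 4 ^ N * 2 ^ N" by (simp add: power_mult_distrib[symmetric])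
  moreover have "(-4::'a) ^ N = (-1) ^ N * 4 ^ N" by (simp add: power_mult_distrib[symmetric])
  ultimately show ?thesis unfolding a_coeff_def by simp
qed

text \<open>Reflection at \<open>1/2 - \<mu>\<close> produces the cosine. The argument runs through
  \<open>rGamma\<close>, which is entire, because \<open>Gamma (1/2 - \<mu>)\<close> may have poles
  in the strip; the gamma values that survive have arguments of positive real part.\<close>

lemma a_coeff_Gamma:
  fixes \<mu> :: complex
  assumes "\<bar>Re \<mu>\<bar> < real N + 1/2"
  shows "a_coeff N \<mu> = (-1) ^ N * cos (of_real pi * \<mu>) * (Gamma (of_nat N + 1/2 + \<mu>) * Gamma (of_nat N + 1/2 - \<mu>)) / (of_real pi * 2 ^ N * fact N)"
proof -
  have nz: "of_nat N + 1/2 + \<mu> \<notin> \<int>\<^sub>\<le>\<^sub>0" "of_nat N + 1/2 - \<mu> \<notin> \<int>\<^sub>\<le>\<^sub>0"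
    using assms by (auto elim!: nonpos_Ints_cases simp: complex_eq_iff)
  have poch: "pochhammer z N = rGamma z * Gamma (z + of_nat N)" if "z + of_nat N \<notin> \<int>\<^sub>\<le>\<^sub>0" for z :: complex
    using pochhammer_rGamma[of z N] that by (simp add: Gamma_def rGamma_eq_zero_iff)
  have "rGamma (1/2 - \<mu>) * rGamma (1/2 + \<mu>) = cos (of_real pi * \<mu>) / of_real pi"
  proof -
    have "rGamma (1/2 - \<mu>) * rGamma (1 - (1/2 - \<mu>)) = sin (of_real pi * (1/2 - \<mu>)) / of_real pi"
      by (rule rGamma_reflection_complex)
    also have "sin (of_real pi * (1/2 - \<mu>)) = cos (of_real pi * \<mu>)"
      by (simp add: cos_sin_eq algebra_simps)
    finally show ?thesis by (simp add: algebra_simps)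
  qed
  moreover have "pochhammer (1/2 - \<mu>) N * pochhammer (1/2 + \<mu>) N =
     (rGamma (1/2 - \<mu>) * rGamma (1/2 + \<mu>)) * (Gamma (of_nat N + 1/2 + \<mu>) * Gamma (of_nat N + 1/2 - \<mu>))"
    using nz by (simp add: poch algebra_simps)
  ultimately have "pochhammer (1/2 - \<mu>) N * pochhammer (1/2 + \<mu>) N =
     cos (of_real pi * \<mu>) / of_real pi * (Gamma (of_nat N + 1/2 + \<mu>) * Gamma (of_nat N + 1/2 - \<mu>))" by simp
  then show ?thesis unfolding a_coeff_pochhammer by (simp add: mult.assoc)
qed

lemma of_real_a_coeff: "complex_of_real (a_coeff N m) = a_coeff N (of_real m)"
  by (simp add: a_coeff_def)

lemma of_real_cos_pi: "cos (complex_of_real pi * of_real m) = of_real (cos (pi * m))"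
  by (metis cos_of_real of_real_mult)

lemma a_coeff_Gamma_real:
  fixes m :: real
  assumes "\<bar>m\<bar> < real N + 1/2"
  shows "a_coeff N m = (-1) ^ N * cos (pi * m) * (Gamma (real N + 1/2 + m) * Gamma (real N + 1/2 - m)) / (pi * 2 ^ N * fact N)"
proof -
  have "complex_of_real (a_coeff N m) =
    (-1) ^ N * cos (of_real pi * of_real m) * (Gamma (of_nat N + 1/2 + of_real m) * Gamma (of_nat N + 1/2 - of_real m)) / (of_real pi * 2 ^ N * fact N)"
    unfolding of_real_a_coeff by (rule a_coeff_Gamma) (use assms in simp)
  also have "Gamma (of_nat N + 1/2 + complex_of_real m) = of_real (Gamma (real N + 1/2 + m))"
    by (subst Gamma_complex_of_real[symmetric]) simp
  also have "Gamma (of_nat N + 1/2 - complex_of_real m) = of_real (Gamma (real N + 1/2 - m))"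
    by (subst Gamma_complex_of_real[symmetric]) simp
  also note of_real_cos_pi
  also have "(-1) ^ N * of_real (cos (pi * m)) * (of_real (Gamma (real N + 1/2 + m)) * of_real (Gamma (real N + 1/2 - m))) / (of_real pi * 2 ^ N * fact N)
     = complex_of_real ((-1) ^ N * cos (pi * m) * (Gamma (real N + 1/2 + m) * Gamma (real N + 1/2 - m)) / (pi * 2 ^ N * fact N))"
    by simp
  finally show ?thesis by (simp only: of_real_eq_iff)
qed

text \<open>Where the cosine vanishes \<open>a_coeff N\<close> vanishes too, but their quotient is,
  up to sign, a product of gamma functions continuous on the whole interval
  \<open>\<bar>m\<bar> < real N + 1/2\<close>. Hence the limiting value in
  \<open>a_cos_ratio\<close> is the value of the same formula.\<close>

lemma a_cos_ratio_Gamma: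
  assumes "\<bar>m\<bar> < real N + 1/2"
  shows "a_cos_ratio N m = Gamma (real N + 1/2 + m) * Gamma (real N + 1/2 - m) / (pi * 2 ^ N * fact N)"
proof -
  let ?g = "\<lambda>m. Gamma (real N + 1/2 + m) * Gamma (real N + 1/2 - m) / (pi * 2 ^ N * fact N)"
  have eq: "\<bar>a_coeff N t\<bar> / \<bar>cos (pi * t)\<bar> = ?g t" if "\<bar>t\<bar> < real N + 1/2" "cos (pi * t) \<noteq> 0" for t
  proof -
    have "Gamma (real N + 1/2 + t) > 0" "Gamma (real N + 1/2 - t) > 0"
      using that by (auto intro!: Gamma_real_pos)
    then show ?thesis
      unfolding a_coeff_Gamma_real[OF that(1)] using that(2) by (simp add: abs_mult)
  qed
  have cos0: "cos (pi * t) = 0 \<longleftrightarrow> (\<exists>k::int. odd k \<and> 2 * t = of_int k)" for t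
  proof -
    have "cos (pi * t) = 0 \<longleftrightarrow> (\<exists>k::int. odd k \<and> pi * t = of_int k * (pi / 2))"
      unfolding cos_zero_iff_int by blast
    also have "\<dots> \<longleftrightarrow> (\<exists>k::int. odd k \<and> 2 * t = of_int k)"
      by (intro ex_cong conj_cong refl) (auto simp: field_simps)
    finally show ?thesis .
  qed
  show ?thesis
  proof (cases "cos (pi * m) = 0")
    case False
    then show ?thesis using eq[OF assms] unfolding a_cos_ratio_def cos0 by auto
  next
    case True
    have "(?g \<longlongrightarrow> ?g m) (at m)"
      by (intro tendsto_intros) (use assms in \<open>auto elim!: nonpos_Ints_cases\<close>)
    moreover have "\<forall>\<^sub>F t in at m. ?g t = \<bar>a_coeff N t\<bar> / \<bar>cos (pi * t)\<bar>"
    proof -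
      have "open {t. \<bar>t\<bar> < real N + 1/2}" by (intro open_Collect_less continuous_intros)
      then have 1: "\<forall>\<^sub>F t in at m. t \<in> {t. \<bar>t\<bar> < real N + 1/2}"
        using assms by (intro eventually_at_in_open') auto
      have sin: "sin (pi * m) \<noteq> 0" using True by (metis sin_zero_abs_cos_one abs_zero zero_neq_one)
      \<comment> \<open>Neighbouring zeros of \<open>cos (pi * t)\<close> are at distance 1, so the
        zero \<open>m\<close> is isolated with this radius; the addition theorem reduces the claim
        to the zeros of the sine.\<close>
      have "cos (pi * t) \<noteq> 0" if "t \<noteq> m" "dist t m < 1" for t
      proof
        assume "cos (pi * t) = 0"
        moreover have "cos (pi * t) = cos (pi * m + pi * (t - m))" by (simp add: algebra_simps)
        ultimately have s0: "sin (pi * (t - m)) = 0" using True sin by (simp only: cos_add) simp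
        have "\<bar>pi * (t - m)\<bar> < pi * 1" unfolding abs_mult using that by (simp add: dist_real_def)
        then have "- pi < pi * (t - m)" "pi * (t - m) < pi" by linarith+
        then have "pi * (t - m) = 0" using s0 by (rule sin_eq_0_pi)
        then show False using that by simp
      qed
      then have 2: "\<forall>\<^sub>F t in at m. cos (pi * t) \<noteq> 0"
        unfolding eventually_at by (intro exI[of _ 1]) auto
      show ?thesis using 1 2 by eventually_elim (use True eq in auto)
    qed
    ultimately have "((\<lambda>t. \<bar>a_coeff N t\<bar> / \<bar>cos (pi * t)\<bar>) \<longlongrightarrow> ?g m) (at m)"
      by (rule Lim_transform_eventually)
    then have "Lim (at m) (\<lambda>t. \<bar>a_coeff N t\<bar> / \<bar>cos (pi * t)\<bar>) = ?g m"
      by (intro tendsto_Lim) auto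
    then show ?thesis using True unfolding a_cos_ratio_def cos0 by auto
  qed
qed

text \<open>Here the integrals are matched with \<open>a_coeff\<close>: the two arguments of the
  beta value add up to \<open>2 * N + 1\<close>, and \<open>Gamma_half_nat\<close> converts
  \<open>fact (2 * N) / fact N\<close> into \<open>4 ^ N * Gamma (N + 1/2) / sqrt pi\<close>. The
  error bounds therefore carry no further constant.\<close>

lemma remainder_constant:
  assumes "\<bar>m\<bar> < real N + 1/2"
  shows "2 ^ N / pi powr (3/2) * (Gamma (real N + 1/2) * Beta (real N + 1/2 + m) (real N + 1/2 - m)) = a_cos_ratio N m"
proof -
  have "Gamma (real N + 1/2 + m + (real N + 1/2 - m)) = fact (2 * N)"
    using Gamma_fact[of "2 * N", where 'a = real] by (simp add: add_ac)
  moreover have "pi powr (3/2) = pi * sqrt pi"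
    using powr_add[of pi 1 "1/2"] by (simp add: powr_half_sqrt)
  moreover have "(2::real) ^ N * 2 ^ N = 4 ^ N" by (simp add: power_mult_distrib[symmetric])
  ultimately show ?thesis
    unfolding a_cos_ratio_Gamma[OF assms] Beta_def Gamma_half_nat
    by (simp add: divide_simps)
qed

lemma norm_legendre_rem_le:
  assumes \<mu>: "\<bar>Re \<mu>\<bar> < real N + 1/2" and \<nu>: "Re \<nu> > real N - 1/2"
    and B: "\<And>c. c > 0 \<Longrightarrow> norm (terminant N (of_real c * x)) \<le> Gamma (real N + 1/2) * B"
  shows "norm (legendre_rem N x \<mu> \<nu>) \<le> norm (cos (of_real pi * \<mu>)) * a_cos_ratio N (Re \<mu>) *
           Gamma (Re \<nu> - real N + 1/2) * norm x ^ N * B"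
  using norm_legendre_rem_le_aux[OF \<mu> \<nu>, of x "Gamma (real N + 1/2) * B", OF B]
  unfolding remainder_constant[OF \<mu>, symmetric] by (simp add: mult_ac)

text \<open>The constant part of \<open>terminant_beta_Suc\<close> integrates against
  \<open>t powr (\<nu> - N - 1/2) * exp (- t)\<close> to the gamma factor of the \<open>N\<close>-th
  term. In the other part \<open>x / t\<close> lowers the power of \<open>t\<close> by one, whence
  the condition on \<open>\<nu>\<close> with \<open>Suc N\<close>.\<close>

lemma legendre_rem_Suc:
  fixes m :: real
  assumes m: "\<bar>m\<bar> < real N + 1/2" and x: "x \<notin> \<real>\<^sub>\<le>\<^sub>0" and \<nu>: "Re \<nu> > real (Suc N) - 1/2"
  shows "legendre_rem N x (of_real m) \<nu> =
     a_coeff N (of_real m) * Gamma (\<nu> - of_nat N + 1/2) * x ^ N + legendre_rem (Suc N) x (of_real m) \<nu>"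
proof -
  let ?K = "complex_of_real (Gamma (real N + 1/2) * Beta (real N + 1/2 + m) (real N + 1/2 - m))"
  let ?w = "\<lambda>N t. complex_of_real t powr (\<nu> - of_nat N - 1/2) * of_real (exp (- t))"
  let ?f = "\<lambda>N t. ?w N t * terminant_beta N (of_real m) (x / of_real t)"
  have m': "\<bar>Re (complex_of_real m)\<bar> < real (Suc N) + 1/2" "\<bar>Re (complex_of_real m)\<bar> < real N + 1/2" using m by auto
  have int: "set_integrable lborel {0<..} (?w N)" and val: "(LINT t:{0<..}|lborel. ?w N t) = Gamma (\<nu> - of_nat N + 1/2)"
    using set_integral_Gamma_complex[of "\<nu> - of_nat N + 1/2"] \<nu> by (simp_all add: algebra_simps)
  have "(LINT t:{0<..}|lborel. ?f N t) = (LINT t:{0<..}|lborel. ?K * ?w N t - 2 * x * ?f (Suc N) t)"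
  proof (rule set_lebesgue_integral_cong, simp, intro allI impI)
    fix t :: real assume t: "t \<in> {0<..}"
    have y: "x / of_real t \<notin> \<real>\<^sub>\<le>\<^sub>0" using divide_of_real_notin_nonpos_Reals[OF x] t by auto
    have w: "?w N t = of_real t * ?w (Suc N) t"
    proof -
      have "complex_of_real t powr (\<nu> - of_nat N - 1/2) = of_real t powr (1 + (\<nu> - of_nat (Suc N) - 1/2))"
        by (simp add: algebra_simps)
      also have "\<dots> = of_real t * of_real t powr (\<nu> - of_nat (Suc N) - 1/2)"
        using t by (subst powr_add) simp
      finally show ?thesis by simp
    qed
    have "?f N t = ?K * ?w N t - 2 * x * (?w N t / of_real t) * terminant_beta (Suc N) (of_real m) (x / of_real t)"
      unfolding terminant_beta_Suc[OF m y] using t by (simp add: algebra_simps)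
    also have "?w N t / of_real t = ?w (Suc N) t" using t unfolding w by simp
    finally show "?f N t = ?K * ?w N t - 2 * x * ?f (Suc N) t" by simp
  qed
  also have "\<dots> = (LINT t:{0<..}|lborel. ?K * ?w N t) - (LINT t:{0<..}|lborel. 2 * x * ?f (Suc N) t)"
    by (intro set_integral_diff(2) set_integrable_mult_right int legendre_rem_integrable m' x \<nu>)
  also have "\<dots> = ?K * Gamma (\<nu> - of_nat N + 1/2) - 2 * x * (LINT t:{0<..}|lborel. ?f (Suc N) t)"
    by (simp only: set_integral_mult_right val)
  finally have I: "(LINT t:{0<..}|lborel. ?f N t) = ?K * Gamma (\<nu> - of_nat N + 1/2) - 2 * x * (LINT t:{0<..}|lborel. ?f (Suc N) t)" .
  have a: "a_coeff N (of_real m) = (-1) ^ N * (2 ^ N * cos (of_real pi * of_real m) / of_real (pi powr (3/2))) * ?K"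
  proof -
    have "a_coeff N m = (-1) ^ N * cos (pi * m) * a_cos_ratio N m"
      unfolding a_coeff_Gamma_real[OF m] a_cos_ratio_Gamma[OF m] by simp
    also have "\<dots> = (-1) ^ N * (2 ^ N * cos (pi * m) / pi powr (3/2)) * (Gamma (real N + 1/2) * Beta (real N + 1/2 + m) (real N + 1/2 - m))"
      unfolding remainder_constant[OF m, symmetric] by simp
    finally have "complex_of_real (a_coeff N m) = of_real ((-1) ^ N * (2 ^ N * cos (pi * m) / pi powr (3/2)) * (Gamma (real N + 1/2) * Beta (real N + 1/2 + m) (real N + 1/2 - m)))"
      by simp
    then show ?thesis by (simp add: of_real_a_coeff of_real_cos_pi)
  qed
  show ?thesis
    unfolding legendre_rem_def I a by (simp add: algebra_simps)
qed

text \<open>The induction starts from the remainder of index 0, whose beta integral converges for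
  \<open>\<bar>m\<bar> < 1/2\<close>; on that interval the total of sum and remainder is the same
  for every admissible \<open>N\<close>.\<close>

lemma legendre_rem_0_expand:
  fixes m :: real
  assumes m: "\<bar>m\<bar> < 1/2" and x: "x \<notin> \<real>\<^sub>\<le>\<^sub>0" and \<nu>: "Re \<nu> > real N - 1/2"
  shows "legendre_rem 0 x (of_real m) \<nu> =
     (\<Sum>n<N. a_coeff n (of_real m) * Gamma (\<nu> - of_nat n + 1/2) * x ^ n) + legendre_rem N x (of_real m) \<nu>"
  using \<nu>
proof (induction N)
  case (Suc N)
  then show ?case using legendre_rem_Suc[of m N x \<nu>] m x by simp
qed simp

section \<open>Euler's integral for the remainder\<close>

lemma frac_one_plus_subst:
  defines "g \<equiv> \<lambda>s::real. s / (1 + s)"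
  shows "g ` {0<..} = {0<..<1}" "inj_on g {0<..}"
    "\<And>s. s \<in> {0<..} \<Longrightarrow> (g has_field_derivative 1 / (1 + s)\<^sup>2) (at s)"
    "continuous_on {0<..} (\<lambda>s::real. 1 / (1 + s)\<^sup>2)"
proof -
  show "g ` {0<..} = {0<..<1}"
  proof (intro equalityI subsetI)
    fix v :: real assume "v \<in> {0<..<1}"
    then show "v \<in> g ` {0<..}"
      by (intro image_eqI[of _ _ "v / (1 - v)"]) (auto simp: g_def field_simps)
  qed (auto simp: g_def field_simps)
  show "inj_on g {0<..}"
    by (rule inj_onI) (auto simp: g_def field_simps)
  show "(g has_field_derivative 1 / (1 + s)\<^sup>2) (at s)" if "s \<in> {0<..}" for s
    unfolding g_def by (rule derivative_eq_intros refl)+ (use that in \<open>auto simp: field_simps power2_eq_square\<close>)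
  show "continuous_on {0<..} (\<lambda>s::real. 1 / (1 + s)\<^sup>2)"
    by (intro continuous_intros) auto
qed

lemma set_integrable_Beta_Ioi:
  assumes "a > 0" "b > (0::real)"
  shows "set_integrable lborel {0<..} (\<lambda>s. s powr (a - 1) * (1 + s) powr (- (a + b)))"
proof -
  let ?f = "\<lambda>t::real. t powr (a - 1) * (1 - t) powr (b - 1)"
  have "continuous_on {0<..<1} ?f" by (intro continuous_intros) auto
  note sub = set_integral_substitution(1)[OF _ _ frac_one_plus_subst(1) this frac_one_plus_subst(4,3,2)
      set_integrable_Beta_Ioo(1)[OF assms]]
  have eq: "\<bar>1 / (1 + s)\<^sup>2\<bar> *\<^sub>R ?f (s / (1 + s)) = s powr (a - 1) * (1 + s) powr (- (a + b))" if "s \<in> {0<..}" for s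
  proof -
    have s: "s > 0" using that by simp
    have "1 - s / (1 + s) = 1 / (1 + s)" using s by (simp add: field_simps)
    then have "?f (s / (1 + s)) = s powr (a - 1) / ((1 + s) powr (a - 1) * (1 + s) powr (b - 1))"
      using s by (simp add: powr_divide)
    moreover have "(1 + s) powr (- (a + b)) = 1 / ((1 + s)\<^sup>2 * ((1 + s) powr (a - 1) * (1 + s) powr (b - 1)))"
    proof -
      have "(1 + s) powr (a + b) = (1 + s) powr (2 + ((a - 1) + (b - 1)))" by simp
      also have "\<dots> = (1 + s)\<^sup>2 * ((1 + s) powr (a - 1) * (1 + s) powr (b - 1))"
        using s by (simp only: powr_add) (simp add: powr_numeral)
      finally show ?thesis by (simp only: powr_minus_divide)
    qed
    ultimately show ?thesis using s by simp
  qed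
  show ?thesis
    using sub by (rule set_integrable_cong[THEN iffD1, rotated 3]) (use eq in auto)
qed

text \<open>In classical terms this is \<open>Beta (1/2 - m) (\<nu> + 1 + m)\<close> times the
  hypergeometric function with parameters \<open>1/2 + m\<close>, \<open>1/2 - m\<close> and
  \<open>\<nu> + 3/2\<close> at \<open>1 - x / 2\<close>, in Euler's form over the half
  line.\<close>

definition euler_integral :: "real \<Rightarrow> complex \<Rightarrow> complex \<Rightarrow> complex" where
  "euler_integral m \<nu> x = (LINT s:{0<..}|lborel. of_real (s powr (- m - 1/2)) *
     of_real (1 + s) powr (of_real m - \<nu> - 1) * (1 + of_real s * (x / 2)) powr of_real (- m - 1/2))"

lemma half_notin_nonpos_Reals: "x \<notin> \<real>\<^sub>\<le>\<^sub>0 \<Longrightarrow> x / 2 \<notin> \<real>\<^sub>\<le>\<^sub>0" for x :: complex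
  using divide_of_real_notin_nonpos_Reals[of x 2] by simp

lemma one_plus_mult_notin_nonpos_Reals:
  fixes x :: complex
  assumes "x \<notin> \<real>\<^sub>\<le>\<^sub>0" "s \<ge> 0"
  shows "1 + of_real s * x \<notin> \<real>\<^sub>\<le>\<^sub>0"
proof (cases "s = 0")
  case False
  then have "s > 0" using assms by simp
  then have "0 < Re x \<Longrightarrow> 0 < 1 + s * Re x" by (simp add: add_pos_pos)
  with \<open>s > 0\<close> assms show ?thesis
    by (auto simp: complex_nonpos_Reals_iff not_le)
qed simp

lemma continuous_on_powr_slit:
  fixes f :: "'a::topological_space \<Rightarrow> complex"
  assumes "continuous_on A f" "\<And>x. x \<in> A \<Longrightarrow> f x \<notin> \<real>\<^sub>\<le>\<^sub>0"
  shows "continuous_on A (\<lambda>x. f x powr c)"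
  using assms unfolding continuous_on_def by (auto intro!: tendsto_powr_complex)

lemma euler_integrand_continuous:
  fixes x :: complex
  assumes "x \<notin> \<real>\<^sub>\<le>\<^sub>0"
  shows "continuous_on {0<..} (\<lambda>s. of_real (s powr (- m - 1/2)) *
     of_real (1 + s) powr (of_real m - \<nu> - 1) * (1 + of_real s * (x / 2)) powr of_real (- m - 1/2))"
proof -
  have "continuous_on {0<..} (\<lambda>s. (1 + complex_of_real s * (x / 2)) powr of_real (- m - 1/2))"
  proof (rule continuous_on_powr_slit)
    show "1 + of_real s * (x / 2) \<notin> \<real>\<^sub>\<le>\<^sub>0" if "s \<in> {0<..}" for s
      by (rule one_plus_mult_notin_nonpos_Reals[OF half_notin_nonpos_Reals[OF assms]]) (use that in auto)
  qed (intro continuous_intros)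
  moreover have "continuous_on {0<..} (\<lambda>s. complex_of_real (1 + s) powr (of_real m - \<nu> - 1))"
  proof (rule continuous_on_powr_slit)
    show "complex_of_real (1 + s) \<notin> \<real>\<^sub>\<le>\<^sub>0" if "s \<in> {0<..}" for s
      using that unfolding complex_nonpos_Reals_iff by simp
  qed (intro continuous_intros)
  moreover have "continuous_on {0<..} (\<lambda>s. complex_of_real (s powr (- m - 1/2)))"
    by (intro continuous_intros) auto
  ultimately show ?thesis by (intro continuous_on_mult)
qed

lemma euler_weight_integrable:
  assumes m: "\<bar>m\<bar> < 1/2" and \<nu>: "Re \<nu> > - 1/2"
  shows "set_integrable lborel {0<..} (\<lambda>s. s powr (- m - 1/2) * (1 + s) powr (m - Re \<nu> - 1))"
  using set_integrable_Beta_Ioi[of "1/2 - m" "Re \<nu> + 1/2"] m \<nu> by (simp add: algebra_simps)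

lemma norm_euler_integrand_le:
  assumes m: "\<bar>m\<bar> < 1/2" and s: "s \<in> {0<..}" and d: "d > 0" "norm (1 + of_real s * (x / 2)) \<ge> d"
  shows "norm (of_real (s powr (- m - 1/2)) * of_real (1 + s) powr (of_real m - \<nu> - 1) *
       (1 + of_real s * (x / 2)) powr of_real (- m - 1/2))
     \<le> d powr (- m - 1/2) * (s powr (- m - 1/2) * (1 + s) powr (m - Re \<nu> - 1))"
proof -
  have "norm (complex_of_real (1 + s) powr (of_real m - \<nu> - 1)) = (1 + s) powr (m - Re \<nu> - 1)"
    using s by (subst norm_of_real_powr) auto
  moreover have "norm ((1 + of_real s * (x / 2)) powr of_real (- m - 1/2)) = norm (1 + of_real s * (x / 2)) powr (- m - 1/2)"
    by (subst norm_powr_real_powr') auto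
  moreover have "norm (1 + of_real s * (x / 2)) powr (- m - 1/2) \<le> d powr (- m - 1/2)"
    using m d by (intro powr_mono2') auto
  moreover have "norm (complex_of_real (s powr (- m - 1/2))) = s powr (- m - 1/2)"
    by (simp only: norm_of_real abs_of_nonneg[OF powr_ge_zero])
  ultimately show ?thesis
    by (simp only: norm_mult) (subst mult.commute, intro mult_right_mono, auto)
qed

lemma euler_integrable:
  assumes m: "\<bar>m\<bar> < 1/2" and \<nu>: "Re \<nu> > - 1/2" and x: "x \<notin> \<real>\<^sub>\<le>\<^sub>0"
  shows "set_integrable lborel {0<..} (\<lambda>s. of_real (s powr (- m - 1/2)) *
     of_real (1 + s) powr (of_real m - \<nu> - 1) * (1 + of_real s * (x / 2)) powr of_real (- m - 1/2))"
proof -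
  obtain e d where *: "e > 0" "d > 0" "\<And>w u. w \<in> ball (x / 2) e \<Longrightarrow> u \<ge> 0 \<Longrightarrow> norm (1 + of_real u * w) \<ge> d"
    by (rule terminant_denom_locally_bounded[OF half_notin_nonpos_Reals[OF x]]) blast
  show ?thesis
  proof (rule set_integrable_bound_continuous[OF _ euler_integrand_continuous[OF x]
          set_integrable_mult_right[OF euler_weight_integrable[OF m \<nu>]] norm_euler_integrand_le[OF m _ *(2)]])
    show "norm (1 + of_real s * (x / 2)) \<ge> d" if "s \<in> {0<..}" for s
      by (rule *(3)) (use that *(1) in auto)
  qed auto
qed

lemma euler_integral_holomorphic:
  assumes m: "\<bar>m\<bar> < 1/2" and \<nu>: "Re \<nu> > - 1/2"
  shows "euler_integral m \<nu> holomorphic_on - \<real>\<^sub>\<le>\<^sub>0"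
proof -
  have "(\<lambda>x. LINT s:{0<..}|lborel. of_real (s powr (- m - 1/2)) *
     of_real (1 + s) powr (of_real m - \<nu> - 1) * (1 + of_real s * (x / 2)) powr of_real (- m - 1/2)) holomorphic_on - \<real>\<^sub>\<le>\<^sub>0"
    (is "(\<lambda>x. LINT s:_|_. ?f x s) holomorphic_on _")
  proof (rule holomorphic_on_set_lebesgue_integral)
    fix s :: real assume s: "s \<in> {0<..}"
    show "(\<lambda>x. ?f x s) holomorphic_on - \<real>\<^sub>\<le>\<^sub>0"
      by (intro holomorphic_intros one_plus_mult_notin_nonpos_Reals half_notin_nonpos_Reals) (use s in auto)
  next
    fix x :: complex assume "x \<in> - \<real>\<^sub>\<le>\<^sub>0"
    then have x: "x \<notin> \<real>\<^sub>\<le>\<^sub>0" by simp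
    show "set_borel_measurable lborel {0<..} (?f x)"
      using euler_integrable[OF m \<nu> x] by (simp add: set_integrable_def set_borel_measurable_def)
    obtain e d where *: "e > 0" "d > 0" "\<And>w u. w \<in> ball (x / 2) e \<Longrightarrow> u \<ge> 0 \<Longrightarrow> norm (1 + of_real u * w) \<ge> d"
      by (rule terminant_denom_locally_bounded[OF half_notin_nonpos_Reals[OF x]]) blast
    have "norm (?f w s) \<le> d powr (- m - 1/2) * (s powr (- m - 1/2) * (1 + s) powr (m - Re \<nu> - 1))"
      if w: "w \<in> ball x e" and s: "s \<in> {0<..}" for w s
    proof (rule norm_euler_integrand_le[OF m s *(2)])
      have "norm (x / 2 - w / 2) = norm (x - w) / 2"
        unfolding diff_divide_distrib[symmetric] norm_divide by simp
      then have "w / 2 \<in> ball (x / 2) e"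
        using w *(1) norm_ge_zero[of "x / 2 - w / 2"] unfolding mem_ball dist_norm by linarith
      then show "norm (1 + of_real s * (w / 2)) \<ge> d" by (rule *(3)) (use s in auto)
    qed
    then have "\<forall>w\<in>ball x e \<inter> - \<real>\<^sub>\<le>\<^sub>0. \<forall>s\<in>{0<..}. norm (?f w s) \<le> d powr (- m - 1/2) * (s powr (- m - 1/2) * (1 + s) powr (m - Re \<nu> - 1))"
      by blast
    then show "\<exists>e>0. \<exists>g. set_integrable lborel {0<..} g \<and> (\<forall>w\<in>ball x e \<inter> - \<real>\<^sub>\<le>\<^sub>0. \<forall>s\<in>{0<..}. norm (?f w s) \<le> g s)"
      using set_integrable_mult_right[OF euler_weight_integrable[OF m \<nu>]] *(1) by blast
  qed auto
  then show ?thesis unfolding euler_integral_def .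
qed

lemma exp_integral: 
  assumes "(a::real) > 0"
  shows "set_integrable lborel {0<..} (\<lambda>s. exp (- (a * s)))" "(LINT s:{0<..}|lborel. exp (- (a * s))) = 1 / a"
proof -
  have e: "s powr (1 - 1) * exp (- (a * s)) = exp (- (a * s))" if "s \<in> {0<..}" for s using that by simp
  show "set_integrable lborel {0<..} (\<lambda>s. exp (- (a * s)))"
    using set_integrable_Gamma_scaled(1)[of 1, OF _ assms]
    by (rule set_integrable_cong[THEN iffD1, rotated 3, OF _ refl]) auto
  have "(LINT s:{0<..}|lborel. exp (- (a * s))) = (LINT s:{0<..}|lborel. s powr (1 - 1) * exp (- (a * s)))"
    by (rule set_lebesgue_integral_cong) auto
  also have "\<dots> = 1 / a"
    using set_integrable_Gamma_scaled(2)[of 1, OF _ assms] assms by (simp add: powr_minus divide_inverse)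
  finally show "(LINT s:{0<..}|lborel. exp (- (a * s))) = 1 / a" .
qed

definition gauss_laplace :: "real \<Rightarrow> real" where
  "gauss_laplace q = (LINT h:{0<..}|lborel. exp (- h - q / 4 * h\<^sup>2))"

text \<open>The substitution \<open>s = h + q h\<^sup>2 / 4\<close> turns \<open>1 + s q\<close> into the square \<open>(1 + q h / 2)\<^sup>2\<close>.\<close>

lemma terminant_0_of_real:
  assumes q: "q > 0"
  shows "terminant 0 (of_real q) = of_real (sqrt pi * gauss_laplace q)"
proof -
  let ?w = "\<lambda>u::real. u powr (- 1/2) * exp (- u)"
  let ?f = "\<lambda>u s. ?w u * exp (- ((1 + u * q) * s))"
  have w: "set_integrable lborel {0<..} ?w" using Gamma_half_integral(1)[of 0] by simp
  have pos: "1 + u * q > 0" if "u > 0" for u using that q by (simp add: add_pos_pos)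
  have inner1: "(LINT s:{0<..}|lborel. ?f u s) = ?w u / (1 + u * q)" if "u \<in> {0<..}" for u
    using exp_integral(2)[OF pos] that by (simp only: set_integral_mult_right greaterThan_iff) simp
  have cw: "continuous_on {0<..} (\<lambda>u. ?w u / (1 + u * q))"
    by (intro continuous_intros) (auto dest: pos)
  have iw: "set_integrable lborel {0<..} (\<lambda>u. ?w u / (1 + u * q))"
  proof (rule set_integrable_bound_continuous[OF _ cw w])
    fix u :: real assume u: "u \<in> {0<..}"
    have "?w u / (1 + u * q) \<le> ?w u / 1"
      using u q pos[of u] by (intro divide_left_mono) auto
    then show "norm (?w u / (1 + u * q)) \<le> ?w u" using u pos[of u] by simp
  qed auto
  \<comment> \<open>With \<open>1 / (1 + u * q)\<close> written as the integral of
    \<open>exp (- ((1 + u * q) * s))\<close>, the integral over \<open>u\<close> becomes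
    \<open>exp (- s) * Gamma (1/2) * (1 + s * q) powr (- 1/2)\<close>.\<close>
  have "(LINT u:{0<..}|lborel. LINT s:{0<..}|lborel. ?f u s) = (LINT s:{0<..}|lborel. LINT u:{0<..}|lborel. ?f u s)"
  proof (rule set_integral_Fubini)
    show "continuous_on ({0<..} \<times> {0<..}) (\<lambda>p. ?f (fst p) (snd p))"
      by (intro continuous_intros) auto
    show "set_integrable lborel {0<..} (?f u)" if "u \<in> {0<..}" for u
      by (intro set_integrable_mult_right exp_integral) (use pos that in auto)
    show "set_integrable lborel {0<..} (\<lambda>u. LINT s:{0<..}|lborel. norm (?f u s))"
      using iw by (rule set_integrable_cong[THEN iffD1, rotated 3, OF _ refl]) (use inner1 in \<open>simp_all add: abs_mult\<close>)
  qed auto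
  also have "\<dots> = (LINT s:{0<..}|lborel. sqrt pi * (exp (- s) * (1 + s * q) powr (- 1/2)))"
  proof (rule set_lebesgue_integral_cong, simp, intro allI impI)
    fix s :: real assume s: "s \<in> {0<..}"
    have "(LINT u:{0<..}|lborel. ?f u s) = (LINT u:{0<..}|lborel. exp (- s) * (u powr (1/2 - 1) * exp (- ((1 + s * q) * u))))"
      by (rule set_lebesgue_integral_cong) (auto simp: exp_add[symmetric] exp_diff[symmetric] algebra_simps)
    also have "\<dots> = exp (- s) * (Gamma (1/2) * (1 + s * q) powr (- (1/2)))"
      by (subst set_integral_mult_right, subst set_integrable_Gamma_scaled(2)) (use pos[of s] s in auto)
    finally show "(LINT u:{0<..}|lborel. ?f u s) = sqrt pi * (exp (- s) * (1 + s * q) powr (- 1/2))"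
      by (simp add: Gamma_one_half_real)
  qed
  also have "\<dots> = sqrt pi * (LINT s:{0<..}|lborel. exp (- s) * (1 + s * q) powr (- 1/2))"
    by (rule set_integral_mult_right)
  also have "(LINT s:{0<..}|lborel. exp (- s) * (1 + s * q) powr (- 1/2)) = gauss_laplace q"
  proof -
    let ?k = "\<lambda>s::real. exp (- s) * (1 + s * q) powr (- 1/2)"
    let ?g = "\<lambda>h::real. h + q / 4 * h\<^sup>2"
    let ?g' = "\<lambda>h::real. 1 + q / 2 * h"
    have sq: "1 + ?g h * q = (?g' h)\<^sup>2" for h by (simp add: power2_eq_square algebra_simps)
    have im: "?g ` {0<..} = {0<..}"
    proof (intro equalityI subsetI)
      fix v :: real assume v: "v \<in> {0<..}"
      \<comment> \<open>The positive root of \<open>h + q * h\<^sup>2 / 4 = v\<close>.\<close>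
      define h where "h = 2 * (sqrt (1 + v * q) - 1) / q"
      have "sqrt 1 < sqrt (1 + v * q)" using v q by (intro real_sqrt_less_mono) simp
      then have h0: "h > 0" using q unfolding h_def by (intro divide_pos_pos mult_pos_pos) auto
      have "1 + ?g h * q = 1 + v * q"
      proof -
        have "1 + q / 2 * (2 * (S - 1) / q) = S" for S :: real using q by (simp add: field_simps)
        then have "?g' h = sqrt (1 + v * q)" unfolding h_def .
        then have "1 + ?g h * q = (sqrt (1 + v * q))\<^sup>2" by (simp only: sq)
        then show ?thesis using v q by (simp only:) simp
      qed
      moreover have "G = v" if "1 + G * q = 1 + v * q" for G using that q by simp
      ultimately have "?g h = v" by blast
      then show "v \<in> ?g ` {0<..}" using h0 by (intro image_eqI[of _ _ h]) (simp_all only: greaterThan_iff)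
    qed (use q in \<open>auto intro!: add_pos_pos\<close>)
    have inj: "inj_on ?g {0<..}"
    proof (rule inj_onI)
      fix a b :: real assume ab: "a \<in> {0<..}" "b \<in> {0<..}" "?g a = ?g b"
      have "(a - b) * (1 + c * (a + b)) = (a + c * a\<^sup>2) - (b + c * b\<^sup>2)" for c
        by (simp add: algebra_simps power2_eq_square)
      then have "(a - b) * (1 + q / 4 * (a + b)) = ?g a - ?g b" .
      also have "\<dots> = 0" using ab(3) by (rule eq_iff_diff_eq_0[THEN iffD1])
      finally have "(a - b) * (1 + q / 4 * (a + b)) = 0" .
      moreover have "1 + q / 4 * (a + b) > 0" using ab q by (intro add_pos_pos mult_pos_pos) auto
      ultimately show "a = b" by simp
    qed
    have ck: "continuous_on {0<..} ?k" by (intro continuous_intros) (auto dest: pos)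
    have ik: "set_integrable lborel {0<..} ?k"
    proof (rule set_integrable_bound_continuous[OF _ ck exp_integral(1)[of 1]])
      fix s :: real assume s: "s \<in> {0<..}"
      have "(1 + s * q) powr (- 1/2) \<le> 1 powr (- 1/2)"
        using s q by (intro powr_mono2') auto
      then show "norm (?k s) \<le> exp (- (1 * s))" by simp
    qed auto
    have "(LINT h:{0<..}|lborel. \<bar>?g' h\<bar> *\<^sub>R ?k (?g h)) = (LINT s:{0<..}|lborel. ?k s)"
    proof (rule set_integral_substitution(2)[OF _ _ im ck _ _ inj ik])
      show "continuous_on {0<..} ?g'" by (intro continuous_intros)
      show "(?g has_field_derivative ?g' h) (at h)" for h
        by (rule derivative_eq_intros refl)+ simp
    qed auto
    moreover have "(LINT h:{0<..}|lborel. \<bar>?g' h\<bar> *\<^sub>R ?k (?g h)) = gauss_laplace q"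
      unfolding gauss_laplace_def
    proof (rule set_lebesgue_integral_cong, simp, intro allI impI)
      fix h :: real assume h: "h \<in> {0<..}"
      define c where "c = ?g' h"
      have c: "c > 0" unfolding c_def using h q by (intro add_pos_pos mult_pos_pos) auto
      have "c\<^sup>2 powr (- (1/2)) = inverse (c\<^sup>2 powr (1/2))" by (rule powr_minus)
      also have "c\<^sup>2 powr (1/2) = c" using c by (subst powr_half_sqrt) auto
      finally have "c\<^sup>2 powr (- 1/2) = inverse c" by (simp only: minus_divide_left)
      then have E: "\<bar>c\<bar> *\<^sub>R (E * c\<^sup>2 powr (- 1/2)) = E" for E using c by simp
      have e: "1 + ?g h * q = c\<^sup>2" unfolding c_def by (rule sq)
      have A: "\<bar>c\<bar> *\<^sub>R ?k (?g h) = exp (- ?g h)" unfolding e by (rule E)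
      have B: "- ?g h = - h - q / 4 * h\<^sup>2" by (simp only: minus_add_distrib diff_conv_add_uminus)
      have "\<bar>c\<bar> *\<^sub>R ?k (?g h) = exp (- h - q / 4 * h\<^sup>2)" using A unfolding B .
      then show "\<bar>?g' h\<bar> *\<^sub>R ?k (?g h) = exp (- h - q / 4 * h\<^sup>2)" unfolding c_def .
    qed
    ultimately show ?thesis by simp
  qed
  finally have "(LINT u:{0<..}|lborel. LINT s:{0<..}|lborel. ?f u s) = sqrt pi * gauss_laplace q" .
  moreover have "(LINT u:{0<..}|lborel. LINT s:{0<..}|lborel. ?f u s) = (LINT u:{0<..}|lborel. ?w u / (1 + u * q))"
    by (rule set_lebesgue_integral_cong) (use inner1 in auto)
  moreover have "terminant 0 (of_real q) = of_real (LINT u:{0<..}|lborel. ?w u / (1 + u * q))"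
    unfolding terminant_def by (subst set_integral_complex_of_real[symmetric]) simp
  ultimately show ?thesis by simp
qed

lemma gauss_laplace_integrable:
  fixes a q :: real
  assumes "q \<ge> 0" "a > 0"
  shows "set_integrable lborel {0<..} (\<lambda>h. exp (- (a * h) - q * h\<^sup>2))"
proof (rule set_integrable_bound_continuous[OF _ _ exp_integral(1)[OF assms(2)]])
  show "continuous_on {0<..} (\<lambda>h. exp (- (a * h) - q * h\<^sup>2))" by (intro continuous_intros)
qed (use assms in auto)

text \<open>Continuity is inherited from the holomorphy of the terminant through
  \<open>terminant_0_of_real\<close>.\<close>

lemma gauss_laplace_continuous: "continuous_on {0<..} gauss_laplace"
proof -
  have "continuous_on {0<..} (\<lambda>q. terminant 0 (complex_of_real q))"
    by (rule continuous_on_compose2[OF holomorphic_on_imp_continuous_on[OF terminant_holomorphic]])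
       (auto intro!: continuous_intros simp: complex_nonpos_Reals_iff)
  then have "continuous_on {0<..} (\<lambda>q. Re (terminant 0 (complex_of_real q)) / sqrt pi)"
    by (intro continuous_intros) auto
  then show ?thesis
    by (rule continuous_on_eq) (simp add: terminant_0_of_real)
qed

text \<open>With \<open>r = k / (1 + k)\<close> and \<open>h = (1 + k) u\<close> the integral over \<open>k\<close> becomes a gamma integral.\<close>

lemma terminant_beta_0_of_real:
  assumes m: "\<bar>m\<bar> < 1/2" and y: "y > 0"
  shows "terminant_beta 0 (of_real m) (of_real y) = of_real (sqrt pi * (Gamma (1/2 + m) *
     (LINT u:{0<..}|lborel. u powr (- m - 1/2) * exp (- u) * (1 + u * (y / 2)) powr (- m - 1/2))))"
proof -
  let ?W = "\<lambda>r. r powr (m - 1/2) * (1 - r) powr (- m - 1/2)"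
  let ?f = "\<lambda>r. ?W r * gauss_laplace (2 * r * (1 - r) * y)"
  have cr: "complex_of_real r powr (of_nat 0 + of_real m - 1/2) * of_real (1 - r) powr (of_nat 0 - of_real m - 1/2) *
      terminant 0 (of_real (2 * r * (1 - r)) * of_real y) = of_real (sqrt pi * ?f r)" if r: "r \<in> {0<..<1}" for r
  proof -
    have "complex_of_real r powr (of_nat 0 + of_real m - 1/2) = of_real (r powr (m - 1/2))"
      using r powr_of_real[of r "m - 1/2"] by simp
    moreover have "complex_of_real (1 - r) powr (of_nat 0 - of_real m - 1/2) = of_real ((1 - r) powr (- m - 1/2))"
      using r powr_of_real[of "1 - r" "- m - 1/2"] by simp
    moreover have "terminant 0 (of_real (2 * r * (1 - r)) * of_real y) = of_real (sqrt pi * gauss_laplace (2 * r * (1 - r) * y))"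
      using terminant_0_of_real[of "2 * r * (1 - r) * y"] r y by simp
    ultimately show ?thesis by (simp only: of_real_mult) (simp only: mult_ac)
  qed
  have "terminant_beta 0 (of_real m) (of_real y) = (LINT r:{0<..<1}|lborel. complex_of_real (sqrt pi * ?f r))"
    unfolding terminant_beta_def by (rule set_lebesgue_integral_cong) (use cr in auto)
  also have "\<dots> = of_real (LINT r:{0<..<1}|lborel. sqrt pi * ?f r)" by (rule set_integral_complex_of_real)
  also have "(LINT r:{0<..<1}|lborel. sqrt pi * ?f r) = sqrt pi * (LINT r:{0<..<1}|lborel. ?f r)" by (rule set_integral_mult_right)
  finally have T: "terminant_beta 0 (of_real m) (of_real y) = of_real (sqrt pi * (LINT r:{0<..<1}|lborel. ?f r))" .
  have cf: "continuous_on {0<..<1} ?f"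
    by (intro continuous_intros continuous_on_compose2[OF gauss_laplace_continuous]) (use y in auto)
  have int_f: "set_integrable lborel {0<..<1} ?f"
  proof -
    have "set_integrable lborel {0<..<1} (\<lambda>r. complex_of_real (sqrt pi * ?f r))"
      using terminant_beta_integrable[of "of_real m" 0 "of_real y"] m y
      by (intro set_integrable_cong[THEN iffD1, OF refl refl cr]) (auto simp: complex_nonpos_Reals_iff)
    then have "set_integrable lborel {0<..<1} (\<lambda>r. Re (complex_of_real (sqrt pi * ?f r)))"
      unfolding set_integrable_def by (drule_tac integrable_Re) simp
    then have "set_integrable lborel {0<..<1} (\<lambda>r. sqrt pi * ?f r)" by (simp only: Re_complex_of_real)
    then show ?thesis by (subst (asm) set_integrable_mult_right_iff) auto
  qed
  let ?F = "\<lambda>k u::real. k powr (m - 1/2) * exp (- ((1 + k) * u) - k * y / 2 * u\<^sup>2)"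
  have inner1: "\<bar>1 / (1 + k)\<^sup>2\<bar> *\<^sub>R ?f (k / (1 + k)) = (LINT u:{0<..}|lborel. ?F k u)" if k: "k \<in> {0<..}" for k
  proof -
    have k0: "k > 0" using k by simp
    have 1: "1 - k / (1 + k) = 1 / (1 + k)" using k0 by (simp add: field_simps)
    have W: "?W (k / (1 + k)) = k powr (m - 1/2) * (1 + k)"
    proof -
      have "?W (k / (1 + k)) = k powr (m - 1/2) / ((1 + k) powr (m - 1/2) * (1 + k) powr (- m - 1/2))"
        using k0 by (simp add: 1 powr_divide)
      also have "(1 + k) powr (m - 1/2) * (1 + k) powr (- m - 1/2) = (1 + k) powr (- 1)"
        by (simp flip: powr_add)
      finally show ?thesis using k0 by (simp add: powr_minus field_simps)
    qed
    define q where "q = 2 * (k / (1 + k)) * (1 - k / (1 + k)) * y"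
    \<comment> \<open>For \<open>r = k / (1 + k)\<close> one has
      \<open>r * (1 - r) = k / (1 + k)\<^sup>2\<close>, so rescaling the variable of
      \<open>gauss_laplace\<close> by \<open>1 + k\<close> leaves an exponent linear in
      \<open>k\<close>.\<close>
    have qq: "q / 4 * (1 + k)\<^sup>2 = k * y / 2" 
    proof -
      have "2 * (k / c) * (1 / c) * y / 4 * c\<^sup>2 = k * y / 2" if "c \<noteq> 0" for c :: real
        using that by (simp add: power2_eq_square)
      then show ?thesis unfolding q_def 1 using k0 by simp
    qed
    have q0: "q \<ge> 0" unfolding q_def 1 using k0 y by simp
    have im: "(\<lambda>u. (1 + k) * u) ` {0<..} = {0<..}"
      using k0 by (auto simp: image_iff intro!: bexI[of _ "_ / (1 + k)"] mult_pos_pos)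
    have inj: "inj_on (\<lambda>u. (1 + k) * u) {0<..}" using k0 by (auto intro!: inj_onI)
    have "gauss_laplace q = (LINT u:{0<..}|lborel. \<bar>1 + k\<bar> *\<^sub>R exp (- ((1 + k) * u) - q / 4 * ((1 + k) * u)\<^sup>2))"
      unfolding gauss_laplace_def
    proof (rule set_integral_substitution(2)[symmetric, where h = "\<lambda>_. 1 + k"])
      show "set_integrable lborel {0<..} (\<lambda>h. exp (- h - q / 4 * h\<^sup>2))"
        using gauss_laplace_integrable[of "q / 4" 1] q0 by simp
      show "((\<lambda>u. (1 + k) * u) has_field_derivative 1 + k) (at u)" for u
        by (auto intro!: derivative_eq_intros)
    qed (use im inj in \<open>auto intro!: continuous_intros\<close>)
    also have "\<dots> = (LINT u:{0<..}|lborel. (1 + k) * exp (- ((1 + k) * u) - k * y / 2 * u\<^sup>2))"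
    proof (rule set_lebesgue_integral_cong, simp, intro allI impI)
      fix u :: real
      have "q / 4 * ((1 + k) * u)\<^sup>2 = (q / 4 * (1 + k)\<^sup>2) * u\<^sup>2" by (simp only: power_mult_distrib mult.assoc)
      then show "\<bar>1 + k\<bar> *\<^sub>R exp (- ((1 + k) * u) - q / 4 * ((1 + k) * u)\<^sup>2) = (1 + k) * exp (- ((1 + k) * u) - k * y / 2 * u\<^sup>2)"
        unfolding qq using k0 by simp
    qed
    finally have gl: "gauss_laplace q = (1 + k) * (LINT u:{0<..}|lborel. exp (- ((1 + k) * u) - k * y / 2 * u\<^sup>2))"
      by (simp only: set_integral_mult_right)
    have "\<bar>1 / (1 + k)\<^sup>2\<bar> *\<^sub>R ?f (k / (1 + k)) = k powr (m - 1/2) * (LINT u:{0<..}|lborel. exp (- ((1 + k) * u) - k * y / 2 * u\<^sup>2))"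
      unfolding q_def[symmetric] gl W using k0 by (simp add: power2_eq_square)
    then show ?thesis by (simp only: set_integral_mult_right)
  qed
  note sub = set_integral_substitution[OF _ _ frac_one_plus_subst(1) cf frac_one_plus_subst(4,3,2) int_f]
  have "(LINT r:{0<..<1}|lborel. ?f r) = (LINT k:{0<..}|lborel. LINT u:{0<..}|lborel. ?F k u)"
    by (subst sub(2)[symmetric], simp, simp, simp, rule set_lebesgue_integral_cong) (use inner1 in auto)
  also have "\<dots> = (LINT u:{0<..}|lborel. LINT k:{0<..}|lborel. ?F k u)"
  proof (rule set_integral_Fubini)
    show "continuous_on ({0<..} \<times> {0<..}) (\<lambda>p. ?F (fst p) (snd p))"
      by (intro continuous_intros) auto
    show "set_integrable lborel {0<..} (?F k)" if "k \<in> {0<..}" for k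
      by (intro set_integrable_mult_right gauss_laplace_integrable) (use that y in auto)
    have "set_integrable lborel {0<..} (\<lambda>k. \<bar>1 / (1 + k)\<^sup>2\<bar> *\<^sub>R ?f (k / (1 + k)))" using sub(1) by simp
    then show "set_integrable lborel {0<..} (\<lambda>k. LINT u:{0<..}|lborel. norm (?F k u))"
      by (rule set_integrable_cong[THEN iffD1, rotated 3, OF _ refl]) (use inner1 in \<open>auto simp: abs_mult\<close>)
  qed auto
  also have "\<dots> = (LINT u:{0<..}|lborel. Gamma (1/2 + m) * (u powr (- m - 1/2) * exp (- u) * (1 + u * (y / 2)) powr (- m - 1/2)))"
  proof (rule set_lebesgue_integral_cong, simp, intro allI impI)
    fix u :: real assume u: "u \<in> {0<..}"
    \<comment> \<open>Collected by powers of \<open>k\<close> the exponent is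
      \<open>- u - a * k\<close>. The gamma integral in \<open>k\<close> thus has rate
      \<open>a\<close>, and \<open>a powr (- (1/2 + m))\<close> splits into the powers of
      \<open>u\<close> and of \<open>1 + u * (y / 2)\<close>.\<close>
    define a where "a = u * (1 + u * (y / 2))"
    have pos: "1 + u * (y / 2) > 0" using u y by (simp add: add_pos_pos)
    have a: "a > 0" using u pos by (simp add: a_def)
    have "(LINT k:{0<..}|lborel. ?F k u) = (LINT k:{0<..}|lborel. exp (- u) * (k powr ((1/2 + m) - 1) * exp (- (a * k))))"
      by (rule set_lebesgue_integral_cong) (auto simp: a_def exp_add[symmetric] exp_diff[symmetric] algebra_simps power2_eq_square)
    also have "\<dots> = exp (- u) * (Gamma (1/2 + m) * a powr (- (1/2 + m)))"
      by (subst set_integral_mult_right, subst set_integrable_Gamma_scaled(2)) (use m a in auto)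
    also have "a powr (- (1/2 + m)) = u powr (- m - 1/2) * (1 + u * (y / 2)) powr (- m - 1/2)"
      unfolding a_def using u pos by (subst powr_mult) (auto simp: algebra_simps)
    finally show "(LINT k:{0<..}|lborel. ?F k u) = Gamma (1/2 + m) * (u powr (- m - 1/2) * exp (- u) * (1 + u * (y / 2)) powr (- m - 1/2))"
      by (simp add: mult_ac)
  qed
  also have "\<dots> = Gamma (1/2 + m) * (LINT u:{0<..}|lborel. u powr (- m - 1/2) * exp (- u) * (1 + u * (y / 2)) powr (- m - 1/2))"
    by (rule set_integral_mult_right)
  finally show ?thesis unfolding T by simp
qed

text \<open>The substitution \<open>u = t * s\<close> moves \<open>t\<close> out of the argument
  \<open>x / t\<close> into a factor \<open>exp (- (t * s))\<close>, so that the outer integral over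
  \<open>t\<close> in \<open>legendre_rem\<close> becomes a gamma integral.\<close>

lemma terminant_beta_0_scaled:
  assumes m: "\<bar>m\<bar> < 1/2" and x: "x > 0" and t: "t > 0"
  shows "terminant_beta 0 (of_real m) (of_real x / of_real t) = of_real (sqrt pi * (Gamma (1/2 + m) * (t powr (1/2 - m) *
     (LINT s:{0<..}|lborel. s powr (- m - 1/2) * exp (- (t * s)) * (1 + s * (x / 2)) powr (- m - 1/2)))))"
proof -
  let ?f = "\<lambda>u::real. u powr (- m - 1/2) * exp (- u) * (1 + u * (x / t / 2)) powr (- m - 1/2)"
  have pos: "1 + u * (x / t / 2) > 0" if "u > 0" for u
    using that x t by (intro add_pos_pos mult_pos_pos divide_pos_pos) auto
  have cf: "continuous_on {0<..} ?f"
    by (intro continuous_intros) (auto dest: pos)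
  have int: "set_integrable lborel {0<..} ?f"
  proof (rule set_integrable_bound_continuous[OF _ cf])
    show "set_integrable lborel {0<..} (\<lambda>u. u powr ((1/2 - m) - 1) * exp (- u))"
      by (rule set_integrable_Gamma_real) (use m in auto)
    fix u :: real assume u: "u \<in> {0<..}"
    have "(1 + u * (x / t / 2)) powr (- m - 1/2) \<le> 1 powr (- m - 1/2)"
      using u x t m by (intro powr_mono2') auto
    then have "u powr (- m - 1/2) * exp (- u) * (1 + u * (x / t / 2)) powr (- m - 1/2) \<le> u powr (- m - 1/2) * exp (- u) * 1"
      by (intro mult_left_mono) auto
    then show "norm (?f u) \<le> u powr ((1/2 - m) - 1) * exp (- u)"
      by (simp add: abs_mult algebra_simps)
  qed auto
  have im: "(\<lambda>s. t * s) ` {0<..} = {0<..}"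
    using t by (auto simp: image_iff intro!: bexI[of _ "_ / t"])
  have inj: "inj_on (\<lambda>s. t * s) {0<..}" using t by (auto intro!: inj_onI)
  have "(LINT s:{0<..}|lborel. \<bar>t\<bar> *\<^sub>R ?f (t * s)) = (LINT u:{0<..}|lborel. ?f u)"
  proof (rule set_integral_substitution(2)[where h = "\<lambda>_. t", OF _ _ im cf _ _ inj int])
    show "((\<lambda>s. t * s) has_field_derivative t) (at s)" for s by (auto intro!: derivative_eq_intros)
    show "continuous_on {0<..} (\<lambda>_. t)" by simp
  qed auto
  then have "(LINT u:{0<..}|lborel. ?f u) = (LINT s:{0<..}|lborel. \<bar>t\<bar> *\<^sub>R ?f (t * s))" by (rule sym)
  also have "\<dots> = (LINT s:{0<..}|lborel. t powr (1/2 - m) * (s powr (- m - 1/2) * exp (- (t * s)) * (1 + s * (x / 2)) powr (- m - 1/2)))"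
  proof (rule set_lebesgue_integral_cong, simp, intro allI impI)
    fix s :: real assume s: "s \<in> {0<..}"
    have 1: "t * s * (x / t / 2) = s * (x / 2)" using t by simp
    have 2: "(t * s) powr (- m - 1/2) = t powr (- m - 1/2) * s powr (- m - 1/2)" by (rule powr_mult)
    have 3: "t powr (1/2 - m) = t * t powr (- m - 1/2)"
      using t powr_add[of t 1 "- m - 1/2"] by (simp add: algebra_simps)
    show "\<bar>t\<bar> *\<^sub>R ?f (t * s) = t powr (1/2 - m) * (s powr (- m - 1/2) * exp (- (t * s)) * (1 + s * (x / 2)) powr (- m - 1/2))"
      unfolding 1 2 3 using t by simp
  qed
  also have "\<dots> = t powr (1/2 - m) * (LINT s:{0<..}|lborel. s powr (- m - 1/2) * exp (- (t * s)) * (1 + s * (x / 2)) powr (- m - 1/2))"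
    by (rule set_integral_mult_right)
  finally show ?thesis
    using terminant_beta_0_of_real[OF m, of "x / t"] x t by simp
qed

text \<open>Since \<open>a_coeff 0 m = 1\<close>, the formula \<open>a_coeff_Gamma_real\<close> at
  index 0 is the reflection formula.\<close>

lemma Gamma_half_reflection:
  assumes m: "\<bar>m\<bar> < 1/2"
  shows "cos (pi * m) / pi * Gamma (1/2 + m) = 1 / Gamma (1/2 - m)"
proof -
  have "a_coeff 0 m = 1" by (simp add: a_coeff_def)
  then have "cos (pi * m) * (Gamma (1/2 + m) * Gamma (1/2 - m)) / pi = 1"
    using a_coeff_Gamma_real[of m 0] m by simp
  moreover have "Gamma (1/2 - m) > 0" using m by (intro Gamma_real_pos) auto
  ultimately show ?thesis by (simp add: field_simps)
qed

text \<open>For fixed \<open>s\<close> the variable \<open>t\<close> occurs only in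
  \<open>t powr (\<nu> - m) * exp (- ((1 + s) * t))\<close>; integrating over it first leaves
  Euler's integrand times \<open>Gamma (\<nu> + 1 - m)\<close>. The remaining constants collapse to
  \<open>1 / Gamma (1/2 - m)\<close> by \<open>Gamma_half_reflection\<close>.\<close>

lemma legendre_rem_0_euler_pos:
  assumes m: "\<bar>m\<bar> < 1/2" and \<nu>: "Re \<nu> > - 1/2" and x: "x > 0"
  shows "legendre_rem 0 (of_real x) (of_real m) \<nu> =
     Gamma (\<nu> + 1 - of_real m) / of_real (Gamma (1/2 - m)) * euler_integral m \<nu> (of_real x)"
proof -
  let ?S = "\<lambda>s. s powr (- m - 1/2) * (1 + s * (x / 2)) powr (- m - 1/2)"
  let ?W = "\<lambda>t. complex_of_real t powr (\<nu> + 1 - of_real m - 1)"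
  let ?f = "\<lambda>s t. of_real (?S s) * (?W t * exp (- (of_real (1 + s) * of_real t)))"
  have pos: "1 + s * (x / 2) > 0" if "s > 0" for s using that x by (simp add: add_pos_pos)
  have z: "Re (\<nu> + 1 - of_real m) > 0" using m \<nu> by simp
  have inner_t: "(LINT t:{0<..}|lborel. ?f s t) = of_real (?S s) * (Gamma (\<nu> + 1 - of_real m) * of_real (1 + s) powr (- (\<nu> + 1 - of_real m)))"
    "set_integrable lborel {0<..} (?f s)" if "s \<in> {0<..}" for s
  proof -
    have a: "Re (complex_of_real (1 + s)) > 0" using that by simp
    show "(LINT t:{0<..}|lborel. ?f s t) = of_real (?S s) * (Gamma (\<nu> + 1 - of_real m) * of_real (1 + s) powr (- (\<nu> + 1 - of_real m)))"
      by (subst set_integral_mult_right, subst set_integral_Gamma_complex_scaled(2)[OF z a]) (rule refl)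
    show "set_integrable lborel {0<..} (?f s)"
      by (intro set_integrable_mult_right set_integral_Gamma_complex_scaled z a)
  qed
  have norm_f: "norm (?f s t) = ?S s * (t powr (Re \<nu> + 1 - m - 1) * exp (- ((1 + s) * t)))" if "s \<in> {0<..}" "t \<in> {0<..}" for s t
  proof -
    have "norm (?W t) = t powr (Re \<nu> + 1 - m - 1)" using that by (subst norm_of_real_powr) auto
    moreover have "norm (exp (- (of_real (1 + s) * complex_of_real t))) = exp (- ((1 + s) * t))" by simp
    moreover have "norm (complex_of_real (?S s)) = ?S s"
      by (simp only: norm_of_real abs_mult abs_of_nonneg[OF powr_ge_zero])
    ultimately show ?thesis by (simp only: norm_mult)
  qed
  have swap: "(LINT s:{0<..}|lborel. LINT t:{0<..}|lborel. ?f s t) = (LINT t:{0<..}|lborel. LINT s:{0<..}|lborel. ?f s t)"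
  proof (rule set_integral_Fubini)
    have c1: "continuous_on ({0<..} \<times> {0<..}) (\<lambda>p. complex_of_real (snd p) powr (\<nu> + 1 - of_real m - 1))"
      by (rule continuous_on_powr_slit) (auto intro!: continuous_intros simp: complex_nonpos_Reals_iff)
    have c2: "continuous_on ({0<..} \<times> {0<..}) (\<lambda>p. complex_of_real (?S (fst p)))"
      by (intro continuous_intros) (auto dest: pos)
    have c3: "continuous_on ({0<..} \<times> {0<..}) (\<lambda>p. exp (- (complex_of_real (1 + fst p) * of_real (snd p))))"
      by (intro continuous_intros)
    show "continuous_on ({0<..} \<times> {0<..}) (\<lambda>p. ?f (fst p) (snd p))"
      by (intro continuous_on_mult c1 c2 c3)
    show "set_integrable lborel {0<..} (?f s)" if "s \<in> {0<..}" for s by (rule inner_t(2)[OF that])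
    have eq: "(LINT t:{0<..}|lborel. norm (?f s t)) = Gamma (Re \<nu> + 1 - m) * (?S s * (1 + s) powr (m - Re \<nu> - 1))" if s: "s \<in> {0<..}" for s
    proof -
      have "(LINT t:{0<..}|lborel. norm (?f s t)) = (LINT t:{0<..}|lborel. ?S s * (t powr (Re \<nu> + 1 - m - 1) * exp (- ((1 + s) * t))))"
        by (rule set_lebesgue_integral_cong) (use norm_f s in auto)
      also have "\<dots> = ?S s * (Gamma (Re \<nu> + 1 - m) * (1 + s) powr (- (Re \<nu> + 1 - m)))"
        by (subst set_integral_mult_right, subst set_integrable_Gamma_scaled(2)) (use m \<nu> s in auto)
      finally show ?thesis by (simp add: algebra_simps)
    qed
    have "set_integrable lborel {0<..} (\<lambda>s. Gamma (Re \<nu> + 1 - m) * (?S s * (1 + s) powr (m - Re \<nu> - 1)))"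
    proof (rule set_integrable_mult_right, rule set_integrable_bound_continuous[OF _ _ euler_weight_integrable[OF m \<nu>]])
      show "continuous_on {0<..} (\<lambda>s. ?S s * (1 + s) powr (m - Re \<nu> - 1))"
        by (intro continuous_intros) (auto dest: pos)
      fix s :: real assume s: "s \<in> {0<..}"
      have "(1 + s * (x / 2)) powr (- m - 1/2) \<le> 1 powr (- m - 1/2)"
        using s x m by (intro powr_mono2') auto
      then have "s powr (- m - 1/2) * (1 + s * (x / 2)) powr (- m - 1/2) * (1 + s) powr (m - Re \<nu> - 1) \<le> s powr (- m - 1/2) * 1 * (1 + s) powr (m - Re \<nu> - 1)"
        by (intro mult_left_mono mult_right_mono) auto
      then show "norm (?S s * (1 + s) powr (m - Re \<nu> - 1)) \<le> s powr (- m - 1/2) * (1 + s) powr (m - Re \<nu> - 1)"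
        by (simp add: abs_mult)
    qed simp
    then show "set_integrable lborel {0<..} (\<lambda>s. LINT t:{0<..}|lborel. norm (?f s t))"
      by (rule set_integrable_cong[THEN iffD1, rotated 3, OF _ refl]) (simp_all only: eq)
  qed auto
  have outer: "complex_of_real t powr (\<nu> - of_nat 0 - 1/2) * of_real (exp (- t)) * terminant_beta 0 (of_real m) (of_real x / of_real t)
      = of_real (sqrt pi * Gamma (1/2 + m)) * (LINT s:{0<..}|lborel. ?f s t)" if t: "t \<in> {0<..}" for t
  proof -
    let ?E = "\<lambda>s. s powr (- m - 1/2) * exp (- (t * s)) * (1 + s * (x / 2)) powr (- m - 1/2)"
    have "(LINT s:{0<..}|lborel. ?f s t) = (LINT s:{0<..}|lborel. (?W t * of_real (exp (- t))) * of_real (?E s))"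
    proof (rule set_lebesgue_integral_cong, simp, intro allI impI)
      fix s :: real
      have "exp (- (of_real (1 + s) * complex_of_real t)) = of_real (exp (- t)) * of_real (exp (- (t * s)))"
        by (simp flip: exp_of_real exp_add add: algebra_simps)
      then show "?f s t = (?W t * of_real (exp (- t))) * of_real (?E s)"
        by (simp add: mult_ac)
    qed
    also have "\<dots> = (?W t * of_real (exp (- t))) * (LINT s:{0<..}|lborel. complex_of_real (?E s))" by (rule set_integral_mult_right)
    also have "(LINT s:{0<..}|lborel. complex_of_real (?E s)) = of_real (LINT s:{0<..}|lborel. ?E s)" by (rule set_integral_complex_of_real)
    finally have I: "(LINT s:{0<..}|lborel. ?f s t) = (?W t * of_real (exp (- t))) * of_real (LINT s:{0<..}|lborel. ?E s)" .
    have W: "?W t = complex_of_real t powr (\<nu> - of_nat 0 - 1/2) * of_real (t powr (1/2 - m))"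
    proof -
      have "complex_of_real (t powr (1/2 - m)) = of_real t powr of_real (1/2 - m)" using t by (intro powr_of_real[symmetric]) simp
      then show ?thesis using t powr_add[of "complex_of_real t" "\<nu> - of_nat 0 - 1/2" "of_real (1/2 - m)"] by (simp add: algebra_simps)
    qed
    have t0: "t > 0" using t by simp
    show ?thesis unfolding terminant_beta_0_scaled[OF m x t0] I unfolding W by (simp only: of_real_mult mult_ac)
  qed
  have "(LINT t:{0<..}|lborel. of_real t powr (\<nu> - of_nat 0 - 1/2) * of_real (exp (- t)) * terminant_beta 0 (of_real m) (of_real x / of_real t))
     = (LINT t:{0<..}|lborel. of_real (sqrt pi * Gamma (1/2 + m)) * (LINT s:{0<..}|lborel. ?f s t))"
    by (rule set_lebesgue_integral_cong) (use outer in auto)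
  also have "\<dots> = of_real (sqrt pi * Gamma (1/2 + m)) * (LINT s:{0<..}|lborel. LINT t:{0<..}|lborel. ?f s t)"
    by (subst set_integral_mult_right, subst swap) (rule refl)
  also have "(LINT s:{0<..}|lborel. LINT t:{0<..}|lborel. ?f s t) = (LINT s:{0<..}|lborel. Gamma (\<nu> + 1 - of_real m) *
     (of_real (s powr (- m - 1/2)) * of_real (1 + s) powr (of_real m - \<nu> - 1) * (1 + of_real s * (of_real x / 2)) powr of_real (- m - 1/2)))"
  proof (rule set_lebesgue_integral_cong, simp, intro allI impI)
    fix s :: real assume s: "s \<in> {0<..}"
    have "(1 + complex_of_real s * (of_real x / 2)) powr of_real (- m - 1/2) = of_real ((1 + s * (x / 2)) powr (- m - 1/2))"
      using powr_of_real[of "1 + s * (x / 2)" "- m - 1/2"] pos[of s] s by simp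
    then show "(LINT t:{0<..}|lborel. ?f s t) = Gamma (\<nu> + 1 - of_real m) *
     (of_real (s powr (- m - 1/2)) * of_real (1 + s) powr (of_real m - \<nu> - 1) * (1 + of_real s * (of_real x / 2)) powr of_real (- m - 1/2))"
      unfolding inner_t(1)[OF s] by (simp add: mult_ac algebra_simps)
  qed
  also have "\<dots> = Gamma (\<nu> + 1 - of_real m) * euler_integral m \<nu> (of_real x)"
    unfolding euler_integral_def by (rule set_integral_mult_right)
  finally have "legendre_rem 0 (of_real x) (of_real m) \<nu> =
     of_real (cos (pi * m) / pi powr (3/2) * (sqrt pi * Gamma (1/2 + m))) * (Gamma (\<nu> + 1 - of_real m) * euler_integral m \<nu> (of_real x))"
    unfolding legendre_rem_def by (simp add: of_real_cos_pi)
  also have "cos (pi * m) / pi powr (3/2) * (sqrt pi * Gamma (1/2 + m)) = 1 / Gamma (1/2 - m)"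
  proof -
    have "pi powr (3/2) = pi * sqrt pi"
      using powr_add[of pi 1 "1/2"] by (simp add: powr_half_sqrt)
    then show ?thesis using Gamma_half_reflection[OF m] by simp
  qed
  finally show ?thesis by simp
qed

lemma islimpt_of_real_Ioo:
  assumes "a < x" "x < b"
  shows "complex_of_real x islimpt complex_of_real ` {a<..<b}"
proof (subst islimpt_sequential, intro exI[of _ "\<lambda>n. of_real (x + (b - x) / real (n + 2))"] conjI allI)
  have "(\<lambda>n. (b - x) / real (n + 2)) \<longlonglongrightarrow> 0"
    using LIMSEQ_ignore_initial_segment[OF lim_const_over_n[of "b - x"], of 2] .
  then have "(\<lambda>n. complex_of_real (x + (b - x) / real (n + 2))) \<longlonglongrightarrow> of_real (x + 0)"
    by (intro tendsto_of_real tendsto_add tendsto_const)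
  then show "(\<lambda>n. complex_of_real (x + (b - x) / real (n + 2))) \<longlonglongrightarrow> of_real x" by simp
  show "complex_of_real (x + (b - x) / real (n + 2)) \<in> complex_of_real ` {a<..<b} - {of_real x}" for n
  proof -
    have "(b - x) / real (n + 2) < (b - x) / 1"
      using assms by (intro divide_strict_left_mono) auto
    moreover have "(b - x) / real (n + 2) > 0" using assms by simp
    moreover have "c \<in> {0<..<b - x} \<Longrightarrow> x + c \<in> {a<..<b} \<and> x + c \<noteq> x" for c using assms by auto
    ultimately have "x + (b - x) / real (n + 2) \<in> {a<..<b} \<and> x + (b - x) / real (n + 2) \<noteq> x" by simp
    then show ?thesis by (metis Diff_iff imageI of_real_eq_iff singletonD)
  qed
qed

lemma connected_slit: "connected (- \<real>\<^sub>\<le>\<^sub>0 :: complex set)"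
proof (rule starlike_imp_connected)
  have "closed_segment 1 z \<subseteq> - \<real>\<^sub>\<le>\<^sub>0" if z: "z \<in> - \<real>\<^sub>\<le>\<^sub>0" for z :: complex
  proof
    fix w assume "w \<in> closed_segment 1 z"
    then obtain u where u: "0 \<le> u" "u \<le> 1" and w: "w = of_real (1 - u) + of_real u * z"
      by (auto simp: in_segment scaleR_conv_of_real)
    show "w \<in> - \<real>\<^sub>\<le>\<^sub>0"
    proof (cases "u = 0 \<or> Im z \<noteq> 0")
      case True
      then show ?thesis using w by (auto simp: complex_nonpos_Reals_iff)
    next
      case False
      then have "Re z > 0" "u > 0" using z u by (auto simp: complex_nonpos_Reals_iff)
      then have "(1 - u) + u * Re z > 0" using u by (intro add_nonneg_pos) auto
      then show ?thesis using w by (auto simp: complex_nonpos_Reals_iff)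
    qed
  qed
  then show "starlike (- \<real>\<^sub>\<le>\<^sub>0 :: complex set)"
    unfolding starlike_def by (intro bexI[of _ 1]) auto
qed

text \<open>The order of integration was changed for positive \<open>x\<close>, where the factors
  \<open>1 + s * (x / 2)\<close> are at least 1; both sides are holomorphic on the slit plane, which
  is connected.\<close>

lemma legendre_rem_0_euler:
  assumes m: "\<bar>m\<bar> < 1/2" and \<nu>: "Re \<nu> > - 1/2" and x: "x \<notin> \<real>\<^sub>\<le>\<^sub>0"
  shows "legendre_rem 0 x (of_real m) \<nu> =
     Gamma (\<nu> + 1 - of_real m) / of_real (Gamma (1/2 - m)) * euler_integral m \<nu> x"
proof -
  let ?h = "\<lambda>x. legendre_rem 0 x (of_real m) \<nu> - Gamma (\<nu> + 1 - of_real m) / of_real (Gamma (1/2 - m)) * euler_integral m \<nu> x"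
  have "?h x = 0"
  proof (rule analytic_continuation[where S = "- \<real>\<^sub>\<le>\<^sub>0" and U = "of_real ` {0<..<2}" and \<xi> = 1 and f = ?h])
    show "?h holomorphic_on - \<real>\<^sub>\<le>\<^sub>0"
      by (intro holomorphic_intros legendre_rem_holomorphic euler_integral_holomorphic) (use m \<nu> in auto)
    show "1 islimpt complex_of_real ` {0<..<2}" using islimpt_of_real_Ioo[of 0 1 2] by simp
    show "connected (- \<real>\<^sub>\<le>\<^sub>0 :: complex set)" by (rule connected_slit)
    show "?h z = 0" if "z \<in> of_real ` {0<..<2}" for z
      using that legendre_rem_0_euler_pos[OF m \<nu>] by auto
  qed (use x in \<open>auto simp: complex_nonpos_Reals_iff\<close>)
  then show ?thesis by simp
qed

section \<open>A contour identity\<close>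

text \<open>On the imaginary axis this is the Mehler-Dirichlet integrand \<open>exp (\<i> * (\<nu> +
  1/2) * \<eta>) * (cos \<eta> - cos b) powr (- m - 1/2)\<close>. Its branch points
  \<open>\<plusminus>\<i> * b\<close> are the corners of the half strip, and for
  \<open>Re \<nu> > - 1/2\<close> the exponential factor decays to the left.\<close>

definition contour_fun :: "real \<Rightarrow> real \<Rightarrow> complex \<Rightarrow> complex \<Rightarrow> complex" where
  "contour_fun b m \<nu> t = exp ((\<nu> + 1/2) * t) * (cosh t - of_real (cos b)) powr of_real (- m - 1/2)"

lemma Re_cosh_complex: "Re (cosh t) = cosh (Re t) * cos (Im t)"
  and Im_cosh_complex: "Im (cosh t) = sinh (Re t) * sin (Im t)"
  by (simp_all add: cosh_def sinh_def Re_exp Im_exp algebra_simps)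

text \<open>The imaginary part \<open>sinh (Re t) * sin (Im t)\<close> vanishes in the strip only on
  the two axes, where the real part is positive. Hence the principal power is continuous on the
  closed strip apart from the corners.\<close>

lemma cosh_minus_cos_notin_nonpos_Reals:
  assumes b: "0 < b" "b < pi" and t: "\<bar>Im t\<bar> \<le> b" "Re t \<noteq> 0 \<or> \<bar>Im t\<bar> < b"
  shows "cosh t - of_real (cos b) \<notin> \<real>\<^sub>\<le>\<^sub>0"
proof
  assume "cosh t - of_real (cos b) \<in> \<real>\<^sub>\<le>\<^sub>0"
  then have "Re (cosh t) - cos b \<le> 0" "Im (cosh t) = 0"
    unfolding complex_nonpos_Reals_iff by simp_all
  then have le: "cosh (Re t) * cos (Im t) \<le> cos b" and im: "sinh (Re t) = 0 \<or> sin (Im t) = 0"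
    unfolding Re_cosh_complex Im_cosh_complex by (simp_all only: mult_eq_0_iff diff_le_0_iff_le)
  have cb: "cos b < 1" using b cos_monotone_0_pi[of 0 b] by simp
  from im show False
  proof
    assume "sinh (Re t) = 0"
    then have r: "Re t = 0" by simp
    then have "cos b < cos \<bar>Im t\<bar>" using t b by (intro cos_monotone_0_pi) linarith+
    then show False using le r by simp
  next
    assume "sin (Im t) = 0"
    then have "Im t = 0" by (rule sin_eq_0_pi[rotated 2]) (use t b in linarith)+
    then have "cosh (Re t) \<le> cos b" using le by simp
    then show False using cb cosh_real_ge_1[of "Re t"] by linarith
  qed
qed

text \<open>This is the squared modulus of \<open>cosh t - cosh (\<i> * b) = 2 * sinh ((t + \<i> *
  b) / 2) * sinh ((t - \<i> * b) / 2)\<close>. Since \<open>cos \<le> 1 \<le> cosh\<close>, lowering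
  both factors gives the two bounds below, one independent of \<open>Im t\<close>, the other of
  \<open>Re t\<close>.\<close>

lemma norm_cosh_minus_cos_sq:
  "(norm (cosh t - of_real (cos b)))\<^sup>2 = (cosh (Re t) - cos (Im t - b)) * (cosh (Re t) - cos (Im t + b))"
proof -
  have "(norm (cosh t - of_real (cos b)))\<^sup>2 = (cosh (Re t) * cos (Im t) - cos b)\<^sup>2 + (sinh (Re t) * sin (Im t))\<^sup>2"
    by (simp add: cmod_power2 Re_cosh_complex Im_cosh_complex)
  also have "\<dots> = (cosh (Re t) - cos (Im t) * cos b)\<^sup>2 - (sin (Im t) * sin b)\<^sup>2"
  proof -
    define C s c d S where "C = cosh (Re t)" "s = sin (Im t)" "c = cos (Im t)" "d = cos b" "S = sin b"
    have "(sinh (Re t))\<^sup>2 = C\<^sup>2 - 1" by (simp add: C_s_c_d_S_def sinh_square_eq)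
    moreover have "s\<^sup>2 = 1 - c\<^sup>2" "S\<^sup>2 = 1 - d\<^sup>2" by (simp_all add: C_s_c_d_S_def sin_squared_eq)
    moreover have "(C * c - d)\<^sup>2 + (C\<^sup>2 - 1) * (1 - c\<^sup>2) = (C - c * d)\<^sup>2 - (1 - c\<^sup>2) * (1 - d\<^sup>2)"
      by (simp add: power2_eq_square algebra_simps)
    ultimately show ?thesis by (simp add: C_s_c_d_S_def power_mult_distrib)
  qed
  also have "\<dots> = (cosh (Re t) - cos (Im t - b)) * (cosh (Re t) - cos (Im t + b))"
    by (simp add: cos_add cos_diff power2_eq_square algebra_simps)
  finally show ?thesis .
qed

text \<open>Uniform in the height, as the horizontal sides of the contour require; the price is a
  double zero of the bound at \<open>Re t = 0\<close>.\<close>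

lemma norm_cosh_minus_cos_ge_cosh: "norm (cosh t - of_real (cos b)) \<ge> cosh (Re t) - 1"
proof -
  have le: "cos x \<le> cosh (Re t)" for x :: real using cos_le_one[of x] cosh_real_ge_1[of "Re t"] by linarith
  have "(cosh (Re t) - 1)\<^sup>2 = (cosh (Re t) - 1) * (cosh (Re t) - 1)" by (rule power2_eq_square)
  also have "\<dots> \<le> (norm (cosh t - of_real (cos b)))\<^sup>2"
    unfolding norm_cosh_minus_cos_sq by (intro mult_mono) (auto simp: cosh_real_ge_1 le)
  finally show ?thesis by (rule power2_le_imp_le) simp
qed

text \<open>Leaving the imaginary axis increases both factors of
  \<open>norm_cosh_minus_cos_sq\<close>, and on the axis their product is the square of
  \<open>cos (Im t) - cos b\<close>. Uniform in the abscissa, for the vertical sides.\<close>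

lemma norm_cosh_minus_cos_ge_cos: "norm (cosh t - of_real (cos b)) \<ge> cos (Im t) - cos b"
proof -
  have le: "cos x \<le> cosh (Re t)" for x :: real using cos_le_one[of x] cosh_real_ge_1[of "Re t"] by linarith
  have "(cos (Im t) - cos b)\<^sup>2 = (1 - cos (Im t - b)) * (1 - cos (Im t + b))"
  proof -
    define s c d S where "s = sin (Im t)" "c = cos (Im t)" "d = cos b" "S = sin b"
    have "s\<^sup>2 = 1 - c\<^sup>2" "S\<^sup>2 = 1 - d\<^sup>2" by (simp_all add: s_c_d_S_def sin_squared_eq)
    then have "(s * S)\<^sup>2 = (1 - c\<^sup>2) * (1 - d\<^sup>2)" by (simp add: power_mult_distrib)
    moreover have "(1 - (c * d + X)) * (1 - (c * d - X)) = (1 - c * d)\<^sup>2 - X\<^sup>2" for X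
      by (simp add: power2_eq_square algebra_simps)
    ultimately have "(1 - (c * d + s * S)) * (1 - (c * d - s * S)) = (1 - c * d)\<^sup>2 - (1 - c\<^sup>2) * (1 - d\<^sup>2)" by simp
    also have "\<dots> = (c - d)\<^sup>2" by (simp add: power2_eq_square algebra_simps)
    finally show ?thesis by (simp add: s_c_d_S_def cos_add cos_diff)
  qed
  also have "\<dots> \<le> (norm (cosh t - of_real (cos b)))\<^sup>2"
    unfolding norm_cosh_minus_cos_sq by (intro mult_mono) (auto simp: cosh_real_ge_1 le)
  finally show ?thesis by (rule power2_le_imp_le) simp
qed

lemma norm_contour_fun_le:
  assumes b: "\<bar>Im t\<bar> \<le> b" and m: "m > - 1/2" and d: "d > 0" "norm (cosh t - of_real (cos b)) \<ge> d"
  shows "norm (contour_fun b m \<nu> t) \<le> exp (\<bar>Im \<nu>\<bar> * b) * (exp ((Re \<nu> + 1/2) * Re t) * d powr (- m - 1/2))"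
proof -
  have "norm (exp ((\<nu> + 1/2) * t)) = exp ((Re \<nu> + 1/2) * Re t - Im \<nu> * Im t)" by simp
  also have "\<dots> \<le> exp (\<bar>Im \<nu>\<bar> * b + (Re \<nu> + 1/2) * Re t)"
  proof -
    have "- (Im \<nu> * Im t) \<le> \<bar>Im \<nu>\<bar> * \<bar>Im t\<bar>" by (metis abs_ge_minus_self abs_mult)
    also have "\<dots> \<le> \<bar>Im \<nu>\<bar> * b" using b by (intro mult_left_mono) auto
    finally show ?thesis by simp
  qed
  finally have 1: "norm (exp ((\<nu> + 1/2) * t)) \<le> exp (\<bar>Im \<nu>\<bar> * b) * exp ((Re \<nu> + 1/2) * Re t)" by (simp add: exp_add)
  have "norm ((cosh t - of_real (cos b)) powr of_real (- m - 1/2)) = norm (cosh t - of_real (cos b)) powr (- m - 1/2)"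
    by (subst norm_powr_real_powr') auto
  also have "\<dots> \<le> d powr (- m - 1/2)" using d m by (intro powr_mono2') auto
  finally have 2: "norm ((cosh t - of_real (cos b)) powr of_real (- m - 1/2)) \<le> d powr (- m - 1/2)" .
  have "norm (contour_fun b m \<nu> t) \<le> (exp (\<bar>Im \<nu>\<bar> * b) * exp ((Re \<nu> + 1/2) * Re t)) * d powr (- m - 1/2)"
    unfolding contour_fun_def norm_mult by (rule mult_mono[OF 1 2]) auto
  then show ?thesis by (simp add: mult.assoc)
qed

lemma contour_fun_continuous:
  assumes b: "0 < b" "b < pi" and A: "\<And>t. t \<in> A \<Longrightarrow> \<bar>Im t\<bar> \<le> b \<and> (Re t \<noteq> 0 \<or> \<bar>Im t\<bar> < b)"
  shows "continuous_on A (contour_fun b m \<nu>)"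
proof -
  have "continuous_on A (\<lambda>t. (cosh t - complex_of_real (cos b)) powr of_real (- m - 1/2))"
  proof (rule continuous_on_powr_slit)
    show "continuous_on A (\<lambda>t. cosh t - complex_of_real (cos b))"
      unfolding cosh_field_def by (intro continuous_intros) auto
    show "cosh t - of_real (cos b) \<notin> \<real>\<^sub>\<le>\<^sub>0" if "t \<in> A" for t
      by (rule cosh_minus_cos_notin_nonpos_Reals[OF b]) (use A[OF that] in auto)
  qed
  moreover have "continuous_on A (\<lambda>t. exp ((\<nu> + 1/2) * t))" by (intro continuous_intros)
  ultimately show ?thesis unfolding contour_fun_def by (intro continuous_on_mult)
qed

text \<open>The open half strip is convex, so a holomorphic function has a primitive there, and
  Cauchy's theorem for a rectangle reduces to differences of corner values.\<close>

lemma contour_fun_primitive: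
  assumes b: "0 < b" "b < pi"
  obtains A where "\<And>t. Re t < 0 \<Longrightarrow> \<bar>Im t\<bar> < b \<Longrightarrow> (A has_field_derivative contour_fun b m \<nu> t) (at t)"
proof -
  let ?H = "{t. Re t < 0} \<inter> {t. Im t < b} \<inter> {t. Im t > - b}"
  have o: "open ?H" by (intro open_Int open_halfspace_Re_lt open_halfspace_Im_lt open_halfspace_Im_gt)
  have cvx: "convex ?H" by (intro convex_Int convex_halfspace_Re_lt convex_halfspace_Im_lt convex_halfspace_Im_gt)
  have hol: "contour_fun b m \<nu> holomorphic_on ?H"
  proof -
    have "(\<lambda>t. (cosh t - complex_of_real (cos b)) powr of_real (- m - 1/2)) holomorphic_on ?H"
    proof (rule holomorphic_on_powr)
      show "(\<lambda>t. cosh t - complex_of_real (cos b)) holomorphic_on ?H"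
        unfolding cosh_field_def by (intro holomorphic_intros) auto
      show "cosh t - of_real (cos b) \<notin> \<real>\<^sub>\<le>\<^sub>0" if "t \<in> ?H" for t
        by (rule cosh_minus_cos_notin_nonpos_Reals[OF b]) (use that in auto)
    qed auto
    moreover have "(\<lambda>t. exp ((\<nu> + 1/2) * t)) holomorphic_on ?H" by (intro holomorphic_intros)
    ultimately show ?thesis unfolding contour_fun_def by (rule holomorphic_on_mult[rotated])
  qed
  obtain A where A: "\<And>t. t \<in> ?H \<Longrightarrow> (A has_field_derivative contour_fun b m \<nu> t) (at t within ?H)"
    by (rule holomorphic_convex_primitive'[OF cvx o hol]) blast
  show thesis
  proof (rule that)
    fix t assume "Re t < 0" "\<bar>Im t\<bar> < b"
    then have H: "t \<in> ?H" by auto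
    show "(A has_field_derivative contour_fun b m \<nu> t) (at t)"
      using A[OF H] unfolding at_within_open[OF H o] .
  qed
qed

text \<open>The margins \<open>c < b\<close> and \<open>0 < e\<close> keep the rectangle inside the
  domain of the primitive, away from the branch points; both tend to 0 later.\<close>

lemma contour_fun_rectangle:
  assumes b: "0 < b" "b < pi" and c: "0 < c" "c < b" and e: "0 < e" "e < L"
  shows "integral {- L..- e} (\<lambda>\<theta>. contour_fun b m \<nu> (of_real \<theta> + \<i> * of_real c)) -
         integral {- L..- e} (\<lambda>\<theta>. contour_fun b m \<nu> (of_real \<theta> + \<i> * of_real (- c))) =
         integral {- c..c} (\<lambda>\<eta>. \<i> * contour_fun b m \<nu> (of_real (- e) + \<i> * of_real \<eta>)) -
         integral {- c..c} (\<lambda>\<eta>. \<i> * contour_fun b m \<nu> (of_real (- L) + \<i> * of_real \<eta>))"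
proof -
  obtain A where A: "\<And>t. Re t < 0 \<Longrightarrow> \<bar>Im t\<bar> < b \<Longrightarrow> (A has_field_derivative contour_fun b m \<nu> t) (at t)"
    using contour_fun_primitive[OF b] by metis
  have hor: "integral {- L..- e} (\<lambda>\<theta>. contour_fun b m \<nu> (of_real \<theta> + \<i> * of_real d)) =
      A (of_real (- e) + \<i> * of_real d) - A (of_real (- L) + \<i> * of_real d)" if d: "\<bar>d\<bar> < b" for d
  proof (rule integral_unique, rule fundamental_theorem_of_calculus)
    fix \<theta> assume th: "\<theta> \<in> {- L..- e}"
    have "(A has_field_derivative contour_fun b m \<nu> (of_real \<theta> + \<i> * of_real d)) (at (of_real \<theta> + \<i> * of_real d))"
      by (rule A) (use th e d in auto)
    then have "((\<lambda>z. A (z + \<i> * of_real d)) has_field_derivative contour_fun b m \<nu> (of_real \<theta> + \<i> * of_real d)) (at (of_real \<theta>))"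
      by (simp only: DERIV_shift)
    then show "((\<lambda>\<theta>. A (of_real \<theta> + \<i> * of_real d)) has_vector_derivative contour_fun b m \<nu> (of_real \<theta> + \<i> * of_real d)) (at \<theta> within {- L..- e})"
      by (rule has_vector_derivative_real_field)
  qed (use e in auto)
  have ver: "integral {- c..c} (\<lambda>\<eta>. \<i> * contour_fun b m \<nu> (of_real (- d) + \<i> * of_real \<eta>)) =
      A (of_real (- d) + \<i> * of_real c) - A (of_real (- d) + \<i> * of_real (- c))" if d: "d > 0" for d
  proof (rule integral_unique, rule fundamental_theorem_of_calculus)
    fix \<eta> assume et: "\<eta> \<in> {- c..c}"
    have "(A has_field_derivative contour_fun b m \<nu> (of_real (- d) + \<i> * of_real \<eta>)) (at (of_real (- d) + \<i> * of_real \<eta>))"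
      by (rule A) (use et c d in auto)
    moreover have "((\<lambda>z. of_real (- d) + \<i> * z) has_field_derivative \<i>) (at (of_real \<eta>))"
      by (auto intro!: derivative_eq_intros)
    ultimately have "((\<lambda>z. A (of_real (- d) + \<i> * z)) has_field_derivative contour_fun b m \<nu> (of_real (- d) + \<i> * of_real \<eta>) * \<i>) (at (of_real \<eta>))"
      by (rule DERIV_chain2)
    then have "((\<lambda>\<eta>. A (of_real (- d) + \<i> * of_real \<eta>)) has_vector_derivative contour_fun b m \<nu> (of_real (- d) + \<i> * of_real \<eta>) * \<i>) (at \<eta> within {- c..c})"
      by (rule has_vector_derivative_real_field)
    then show "((\<lambda>\<eta>. A (of_real (- d) + \<i> * of_real \<eta>)) has_vector_derivative \<i> * contour_fun b m \<nu> (of_real (- d) + \<i> * of_real \<eta>)) (at \<eta> within {- c..c})"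
      by (simp only: mult.commute)
  qed (use c in auto)
  show ?thesis
    using hor[of c] hor[of "- c"] ver[of e] ver[of L] c e by simp
qed

text \<open>One argument is at most a right angle and the other strictly less, so their sum stays in
  the principal range. The boundary case serves the purely imaginary factor
  \<open>- \<i> * sin c\<close>.\<close>

lemma mult_powr_Re_nonneg:
  assumes "w \<noteq> 0" "Re w \<ge> 0" "Re y > 0"
  shows "(w * y) powr a = w powr a * y powr a"
proof -
  have y: "y \<noteq> 0" using assms by auto
  have "\<bar>Im (Ln w)\<bar> \<le> pi / 2" using Re_Ln_pos_le[OF assms(1)] assms(2) by simp
  moreover have "\<bar>Im (Ln y)\<bar> < pi / 2" using Re_Ln_pos_lt[OF y] assms(3) by simp
  ultimately have "Ln (w * y) = Ln w + Ln y"
    by (intro Ln_times_simple) (use assms y in \<open>auto simp: abs_le_iff abs_less_iff\<close>)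
  then show ?thesis using assms(1) y by (simp add: powr_def exp_add[symmetric] algebra_simps)
qed

text \<open>With \<open>s = exp (- \<theta>) - 1\<close> the base of the power factors as
  \<open>s / (1 + s)\<close> times \<open>- \<i> * sin c\<close> times
  \<open>1 + s * (x / 2)\<close>, where \<open>x = 1 + \<i> * cot c\<close>. This \<open>x\<close>
  is \<open>- exp (- \<xi>) / sinh \<xi>\<close> at \<open>\<xi> = \<i> * c\<close>, which is how
  the horizontal edges come to carry Euler's integral at the arguments of the two
  remainders.\<close>

lemma contour_fun_substitution:
  assumes b: "0 < b" "b < pi" and c: "\<bar>c\<bar> = b" and \<theta>: "\<theta> < 0"
  shows "contour_fun b m \<nu> (of_real \<theta> + \<i> * of_real c) =
     exp (\<i> * (\<nu> + 1/2) * of_real c) * (- \<i> * of_real (sin c)) powr of_real (- m - 1/2) *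
     (exp (- \<theta>) *\<^sub>R (of_real ((exp (- \<theta>) - 1) powr (- m - 1/2)) *
     of_real (1 + (exp (- \<theta>) - 1)) powr (of_real m - \<nu> - 1) *
     (1 + of_real (exp (- \<theta>) - 1) * ((1 + \<i> * of_real (cot c)) / 2)) powr of_real (- m - 1/2)))"
proof -
  define s where "s = exp (- \<theta>) - 1"
  have s: "s > 0" using \<theta> by (simp add: s_def)
  have ln: "ln (1 + s) = - \<theta>" by (simp add: s_def)
  have c0: "c \<noteq> 0" "\<bar>c\<bar> < pi" using b c by auto
  have sinc: "sin c \<noteq> 0"
  proof
    assume "sin c = 0"
    then have "c = 0" by (rule sin_eq_0_pi[rotated 2]) (use c0 in linarith)+
    then show False using c0 by simp
  qed
  have cosb: "cos b = cos c" using c by (metis cos_abs_real)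
  let ?y = "1 + of_real s * ((1 + \<i> * of_real (cot c)) / 2)"
  let ?w = "- \<i> * complex_of_real (sin c)"
  \<comment> \<open>In terms of \<open>E = exp (\<i> * c)\<close> and \<open>T = 1 + s\<close> the
    claim is the rational identity \<open>4\<close> below. The factors are positive, purely
    imaginary and of positive real part, so their powers multiply without a branch
    correction.\<close>
  have base: "cosh (of_real \<theta> + \<i> * of_real c) - of_real (cos b) = of_real (s / (1 + s)) * (?w * ?y)"
  proof -
    define E where "E = exp (\<i> * complex_of_real c)"
    have E: "E \<noteq> 0" by (simp add: E_def)
    have Em: "exp (- (\<i> * complex_of_real c)) = 1 / E" by (simp add: E_def exp_minus inverse_eq_divide)
    have E1: "E = of_real (cos c) + \<i> * of_real (sin c)"
      unfolding E_def exp_Euler cos_of_real sin_of_real ..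
    have E2: "1 / E = of_real (cos c) - \<i> * of_real (sin c)"
      unfolding Em[symmetric] exp_minus_Euler cos_of_real sin_of_real ..
    have es: "1 + s = exp (- \<theta>)" by (simp add: s_def)
    have eth: "exp (complex_of_real \<theta>) = 1 / of_real (1 + s)" "exp (- complex_of_real \<theta>) = of_real (1 + s)"
      unfolding es by (simp_all add: exp_of_real[symmetric] exp_minus inverse_eq_divide)
    have cs: "complex_of_real (cos c) = (E + 1 / E) / 2" unfolding E2 unfolding E1 by simp
    have wy: "?w * (1 + \<i> * of_real (cot c)) = 1 / E"
      unfolding E2 using sinc by (simp add: cot_def algebra_simps)
    have w: "?w = (1 / E - E) / 2" unfolding E2 unfolding E1 by simp
    have 1: "cosh (of_real \<theta> + \<i> * of_real c) = (1 / of_real (1 + s) * E + of_real (1 + s) * (1 / E)) / 2"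
    proof -
      have "exp (of_real \<theta> + \<i> * of_real c) = 1 / of_real (1 + s) * E" by (simp only: exp_add eth E_def)
      moreover have "exp (- (of_real \<theta> + \<i> * of_real c)) = of_real (1 + s) * (1 / E)"
        by (simp only: minus_add_distrib exp_add eth Em)
      ultimately show ?thesis unfolding cosh_field_def by (simp only:)
    qed
    have 2: "?w * ?y = ?w + of_real s * (?w * (1 + \<i> * of_real (cot c))) / 2" by (simp add: algebra_simps)
    have 3: "?w * ?y = (1 / E - E) / 2 + of_real s * (1 / E) / 2" unfolding 2 wy unfolding w ..
    have 4: "(1 / T * E + T * (1 / E)) / 2 - (E + 1 / E) / 2 = (T - 1) / T * ((1 / E - E) / 2 + (T - 1) * (1 / E) / 2)"
      if "T \<noteq> 0" for T :: complex using that E by (simp add: field_simps)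
    have "complex_of_real (1 + s) \<noteq> 0" using s by (simp only: of_real_eq_0_iff)
    from 4[OF this] show ?thesis unfolding cosb cs 1 3 by simp
  qed
  have Rey: "Re ?y > 0" using s by simp
  have f1: "(cosh (of_real \<theta> + \<i> * of_real c) - of_real (cos b)) powr of_real (- m - 1/2) =
      of_real ((s / (1 + s)) powr (- m - 1/2)) * (?w powr of_real (- m - 1/2) * ?y powr of_real (- m - 1/2))"
  proof -
    have "(of_real (s / (1 + s)) * (?w * ?y)) powr of_real (- m - 1/2) =
        of_real (s / (1 + s)) powr of_real (- m - 1/2) * (?w * ?y) powr of_real (- m - 1/2)"
      by (rule powr_times_real_left) (use s in auto)
    moreover have "complex_of_real (s / (1 + s)) powr of_real (- m - 1/2) = of_real ((s / (1 + s)) powr (- m - 1/2))"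
      using s by (intro powr_of_real) simp
    moreover have "(?w * ?y) powr of_real (- m - 1/2) = ?w powr of_real (- m - 1/2) * ?y powr of_real (- m - 1/2)"
      by (rule mult_powr_Re_nonneg) (use sinc Rey in auto)
    ultimately show ?thesis unfolding base by simp
  qed
  have f2: "exp ((\<nu> + 1/2) * (of_real \<theta> + \<i> * of_real c)) * of_real ((s / (1 + s)) powr (- m - 1/2)) =
     exp (\<i> * (\<nu> + 1/2) * of_real c) * (of_real (1 + s) * (of_real (s powr (- m - 1/2)) * of_real (1 + s) powr (of_real m - \<nu> - 1)))"
  proof -
    have p: "complex_of_real (1 + s) powr z = exp (- z * of_real \<theta>)" for z
    proof -
      have "Ln (complex_of_real (1 + s)) = of_real (ln (1 + s))" using s by (intro Ln_of_real) simp
      moreover have "complex_of_real (1 + s) \<noteq> 0" using s by (simp only: of_real_eq_0_iff)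
      ultimately show ?thesis unfolding powr_def ln by (simp only: if_False) simp
    qed
    have q1: "(s / (1 + s)) powr (- m - 1/2) = s powr (- m - 1/2) / (1 + s) powr (- m - 1/2)" using s by (simp add: powr_divide)
    have q2: "complex_of_real ((1 + s) powr (- m - 1/2)) = of_real (1 + s) powr of_real (- m - 1/2)"
      using s by (intro powr_of_real[symmetric]) simp
    have q3: "of_real (1 + s) powr 1 = complex_of_real (1 + s)" using s by simp
    have q4: "exp ((\<nu> + 1/2) * of_real \<theta>) / of_real (1 + s) powr of_real (- m - 1/2) = of_real (1 + s) powr 1 * of_real (1 + s) powr (of_real m - \<nu> - 1)"
      unfolding p by (simp add: exp_diff[symmetric] exp_add[symmetric] algebra_simps)
    have "exp ((\<nu> + 1/2) * of_real \<theta>) * of_real ((s / (1 + s)) powr (- m - 1/2)) =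
        of_real (s powr (- m - 1/2)) * (exp ((\<nu> + 1/2) * of_real \<theta>) / of_real ((1 + s) powr (- m - 1/2)))"
      unfolding q1 of_real_divide by (simp only: times_divide_eq_right mult.commute)
    also have "\<dots> = of_real (1 + s) * (of_real (s powr (- m - 1/2)) * of_real (1 + s) powr (of_real m - \<nu> - 1))"
      unfolding q2 q4 q3 by (simp only: mult.left_commute)
    finally have r1: "exp ((\<nu> + 1/2) * of_real \<theta>) * of_real ((s / (1 + s)) powr (- m - 1/2)) =
        of_real (1 + s) * (of_real (s powr (- m - 1/2)) * of_real (1 + s) powr (of_real m - \<nu> - 1))" .
    have r2: "exp ((\<nu> + 1/2) * (of_real \<theta> + \<i> * of_real c)) = exp ((\<nu> + 1/2) * of_real \<theta>) * exp (\<i> * (\<nu> + 1/2) * of_real c)"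
      by (simp add: exp_add[symmetric] algebra_simps)
    show ?thesis unfolding r2 r1[symmetric] by (simp only: mult_ac)
  qed
  have f3: "exp (- \<theta>) = 1 + s" by (simp add: s_def)
  have "contour_fun b m \<nu> (of_real \<theta> + \<i> * of_real c) =
     (exp ((\<nu> + 1/2) * (of_real \<theta> + \<i> * of_real c)) * of_real ((s / (1 + s)) powr (- m - 1/2))) *
     (?w powr of_real (- m - 1/2) * ?y powr of_real (- m - 1/2))"
    unfolding contour_fun_def f1 by (simp only: mult.assoc)
  also note f2
  finally show ?thesis
    unfolding s_def[symmetric] unfolding scaleR_conv_of_real f3 by (simp only: mult_ac)
qed

lemma exp_minus_one_subst:
  defines "g \<equiv> \<lambda>\<theta>::real. exp (- \<theta>) - 1"
  shows "g ` {..<0} = {0<..}" "inj_on g {..<0}"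
    "\<And>\<theta>. \<theta> \<in> {..<0} \<Longrightarrow> (g has_field_derivative - exp (- \<theta>)) (at \<theta>)"
    "continuous_on {..<0} (\<lambda>\<theta>::real. - exp (- \<theta>))"
proof -
  show "g ` {..<0} = {0<..}"
  proof (intro equalityI subsetI)
    fix v :: real assume "v \<in> {0<..}"
    then show "v \<in> g ` {..<0}"
      by (intro image_eqI[of _ _ "- ln (1 + v)"]) (auto simp: g_def)
  qed (auto simp: g_def)
  show "inj_on g {..<0}" by (rule inj_onI) (auto simp: g_def)
  show "(g has_field_derivative - exp (- \<theta>)) (at \<theta>)" for \<theta>
    unfolding g_def by (auto intro!: derivative_eq_intros)
  show "continuous_on {..<0} (\<lambda>\<theta>::real. - exp (- \<theta>))" by (intro continuous_intros)
qed

lemma notin_nonpos_Reals_Re: "Re z > 0 \<Longrightarrow> z \<notin> \<real>\<^sub>\<le>\<^sub>0"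
  by (auto simp: complex_nonpos_Reals_iff)

text \<open>Both edges of the strip, \<open>c = b\<close> and \<open>c = - b\<close>, are treated at
  once; the outer factor keeps the phase of \<open>(- \<i> * sin c) powr (- m - 1/2)\<close>, which
  depends on the sign of \<open>c\<close>.\<close>

lemma contour_fun_ray_integral:
  assumes m: "\<bar>m\<bar> < 1/2" and \<nu>: "Re \<nu> > - 1/2" and b: "0 < b" "b < pi" and c: "\<bar>c\<bar> = b"
  shows "(LINT \<theta>:{..<0}|lborel. contour_fun b m \<nu> (of_real \<theta> + \<i> * of_real c)) =
     exp (\<i> * (\<nu> + 1/2) * of_real c) * (- \<i> * of_real (sin c)) powr of_real (- m - 1/2) *
     euler_integral m \<nu> (1 + \<i> * of_real (cot c))"
proof -
  let ?x = "1 + \<i> * complex_of_real (cot c)"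
  let ?K = "exp (\<i> * (\<nu> + 1/2) * of_real c) * (- \<i> * of_real (sin c)) powr of_real (- m - 1/2)"
  let ?F = "\<lambda>s. complex_of_real (s powr (- m - 1/2)) * of_real (1 + s) powr (of_real m - \<nu> - 1) *
      (1 + of_real s * (?x / 2)) powr of_real (- m - 1/2)"
  have x: "?x \<notin> \<real>\<^sub>\<le>\<^sub>0" by (rule notin_nonpos_Reals_Re) simp
  have "(LINT \<theta>:{..<0}|lborel. contour_fun b m \<nu> (of_real \<theta> + \<i> * of_real c)) =
      (LINT \<theta>:{..<0}|lborel. ?K * (\<bar>- exp (- \<theta>)\<bar> *\<^sub>R ?F (exp (- \<theta>) - 1)))"
    by (rule set_lebesgue_integral_cong, simp, intro allI impI)
       (subst contour_fun_substitution[OF b c], simp, simp only: abs_minus_cancel abs_exp_cancel)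
  also have "\<dots> = ?K * (LINT \<theta>:{..<0}|lborel. \<bar>- exp (- \<theta>)\<bar> *\<^sub>R ?F (exp (- \<theta>) - 1))"
    by (rule set_integral_mult_right)
  also have "(LINT \<theta>:{..<0}|lborel. \<bar>- exp (- \<theta>)\<bar> *\<^sub>R ?F (exp (- \<theta>) - 1)) = (LINT s:{0<..}|lborel. ?F s)"
    by (rule set_integral_substitution(2)[OF _ _ exp_minus_one_subst(1) euler_integrand_continuous[OF x]
          exp_minus_one_subst(4,3,2) euler_integrable[OF m \<nu> x]]) auto
  finally show ?thesis unfolding euler_integral_def .
qed

text \<open>Near 0 the majorant behaves like \<open>\<bar>\<theta>\<bar> powr (- 2 * m - 1)\<close>,
  integrable only for \<open>m < 0\<close>: the reason why the contour argument starts from negative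
  order. With \<open>s = exp (- \<theta>) - 1\<close> one has
  \<open>cosh \<theta> - 1 = s\<^sup>2 / (2 * (1 + s))\<close>, and a beta integral appears.\<close>

lemma contour_horizontal_bound_integrable:
  assumes m: "- 1/2 < m" "m < 0" and \<nu>: "Re \<nu> > - 1/2"
  shows "set_integrable lborel {..<0} (\<lambda>\<theta>. exp ((Re \<nu> + 1/2) * \<theta>) * (cosh \<theta> - 1) powr (- m - 1/2))"
proof -
  let ?F = "\<lambda>s::real. s powr (- 2 * m - 1) * (1 + s) powr (- (- 2 * m + (Re \<nu> + 1 + m)))"
  have int: "set_integrable lborel {0<..} ?F"
    by (rule set_integrable_Beta_Ioi) (use m \<nu> in auto)
  have cF: "continuous_on {0<..} ?F" by (intro continuous_intros) auto
  have "set_integrable lborel {..<0} (\<lambda>\<theta>. \<bar>- exp (- \<theta>)\<bar> *\<^sub>R ?F (exp (- \<theta>) - 1))"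
    by (rule set_integral_substitution(1)[OF _ _ exp_minus_one_subst(1) cF exp_minus_one_subst(4,3,2) int]) auto
  then have "set_integrable lborel {..<0} (\<lambda>\<theta>. (1/2) powr (- m - 1/2) * (\<bar>- exp (- \<theta>)\<bar> *\<^sub>R ?F (exp (- \<theta>) - 1)))"
    by (rule set_integrable_mult_right)
  moreover have "(1/2) powr (- m - 1/2) * (\<bar>- exp (- \<theta>)\<bar> *\<^sub>R ?F (exp (- \<theta>) - 1)) = exp ((Re \<nu> + 1/2) * \<theta>) * (cosh \<theta> - 1) powr (- m - 1/2)"
    if th: "\<theta> \<in> {..<0}" for \<theta>
  proof -
    define s where "s = exp (- \<theta>) - 1"
    have s: "s > 0" using th by (simp add: s_def)
    have es: "exp (- \<theta>) = 1 + s" by (simp add: s_def)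
    have "cosh \<theta> - 1 = (1/2) * (s\<^sup>2 / (1 + s))"
    proof -
      have "exp \<theta> = 1 / (1 + s)" unfolding es[symmetric] by (simp add: exp_minus inverse_eq_divide)
      then have "cosh \<theta> = (1 / (1 + s) + (1 + s)) / 2" unfolding cosh_field_def es by simp
      then show ?thesis using s by (simp add: field_simps power2_eq_square)
    qed
    then have "(cosh \<theta> - 1) powr (- m - 1/2) = (1/2) powr (- m - 1/2) * (s\<^sup>2 / (1 + s)) powr (- m - 1/2)"
      by (simp only: powr_mult)
    also have "(s\<^sup>2 / (1 + s)) powr (- m - 1/2) = s powr (- 2 * m - 1) * (1 + s) powr (m + 1/2)"
    proof -
      have "s\<^sup>2 powr (- m - 1/2) = (s powr 2) powr (- m - 1/2)" using s by (simp add: powr_numeral)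
      also have "\<dots> = s powr (- 2 * m - 1)" by (simp add: powr_powr algebra_simps)
      finally have 1: "s\<^sup>2 powr (- m - 1/2) = s powr (- 2 * m - 1)" .
      have "(s\<^sup>2 / (1 + s)) powr (- m - 1/2) = s\<^sup>2 powr (- m - 1/2) / (1 + s) powr (- m - 1/2)"
        using s by (simp add: powr_divide)
      also have "\<dots> = s\<^sup>2 powr (- m - 1/2) * (1 + s) powr (- (- m - 1/2))"
        by (simp only: powr_minus divide_inverse)
      finally show ?thesis unfolding 1 by (simp add: add.commute)
    qed
    finally have A: "(cosh \<theta> - 1) powr (- m - 1/2) = (1/2) powr (- m - 1/2) * (s powr (- 2 * m - 1) * (1 + s) powr (m + 1/2))" .
    have B: "exp ((Re \<nu> + 1/2) * \<theta>) = (1 + s) powr (- (Re \<nu> + 1/2))"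
      unfolding es[symmetric] by (simp add: powr_def algebra_simps)
    have C: "(1 + s) * (1 + s) powr (- (- 2 * m + (Re \<nu> + 1 + m))) = (1 + s) powr (m + 1/2) * (1 + s) powr (- (Re \<nu> + 1/2))"
    proof -
      have "(1 + s) * (1 + s) powr (- (- 2 * m + (Re \<nu> + 1 + m))) = (1 + s) powr 1 * (1 + s) powr (- (- 2 * m + (Re \<nu> + 1 + m)))"
        using s by simp
      also have "\<dots> = (1 + s) powr (m + 1/2 + - (Re \<nu> + 1/2))"
        unfolding powr_add[symmetric] by (simp add: algebra_simps)
      finally show ?thesis by (simp only: powr_add)
    qed
    have "(1/2) powr (- m - 1/2) * (\<bar>- exp (- \<theta>)\<bar> *\<^sub>R ?F (exp (- \<theta>) - 1)) =
       (1/2) powr (- m - 1/2) * (s powr (- 2 * m - 1) * ((1 + s) * (1 + s) powr (- (- 2 * m + (Re \<nu> + 1 + m)))))"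
      unfolding es using s by simp
    then show ?thesis unfolding C A B by (simp only: mult_ac)
  qed
  ultimately show ?thesis
    by (rule set_integrable_cong[THEN iffD1, rotated 3, OF _ refl refl])
qed

text \<open>Half angles enter because \<open>cos \<eta> - cos b\<close> equals
  \<open>2 * (sin (b/2))\<^sup>2\<close> times \<open>1 - g \<eta>\<close>: the substitution turns
  the Mehler-Dirichlet weight into a beta weight. It is used once for integrability and once to
  identify Mehler's integral.\<close>

lemma sin_half_subst:
  assumes b: "0 < b" "b < pi"
  defines "w \<equiv> (sin (b/2))\<^sup>2" and "g \<equiv> \<lambda>\<eta>. (sin (\<eta>/2))\<^sup>2 / (sin (b/2))\<^sup>2"
  shows "g ` {0<..<b} = {0<..<1}" "inj_on g {0<..<b}"
    "\<And>\<eta>. (g has_field_derivative sin (\<eta>/2) * cos (\<eta>/2) / w) (at \<eta>)"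
    "continuous_on {0<..<b} (\<lambda>\<eta>. sin (\<eta>/2) * cos (\<eta>/2) / w)"
    "w > 0"
proof -
  have sb: "sin (b/2) > 0" using b by (intro sin_gt_zero) auto
  then show w: "w > 0" by (simp add: w_def)
  have mono: "sin (x/2) < sin (y/2)" if "0 \<le> x" "x < y" "y \<le> b" for x y
    using that b by (intro sin_monotone_2pi) auto
  have pos: "sin (x/2) > 0" if "0 < x" "x \<le> b" for x using mono[of 0 x] that by simp
  have gmono: "g x < g y" if "0 < x" "x < y" "y \<le> b" for x y
    unfolding g_def using sb mono[of x y] pos[of x] that by (intro divide_strict_right_mono power_strict_mono) auto
  show "g ` {0<..<b} = {0<..<1}"
  proof (intro equalityI subsetI)
    fix v assume "v \<in> g ` {0<..<b}"
    then obtain x where x: "0 < x" "x < b" "v = g x" by auto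
    have "g x > 0" unfolding g_def using pos[of x] x sb by simp
    moreover have "g x < g b" using x b by (intro gmono) auto
    moreover have "g b = 1" using sb by (simp add: g_def)
    ultimately show "v \<in> {0<..<1}" using x by simp
  next
    fix v :: real assume v: "v \<in> {0<..<1}"
    define y where "y = sqrt v * sin (b/2)"
    have y: "0 < y" "y < sin (b/2)" using v sb by (auto simp: y_def)
    then have y1: "y < 1" using sin_le_one[of "b/2"] by linarith
    have "arcsin 0 < arcsin y" using y y1 by (intro arcsin_less_arcsin) auto
    then have a0: "arcsin y > 0" by simp
    have "arcsin y < arcsin (sin (b/2))" using y by (intro arcsin_less_arcsin) auto
    also have "arcsin (sin (b/2)) = b/2" using b by (intro arcsin_sin) auto
    finally have a1: "arcsin y < b/2" .
    have "sin (2 * arcsin y / 2) = y" using y y1 by simp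
    then have "g (2 * arcsin y) = v" unfolding g_def y_def using v sb by (simp add: power_mult_distrib)
    then show "v \<in> g ` {0<..<b}" using a0 a1 by (intro image_eqI[of _ _ "2 * arcsin y"]) auto
  qed
  show "inj_on g {0<..<b}"
    by (rule linorder_inj_onI) (use gmono in force)+
  show "(g has_field_derivative sin (\<eta>/2) * cos (\<eta>/2) / w) (at \<eta>)" for \<eta>
  proof -
    have "((\<lambda>\<eta>. (sin (\<eta>/2))\<^sup>2) has_field_derivative sin (\<eta>/2) * cos (\<eta>/2)) (at \<eta>)"
      by (auto intro!: derivative_eq_intros)
    then show ?thesis unfolding g_def w_def by (rule DERIV_cdivide)
  qed
  show "continuous_on {0<..<b} (\<lambda>\<eta>. sin (\<eta>/2) * cos (\<eta>/2) / w)"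
    by (intro continuous_intros) (use w in auto)
qed

lemma sin_half_subst_values:
  assumes b: "0 < b" "b < pi" and e: "0 < \<eta>" "\<eta> < b"
  shows "cos \<eta> - cos b = 2 * (sin (b/2))\<^sup>2 * (1 - (sin (\<eta>/2))\<^sup>2 / (sin (b/2))\<^sup>2)"
    "sin (\<eta>/2) > 0" "cos (\<eta>/2) > 0" "cos (\<eta>/2) > cos (b/2)" "cos (b/2) > 0" "cos \<eta> - cos b > 0" "sin (b/2) > 0"
proof -
  show sb: "sin (b/2) > 0" "sin (\<eta>/2) > 0" using b e by (auto intro!: sin_gt_zero)
  have c: "cos x = 1 - 2 * (sin (x/2))\<^sup>2" for x :: real using cos_double_sin[of "x/2"] by simp
  show "cos \<eta> - cos b = 2 * (sin (b/2))\<^sup>2 * (1 - (sin (\<eta>/2))\<^sup>2 / (sin (b/2))\<^sup>2)"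
    unfolding c[of b] c[of \<eta>] using sb by (simp add: field_simps)
  show "cos (\<eta>/2) > 0" "cos (b/2) > 0" using b e by (auto intro!: cos_gt_zero_pi)
  show "cos (\<eta>/2) > cos (b/2)" using b e by (intro cos_monotone_0_pi) auto
  show "cos \<eta> - cos b > 0" using cos_monotone_0_pi[of \<eta> b] b e by simp
qed

lemma cos_minus_cos_powr_integrable:
  assumes b: "0 < b" "b < pi" and m: "m < 1/2"
  shows "set_integrable lborel {-b<..<b} (\<lambda>\<eta>. (cos \<eta> - cos b) powr (- m - 1/2))"
proof -
  let ?p = "\<lambda>\<eta>. (cos \<eta> - cos b) powr (- m - 1/2)"
  let ?w = "(sin (b/2))\<^sup>2"
  let ?f = "\<lambda>t::real. t powr (1/2 - 1) * (1 - t) powr ((1/2 - m) - 1)"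
  have "continuous_on {0<..<1} ?f" by (intro continuous_intros) auto
  note sub = set_integral_substitution(1)[OF _ _ sin_half_subst(1)[OF b] this sin_half_subst(4)[OF b] sin_half_subst(3)[OF b] sin_half_subst(2)[OF b]
      set_integrable_Beta_Ioo(1)[of "1/2" "1/2 - m"]]
  have "continuous_on {0<..<b} ?p"
    by (intro continuous_intros) (use sin_half_subst_values(6)[OF b] in force)
  have half: "set_integrable lborel {0<..<b} ?p"
  proof (rule set_integrable_bound_continuous[OF _ \<open>continuous_on {0<..<b} ?p\<close>])
    \<comment> \<open>The constant undoes the Jacobian except for its factor
      \<open>cos (\<eta>/2)\<close>; since \<open>cos (\<eta>/2) / cos (b/2) \<ge> 1\<close>, the
      transformed beta integrand is a majorant.\<close>
    let ?C = "sqrt ?w * (2 * ?w) powr (- m - 1/2) / cos (b/2)"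
    show "set_integrable lborel {0<..<b} (\<lambda>\<eta>. ?C * (\<bar>sin (\<eta>/2) * cos (\<eta>/2) / ?w\<bar> *\<^sub>R ?f ((sin (\<eta>/2))\<^sup>2 / ?w)))"
      by (rule set_integrable_mult_right, rule sub) (use m in auto)
    fix \<eta> assume "\<eta> \<in> {0<..<b}"
    then have e: "0 < \<eta>" "\<eta> < b" by auto
    note v = sin_half_subst_values[OF b e]
    define S C B c1 where "S = sin (\<eta>/2)" "C = cos (\<eta>/2)" "B = sin (b/2)" "c1 = cos (b/2)"
    note defs = S_C_B_c1_def
    have pos: "S > 0" "C > 0" "B > 0" "c1 > 0" "C > c1" using v by (auto simp: defs)
    have X: "1 - S\<^sup>2 / B\<^sup>2 > 0"
    proof -
      have "0 < 2 * B\<^sup>2 * (1 - S\<^sup>2 / B\<^sup>2)" using v(1,6) by (simp add: defs)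
      then show ?thesis using pos by (simp add: zero_less_mult_iff)
    qed
    have p: "?p \<eta> = (2 * B\<^sup>2) powr (- m - 1/2) * (1 - S\<^sup>2 / B\<^sup>2) powr (- m - 1/2)"
      unfolding v(1) defs by (rule powr_mult)
    have t: "(S\<^sup>2 / B\<^sup>2) powr (1/2 - 1) = B / S"
    proof -
      have "(S\<^sup>2 / B\<^sup>2) powr (1/2 - 1) = ((S / B)\<^sup>2) powr (- (1/2))" by (simp add: power_divide)
      also have "\<dots> = inverse (((S / B)\<^sup>2) powr (1/2))" by (rule powr_minus)
      also have "((S / B)\<^sup>2) powr (1/2) = S / B" using pos by (subst powr_half_sqrt) auto
      finally show ?thesis by simp
    qed
    have exp1: "(1/2 - m) - 1 = - m - 1/2" by simp
    have "?C * (\<bar>sin (\<eta>/2) * cos (\<eta>/2) / ?w\<bar> *\<^sub>R ?f ((sin (\<eta>/2))\<^sup>2 / ?w)) =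
       (B * (2 * B\<^sup>2) powr (- m - 1/2) / c1) * ((S * C / B\<^sup>2) * (B / S * (1 - S\<^sup>2 / B\<^sup>2) powr (- m - 1/2)))"
      unfolding defs[symmetric] t exp1 using pos by simp
    also have "\<dots> = (C / c1) * ?p \<eta>"
      unfolding p using pos by (simp add: power2_eq_square)
    finally have eq: "?C * (\<bar>sin (\<eta>/2) * cos (\<eta>/2) / ?w\<bar> *\<^sub>R ?f ((sin (\<eta>/2))\<^sup>2 / ?w)) = (C / c1) * ?p \<eta>" .
    have "norm (?p \<eta>) = 1 * ?p \<eta>" by simp
    also have "\<dots> \<le> (C / c1) * ?p \<eta>" using pos by (intro mult_right_mono) auto
    finally show "norm (?p \<eta>) \<le> ?C * (\<bar>sin (\<eta>/2) * cos (\<eta>/2) / ?w\<bar> *\<^sub>R ?f ((sin (\<eta>/2))\<^sup>2 / ?w))" unfolding eq .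
  qed auto
  have "set_integrable lborel {-b<..<0} ?p"
  proof -
    have "integrable lborel (\<lambda>x. indicator {0<..<b} (0 + (-1) * x) *\<^sub>R ?p (0 + (-1) * x))"
      using half unfolding set_integrable_def by (rule lborel_integrable_real_affine) simp
    moreover have "(\<lambda>x. indicator {0<..<b} (0 + (-1) * x) *\<^sub>R ?p (0 + (-1) * x)) = (\<lambda>x. indicator {-b<..<0} x *\<^sub>R ?p x)"
      by (auto simp: indicator_def fun_eq_iff)
    ultimately show ?thesis unfolding set_integrable_def by simp
  qed
  moreover have "set_integrable lborel {0::real} ?p"
    by (rule set_borel_integrable_singleton)
  ultimately have "set_integrable lborel ({-b<..<0} \<union> {0} \<union> {0<..<b}) ?p"
    using half by (intro set_integrable_Un) auto
  moreover have "{-b<..<0} \<union> {0} \<union> {0<..<b} = {-b<..<b}" using b by auto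
  ultimately show ?thesis by simp
qed

text \<open>The intervals of integration will vary with the index; an indicator on a fixed set
  brings the integrals into the form of dominated convergence.\<close>

lemma integral_Icc_eq_set_integral:
  fixes g :: "real \<Rightarrow> 'b::euclidean_space"
  assumes "continuous_on {a..b} g" "{a..b} \<subseteq> A"
  shows "integral {a..b} g = (LINT x:A|lborel. indicator {a..b} x *\<^sub>R g x)"
    and "set_borel_measurable lborel A (\<lambda>x. indicator {a..b} x *\<^sub>R g x)"
proof -
  have eq: "(\<lambda>x. indicator A x *\<^sub>R (indicator {a..b} x *\<^sub>R g x)) = (\<lambda>x. indicator {a..b} x *\<^sub>R g x)"
    using assms(2) by (auto simp: indicator_def fun_eq_iff)
  have int: "set_integrable lborel {a..b} g" using assms(1) by (rule borel_integrable_atLeastAtMost')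
  show "integral {a..b} g = (LINT x:A|lborel. indicator {a..b} x *\<^sub>R g x)"
    using set_borel_integral_eq_integral(2)[OF int] by (simp only: set_lebesgue_integral_def eq)
  show "set_borel_measurable lborel A (\<lambda>x. indicator {a..b} x *\<^sub>R g x)"
    using int by (simp only: set_borel_measurable_def eq set_integrable_def borel_measurable_integrable)
qed

lemma contour_fun_tendsto:
  assumes b: "0 < b" "b < pi" and X: "X \<longlonglongrightarrow> l"
    and A: "\<And>n. \<bar>Im (X n)\<bar> < b" "\<bar>Im l\<bar> \<le> b" "Re l \<noteq> 0 \<or> \<bar>Im l\<bar> < b"
  shows "(\<lambda>n. contour_fun b m \<nu> (X n)) \<longlonglongrightarrow> contour_fun b m \<nu> l"
proof (rule continuous_on_tendsto_compose[OF _ X])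
  show "continuous_on {t. \<bar>Im t\<bar> \<le> b \<and> (Re t \<noteq> 0 \<or> \<bar>Im t\<bar> < b)} (contour_fun b m \<nu>)"
    by (rule contour_fun_continuous[OF b]) auto
  show "\<forall>\<^sub>F n in sequentially. X n \<in> {t. \<bar>Im t\<bar> \<le> b \<and> (Re t \<noteq> 0 \<or> \<bar>Im t\<bar> < b)}"
    using A(1) by (intro always_eventually) (auto intro: less_imp_le)
qed (use A in auto)

lemma tendsto_indicator_scaleR:
  fixes g :: "nat \<Rightarrow> 'b::real_normed_vector"
  assumes "\<forall>\<^sub>F n in sequentially. x \<in> S n" "g \<longlonglongrightarrow> l"
  shows "(\<lambda>n. indicator (S n) x *\<^sub>R g n) \<longlonglongrightarrow> l"
  by (rule Lim_transform_eventually[OF assms(2)]) (use assms(1) in eventually_elim, simp)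

text \<open>The height tends to \<open>c\<close> while the interval exhausts the half line. A single
  limit passage suffices because \<open>norm_cosh_minus_cos_ge_cosh\<close> bounds all heights by
  one integrable function.\<close>

lemma contour_horizontal_limit:
  assumes m: "- 1/2 < m" "m < 0" and \<nu>: "Re \<nu> > - 1/2" and b: "0 < b" "b < pi"
    and d: "\<And>n. \<bar>d n\<bar> < b" "d \<longlonglongrightarrow> c" "\<bar>c\<bar> = b"
  shows "(\<lambda>n. integral {- (real n + 1)..- (1 / (real n + 2))} (\<lambda>\<theta>. contour_fun b m \<nu> (of_real \<theta> + \<i> * of_real (d n))))
     \<longlonglongrightarrow> (LINT \<theta>:{..<0}|lborel. contour_fun b m \<nu> (of_real \<theta> + \<i> * of_real c))"
proof -
  let ?S = "\<lambda>n. {- (real n + 1)..- (1 / (real n + 2))}"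
  let ?f = "\<lambda>n \<theta>. contour_fun b m \<nu> (of_real \<theta> + \<i> * of_real (d n))"
  have sub: "?S n \<subseteq> {..<0}" for n
  proof
    fix x assume "x \<in> ?S n"
    then have "x \<le> - (1 / (real n + 2))" by simp
    also have "\<dots> < 0" by simp
    finally show "x \<in> {..<0}" by simp
  qed
  have cont: "continuous_on (?S n) (?f n)" for n
  proof (rule continuous_on_compose2[OF contour_fun_continuous[OF b]])
    show "continuous_on (?S n) (\<lambda>\<theta>. of_real \<theta> + \<i> * of_real (d n))" by (intro continuous_intros)
    show "(\<lambda>\<theta>. complex_of_real \<theta> + \<i> * of_real (d n)) ` ?S n \<subseteq> (\<lambda>\<theta>. complex_of_real \<theta> + \<i> * of_real (d n)) ` ?S n" ..
    show "\<bar>Im t\<bar> \<le> b \<and> (Re t \<noteq> 0 \<or> \<bar>Im t\<bar> < b)" if "t \<in> (\<lambda>\<theta>. complex_of_real \<theta> + \<i> * of_real (d n)) ` ?S n" for t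
      using that d(1)[of n] by auto
  qed
  have "(\<lambda>n. LINT \<theta>:{..<0}|lborel. indicator (?S n) \<theta> *\<^sub>R ?f n \<theta>) \<longlonglongrightarrow>
      (LINT \<theta>:{..<0}|lborel. contour_fun b m \<nu> (of_real \<theta> + \<i> * of_real c))"
  proof (rule set_integral_dominated_convergence)
    show "set_integrable lborel {..<0} (\<lambda>\<theta>. exp (\<bar>Im \<nu>\<bar> * b) * (exp ((Re \<nu> + 1/2) * \<theta>) * (cosh \<theta> - 1) powr (- m - 1/2)))"
      by (intro set_integrable_mult_right contour_horizontal_bound_integrable m \<nu>)
    show "set_borel_measurable lborel {..<0} (\<lambda>\<theta>. indicator (?S n) \<theta> *\<^sub>R ?f n \<theta>)" for n
      by (rule integral_Icc_eq_set_integral(2)[OF cont sub])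
    fix \<theta> :: real assume th: "\<theta> \<in> {..<0}"
    have "sinh \<theta> \<noteq> 0" using th by simp
    then have "cosh \<theta> \<noteq> 1" using cosh_square_eq[of \<theta>] by auto
    then have ch: "cosh \<theta> > 1" using cosh_real_ge_1[of \<theta>] by linarith
    show "norm (indicator (?S n) \<theta> *\<^sub>R ?f n \<theta>) \<le> exp (\<bar>Im \<nu>\<bar> * b) * (exp ((Re \<nu> + 1/2) * \<theta>) * (cosh \<theta> - 1) powr (- m - 1/2))" for n
    proof -
      have "norm (indicator (?S n) \<theta> *\<^sub>R ?f n \<theta>) \<le> norm (?f n \<theta>)" by (auto simp: indicator_def)
      also have "\<dots> \<le> exp (\<bar>Im \<nu>\<bar> * b) * (exp ((Re \<nu> + 1/2) * Re (of_real \<theta> + \<i> * of_real (d n))) * (cosh \<theta> - 1) powr (- m - 1/2))"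
        using norm_cosh_minus_cos_ge_cosh[of "of_real \<theta> + \<i> * of_real (d n)" b] d(1)[of n] ch m
        by (intro norm_contour_fun_le) auto
      finally show ?thesis by simp
    qed
    have "\<forall>\<^sub>F n in sequentially. \<theta> \<in> ?S n"
    proof -
      obtain n0 where n0: "real n0 > - \<theta>" "real n0 > 1 / (- \<theta>)"
        using reals_Archimedean2[of "max (- \<theta>) (1 / (- \<theta>))"] by auto
      have "\<theta> \<in> ?S n" if "n \<ge> n0" for n
      proof -
        have n: "real n \<ge> real n0" using that by simp
        have "1 / (real n + 2) \<le> 1 / (1 / (- \<theta>))"
        proof (rule divide_left_mono)
          show "1 / (- \<theta>) \<le> real n + 2" using n n0(2) by linarith
          have "1 / (- \<theta>) > 0" using th by simp
          then show "0 < (real n + 2) * (1 / (- \<theta>))" by (intro mult_pos_pos) auto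
        qed simp
        then have "\<theta> \<le> - (1 / (real n + 2))" by simp
        then show ?thesis using n n0(1) by simp
      qed
      then show ?thesis by (auto simp: eventually_sequentially)
    qed
    moreover have "(\<lambda>n. ?f n \<theta>) \<longlonglongrightarrow> contour_fun b m \<nu> (of_real \<theta> + \<i> * of_real c)"
    proof (rule contour_fun_tendsto[OF b])
      show "(\<lambda>n. complex_of_real \<theta> + \<i> * of_real (d n)) \<longlonglongrightarrow> of_real \<theta> + \<i> * of_real c"
        by (intro tendsto_intros d)
    qed (use d th in auto)
    ultimately show "(\<lambda>n. indicator (?S n) \<theta> *\<^sub>R ?f n \<theta>) \<longlonglongrightarrow> contour_fun b m \<nu> (of_real \<theta> + \<i> * of_real c)"
      by (rule tendsto_indicator_scaleR)
  qed auto
  then show ?thesis by (simp only: integral_Icc_eq_set_integral(1)[OF cont sub])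
qed

text \<open>One statement for both vertical sides: the abscissas \<open>- h n\<close> may tend to 0,
  with \<open>F\<close> the values on the imaginary axis, or to minus infinity, with
  \<open>F = 0\<close>. The majorant contains no \<open>h n\<close> because the exponential in the
  real part is at most 1 to the left of the axis.\<close>

lemma contour_vertical_limit:
  assumes m: "- 1/2 < m" "m < 0" and \<nu>: "Re \<nu> > - 1/2" and b: "0 < b" "b < pi"
    and d: "\<And>n. 0 < d n" "\<And>n. d n < b" "d \<longlonglongrightarrow> b" and h: "\<And>n. h n > 0"
    and lim: "\<And>\<eta>. \<eta> \<in> {-b<..<b} \<Longrightarrow> (\<lambda>n. contour_fun b m \<nu> (of_real (- h n) + \<i> * of_real \<eta>)) \<longlonglongrightarrow> F \<eta>"
  shows "(\<lambda>n. integral {- d n..d n} (\<lambda>\<eta>. \<i> * contour_fun b m \<nu> (of_real (- h n) + \<i> * of_real \<eta>)))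
     \<longlonglongrightarrow> (LINT \<eta>:{-b<..<b}|lborel. \<i> * F \<eta>)"
proof -
  let ?S = "\<lambda>n. {- d n..d n}"
  let ?f = "\<lambda>n \<eta>. \<i> * contour_fun b m \<nu> (of_real (- h n) + \<i> * of_real \<eta>)"
  have sub: "?S n \<subseteq> {-b<..<b}" for n using d(2)[of n] by auto
  have cont: "continuous_on (?S n) (?f n)" for n
  proof (rule continuous_on_mult[OF continuous_on_const], rule continuous_on_compose2[OF contour_fun_continuous[OF b]])
    show "continuous_on (?S n) (\<lambda>\<eta>. of_real (- h n) + \<i> * of_real \<eta>)" by (intro continuous_intros)
    show "(\<lambda>\<eta>. complex_of_real (- h n) + \<i> * of_real \<eta>) ` ?S n \<subseteq> (\<lambda>\<eta>. complex_of_real (- h n) + \<i> * of_real \<eta>) ` ?S n" ..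
    show "\<bar>Im t\<bar> \<le> b \<and> (Re t \<noteq> 0 \<or> \<bar>Im t\<bar> < b)" if "t \<in> (\<lambda>\<eta>. complex_of_real (- h n) + \<i> * of_real \<eta>) ` ?S n" for t
      using that d(2)[of n] h[of n] by auto
  qed
  have "(\<lambda>n. LINT \<eta>:{-b<..<b}|lborel. indicator (?S n) \<eta> *\<^sub>R ?f n \<eta>) \<longlonglongrightarrow> (LINT \<eta>:{-b<..<b}|lborel. \<i> * F \<eta>)"
  proof (rule set_integral_dominated_convergence)
    show "set_integrable lborel {-b<..<b} (\<lambda>\<eta>. exp (\<bar>Im \<nu>\<bar> * b) * (cos \<eta> - cos b) powr (- m - 1/2))"
      by (intro set_integrable_mult_right cos_minus_cos_powr_integrable b) (use m in simp)
    show "set_borel_measurable lborel {-b<..<b} (\<lambda>\<eta>. indicator (?S n) \<eta> *\<^sub>R ?f n \<eta>)" for n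
      by (rule integral_Icc_eq_set_integral(2)[OF cont sub])
    fix \<eta> :: real assume et: "\<eta> \<in> {-b<..<b}"
    have cp: "cos \<eta> - cos b > 0"
    proof -
      have "cos b < cos \<bar>\<eta>\<bar>" using et b by (intro cos_monotone_0_pi) auto
      then show ?thesis by simp
    qed
    show "norm (indicator (?S n) \<eta> *\<^sub>R ?f n \<eta>) \<le> exp (\<bar>Im \<nu>\<bar> * b) * (cos \<eta> - cos b) powr (- m - 1/2)" for n
    proof -
      let ?t = "complex_of_real (- h n) + \<i> * of_real \<eta>"
      have "norm (indicator (?S n) \<eta> *\<^sub>R ?f n \<eta>) \<le> norm (contour_fun b m \<nu> ?t)"
        by (auto simp: indicator_def norm_mult)
      also have "\<dots> \<le> exp (\<bar>Im \<nu>\<bar> * b) * (exp ((Re \<nu> + 1/2) * Re ?t) * (cos \<eta> - cos b) powr (- m - 1/2))"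
        using norm_cosh_minus_cos_ge_cos[of ?t b] cp et m
        by (intro norm_contour_fun_le) auto
      also have "\<dots> \<le> exp (\<bar>Im \<nu>\<bar> * b) * (1 * (cos \<eta> - cos b) powr (- m - 1/2))"
        using \<nu> h[of n] by (intro mult_left_mono mult_right_mono) (auto simp: mult_le_0_iff)
      finally show ?thesis by simp
    qed
    have "\<forall>\<^sub>F n in sequentially. \<bar>\<eta>\<bar> < d n"
      using order_tendstoD(1)[OF d(3), of "\<bar>\<eta>\<bar>"] et by auto
    then have "\<forall>\<^sub>F n in sequentially. \<eta> \<in> ?S n"
      by eventually_elim auto
    moreover have "(\<lambda>n. ?f n \<eta>) \<longlonglongrightarrow> \<i> * F \<eta>" by (intro tendsto_intros lim et)
    ultimately show "(\<lambda>n. indicator (?S n) \<eta> *\<^sub>R ?f n \<eta>) \<longlonglongrightarrow> \<i> * F \<eta>" by (rule tendsto_indicator_scaleR)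
  qed auto
  then show ?thesis by (simp only: integral_Icc_eq_set_integral(1)[OF cont sub])
qed

text \<open>The integral of \<open>contour_fun\<close> around a half-infinite strip vanishes.\<close>

lemma contour_identity:
  assumes m: "- 1/2 < m" "m < 0" and \<nu>: "Re \<nu> > - 1/2" and b: "0 < b" "b < pi"
  shows "(LINT \<theta>:{..<0}|lborel. contour_fun b m \<nu> (of_real \<theta> + \<i> * of_real b)) -
         (LINT \<theta>:{..<0}|lborel. contour_fun b m \<nu> (of_real \<theta> + \<i> * of_real (- b))) =
         (LINT \<eta>:{-b<..<b}|lborel. \<i> * contour_fun b m \<nu> (\<i> * of_real \<eta>))"
proof -
  \<comment> \<open>Heights stay strictly below \<open>b\<close>, away from the branch points. The
    shift by 2 makes \<open>d 0\<close> positive and places the abscissa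
    \<open>- (1 / (n + 2))\<close> to the right of \<open>- (n + 1)\<close> already at
    \<open>n = 0\<close>.\<close>
  define d where "d n = b * (1 - 1 / (real n + 2))" for n
  have d01: "0 < 1 - 1 / (real n + 2)" "1 - 1 / (real n + 2) < 1" for n by (auto simp: field_simps)
  have d0: "0 < d n" "d n < b" for n
    using mult_strict_left_mono[OF d01(2)[of n] b(1)] mult_pos_pos[OF b(1) d01(1)[of n]] by (auto simp: d_def)
  have inv: "(\<lambda>n. 1 / (real n + 2)) \<longlonglongrightarrow> 0" by real_asymp
  have dl: "d \<longlonglongrightarrow> b"
    unfolding d_def by (rule tendsto_eq_intros inv refl)+ simp
  have dl': "(\<lambda>n. - d n) \<longlonglongrightarrow> - b" by (intro tendsto_minus dl)
  let ?H = "\<lambda>s n. integral {- (real n + 1)..- (1 / (real n + 2))} (\<lambda>\<theta>. contour_fun b m \<nu> (of_real \<theta> + \<i> * of_real (s n)))"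
  let ?V = "\<lambda>h n. integral {- d n..d n} (\<lambda>\<eta>. \<i> * contour_fun b m \<nu> (of_real (- h n) + \<i> * of_real \<eta>))"
  have H1: "?H d \<longlonglongrightarrow> (LINT \<theta>:{..<0}|lborel. contour_fun b m \<nu> (of_real \<theta> + \<i> * of_real b))"
    by (rule contour_horizontal_limit[OF m \<nu> b _ dl]) (use d0 b in \<open>auto simp: abs_of_pos\<close>)
  have H2: "?H (\<lambda>n. - d n) \<longlonglongrightarrow> (LINT \<theta>:{..<0}|lborel. contour_fun b m \<nu> (of_real \<theta> + \<i> * of_real (- b)))"
    by (rule contour_horizontal_limit[OF m \<nu> b _ dl']) (use d0 b in \<open>auto simp: abs_of_pos\<close>)
  have V1: "?V (\<lambda>n. 1 / (real n + 2)) \<longlonglongrightarrow> (LINT \<eta>:{-b<..<b}|lborel. \<i> * contour_fun b m \<nu> (\<i> * of_real \<eta>))"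
  proof (rule contour_vertical_limit[OF m \<nu> b d0 dl])
    fix \<eta> assume et: "\<eta> \<in> {-b<..<b}"
    show "(\<lambda>n. contour_fun b m \<nu> (of_real (- (1 / (real n + 2))) + \<i> * of_real \<eta>)) \<longlonglongrightarrow> contour_fun b m \<nu> (\<i> * of_real \<eta>)"
    proof (rule contour_fun_tendsto[OF b])
      have "(\<lambda>n. complex_of_real (- (1 / (real n + 2))) + \<i> * of_real \<eta>) \<longlonglongrightarrow> of_real (- 0) + \<i> * of_real \<eta>"
        by (intro tendsto_intros inv)
      then show "(\<lambda>n. complex_of_real (- (1 / (real n + 2))) + \<i> * of_real \<eta>) \<longlonglongrightarrow> \<i> * of_real \<eta>" by simp
    qed (use et in auto)
  qed auto
  \<comment> \<open>The far side contributes nothing: \<open>Re \<nu> + 1/2 > 0\<close> makes the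
    exponential factor tend to 0.\<close>
  have V2: "?V (\<lambda>n. real n + 1) \<longlonglongrightarrow> (LINT \<eta>:{-b<..<b}|lborel. \<i> * (\<lambda>_. 0) \<eta>)"
  proof (rule contour_vertical_limit[OF m \<nu> b d0 dl])
    fix \<eta> assume et: "\<eta> \<in> {-b<..<b}"
    have cp: "cos \<eta> - cos b > 0"
    proof -
      have "cos b < cos \<bar>\<eta>\<bar>" using et b by (intro cos_monotone_0_pi) auto
      then show ?thesis by simp
    qed
    let ?C = "exp (\<bar>Im \<nu>\<bar> * b)" and ?p = "(cos \<eta> - cos b) powr (- m - 1/2)"
    show "(\<lambda>n. contour_fun b m \<nu> (of_real (- (real n + 1)) + \<i> * of_real \<eta>)) \<longlonglongrightarrow> 0"
    proof (rule Lim_null_comparison)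
      have "(\<lambda>n. exp (- (Re \<nu> + 1/2) * (real n + 1))) \<longlonglongrightarrow> 0"
        using \<nu> by real_asymp
      then have "(\<lambda>n. ?C * (exp (- (Re \<nu> + 1/2) * (real n + 1)) * ?p)) \<longlonglongrightarrow> ?C * (0 * ?p)"
        by (intro tendsto_intros)
      then show "(\<lambda>n. ?C * (exp (- (Re \<nu> + 1/2) * (real n + 1)) * ?p)) \<longlonglongrightarrow> 0" by simp
      have "norm (contour_fun b m \<nu> (of_real (- (real n + 1)) + \<i> * of_real \<eta>)) \<le> ?C * (exp (- (Re \<nu> + 1/2) * (real n + 1)) * ?p)" for n
      proof -
        let ?t = "complex_of_real (- (real n + 1)) + \<i> * of_real \<eta>"
        have "norm (contour_fun b m \<nu> ?t) \<le> ?C * (exp ((Re \<nu> + 1/2) * Re ?t) * ?p)"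
          using norm_cosh_minus_cos_ge_cos[of ?t b] cp et m
          by (intro norm_contour_fun_le) auto
        also have "(Re \<nu> + 1/2) * Re ?t = - (Re \<nu> + 1/2) * (real n + 1)" by (simp add: field_simps)
        finally show ?thesis .
      qed
      then show "\<forall>\<^sub>F n in sequentially. norm (contour_fun b m \<nu> (of_real (- (real n + 1)) + \<i> * of_real \<eta>)) \<le> ?C * (exp (- (Re \<nu> + 1/2) * (real n + 1)) * ?p)"
        by simp
    qed
  qed auto
  have "?H d n - ?H (\<lambda>n. - d n) n = ?V (\<lambda>n. 1 / (real n + 2)) n - ?V (\<lambda>n. real n + 1) n" for n
  proof (rule contour_fun_rectangle[OF b d0[of n]])
    have "1 / (real n + 2) \<le> 1 / 2" by (intro divide_left_mono) auto
    then show "1 / (real n + 2) < real n + 1" by linarith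
  qed simp
  then have "(\<lambda>n. ?H d n - ?H (\<lambda>n. - d n) n) = (\<lambda>n. ?V (\<lambda>n. 1 / (real n + 2)) n - ?V (\<lambda>n. real n + 1) n)" by blast
  moreover have "(\<lambda>n. ?H d n - ?H (\<lambda>n. - d n) n) \<longlonglongrightarrow> (LINT \<theta>:{..<0}|lborel. contour_fun b m \<nu> (of_real \<theta> + \<i> * of_real b)) -
         (LINT \<theta>:{..<0}|lborel. contour_fun b m \<nu> (of_real \<theta> + \<i> * of_real (- b)))"
    by (rule tendsto_diff[OF H1 H2])
  moreover have "(\<lambda>n. ?V (\<lambda>n. 1 / (real n + 2)) n - ?V (\<lambda>n. real n + 1) n) \<longlonglongrightarrow>
      (LINT \<eta>:{-b<..<b}|lborel. \<i> * contour_fun b m \<nu> (\<i> * of_real \<eta>)) - (LINT \<eta>:{-b<..<b}|lborel. \<i> * (\<lambda>_. 0) \<eta>)"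
    by (rule tendsto_diff[OF V1 V2])
  ultimately have "(LINT \<theta>:{..<0}|lborel. contour_fun b m \<nu> (of_real \<theta> + \<i> * of_real b)) -
         (LINT \<theta>:{..<0}|lborel. contour_fun b m \<nu> (of_real \<theta> + \<i> * of_real (- b))) =
      (LINT \<eta>:{-b<..<b}|lborel. \<i> * contour_fun b m \<nu> (\<i> * of_real \<eta>)) - (LINT \<eta>:{-b<..<b}|lborel. \<i> * (\<lambda>_. 0) \<eta>)"
    by (simp only:) (rule LIMSEQ_unique)
  then show ?thesis by simp
qed

section \<open>The hypergeometric series\<close>

text \<open>The shift \<open>k\<close> serves two estimates: \<open>k = 1\<close> for the division
  by \<open>pochhammer (1/2) n\<close>, and large \<open>k\<close> for the values
  \<open>rGamma (1 - \<mu> + n)\<close>. As \<open>n - k\<close> is truncated, the ratio test is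
  applied from index \<open>k\<close> on; the ratio tends to \<open>w\<close>.\<close>

lemma summable_hypergeometric_majorant:
  fixes a b :: complex
  assumes w: "0 \<le> w" "w < 1"
  shows "summable (\<lambda>n. norm (pochhammer a n * pochhammer b n) / (fact n * fact (n - k)) * w ^ n)"
proof -
  let ?f = "\<lambda>n. norm (pochhammer a n * pochhammer b n) / (fact n * fact (n - k)) * w ^ n"
  let ?g = "\<lambda>j. ?f (j + k)"
  define r where "r j = norm ((a + of_nat (j + k)) / of_nat (j + k + 1)) * norm ((b + of_nat (j + k)) / of_nat (j + 1)) * w" for j
  have rec: "?g (Suc j) = ?g j * r j" for j
  proof -
    have "Suc j + k - k = Suc (j + k - k)" "Suc j + k = Suc (j + k)" by auto
    then have "?g (Suc j) = norm (pochhammer a (Suc (j + k)) * pochhammer b (Suc (j + k))) / (fact (Suc (j + k)) * fact (Suc j)) * w ^ Suc (j + k)"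
      by (simp only: add_diff_cancel_right')
    also have "\<dots> = ?g j * r j"
      unfolding pochhammer_Suc fact_Suc r_def
      by (simp add: norm_mult norm_divide mult_ac add_ac del: of_nat_Suc of_nat_add)
    finally show ?thesis .
  qed
  have lim1: "(\<lambda>j. norm ((c + of_nat (j + k)) / of_nat (j + l + 1))) \<longlonglongrightarrow> 1" for c :: complex and k l :: nat
  proof -
    have "(\<lambda>j. (1::complex) + (c + of_nat k - of_nat l - 1) * (1 / of_nat (j + l + 1))) \<longlonglongrightarrow> 1 + (c + of_nat k - of_nat l - 1) * 0"
    proof (intro tendsto_intros)
      have "(\<lambda>j. 1 / (of_nat (j + (l + 1)) :: complex)) \<longlonglongrightarrow> 0"
        by (rule LIMSEQ_ignore_initial_segment[OF lim_1_over_n])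
      then show "(\<lambda>j. 1 / (of_nat (j + l + 1) :: complex)) \<longlonglongrightarrow> 0" by (simp add: add.assoc)
    qed
    moreover have "1 + (c + of_nat k - of_nat l - 1) * (1 / of_nat (j + l + 1)) = (c + of_nat (j + k)) / of_nat (j + l + 1)" for j
    proof -
      have "(of_nat (j + l + 1) :: complex) \<noteq> 0" by (simp only: of_nat_eq_0_iff)
      then show ?thesis by (simp add: divide_simps del: of_nat_add of_nat_Suc) (simp add: algebra_simps)
    qed
    ultimately have "(\<lambda>j. (c + of_nat (j + k)) / of_nat (j + l + 1)) \<longlonglongrightarrow> 1" by simp
    from tendsto_norm[OF this] show ?thesis by simp
  qed
  have "r \<longlonglongrightarrow> 1 * 1 * w"
    unfolding r_def using lim1[of a k k] lim1[of b k 0] by (intro tendsto_intros) simp_all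
  then have "\<forall>\<^sub>F j in sequentially. r j < (1 + w) / 2"
    using w by (intro order_tendstoD(2)) auto
  then obtain N where N: "\<And>j. j \<ge> N \<Longrightarrow> r j < (1 + w) / 2" by (auto simp: eventually_sequentially)
  have g0: "?g j \<ge> 0" for j using w by simp
  have r0: "r j \<ge> 0" for j unfolding r_def using w by simp
  have "summable ?g"
  proof (rule summable_ratio_test[of "(1 + w) / 2" N])
    fix j assume "N \<le> j"
    have "norm (?g (Suc j)) = r j * ?g j" 
    proof -
      have "norm (G * R) = R * G" if "G \<ge> 0" "R \<ge> 0" for G R :: real using that by simp
      from this[OF g0[of j] r0[of j]] show ?thesis unfolding rec .
    qed
    also have "\<dots> \<le> (1 + w) / 2 * ?g j" using N[OF \<open>N \<le> j\<close>] g0[of j] by (intro mult_right_mono) (auto intro: less_imp_le)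
    finally show "norm (?g (Suc j)) \<le> (1 + w) / 2 * norm (?g j)" using g0[of j] by (simp only: real_norm_def abs_of_nonneg)
  qed (use w in auto)
  then show ?thesis by (subst (asm) summable_iff_shift)
qed

section \<open>The series with third parameter 1/2 and its closed form\<close>

text \<open>The coefficients of the hypergeometric function with parameters
  \<open>\<nu> + 1\<close>, \<open>- \<nu>\<close> and \<open>1/2\<close>. It is elementary: at
  \<open>(sin z)\<^sup>2\<close> it equals \<open>cos ((2 * \<nu> + 1) * z) / cos z\<close> for
  \<open>z\<close> near 0.\<close>

definition cheb_coeff :: "complex \<Rightarrow> nat \<Rightarrow> complex" where
  "cheb_coeff \<nu> n = pochhammer (\<nu> + 1) n * pochhammer (- \<nu>) n / (pochhammer (1/2) n * fact n)"

lemma half_plus_nat_nonzero: "(1/2 + of_nat n :: complex) \<noteq> 0"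
  by (simp add: complex_eq_iff)

lemma pochhammer_half_nonzero: "pochhammer (1/2 :: complex) n \<noteq> 0"
proof
  assume "pochhammer (1/2 :: complex) n = 0"
  then obtain k where "(1/2 :: complex) = - of_nat k" by (auto simp: pochhammer_eq_0_iff)
  then have "1/2 + of_nat k = (0 :: complex)" by (simp only:) simp
  then show False using half_plus_nat_nonzero[of k] by contradiction
qed

lemma cheb_coeff_Suc:
  "cheb_coeff \<nu> (Suc n) * ((of_nat n + 1) * (of_nat n + 1/2)) = cheb_coeff \<nu> n * ((of_nat n - \<nu>) * (of_nat n + \<nu> + 1))"
proof -
  have 1: "(of_nat (Suc n) :: complex) \<noteq> 0" by (simp only: of_nat_eq_0_iff)
  have e: "of_nat n + 1/2 = (1/2 + of_nat n :: complex)" "of_nat n + 1 = (of_nat (Suc n) :: complex)" by simp_all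
  have "cheb_coeff \<nu> (Suc n) = cheb_coeff \<nu> n * ((\<nu> + 1 + of_nat n) * (- \<nu> + of_nat n)) / ((1/2 + of_nat n) * of_nat (Suc n))"
    unfolding cheb_coeff_def pochhammer_Suc fact_Suc by (simp only: times_divide_eq_left times_divide_eq_right divide_divide_eq_left mult_ac)
  then show ?thesis unfolding e using half_plus_nat_nonzero[of n] 1 by (simp add: mult_ac add_ac del: of_nat_Suc)
qed

text \<open>In \<open>(1/2) * (3/2) * (5/2) * ...\<close> the summand \<open>1/2\<close> is dropped
  from every factor but the first. At \<open>n = 0\<close> the truncated \<open>n - 1\<close> yields
  the harmless bound \<open>1/2\<close>.\<close>

lemma norm_pochhammer_half_ge: "norm (pochhammer (1/2 :: complex) n) \<ge> fact (n - 1) / 2"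
proof (induction n)
  case (Suc n)
  show ?case
  proof (cases n)
    case (Suc k)
    have "norm (pochhammer (1/2 :: complex) (Suc n)) = norm (pochhammer (1/2 :: complex) n) * norm (1/2 + of_nat n :: complex)"
      by (simp add: pochhammer_Suc norm_mult)
    also have "norm (1/2 + of_nat n :: complex) = 1/2 + real n"
      using norm_of_real[of "1/2 + real n", where 'a = complex] by simp
    also have "norm (pochhammer (1/2 :: complex) n) * (1/2 + real n) \<ge> fact (n - 1) / 2 * real n"
      using Suc.IH by (intro mult_mono) auto
    also have "fact (n - 1) / 2 * real n = fact (Suc n - 1) / 2" using Suc by (simp add: mult.commute)
    finally show ?thesis .
  qed simp
qed simp

lemma cheb_coeff_abs_summable:
  assumes w: "0 \<le> w" "w < 1"
  shows "summable (\<lambda>n. norm (cheb_coeff \<nu> n) * w ^ n)"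
proof (rule summable_comparison_test'[of "\<lambda>n. 2 * (norm (pochhammer (\<nu> + 1) n * pochhammer (- \<nu>) n) / (fact n * fact (n - 1)) * w ^ n)" 0])
  show "summable (\<lambda>n. 2 * (norm (pochhammer (\<nu> + 1) n * pochhammer (- \<nu>) n) / (fact n * fact (n - 1)) * w ^ n))"
    by (rule summable_mult[OF summable_hypergeometric_majorant[OF w]])
  fix n
  let ?P = "norm (pochhammer (\<nu> + 1) n * pochhammer (- \<nu>) n)"
  have "norm (cheb_coeff \<nu> n) = ?P / (fact n * norm (pochhammer (1/2 :: complex) n))"
    by (simp add: cheb_coeff_def norm_mult norm_divide mult.commute)
  also have "\<dots> \<le> ?P / (fact n * (fact (n - 1) / 2))"
    using norm_pochhammer_half_ge[of n] pochhammer_half_nonzero[of n] by (intro divide_left_mono mult_left_mono mult_pos_pos) auto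
  finally have "norm (cheb_coeff \<nu> n) \<le> 2 * (?P / (fact n * fact (n - 1)))" by (simp add: mult.commute)
  then have "norm (cheb_coeff \<nu> n) * w ^ n \<le> 2 * (?P / (fact n * fact (n - 1))) * w ^ n"
    using w by (intro mult_right_mono) auto
  then show "norm (norm (cheb_coeff \<nu> n) * w ^ n) \<le> 2 * (?P / (fact n * fact (n - 1)) * w ^ n)"
    using w by (simp add: mult.assoc)
qed

definition cheb_series :: "complex \<Rightarrow> complex \<Rightarrow> complex" where
  "cheb_series \<nu> w = (\<Sum>n. cheb_coeff \<nu> n * w ^ n)"

lemma cheb_summable: "norm w < 1 \<Longrightarrow> summable (\<lambda>n. cheb_coeff \<nu> n * w ^ n)"
  by (rule summable_norm_cancel) (use cheb_coeff_abs_summable[of "norm w" \<nu>] in \<open>simp add: norm_mult norm_power\<close>)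

lemma powser_DERIV:
  fixes c :: "nat \<Rightarrow> complex"
  assumes "\<And>w. norm w < 1 \<Longrightarrow> summable (\<lambda>n. c n * w ^ n)" "norm w < 1"
  shows "((\<lambda>w. \<Sum>n. c n * w ^ n) has_field_derivative (\<Sum>n. diffs c n * w ^ n)) (at w)"
    and "summable (\<lambda>n. diffs c n * w ^ n)"
proof -
  show "summable (\<lambda>n. diffs c n * w ^ n)" by (rule termdiff_converges[OF assms(2,1)])
  obtain K where K: "norm w < K" "K < 1" using dense[OF assms(2)] by auto
  then have "K > 0" using norm_ge_zero[of w] by linarith
  then show "((\<lambda>w. \<Sum>n. c n * w ^ n) has_field_derivative (\<Sum>n. diffs c n * w ^ n)) (at w)"
    using K by (intro termdiffs_strong[of c "of_real K"] assms(1)) auto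
qed

lemma powser_shift_sums:
  fixes f :: "nat \<Rightarrow> complex"
  assumes "(\<lambda>n. f (Suc n) * w ^ n) sums s" "f 0 = 0"
  shows "(\<lambda>n. f n * w ^ n) sums (w * s)"
proof -
  have "(\<lambda>n. w * (f (Suc n) * w ^ n)) sums (w * s)" by (rule sums_mult[OF assms(1)])
  then have "(\<lambda>n. f (Suc n) * w ^ Suc n) sums (w * s)" by (simp add: mult_ac)
  then show ?thesis by (subst (asm) sums_Suc_iff) (simp add: assms(2))
qed

text \<open>Gauss's hypergeometric equation for these parameters; coefficient by coefficient it is
  the recursion \<open>cheb_coeff_Suc\<close>.\<close>

lemma cheb_series_ODE:
  fixes \<nu> w :: complex
  assumes w: "norm w < 1"
  defines "c0 \<equiv> cheb_coeff \<nu>" and "c1 \<equiv> diffs (cheb_coeff \<nu>)" and "c2 \<equiv> diffs (diffs (cheb_coeff \<nu>))"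
  shows "w * (1 - w) * (\<Sum>n. c2 n * w ^ n) + (1/2 - 2 * w) * (\<Sum>n. c1 n * w ^ n) + \<nu> * (\<nu> + 1) * (\<Sum>n. c0 n * w ^ n) = 0"
proof -
  note D1 = powser_DERIV(2)[of "cheb_coeff \<nu>", OF cheb_summable]
  note D2 = powser_DERIV(2)[of "diffs (cheb_coeff \<nu>)", OF D1 w]
  define e0 e1 e2 where "e0 = (\<Sum>n. c0 n * w ^ n)" and "e1 = (\<Sum>n. c1 n * w ^ n)" and "e2 = (\<Sum>n. c2 n * w ^ n)"
  have s0: "(\<lambda>n. c0 n * w ^ n) sums e0" unfolding e0_def c0_def using cheb_summable[OF w] by (rule summable_sums)
  have s1: "(\<lambda>n. (of_nat (Suc n) * c0 (Suc n)) * w ^ n) sums e1"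
    using summable_sums[OF D1[OF _ w]] unfolding e1_def c1_def c0_def diffs_def by simp
  have s2: "(\<lambda>n. (of_nat (Suc n) * (of_nat (Suc (Suc n)) * c0 (Suc (Suc n)))) * w ^ n) sums e2"
    using summable_sums[OF D2] unfolding e2_def c2_def c0_def diffs_def by simp
  have w1: "(\<lambda>n. (of_nat n * c0 n) * w ^ n) sums (w * e1)" by (rule powser_shift_sums) (use s1 in auto)
  have w2: "(\<lambda>n. (of_nat n * (of_nat (Suc n) * c0 (Suc n))) * w ^ n) sums (w * e2)"
    by (rule powser_shift_sums) (use s2 in auto)
  \<comment> \<open>At index 0 the truncated \<open>n - 1\<close> is multiplied by
    \<open>of_nat 0\<close>, so it may later be read as the true difference.\<close>
  have w3: "(\<lambda>n. (of_nat (n - 1) * (of_nat n * c0 n)) * w ^ n) sums (w * (w * e2))"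
    by (rule powser_shift_sums) (use w2 in auto)
  have "(\<lambda>n. (of_nat n * (of_nat (Suc n) * c0 (Suc n))) * w ^ n + 1/2 * ((of_nat (Suc n) * c0 (Suc n)) * w ^ n)
       - ((of_nat (n - 1) * (of_nat n * c0 n)) * w ^ n + 2 * ((of_nat n * c0 n) * w ^ n) - \<nu> * (\<nu> + 1) * (c0 n * w ^ n)))
     sums (w * e2 + 1/2 * e1 - (w * (w * e2) + 2 * (w * e1) - \<nu> * (\<nu> + 1) * e0))"
    by (intro sums_add sums_diff sums_mult w1 w2 w3 s0 s1)
  moreover have "(of_nat n * (of_nat (Suc n) * c0 (Suc n))) * w ^ n + 1/2 * ((of_nat (Suc n) * c0 (Suc n)) * w ^ n)
       - ((of_nat (n - 1) * (of_nat n * c0 n)) * w ^ n + 2 * ((of_nat n * c0 n) * w ^ n) - \<nu> * (\<nu> + 1) * (c0 n * w ^ n)) = 0" for n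
  proof -
    have k: "of_nat (n - 1) * (of_nat n * c0 n) = (of_nat n - 1) * (of_nat n * c0 n)" by (cases n) auto
    have "of_nat n * (of_nat (Suc n) * c0 (Suc n)) + 1/2 * (of_nat (Suc n) * c0 (Suc n)) = c0 (Suc n) * ((of_nat n + 1) * (of_nat n + 1/2))"
      by (simp add: field_simps)
    also have "\<dots> = c0 n * ((of_nat n - \<nu>) * (of_nat n + \<nu> + 1))" unfolding c0_def by (rule cheb_coeff_Suc)
    also have "\<dots> = (of_nat n - 1) * (of_nat n * c0 n) + 2 * (of_nat n * c0 n) - \<nu> * (\<nu> + 1) * c0 n" by (simp add: algebra_simps)
    finally have e: "of_nat n * (of_nat (Suc n) * c0 (Suc n)) + 1/2 * (of_nat (Suc n) * c0 (Suc n)) -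
        ((of_nat n - 1) * (of_nat n * c0 n) + 2 * (of_nat n * c0 n) - \<nu> * (\<nu> + 1) * c0 n) = 0" by simp
    have dist: "X * W + 1/2 * (Y * W) - (Z * W + 2 * (U * W) - \<nu> * (\<nu> + 1) * (C * W)) = (X + 1/2 * Y - (Z + 2 * U - \<nu> * (\<nu> + 1) * C)) * W"
      for X Y Z U C W :: complex by (simp add: algebra_simps)
    show ?thesis unfolding k dist e by simp
  qed
  ultimately have "(\<lambda>n. 0) sums (w * e2 + 1/2 * e1 - (w * (w * e2) + 2 * (w * e1) - \<nu> * (\<nu> + 1) * e0))"
    by (simp only:)
  then have "w * e2 + 1/2 * e1 - (w * (w * e2) + 2 * (w * e1) - \<nu> * (\<nu> + 1) * e0) = 0"
    by (rule sums_unique2[OF _ sums_zero])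
  then show ?thesis unfolding e0_def[symmetric] e1_def[symmetric] e2_def[symmetric] by (simp add: algebra_simps)
qed

text \<open>By the hypergeometric equation the left side \<open>S\<close> satisfies
  \<open>S'' = - (2 * \<nu> + 1)\<^sup>2 * S\<close> with \<open>S 0 = 1\<close> and vanishing
  derivative at 0, so it is the cosine. The ball keeps the argument of the series in the unit
  disc.\<close>

lemma cheb_series_cos:
  fixes z \<nu> :: complex
  assumes \<nu>: "2 * \<nu> + 1 \<noteq> 0" and B: "\<And>z :: complex. z \<in> ball 0 \<delta> \<Longrightarrow> norm (sin z) < 1" and z: "z \<in> ball 0 \<delta>"
  shows "cos z * cheb_series \<nu> ((sin z)\<^sup>2) = cos ((2 * \<nu> + 1) * z)"
proof -
  define l where "l = 2 * \<nu> + 1"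
  define E0 where "E0 = (\<lambda>w. \<Sum>n. cheb_coeff \<nu> n * w ^ n)"
  define E1 where "E1 = (\<lambda>w. \<Sum>n. diffs (cheb_coeff \<nu>) n * w ^ n)"
  define E2 where "E2 = (\<lambda>w. \<Sum>n. diffs (diffs (cheb_coeff \<nu>)) n * w ^ n)"
  note D1 = powser_DERIV[of "cheb_coeff \<nu>", OF cheb_summable]
  note D2 = powser_DERIV[of "diffs (cheb_coeff \<nu>)", OF D1(2)]
  have dE0: "(E0 has_field_derivative E1 w) (at w)" if "norm w < 1" for w
    unfolding E0_def E1_def using that by (intro D1)
  have dE1: "(E1 has_field_derivative E2 w) (at w)" if "norm w < 1" for w
    unfolding E1_def E2_def using that by (intro D2)
  have ODE: "w * (1 - w) * E2 w + (1/2 - 2 * w) * E1 w + \<nu> * (\<nu> + 1) * E0 w = 0" if "norm w < 1" for w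
    using cheb_series_ODE[OF that, of \<nu>] unfolding E0_def E1_def E2_def .
  define S where "S z = cos z * E0 ((sin z)\<^sup>2)" for z
  define S1 where "S1 z = - sin z * E0 ((sin z)\<^sup>2) + 2 * sin z * (cos z)\<^sup>2 * E1 ((sin z)\<^sup>2)" for z
  have sq: "norm ((sin z)\<^sup>2) < 1" if "z \<in> ball 0 \<delta>" for z :: complex
    using B[OF that] by (simp add: norm_power abs_square_less_1)
  have dsin: "((\<lambda>z. (sin z)\<^sup>2) has_field_derivative 2 * sin z * cos z) (at z)" for z :: complex
    by (auto intro!: derivative_eq_intros)
  have d0: "((\<lambda>z. E0 ((sin z)\<^sup>2)) has_field_derivative E1 ((sin z)\<^sup>2) * (2 * sin z * cos z)) (at z)" if "z \<in> ball 0 \<delta>" for z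
    by (rule DERIV_chain2[OF dE0[OF sq[OF that]] dsin])
  have d1: "((\<lambda>z. E1 ((sin z)\<^sup>2)) has_field_derivative E2 ((sin z)\<^sup>2) * (2 * sin z * cos z)) (at z)" if "z \<in> ball 0 \<delta>" for z
    by (rule DERIV_chain2[OF dE1[OF sq[OF that]] dsin])
  have dS: "(S has_field_derivative S1 z) (at z)" if z: "z \<in> ball 0 \<delta>" for z
  proof -
    have "(S has_field_derivative cos z * (E1 ((sin z)\<^sup>2) * (2 * sin z * cos z)) + (- sin z) * E0 ((sin z)\<^sup>2)) (at z)"
      unfolding S_def by (rule DERIV_mult'[OF DERIV_cos d0[OF z]])
    then show ?thesis unfolding S1_def by (rule DERIV_cong) (simp add: power2_eq_square)
  qed
  have dS1: "(S1 has_field_derivative - (l\<^sup>2 * S z)) (at z)" if z: "z \<in> ball 0 \<delta>" for z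
  proof -
    have a: "((\<lambda>z. - sin z * E0 ((sin z)\<^sup>2)) has_field_derivative
        - sin z * (E1 ((sin z)\<^sup>2) * (2 * sin z * cos z)) + (- cos z) * E0 ((sin z)\<^sup>2)) (at z)"
      by (rule DERIV_mult'[OF DERIV_minus[OF DERIV_sin] d0[OF z]])
    have p: "((\<lambda>z. 2 * sin z * (cos z)\<^sup>2) has_field_derivative 2 * (cos z) ^ 3 - 4 * (sin z)\<^sup>2 * cos z) (at z)"
    proof -
      have c: "((\<lambda>z. (cos z)\<^sup>2) has_field_derivative - 2 * cos z * sin z) (at z)"
        by (auto intro!: derivative_eq_intros)
      have "((\<lambda>z. 2 * sin z) has_field_derivative 2 * cos z) (at z)" by (intro DERIV_cmult DERIV_sin)
      from DERIV_mult'[OF this c] show ?thesis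
        by (rule DERIV_cong) (simp add: power2_eq_square power3_eq_cube)
    qed
    have b: "((\<lambda>z. 2 * sin z * (cos z)\<^sup>2 * E1 ((sin z)\<^sup>2)) has_field_derivative
        2 * sin z * (cos z)\<^sup>2 * (E2 ((sin z)\<^sup>2) * (2 * sin z * cos z)) + (2 * (cos z) ^ 3 - 4 * (sin z)\<^sup>2 * cos z) * E1 ((sin z)\<^sup>2)) (at z)"
      by (rule DERIV_mult'[OF p d1[OF z]])
    define w where "w = (sin z)\<^sup>2"
    have c2: "(cos z)\<^sup>2 = 1 - w" by (simp add: w_def cos_squared_eq)
    have "(S1 has_field_derivative
       (- sin z * (E1 ((sin z)\<^sup>2) * (2 * sin z * cos z)) + (- cos z) * E0 ((sin z)\<^sup>2)) +
       (2 * sin z * (cos z)\<^sup>2 * (E2 ((sin z)\<^sup>2) * (2 * sin z * cos z)) + (2 * (cos z) ^ 3 - 4 * (sin z)\<^sup>2 * cos z) * E1 ((sin z)\<^sup>2))) (at z)"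
      unfolding S1_def by (rule DERIV_add[OF a b])
    also have "(- sin z * (E1 ((sin z)\<^sup>2) * (2 * sin z * cos z)) + (- cos z) * E0 ((sin z)\<^sup>2)) +
       (2 * sin z * (cos z)\<^sup>2 * (E2 ((sin z)\<^sup>2) * (2 * sin z * cos z)) + (2 * (cos z) ^ 3 - 4 * (sin z)\<^sup>2 * cos z) * E1 ((sin z)\<^sup>2))
       = cos z * (- 2 * w * E1 w - E0 w + 4 * w * (cos z)\<^sup>2 * E2 w + (2 * (cos z)\<^sup>2 - 4 * w) * E1 w)"
      unfolding w_def by (simp add: power2_eq_square power3_eq_cube algebra_simps)
    also have "\<dots> = cos z * (4 * (w * (1 - w) * E2 w + (1/2 - 2 * w) * E1 w + \<nu> * (\<nu> + 1) * E0 w) - (4 * \<nu> * (\<nu> + 1) + 1) * E0 w)"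
      unfolding c2 by (simp add: algebra_simps)
    also have "\<dots> = - (l\<^sup>2 * S z)"
      using ODE[OF sq[OF z]] unfolding w_def[symmetric] S_def l_def by (simp add: power2_eq_square algebra_simps)
    finally show ?thesis .
  qed
  \<comment> \<open>The equation splits into first-order factors: for
    \<open>k = \<plusminus>\<i> * l\<close> the function \<open>y = S1 - k * S\<close> satisfies
    \<open>y' = - k * y\<close> and is therefore known explicitly. Subtracting the two solutions
    isolates \<open>2 * \<i> * l * S\<close>, and \<open>l \<noteq> 0\<close> allows the
    division.\<close>
  have const: "(S1 z - k * S z) * exp (k * z) = S1 0 - k * S 0" if z: "z \<in> ball 0 \<delta>" and k: "k\<^sup>2 = - (l\<^sup>2)" for z k
  proof -
    have "((\<lambda>z. (S1 z - k * S z) * exp (k * z)) has_field_derivative 0) (at y within ball 0 \<delta>)" if y: "y \<in> ball 0 \<delta>" for y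
    proof -
      have "((\<lambda>z. S1 z - k * S z) has_field_derivative - (l\<^sup>2 * S y) - k * S1 y) (at y)"
        by (intro DERIV_diff dS1 DERIV_cmult dS y)
      moreover have "((\<lambda>z. exp (k * z)) has_field_derivative exp (k * y) * k) (at y)"
        by (auto intro!: derivative_eq_intros)
      ultimately have "((\<lambda>z. (S1 z - k * S z) * exp (k * z)) has_field_derivative
          (S1 y - k * S y) * (exp (k * y) * k) + (- (l\<^sup>2 * S y) - k * S1 y) * exp (k * y)) (at y)"
        by (rule DERIV_mult')
      moreover have "(S1 y - k * S y) * (exp (k * y) * k) + (- (l\<^sup>2 * S y) - k * S1 y) * exp (k * y) = - (k\<^sup>2 + l\<^sup>2) * S y * exp (k * y)"
        by (simp add: algebra_simps power2_eq_square)
      ultimately show ?thesis using k by (simp add: has_field_derivative_at_within)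
    qed
    then have "\<exists>C. \<forall>y\<in>ball 0 \<delta>. (S1 y - k * S y) * exp (k * y) = C"
      by (rule has_field_derivative_zero_constant[OF convex_ball])
    then obtain C where C: "\<And>y. y \<in> ball 0 \<delta> \<Longrightarrow> (S1 y - k * S y) * exp (k * y) = C" by blast
    have "dist 0 z < \<delta>" using z by simp
    then have "\<delta> > 0" using zero_le_dist[of 0 z] by linarith
    then show ?thesis using C[OF z] C[of 0] by simp
  qed
  have E00: "E0 0 = 1" unfolding E0_def using powser_zero[of "cheb_coeff \<nu>"] by (simp add: cheb_coeff_def)
  have init: "S 0 = 1" "S1 0 = 0" by (simp_all add: S_def S1_def E00)
  have il: "(\<i> * l)\<^sup>2 = - (l\<^sup>2)" "(- (\<i> * l))\<^sup>2 = - (l\<^sup>2)" by (simp_all add: power_mult_distrib)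
  have solve: "S1 z - k * S z = - k * exp (- (k * z))" if k: "k\<^sup>2 = - (l\<^sup>2)" for k
  proof -
    have "S1 z - k * S z = (S1 z - k * S z) * exp (k * z) * exp (- (k * z))"
      by (simp only: mult.assoc exp_minus_inverse mult_1_right)
    also have "(S1 z - k * S z) * exp (k * z) = - k" using const[OF z k] init by simp
    finally show ?thesis .
  qed
  have "(S1 z - (- (\<i> * l)) * S z) - (S1 z - \<i> * l * S z) = \<i> * l * (exp (\<i> * (l * z)) + exp (- (\<i> * (l * z))))"
    unfolding solve[OF il(1)] solve[OF il(2)] by (simp add: algebra_simps)
  then have "(\<i> * l) * (2 * S z) = (\<i> * l) * (exp (\<i> * (l * z)) + exp (- (\<i> * (l * z))))" by (simp add: algebra_simps)
  moreover have "\<i> * l \<noteq> 0" using \<nu> by (simp add: l_def)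
  ultimately have "2 * S z = exp (\<i> * (l * z)) + exp (- (\<i> * (l * z)))" using mult_left_cancel by blast
  then have "S z = (exp (\<i> * (l * z)) + exp (- (\<i> * (l * z)))) / 2"
    by (simp add: field_simps)
  then show ?thesis unfolding cos_exp_eq S_def E0_def cheb_series_def l_def by simp
qed

lemma sin_lt_1_ball:
  obtains \<delta> :: real where "\<delta> > 0" "\<And>z :: complex. z \<in> ball 0 \<delta> \<Longrightarrow> norm (sin z) < 1"
proof -
  have "((\<lambda>z :: complex. norm (sin z)) \<longlongrightarrow> norm (sin 0 :: complex)) (at 0)"
    by (intro tendsto_intros)
  then have "\<forall>\<^sub>F z :: complex in at 0. norm (sin z) < 1"
    by (rule order_tendstoD(2)) simp
  then obtain d where "d > 0" "\<And>z :: complex. z \<noteq> 0 \<Longrightarrow> dist z 0 < d \<Longrightarrow> norm (sin z) < 1"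
    by (auto simp: eventually_at)
  then show ?thesis using that[of d] by (metis dist_commute mem_ball norm_zero sin_zero zero_less_one)
qed

lemma sinh_of_real_complex: "sinh (complex_of_real x) = of_real (sinh x)"
  and cosh_of_real_complex: "cosh (complex_of_real x) = of_real (cosh x)"
  by (simp_all add: sinh_def cosh_def exp_of_real scaleR_conv_of_real flip: of_real_minus)

text \<open>With \<open>w = (sin z)\<^sup>2\<close> near 0 the two square roots are
  \<open>cos z\<close> and \<open>\<plusminus>\<i> * sin z\<close>, so the logarithm is
  \<open>\<plusminus>\<i> * z\<close> and the second branch is the closed form of the series. It is
  holomorphic off \<open>[0, \<infinity>)\<close>, the series covers \<open>[0, 1)\<close>, and
  together they reach the whole slit plane.\<close>

definition cheb_ext :: "complex \<Rightarrow> complex \<Rightarrow> complex" where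
  "cheb_ext \<nu> w = (if w \<in> ball 0 1 then cheb_series \<nu> w
     else cosh ((2 * \<nu> + 1) * Ln (csqrt (1 - w) + csqrt (- w))) / csqrt (1 - w))"

lemma cheb_series_holomorphic: "cheb_series \<nu> holomorphic_on ball 0 1"
  unfolding holomorphic_on_open[OF open_ball] cheb_series_def
proof (intro ballI exI)
  fix w :: complex assume "w \<in> ball 0 1"
  then show "((\<lambda>w. \<Sum>n. cheb_coeff \<nu> n * w ^ n) has_field_derivative (\<Sum>n. diffs (cheb_coeff \<nu>) n * w ^ n)) (at w)"
    by (intro powser_DERIV(1)[of "cheb_coeff \<nu>", OF cheb_summable]) auto
qed

lemma Re_csqrt_pos: "w \<notin> \<real>\<^sub>\<le>\<^sub>0 \<Longrightarrow> Re (csqrt w) > 0"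
proof -
  assume w: "w \<notin> \<real>\<^sub>\<le>\<^sub>0"
  have "Re (csqrt w) \<ge> 0" by (rule Re_csqrt)
  moreover have "Re (csqrt w) \<noteq> 0"
  proof
    assume "Re (csqrt w) = 0"
    then have "csqrt w = \<i> * of_real (Im (csqrt w))" by (simp add: complex_eq_iff)
    then have "(csqrt w)\<^sup>2 = of_real (- ((Im (csqrt w))\<^sup>2))" by (simp add: power_mult_distrib)
    then have "w = of_real (- ((Im (csqrt w))\<^sup>2))" by (simp only: power2_csqrt)
    then have "w \<in> \<real>\<^sub>\<le>\<^sub>0" by (metis nonpos_Reals_of_real_iff neg_le_0_iff_le zero_le_power2)
    then show False using w by contradiction
  qed
  ultimately show ?thesis by linarith
qed

text \<open>Off \<open>[0, \<infinity>)\<close> both square roots have positive real part, hence so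
  has their sum, and the principal logarithm never meets its cut.\<close>

lemma cheb_closed_holomorphic:
  "(\<lambda>w. cosh ((2 * \<nu> + 1) * Ln (csqrt (1 - w) + csqrt (- w))) / csqrt (1 - w)) holomorphic_on {w. - w \<notin> \<real>\<^sub>\<le>\<^sub>0}"
proof -
  have 1: "1 - w \<notin> \<real>\<^sub>\<le>\<^sub>0" if "- w \<notin> \<real>\<^sub>\<le>\<^sub>0" for w :: complex
    using that by (auto simp: complex_nonpos_Reals_iff)
  have h1: "(\<lambda>w. csqrt (1 - w)) holomorphic_on {w. - w \<notin> \<real>\<^sub>\<le>\<^sub>0}"
    by (intro holomorphic_on_csqrt' holomorphic_intros) (use 1 in auto)
  have h2: "(\<lambda>w. csqrt (- w)) holomorphic_on {w. - w \<notin> \<real>\<^sub>\<le>\<^sub>0}"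
    by (intro holomorphic_on_csqrt' holomorphic_intros) auto
  have nz: "csqrt (1 - w) + csqrt (- w) \<notin> \<real>\<^sub>\<le>\<^sub>0" "csqrt (1 - w) \<noteq> 0" if "w \<in> {w. - w \<notin> \<real>\<^sub>\<le>\<^sub>0}" for w
  proof -
    have n: "- w \<notin> \<real>\<^sub>\<le>\<^sub>0" using that by blast
    have "Re (csqrt (1 - w)) > 0" "Re (csqrt (- w)) > 0"
      by (rule Re_csqrt_pos[OF 1[OF n]], rule Re_csqrt_pos[OF n])
    then have "Re (csqrt (1 - w) + csqrt (- w)) > 0" "Re (csqrt (1 - w)) \<noteq> 0"
      unfolding plus_complex.sel by linarith+
    then show "csqrt (1 - w) + csqrt (- w) \<notin> \<real>\<^sub>\<le>\<^sub>0" "csqrt (1 - w) \<noteq> 0"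
      using notin_nonpos_Reals_Re by (blast, metis zero_complex.sel(1))
  qed
  have "(\<lambda>w. Ln (csqrt (1 - w) + csqrt (- w))) holomorphic_on {w. - w \<notin> \<real>\<^sub>\<le>\<^sub>0}"
    by (intro holomorphic_on_Ln' holomorphic_on_add h1 h2 nz)
  then show ?thesis
    unfolding cosh_field_def by (intro holomorphic_on_divide holomorphic_on_add holomorphic_on_exp' holomorphic_on_minus holomorphic_on_mult holomorphic_on_const h1 nz) auto
qed

lemma open_neg_slit: "open {w :: complex. - w \<notin> \<real>\<^sub>\<le>\<^sub>0}"
proof -
  have "{w :: complex. - w \<notin> \<real>\<^sub>\<le>\<^sub>0} = uminus -` (- \<real>\<^sub>\<le>\<^sub>0)" by auto
  then show ?thesis by (simp add: open_vimage open_Compl continuous_on_minus)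
qed

text \<open>At small negative \<open>w = - (sinh t)\<^sup>2\<close> the identity is
  \<open>cheb_series_cos\<close> at \<open>z = \<i> * t\<close>, where all roots and the logarithm
  are real; from there it spreads over the slit disc.\<close>

lemma cheb_closed_eq_series:
  assumes \<nu>: "2 * \<nu> + 1 \<noteq> 0" and w: "norm w < 1" "- w \<notin> \<real>\<^sub>\<le>\<^sub>0"
  shows "cheb_series \<nu> w = cosh ((2 * \<nu> + 1) * Ln (csqrt (1 - w) + csqrt (- w))) / csqrt (1 - w)"
proof -
  obtain \<delta> :: real where d: "\<delta> > 0" "\<And>z :: complex. z \<in> ball 0 \<delta> \<Longrightarrow> norm (sin z) < 1"
    by (rule sin_lt_1_ball) blast
  let ?S = "ball 0 1 \<inter> {w. - w \<notin> \<real>\<^sub>\<le>\<^sub>0} :: complex set"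
  let ?F = "\<lambda>w. cosh ((2 * \<nu> + 1) * Ln (csqrt (1 - w) + csqrt (- w))) / csqrt (1 - w)"
  \<comment> \<open>The first entry ensures \<open>t < \<delta>\<close> for
    \<open>t = arsinh (sqrt (- x))\<close>, the second keeps \<open>x\<close> in the unit
    disc.\<close>
  define e where "e = min ((sinh \<delta>)\<^sup>2) 1"
  have e: "0 < e" "e \<le> 1" "e \<le> (sinh \<delta>)\<^sup>2" using d(1) by (auto simp: e_def)
  have "cheb_series \<nu> w - ?F w = 0"
  proof (rule analytic_continuation[where S = ?S and U = "complex_of_real ` {- e<..<0}" and \<xi> = "of_real (- e / 2)"
        and f = "\<lambda>w. cheb_series \<nu> w - ?F w"])
    show "(\<lambda>w. cheb_series \<nu> w - ?F w) holomorphic_on ?S"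
      by (rule holomorphic_on_diff[OF holomorphic_on_subset[OF cheb_series_holomorphic] holomorphic_on_subset[OF cheb_closed_holomorphic]]) auto
    show "open ?S" by (intro open_Int open_ball open_neg_slit)
    show "connected ?S"
    proof (rule starlike_imp_connected)
      \<comment> \<open>The slit disc omits 0; it is starlike about \<open>- 1/2\<close>, a point
        opposite to the slit.\<close>
      have "closed_segment (- 1/2) z \<subseteq> ?S" if z: "z \<in> ?S" for z
      proof
        fix v assume v: "v \<in> closed_segment (- 1/2) z"
        have "closed_segment (- 1/2) z \<subseteq> ball 0 1"
          by (rule closed_segment_subset[OF _ _ convex_ball]) (use z in auto)
        then have b: "v \<in> ball 0 1" using v by blast
        obtain u where u: "0 \<le> u" "u \<le> 1" and v: "v = of_real (1 - u) * (- 1/2) + of_real u * z"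
          using v by (auto simp: in_segment scaleR_conv_of_real)
        have "- v \<notin> \<real>\<^sub>\<le>\<^sub>0"
        proof
          assume "- v \<in> \<real>\<^sub>\<le>\<^sub>0"
          then have im: "u * Im z = 0" and re: "1 - u \<le> u * Re z * 2"
            unfolding v by (auto simp: complex_nonpos_Reals_iff)
          then have "u \<noteq> 0" by auto
          then have "Im z = 0" "u > 0" using im u by auto
          then have "Re z < 0" using z by (auto simp: complex_nonpos_Reals_iff)
          then have "u * Re z < 0" using \<open>u > 0\<close> by (simp add: mult_pos_neg)
          then show False using re u by linarith
        qed
        then show "v \<in> ?S" using b by simp
      qed
      moreover have "- 1/2 \<in> ?S" by (auto simp: complex_nonpos_Reals_iff)
      ultimately show "starlike ?S" unfolding starlike_def by blast
    qed
    show "of_real (- e / 2) islimpt complex_of_real ` {- e<..<0}"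
      by (rule islimpt_of_real_Ioo) (use e in auto)
    show "complex_of_real ` {- e<..<0} \<subseteq> ?S" using e by (auto simp: complex_nonpos_Reals_iff)
    show "complex_of_real (- e / 2) \<in> ?S" using e by (auto simp: complex_nonpos_Reals_iff)
    show "w \<in> ?S" using w by simp
    fix v assume "v \<in> complex_of_real ` {- e<..<0}"
    then obtain x where x: "- e < x" "x < 0" "v = of_real x" by auto
    define t where "t = arsinh (sqrt (- x))"
    have st: "sinh t = sqrt (- x)" by (simp add: t_def sinh_arsinh_real)
    have "sinh t > 0" unfolding st using x by simp
    then have t0: "t > 0" by (simp only: sinh_real_pos_iff)
    have "sinh t < sinh \<delta>"
    proof -
      have "(sqrt (- x))\<^sup>2 < (sinh \<delta>)\<^sup>2" using x e by simp
      then show ?thesis unfolding st by (rule power_less_imp_less_base) (use d(1) in simp)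
    qed
    then have td: "t < \<delta>" by simp
    let ?z = "\<i> * complex_of_real t"
    have zb: "?z \<in> ball 0 \<delta>" using t0 td by (simp add: norm_mult)
    have sinz: "sin ?z = \<i> * of_real (sinh t)"
      using sinh_conv_sin[of "complex_of_real t"] by (simp add: sinh_of_real_complex[symmetric])
    have cosz: "cos (\<i> * y) = cosh y" for y :: complex
      using cosh_conv_cos[of y] by simp
    have vs: "(sin ?z)\<^sup>2 = v"
    proof -
      have "(sqrt (- x))\<^sup>2 = - x" using x by simp
      then have "complex_of_real ((sqrt (- x))\<^sup>2) = of_real (- x)" by (rule arg_cong)
      then have "(complex_of_real (sqrt (- x)))\<^sup>2 = - of_real x" unfolding of_real_power of_real_minus .
      then show ?thesis unfolding sinz st power_mult_distrib x(3) by (simp only: i_squared) simp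
    qed
    have sum: "cosh t + sinh t = exp t" by (simp add: cosh_plus_sinh)
    have c1: "csqrt (1 - v) = of_real (cosh t)"
    proof -
      have "1 - v = of_real ((cosh t)\<^sup>2)" unfolding cosh_square_eq st using x by simp
      then show ?thesis by (simp add: csqrt_of_real_nonneg)
    qed
    have c2: "csqrt (- v) = of_real (sinh t)"
    proof -
      have "- v = of_real ((sinh t)\<^sup>2)" unfolding st using x by simp
      then show ?thesis using t0 by (simp add: csqrt_of_real_nonneg)
    qed
    have ln: "Ln (csqrt (1 - v) + csqrt (- v)) = of_real t"
    proof -
      have "csqrt (1 - v) + csqrt (- v) = of_real (exp t)" unfolding c1 c2 sum[symmetric] by simp
      then show ?thesis by (simp only: Ln_of_real exp_gt_zero ln_exp)
    qed
    have "cos ?z * cheb_series \<nu> v = cos ((2 * \<nu> + 1) * ?z)"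
      using cheb_series_cos[OF \<nu> d(2) zb] unfolding vs .
    moreover have "cos ((2 * \<nu> + 1) * ?z) = cosh ((2 * \<nu> + 1) * of_real t)"
      using cosz[of "(2 * \<nu> + 1) * of_real t"] by (simp add: mult_ac)
    moreover have "cos ?z = of_real (cosh t)" using cosz[of "of_real t"] by (simp add: cosh_of_real_complex)
    ultimately have "cosh ((2 * \<nu> + 1) * of_real t) = of_real (cosh t) * cheb_series \<nu> v" by (simp only:)
    moreover have "complex_of_real (cosh t) \<noteq> 0" by simp
    ultimately show "cheb_series \<nu> v - ?F v = 0" unfolding ln unfolding c1 by simp
  qed
  then show ?thesis by simp
qed

lemma slit_plane_eq: "slit_plane = ball 0 1 \<union> {w. - w \<notin> \<real>\<^sub>\<le>\<^sub>0}"
proof (intro equalityI subsetI)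
  fix w assume w: "w \<in> slit_plane"
  show "w \<in> ball 0 1 \<union> {w. - w \<notin> \<real>\<^sub>\<le>\<^sub>0}"
  proof (rule ccontr)
    assume *: "w \<notin> ball 0 1 \<union> {w. - w \<notin> \<real>\<^sub>\<le>\<^sub>0}"
    then have "Im w = 0" "Re w \<ge> 0" by (auto simp: complex_nonpos_Reals_iff)
    then have eq: "w = of_real (Re w)" by (simp add: complex_eq_iff)
    then have "norm w = Re w" using \<open>Re w \<ge> 0\<close> by (metis norm_of_real abs_of_nonneg)
    then have "Re w \<ge> 1" using * by simp
    then show False using w eq by (auto simp: slit_plane_def)
  qed
next
  fix w assume "w \<in> ball 0 1 \<union> {w :: complex. - w \<notin> \<real>\<^sub>\<le>\<^sub>0}"
  then show "w \<in> slit_plane" by (auto simp: slit_plane_def complex_nonpos_Reals_iff)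
qed

lemma cheb_ext_holomorphic:
  assumes "2 * \<nu> + 1 \<noteq> 0"
  shows "cheb_ext \<nu> holomorphic_on slit_plane"
  unfolding slit_plane_eq cheb_ext_def
  by (intro holomorphic_on_If_Un cheb_series_holomorphic cheb_closed_holomorphic open_ball open_neg_slit)
     (use cheb_closed_eq_series[OF assms] in auto)

section \<open>Mehler's integral and the continuation of the hypergeometric series\<close>

text \<open>Euler's beta average in the third parameter: the weight changes it from
  \<open>1/2\<close> to \<open>1 - \<mu>\<close>, up to gamma factors. At
  \<open>w = (sin (b/2))\<^sup>2\<close> for small \<open>b\<close> this is Mehler's integral in
  disguise, and for \<open>Re \<mu> < 1/2\<close> it continues the hypergeometric series to the slit
  plane.\<close>

definition mehler_integral :: "complex \<Rightarrow> complex \<Rightarrow> complex \<Rightarrow> complex" where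
  "mehler_integral \<nu> \<mu> w = (LINT r:{0<..<1}|lborel. of_real (r powr (- 1/2)) * of_real (1 - r) powr (- \<mu> - 1/2) * cheb_ext \<nu> (w * of_real r))"

lemma slit_plane_scale: "w \<in> slit_plane \<Longrightarrow> 0 \<le> r \<Longrightarrow> r \<le> 1 \<Longrightarrow> w * of_real r \<in> slit_plane"
proof -
  assume w: "w \<in> slit_plane" and r: "0 \<le> r" "r \<le> 1"
  show "w * of_real r \<in> slit_plane"
  proof (rule ccontr)
    assume "w * of_real r \<notin> slit_plane"
    then obtain t where t: "t \<ge> 1" "w * of_real r = of_real t" by (auto simp: slit_plane_def)
    then have "r > 0" using r by (cases "r = 0") auto
    then have "w = of_real (t / r)" "t / r \<ge> 1" using t r by (auto simp: field_simps)
    then have "w \<in> complex_of_real ` {1..}" by (intro image_eqI[of _ _ "t / r"]) auto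
    then show False using w by (simp add: slit_plane_def)
  qed
qed

lemma mehler_weight_integrable:
  fixes m :: real
  assumes "m < 1/2"
  shows "set_integrable lborel {0<..<1} (\<lambda>r. r powr (- 1/2) * (1 - r) powr (- m - 1/2))"
  using set_integrable_Beta_Ioo(1)[of "1/2" "1/2 - m"] assms by (simp add: algebra_simps)

lemma norm_mehler_integrand:
  assumes r: "r \<in> {0<..<1}" and C: "norm (cheb_ext \<nu> (w * of_real r)) \<le> C"
  shows "norm (of_real (r powr (- 1/2)) * of_real (1 - r) powr (- \<mu> - 1/2) * cheb_ext \<nu> (w * of_real r))
    \<le> C * (r powr (- 1/2) * (1 - r) powr (- Re \<mu> - 1/2))"
proof -
  have "norm (complex_of_real (1 - r) powr (- \<mu> - 1/2)) = (1 - r) powr (- Re \<mu> - 1/2)"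
    using r by (subst norm_of_real_powr) auto
  moreover have "norm (complex_of_real (r powr (- 1/2))) = r powr (- 1/2)"
    by (simp only: norm_of_real abs_of_nonneg[OF powr_ge_zero])
  ultimately show ?thesis
    using C by (simp only: norm_mult) (subst mult.commute, intro mult_right_mono, auto)
qed

lemma mehler_integrand_continuous:
  assumes \<nu>: "2 * \<nu> + 1 \<noteq> 0" and w: "w \<in> slit_plane"
  shows "continuous_on {0<..<1} (\<lambda>r. of_real (r powr (- 1/2)) * of_real (1 - r) powr (- \<mu> - 1/2) * cheb_ext \<nu> (w * of_real r))"
proof -
  have "continuous_on {0<..<1} (\<lambda>r. cheb_ext \<nu> (w * of_real r))"
    by (rule continuous_on_compose2[OF holomorphic_on_imp_continuous_on[OF cheb_ext_holomorphic[OF \<nu>]]])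
       (use slit_plane_scale[OF w] in \<open>auto intro!: continuous_intros\<close>)
  moreover have "continuous_on {0<..<1} (\<lambda>r. complex_of_real (1 - r) powr (- \<mu> - 1/2))"
    by (rule continuous_on_powr_slit) (auto intro!: continuous_intros simp: complex_nonpos_Reals_iff)
  moreover have "continuous_on {0<..<1} (\<lambda>r. complex_of_real (r powr (- 1/2)))"
    by (intro continuous_intros) auto
  ultimately show ?thesis by (intro continuous_on_mult)
qed

lemma mehler_integrand_measurable:
  assumes \<nu>: "2 * \<nu> + 1 \<noteq> 0" and w: "w \<in> slit_plane"
  shows "set_borel_measurable lborel {0<..<1} (\<lambda>r. of_real (r powr (- 1/2)) * of_real (1 - r) powr (- \<mu> - 1/2) * cheb_ext \<nu> (w * of_real r))"
  using set_measurable_continuous_on[OF _ mehler_integrand_continuous[OF assms]]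
  by (simp only: set_borel_measurable_def measurable_lborel2 borel_open open_greaterThanLessThan)

text \<open>The products \<open>v * r\<close> with \<open>v\<close> in a small closed disc and
  \<open>r\<close> in \<open>[0, 1]\<close> form a compact subset of the slit plane, which is
  starlike about 0.\<close>

lemma cheb_ext_locally_bounded:
  assumes \<nu>: "2 * \<nu> + 1 \<noteq> 0" and w: "w \<in> slit_plane"
  obtains e C where "e > 0" "\<And>v r. v \<in> ball w e \<Longrightarrow> r \<in> {0<..<1} \<Longrightarrow> norm (cheb_ext \<nu> (v * of_real r)) \<le> C"
proof -
  obtain e where e: "e > 0" "cball w e \<subseteq> slit_plane"
    using open_slit_plane w open_contains_cball by blast
  let ?K = "(\<lambda>p. fst p * complex_of_real (snd p)) ` (cball w e \<times> {0..1})"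
  have "compact ?K"
    by (intro compact_continuous_image compact_Times continuous_intros) auto
  moreover have "?K \<subseteq> slit_plane" using e(2) slit_plane_scale by force
  ultimately have "compact (cheb_ext \<nu> ` ?K)"
    using cheb_ext_holomorphic[OF \<nu>] by (meson compact_continuous_image continuous_on_subset holomorphic_on_imp_continuous_on)
  then obtain C where C: "\<And>y. y \<in> cheb_ext \<nu> ` ?K \<Longrightarrow> norm y \<le> C"
    using compact_imp_bounded bounded_iff by metis
  show ?thesis
  proof (rule that[OF e(1)])
    fix v r assume "v \<in> ball w e" "r \<in> {0<..<(1::real)}"
    then have "v * of_real r \<in> ?K" by (intro image_eqI[of _ _ "(v, r)"]) auto
    then show "norm (cheb_ext \<nu> (v * of_real r)) \<le> C" by (intro C imageI)
  qed
qed

lemma mehler_holomorphic: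
  assumes \<nu>: "2 * \<nu> + 1 \<noteq> 0" and \<mu>: "Re \<mu> < 1/2"
  shows "mehler_integral \<nu> \<mu> holomorphic_on slit_plane"
proof -
  have "(\<lambda>w. LINT r:{0<..<1}|lborel. of_real (r powr (- 1/2)) * of_real (1 - r) powr (- \<mu> - 1/2) * cheb_ext \<nu> (w * of_real r)) holomorphic_on slit_plane"
    (is "(\<lambda>w. LINT r:_|_. ?f w r) holomorphic_on _")
  proof (rule holomorphic_on_set_lebesgue_integral[OF open_slit_plane])
    fix r :: real assume r: "r \<in> {0<..<1}"
    have "(\<lambda>w. cheb_ext \<nu> (w * of_real r)) holomorphic_on slit_plane"
      by (rule holomorphic_on_compose_gen[OF _ cheb_ext_holomorphic[OF \<nu>], unfolded o_def])
         (use slit_plane_scale r in \<open>auto intro!: holomorphic_intros\<close>)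
    then show "(\<lambda>w. ?f w r) holomorphic_on slit_plane" by (intro holomorphic_intros)
  next
    fix w assume w: "w \<in> slit_plane"
    show "set_borel_measurable lborel {0<..<1} (?f w)" by (rule mehler_integrand_measurable[OF \<nu> w])
    obtain e C where eC: "e > 0" "\<And>v r. v \<in> ball w e \<Longrightarrow> r \<in> {0<..<1} \<Longrightarrow> norm (cheb_ext \<nu> (v * of_real r)) \<le> C"
      by (rule cheb_ext_locally_bounded[OF \<nu> w]) blast
    have "\<forall>v\<in>ball w e \<inter> slit_plane. \<forall>r\<in>{0<..<1}. norm (?f v r) \<le> C * (r powr (- 1/2) * (1 - r) powr (- Re \<mu> - 1/2))"
      by (intro ballI norm_mehler_integrand eC(2)) auto
    then show "\<exists>e>0. \<exists>g. set_integrable lborel {0<..<1} g \<and> (\<forall>v\<in>ball w e \<inter> slit_plane. \<forall>r\<in>{0<..<1}. norm (?f v r) \<le> g r)"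
      using set_integrable_mult_right[OF mehler_weight_integrable[OF \<mu>]] eC(1) by blast
  qed auto
  then show ?thesis unfolding mehler_integral_def .
qed

lemma mehler_holomorphic_mu:
  assumes \<nu>: "2 * \<nu> + 1 \<noteq> 0" and w: "w \<in> slit_plane"
  shows "(\<lambda>\<mu>. mehler_integral \<nu> \<mu> w) holomorphic_on {\<mu>. Re \<mu> < 1/2}"
proof -
  let ?U = "{\<mu>. Re \<mu> < 1/2}"
  obtain e0 C where C: "e0 > 0" "\<And>v r. v \<in> ball w e0 \<Longrightarrow> r \<in> {0<..<1} \<Longrightarrow> norm (cheb_ext \<nu> (v * of_real r)) \<le> C"
    by (rule cheb_ext_locally_bounded[OF \<nu> w]) blast
  have Cw: "norm (cheb_ext \<nu> (w * of_real r)) \<le> C" if "r \<in> {0<..<1}" for r by (rule C(2)) (use that C(1) in auto)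
  have C0: "C \<ge> 0" using order_trans[OF norm_ge_zero Cw[of "1/2"]] by simp
  have "(\<lambda>\<mu>. LINT r:{0<..<1}|lborel. of_real (r powr (- 1/2)) * of_real (1 - r) powr (- \<mu> - 1/2) * cheb_ext \<nu> (w * of_real r)) holomorphic_on ?U"
    (is "(\<lambda>\<mu>. LINT r:_|_. ?f \<mu> r) holomorphic_on _")
  proof (rule holomorphic_on_set_lebesgue_integral)
    fix \<mu> assume "\<mu> \<in> ?U"
    then have \<mu>: "Re \<mu> < 1/2" by simp
    show "set_borel_measurable lborel {0<..<1} (?f \<mu>)" by (rule mehler_integrand_measurable[OF \<nu> w])
    define e where "e = (1/2 - Re \<mu>) / 2"
    have e: "e > 0" "Re \<mu> + e < 1/2" using \<mu> by (auto simp: e_def field_simps)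
    let ?g = "\<lambda>r. C * (r powr (- 1/2) * (1 - r) powr (- (Re \<mu> + e) - 1/2))"
    have "norm (?f v r) \<le> ?g r" if v: "v \<in> ball \<mu> e" and r: "r \<in> {0<..<1}" for v r
    proof -
      have "Re v \<le> Re \<mu> + e" using v abs_Re_le_cmod[of "\<mu> - v"] by (simp add: dist_norm)
      then have le: "(1 - r) powr (- Re v - 1/2) \<le> (1 - r) powr (- (Re \<mu> + e) - 1/2)"
        using r by (intro powr_mono') auto
      have "norm (?f v r) \<le> C * (r powr (- 1/2) * (1 - r) powr (- Re v - 1/2))" by (rule norm_mehler_integrand[OF r Cw[OF r]])
      also have "\<dots> \<le> ?g r" using C0 le by (intro mult_left_mono) auto
      finally show ?thesis .
    qed
    then have "\<forall>v\<in>ball \<mu> e \<inter> ?U. \<forall>r\<in>{0<..<1}. norm (?f v r) \<le> ?g r" by blast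
    then show "\<exists>e>0. \<exists>g. set_integrable lborel {0<..<1} g \<and> (\<forall>v\<in>ball \<mu> e \<inter> ?U. \<forall>r\<in>{0<..<1}. norm (?f v r) \<le> g r)"
      using set_integrable_mult_right[OF mehler_weight_integrable[OF e(2)]] e(1) by blast
  next
    show "open ?U" by (rule open_halfspace_Re_lt)
  qed (auto intro!: holomorphic_intros)
  then show ?thesis unfolding mehler_integral_def .
qed

text \<open>Termwise integration; the beta integrals supply the factors \<open>rGamma (1 - m + n)\<close>.\<close>

lemma mehler_eq_series_real:
  assumes m: "m < 1/2" and w: "norm w < 1"
  shows "of_real (rGamma (1/2 - m) / sqrt pi) * mehler_integral \<nu> (of_real m) w = hyp2F1_reg_series (\<nu> + 1) (- \<nu>) (1 - of_real m) w"
proof -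
  let ?W = "\<lambda>r. r powr (- 1/2) * (1 - r) powr (- m - 1/2)"
  let ?c = "cheb_coeff \<nu>"
  have Wc: "complex_of_real (r powr (- 1/2)) * of_real (1 - r) powr (- of_real m - 1/2) = of_real (?W r)" if "r \<in> {0<..<1}" for r
    using that powr_of_real[of "1 - r" "- m - 1/2"] by simp
  have trm: "set_integrable lborel {0<..<1} (\<lambda>r. complex_of_real (?W r * r ^ n))"
    "(LINT r:{0<..<1}|lborel. complex_of_real (?W r * r ^ n)) = of_real (Beta (real n + 1/2) (1/2 - m))" for n
  proof -
    have e: "r powr (real n + 1/2 - 1) * (1 - r) powr (1/2 - m - 1) = ?W r * r ^ n" if "r \<in> {0<..<1}" for r
    proof -
      have "r powr (real n + 1/2 - 1) = r powr (real n + (- 1/2))" by simp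
      also have "\<dots> = r ^ n * r powr (- 1/2)" using that by (subst powr_add) (simp add: powr_realpow)
      finally show ?thesis by (simp add: algebra_simps)
    qed
    have i: "set_integrable lborel {0<..<1} (\<lambda>r. ?W r * r ^ n)"
      using set_integrable_Beta_Ioo(1)[of "real n + 1/2" "1/2 - m"] m
      by (intro set_integrable_cong[THEN iffD1, OF refl refl e]) auto
    then show "set_integrable lborel {0<..<1} (\<lambda>r. complex_of_real (?W r * r ^ n))"
      unfolding set_integrable_def
      by (subst (asm) complex_of_real_integrable_eq[symmetric]) (simp add: scaleR_conv_of_real)
    have "(LINT r:{0<..<1}|lborel. ?W r * r ^ n) = (LINT r:{0<..<1}|lborel. r powr (real n + 1/2 - 1) * (1 - r) powr (1/2 - m - 1))"
      by (rule set_lebesgue_integral_cong) (use e in auto)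
    also have "\<dots> = Beta (real n + 1/2) (1/2 - m)"
      by (rule set_integrable_Beta_Ioo(2)) (use m in auto)
    finally show "(LINT r:{0<..<1}|lborel. complex_of_real (?W r * r ^ n)) = of_real (Beta (real n + 1/2) (1/2 - m))"
      unfolding set_integral_complex_of_real by simp
  qed
  let ?s = "\<lambda>N r. \<Sum>n<N. (?c n * w ^ n) * complex_of_real (?W r * r ^ n)"
  have int_s: "set_integrable lborel {0<..<1} (?s N) \<and> (LINT r:{0<..<1}|lborel. ?s N r) = (\<Sum>n<N. (?c n * w ^ n) * of_real (Beta (real n + 1/2) (1/2 - m)))" for N
  proof (induction N)
    case 0
    then show ?case by (simp add: set_integrable_def)
  next
    case (Suc N)
    have t: "set_integrable lborel {0<..<1} (\<lambda>r. (?c N * w ^ N) * complex_of_real (?W r * r ^ N))"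
      by (rule set_integrable_mult_right[OF trm(1)])
    have v: "(LINT r:{0<..<1}|lborel. (?c N * w ^ N) * complex_of_real (?W r * r ^ N)) = (?c N * w ^ N) * of_real (Beta (real N + 1/2) (1/2 - m))"
      by (simp only: set_integral_mult_right trm(2))
    show ?case
      unfolding sum.lessThan_Suc v[symmetric] conjunct2[OF Suc, symmetric]
      by (intro conjI set_integral_add conjunct1[OF Suc] t)
  qed
  define C where "C = (\<Sum>n. norm (?c n) * norm w ^ n)"
  have abs_sum: "summable (\<lambda>n. norm (?c n) * norm w ^ n)" by (rule cheb_coeff_abs_summable) (use w in auto)
  have "(\<lambda>N. LINT r:{0<..<1}|lborel. ?s N r) \<longlonglongrightarrow> (LINT r:{0<..<1}|lborel. of_real (r powr (- 1/2)) * of_real (1 - r) powr (- of_real m - 1/2) * cheb_ext \<nu> (w * of_real r))"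
  proof (rule set_integral_dominated_convergence)
    show "set_integrable lborel {0<..<1} (\<lambda>r. C * ?W r)" by (intro set_integrable_mult_right mehler_weight_integrable m)
    show "set_borel_measurable lborel {0<..<1} (?s N)" for N
      using int_s[of N] by (simp only: set_integrable_def set_borel_measurable_def borel_measurable_integrable)
    fix r :: real assume r: "r \<in> {0<..<1}"
    have W0: "?W r \<ge> 0" by simp
    show "norm (?s N r) \<le> C * ?W r" for N
    proof -
      have "norm (?s N r) \<le> (\<Sum>n<N. norm ((?c n * w ^ n) * complex_of_real (?W r * r ^ n)))" by (rule norm_sum)
      also have "\<dots> \<le> (\<Sum>n<N. (norm (?c n) * norm w ^ n) * ?W r)"
      proof (rule sum_mono)
        fix n
        have "r ^ n \<le> 1" using r by (intro power_le_one) auto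
        then have "?W r * r ^ n \<le> ?W r * 1" using W0 by (intro mult_left_mono)
        moreover have "norm (complex_of_real (?W r * r ^ n)) = ?W r * r ^ n"
          using r by (simp only: norm_of_real) simp
        ultimately show "norm ((?c n * w ^ n) * complex_of_real (?W r * r ^ n)) \<le> (norm (?c n) * norm w ^ n) * ?W r"
          by (simp only: norm_mult[of "?c n * w ^ n"] norm_mult[of "?c n"] norm_power) (intro mult_left_mono, auto)
      qed
      also have "\<dots> = (\<Sum>n<N. norm (?c n) * norm w ^ n) * ?W r" by (rule sum_distrib_right[symmetric])
      also have "\<dots> \<le> C * ?W r"
        unfolding C_def by (intro mult_right_mono sum_le_suminf abs_sum) auto
      finally show ?thesis .
    qed
    have nw: "norm (w * of_real r) < 1"
    proof -
      have "norm w * r \<le> norm w * 1" using r by (intro mult_left_mono) auto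
      then show ?thesis using w r by (simp add: norm_mult)
    qed
    then have "(\<lambda>n. ?c n * (w * of_real r) ^ n) sums cheb_series \<nu> (w * of_real r)"
      unfolding cheb_series_def using cheb_summable by (intro summable_sums)
    then have "(\<lambda>n. of_real (?W r) * (?c n * (w * of_real r) ^ n)) sums (of_real (?W r) * cheb_series \<nu> (w * of_real r))"
      by (rule sums_mult)
    moreover have "of_real (?W r) * (?c n * (w * of_real r) ^ n) = (?c n * w ^ n) * complex_of_real (?W r * r ^ n)" for n
      by (simp add: power_mult_distrib)
    moreover have "cheb_ext \<nu> (w * of_real r) = cheb_series \<nu> (w * of_real r)" using nw by (simp add: cheb_ext_def)
    ultimately have "(\<lambda>n. (?c n * w ^ n) * complex_of_real (?W r * r ^ n)) sums (of_real (?W r) * cheb_ext \<nu> (w * of_real r))"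
      by (simp only:)
    then show "(\<lambda>N. ?s N r) \<longlonglongrightarrow> of_real (r powr (- 1/2)) * of_real (1 - r) powr (- of_real m - 1/2) * cheb_ext \<nu> (w * of_real r)"
      unfolding sums_def Wc[OF r] .
  qed auto
  then have "(\<lambda>n. (?c n * w ^ n) * of_real (Beta (real n + 1/2) (1/2 - m))) sums mehler_integral \<nu> (of_real m) w"
    unfolding sums_def mehler_integral_def using int_s by simp
  then have S: "(\<lambda>n. of_real (rGamma (1/2 - m) / sqrt pi) * ((?c n * w ^ n) * of_real (Beta (real n + 1/2) (1/2 - m)))) sums
      (of_real (rGamma (1/2 - m) / sqrt pi) * mehler_integral \<nu> (of_real m) w)"
    by (rule sums_mult)
  have "of_real (rGamma (1/2 - m) / sqrt pi) * ((?c n * w ^ n) * of_real (Beta (real n + 1/2) (1/2 - m))) =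
      pochhammer (\<nu> + 1) n * pochhammer (- \<nu>) n / fact n * rGamma (1 - of_real m + of_nat n) * w ^ n" for n
  proof -
    have "Gamma (1/2 - m) \<noteq> 0" using m by (simp add: Gamma_real_pos less_imp_neq[symmetric])
    \<comment> \<open>\<open>Gamma (n + 1/2)\<close> is \<open>pochhammer (1/2) n * sqrt pi\<close>,
      whose first factor cancels the denominator of \<open>cheb_coeff\<close>; the two arguments of
      the beta value add up to \<open>1 - m + n\<close>.\<close>
    then have 1: "rGamma (1/2 - m) / sqrt pi * Beta (real n + 1/2) (1/2 - m) = pochhammer (1/2) n * rGamma (1 - m + real n)"
    proof -
      have "1/2 \<notin> (\<int>\<^sub>\<le>\<^sub>0 :: real set)" by (auto elim!: nonpos_Ints_cases)
      then have g: "Gamma (real n + 1/2) = pochhammer (1/2) n * sqrt pi"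
        using pochhammer_Gamma[of "1/2 :: real" n] by (simp add: Gamma_one_half_real add.commute)
      have "Beta (real n + 1/2) (1/2 - m) = pochhammer (1/2) n * sqrt pi * Gamma (1/2 - m) * rGamma (1 - m + real n)"
      proof -
        have s: "real n + 1/2 + (1/2 - m) = 1 - m + real n" by simp
        show ?thesis unfolding Beta_def g s rGamma_inverse_Gamma by (rule divide_inverse)
      qed
      then show ?thesis using \<open>Gamma (1/2 - m) \<noteq> 0\<close> by (simp add: rGamma_inverse_Gamma)
    qed
    have "complex_of_real (rGamma (1/2 - m) / sqrt pi) * of_real (Beta (real n + 1/2) (1/2 - m)) = of_real (pochhammer (1/2) n * rGamma (1 - m + real n))"
      unfolding 1[symmetric] by simp
    also have "\<dots> = pochhammer (1/2) n * rGamma (1 - of_real m + of_nat n)"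
      by (simp add: pochhammer_of_real[symmetric] rGamma_complex_of_real[symmetric])
    finally have 2: "complex_of_real (rGamma (1/2 - m) / sqrt pi) * of_real (Beta (real n + 1/2) (1/2 - m)) = pochhammer (1/2) n * rGamma (1 - of_real m + of_nat n)" .
    have "of_real (rGamma (1/2 - m) / sqrt pi) * ((?c n * w ^ n) * of_real (Beta (real n + 1/2) (1/2 - m))) =
        (?c n * pochhammer (1/2) n) * rGamma (1 - of_real m + of_nat n) * w ^ n"
      using 2 by (simp only: mult_ac)
    also have "?c n * pochhammer (1/2) n = pochhammer (\<nu> + 1) n * pochhammer (- \<nu>) n / fact n"
      unfolding cheb_coeff_def using pochhammer_half_nonzero[of n] by simp
    finally show ?thesis .
  qed
  then show ?thesis using sums_unique[OF S] unfolding hyp2F1_reg_series_def by (simp only:)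
qed

lemma norm_pochhammer_ge_fact:
  fixes z :: complex
  assumes "Re z \<ge> 1"
  shows "norm (pochhammer z j) \<ge> fact j"
proof (induction j)
  case (Suc j)
  have "real (Suc j) \<le> Re (z + of_nat j)" using assms by simp
  also have "\<dots> \<le> norm (z + of_nat j)" by (rule complex_Re_le_cmod)
  finally have "fact j * real (Suc j) \<le> norm (pochhammer z j) * norm (z + of_nat j)"
    using Suc by (intro mult_mono) auto
  then show ?case unfolding pochhammer_Suc norm_mult fact_Suc by (simp only: mult.commute)
qed simp

text \<open>The difficulty is a bound of \<open>rGamma (1 - y + n)\<close> uniform for
  \<open>y\<close> near \<open>\<mu>\<close>. From \<open>z = 1 - y + k\<close> with
  \<open>Re z \<ge> 1\<close>, the relation
  \<open>rGamma z = pochhammer z (n - k) * rGamma (z + (n - k))\<close> and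
  \<open>norm (pochhammer z j) \<ge> fact j\<close> bound it by \<open>C / fact (n - k)\<close>,
  which leads to the hypergeometric majorant.\<close>

lemma hyp_series_sums_holomorphic_mu:
  assumes w: "norm w < 1"
  shows "summable (\<lambda>n. pochhammer (\<nu> + 1) n * pochhammer (- \<nu>) n / fact n * rGamma (1 - \<mu> + of_nat n) * w ^ n)"
    and "(\<lambda>\<mu>. hyp2F1_reg_series (\<nu> + 1) (- \<nu>) (1 - \<mu>) w) holomorphic_on UNIV"
proof -
  let ?f = "\<lambda>n \<mu>. pochhammer (\<nu> + 1) n * pochhammer (- \<nu>) n / fact n * rGamma (1 - \<mu> + of_nat n) * w ^ n"
  let ?P = "\<lambda>n. norm (pochhammer (\<nu> + 1) n * pochhammer (- \<nu>) n)"
  have bound: "\<exists>d h. 0 < d \<and> summable h \<and> range h \<subseteq> \<real>\<^sub>\<ge>\<^sub>0 \<and> (\<forall>\<^sub>F n in sequentially. \<forall>y\<in>ball \<mu> d \<inter> UNIV. cmod (?f n y) \<le> cmod (h n))" for \<mu>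
  proof -
    \<comment> \<open>Large enough that \<open>1 - y + k\<close> has real part at least 1 for every
      \<open>y\<close> in the unit ball about \<open>\<mu>\<close>.\<close>
    obtain k :: nat where k: "real k \<ge> norm \<mu> + 2" using real_arch_simple by blast
    have "(\<lambda>y. rGamma (1 - y + of_nat k)) holomorphic_on cball \<mu> 1" by (intro holomorphic_intros)
    then have "bounded ((\<lambda>y. rGamma (1 - y + of_nat k)) ` cball \<mu> 1)"
      by (intro compact_imp_bounded compact_continuous_image holomorphic_on_imp_continuous_on compact_cball)
    then obtain C where C: "\<And>y. y \<in> cball \<mu> 1 \<Longrightarrow> norm (rGamma (1 - y + of_nat k)) \<le> C"
      unfolding bounded_iff ball_simps by (elim exE) blast
    have C0: "C \<ge> 0" using order_trans[OF norm_ge_zero C[of \<mu>]] by simp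
    let ?h = "\<lambda>n. C * (?P n / (fact n * fact (n - k)) * norm w ^ n)"
    have le: "cmod (?f n y) \<le> ?h n" if n: "n \<ge> k" and y: "y \<in> ball \<mu> 1" for n y
    proof -
      define z where "z = 1 - y + of_nat k"
      have "Re y \<le> norm \<mu> + 1"
      proof -
        have "Re y \<le> norm y" by (rule complex_Re_le_cmod)
        also have "norm y \<le> norm \<mu> + norm (\<mu> - y)" using norm_triangle_ineq4[of \<mu> "\<mu> - y"] by simp
        finally show ?thesis using y by (simp add: dist_norm)
      qed
      then have z: "Re z \<ge> 1" using k by (simp add: z_def)
      have "rGamma z = pochhammer z (n - k) * rGamma (z + of_nat (n - k))" by (rule pochhammer_rGamma)
      moreover have "z + of_nat (n - k) = 1 - y + of_nat n" using n by (simp add: z_def)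
      ultimately have "norm (rGamma z) = norm (pochhammer z (n - k)) * norm (rGamma (1 - y + of_nat n))" by (simp add: norm_mult)
      moreover have "fact (n - k) * norm (rGamma (1 - y + of_nat n)) \<le> norm (pochhammer z (n - k)) * norm (rGamma (1 - y + of_nat n))"
        by (intro mult_right_mono norm_pochhammer_ge_fact z) simp
      moreover have "norm (rGamma z) \<le> C" unfolding z_def by (rule C) (use y in auto)
      ultimately have "fact (n - k) * norm (rGamma (1 - y + of_nat n)) \<le> C" by linarith
      then have r: "norm (rGamma (1 - y + of_nat n)) \<le> C / fact (n - k)" by (simp add: pos_le_divide_eq mult.commute)
      have "cmod (?f n y) = ?P n / fact n * norm w ^ n * norm (rGamma (1 - y + of_nat n))"
        by (simp add: norm_mult norm_divide norm_power)
      also have "\<dots> \<le> ?P n / fact n * norm w ^ n * (C / fact (n - k))" by (intro mult_left_mono r) auto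
      finally show ?thesis by (simp add: mult_ac)
    qed
    have h1: "summable (\<lambda>n. complex_of_real (?h n))"
      by (intro summable_of_real summable_mult summable_hypergeometric_majorant) (use w in auto)
    have h2: "range (\<lambda>n. complex_of_real (?h n)) \<subseteq> \<real>\<^sub>\<ge>\<^sub>0"
    proof (rule image_subsetI)
      fix n
      have "?h n \<ge> 0" using C0 by simp
      then show "complex_of_real (?h n) \<in> \<real>\<^sub>\<ge>\<^sub>0" by (simp only: nonneg_Reals_of_real_iff)
    qed
    have h3: "\<forall>\<^sub>F n in sequentially. \<forall>y\<in>ball \<mu> 1 \<inter> UNIV. cmod (?f n y) \<le> cmod (complex_of_real (?h n))"
      unfolding eventually_sequentially
    proof (intro exI[of _ k] allI impI ballI)
      fix n y assume "k \<le> n" "y \<in> ball \<mu> 1 \<inter> UNIV"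
      then have "cmod (?f n y) \<le> ?h n" by (intro le) auto
      also have "\<dots> \<le> \<bar>?h n\<bar>" by (rule abs_ge_self)
      finally show "cmod (?f n y) \<le> cmod (complex_of_real (?h n))" by (simp only: norm_of_real)
    qed
    show ?thesis by (intro exI[of _ 1] exI[of _ "\<lambda>n. complex_of_real (?h n)"] conjI zero_less_one h1 h2 h3)
  qed
  have fd: "?f n field_differentiable at \<mu>" for n \<mu>
  proof -
    have "?f n holomorphic_on UNIV" by (intro holomorphic_intros) simp
    then show ?thesis by (rule holomorphic_on_imp_differentiable_at) auto
  qed
  obtain g where g': "\<forall>\<mu>\<in>UNIV. ((\<lambda>n. ?f n \<mu>) sums g \<mu>) \<and> g field_differentiable at \<mu>"
    by (rule series_differentiable_comparison_complex[of UNIV ?f, OF open_UNIV fd bound])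
  have g: "(\<lambda>n. ?f n \<mu>) sums g \<mu>" "g field_differentiable at \<mu>" for \<mu>
    using g'[THEN bspec[of _ _ \<mu>], OF UNIV_I] by (rule conjunct1, rule conjunct2)
  show "summable (\<lambda>n. ?f n \<mu>)" using g(1) by (rule sums_summable)
  have "g = (\<lambda>\<mu>. hyp2F1_reg_series (\<nu> + 1) (- \<nu>) (1 - \<mu>) w)"
    unfolding hyp2F1_reg_series_def by (rule ext) (rule sums_unique[OF g(1)])
  then show "(\<lambda>\<mu>. hyp2F1_reg_series (\<nu> + 1) (- \<nu>) (1 - \<mu>) w) holomorphic_on UNIV"
    using g(2) by (simp add: holomorphic_on_def)
qed

text \<open>Both sides are holomorphic in \<open>\<mu>\<close> for \<open>Re \<mu> < 1/2\<close>, so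
  real order decides.\<close>

lemma mehler_eq_series:
  assumes \<nu>: "2 * \<nu> + 1 \<noteq> 0" and \<mu>: "Re \<mu> < 1/2" and w: "norm w < 1"
  shows "rGamma (1/2 - \<mu>) / of_real (sqrt pi) * mehler_integral \<nu> \<mu> w = hyp2F1_reg_series (\<nu> + 1) (- \<nu>) (1 - \<mu>) w"
proof -
  let ?U = "{\<mu>. Re \<mu> < 1/2}"
  let ?h = "\<lambda>\<mu>. rGamma (1/2 - \<mu>) / of_real (sqrt pi) * mehler_integral \<nu> \<mu> w - hyp2F1_reg_series (\<nu> + 1) (- \<nu>) (1 - \<mu>) w"
  have ws: "w \<in> slit_plane" using w ball_subset_slit_plane by (auto simp: subset_iff)
  have "?h \<mu> = 0"
  proof (rule analytic_continuation[where S = ?U and U = "of_real ` {- 1<..<1/2}" and \<xi> = "of_real 0" and f = ?h])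
    show "?h holomorphic_on ?U"
      by (intro holomorphic_intros mehler_holomorphic_mu[OF \<nu> ws] holomorphic_on_subset[OF hyp_series_sums_holomorphic_mu(2)[OF w]]) auto
    show "open ?U" by (rule open_halfspace_Re_lt)
    show "connected ?U" by (intro convex_connected convex_halfspace_Re_lt)
    show "complex_of_real 0 islimpt of_real ` {- 1<..<1/2}" by (rule islimpt_of_real_Ioo) auto
    fix z assume "z \<in> complex_of_real ` {- 1<..<1/2}"
    then obtain m where m: "m < 1/2" "z = of_real m" by auto
    have "rGamma (1/2 - complex_of_real m) = of_real (rGamma (1/2 - m))"
      by (subst rGamma_complex_of_real[symmetric]) simp
    then show "?h z = 0" using mehler_eq_series_real[OF m(1) w, of \<nu>] m(2) by simp
  qed (use \<mu> in auto)
  then show ?thesis by simp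
qed

text \<open>This makes the choice in \<open>hyp2F1_reg\<close> meaningful. Mehler's integral gives
  the continuation for \<open>Re \<mu> < 1/2\<close>; further orders come from a contiguity
  relation: if \<open>F\<close> belongs to \<open>\<mu> - 1\<close>, then
  \<open>(1 - \<mu>) * F w + w * deriv F w\<close> belongs to \<open>\<mu>\<close>, since \<open>(1
  - \<mu> + n) * rGamma (2 - \<mu> + n) = rGamma (1 - \<mu> + n)\<close>.\<close>

lemma hyp_continuation_exists:
  assumes \<nu>: "2 * \<nu> + 1 \<noteq> 0"
  shows "\<exists>F. F holomorphic_on slit_plane \<and> (\<forall>w. norm w < 1 \<longrightarrow> F w = hyp2F1_reg_series (\<nu> + 1) (- \<nu>) (1 - \<mu>) w)"
proof -
  have "\<exists>F. F holomorphic_on slit_plane \<and> (\<forall>w. norm w < 1 \<longrightarrow> F w = hyp2F1_reg_series (\<nu> + 1) (- \<nu>) (1 - \<mu>) w)"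
    if "Re \<mu> < 1/2 + real k" for k \<mu>
    using that
  proof (induction k arbitrary: \<mu>)
    case 0
    then have \<mu>: "Re \<mu> < 1/2" by simp
    show ?case
    proof (intro exI conjI allI impI)
      show "(\<lambda>w. rGamma (1/2 - \<mu>) / of_real (sqrt pi) * mehler_integral \<nu> \<mu> w) holomorphic_on slit_plane"
        by (intro holomorphic_intros mehler_holomorphic[OF \<nu> \<mu>])
    qed (rule mehler_eq_series[OF \<nu> \<mu>])
  next
    case (Suc k)
    then have "Re (\<mu> - 1) < 1/2 + real k" by simp
    from Suc.IH[OF this] obtain F where F: "F holomorphic_on slit_plane"
      "\<And>w. norm w < 1 \<Longrightarrow> F w = hyp2F1_reg_series (\<nu> + 1) (- \<nu>) (1 - (\<mu> - 1)) w" by blast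
    define d where "d n = pochhammer (\<nu> + 1) n * pochhammer (- \<nu>) n / fact n * rGamma (1 - (\<mu> - 1) + of_nat n)" for n
    have sd: "summable (\<lambda>n. d n * w ^ n)" if "norm w < 1" for w
      unfolding d_def by (rule hyp_series_sums_holomorphic_mu(1)[OF that])
    have Fd: "F w = (\<Sum>n. d n * w ^ n)" if "norm w < 1" for w
      using F(2)[OF that] unfolding hyp2F1_reg_series_def d_def .
    have dF: "deriv F w = (\<Sum>n. diffs d n * w ^ n)" if w: "norm w < 1" for w
    proof -
      have "\<forall>\<^sub>F v in nhds w. v \<in> ball 0 1" using w by (intro eventually_nhds_in_open) auto
      then have "\<forall>\<^sub>F v in nhds w. F v = (\<Sum>n. d n * v ^ n)" by eventually_elim (use Fd in auto)
      then have "deriv F w = deriv (\<lambda>v. \<Sum>n. d n * v ^ n) w" by (intro deriv_cong_ev) auto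
      also have "\<dots> = (\<Sum>n. diffs d n * w ^ n)" by (intro DERIV_imp_deriv powser_DERIV(1) sd w)
      finally show ?thesis .
    qed
    show ?case
    proof (intro exI conjI allI impI)
      show "(\<lambda>w. (1 - \<mu>) * F w + w * deriv F w) holomorphic_on slit_plane"
        by (intro holomorphic_intros F(1) holomorphic_deriv open_slit_plane)
      fix w :: complex assume w: "norm w < 1"
      have 1: "(\<lambda>n. d n * w ^ n) sums F w" unfolding Fd[OF w] using sd[OF w] by (rule summable_sums)
      have "(\<lambda>n. (of_nat (Suc n) * d (Suc n)) * w ^ n) sums deriv F w"
        unfolding dF[OF w] using summable_sums[OF powser_DERIV(2)[OF sd w]] by (simp add: diffs_def)
      then have 2: "(\<lambda>n. (of_nat n * d n) * w ^ n) sums (w * deriv F w)" by (intro powser_shift_sums) auto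
      have "(\<lambda>n. (1 - \<mu>) * (d n * w ^ n) + (of_nat n * d n) * w ^ n) sums ((1 - \<mu>) * F w + w * deriv F w)"
        by (intro sums_add sums_mult 1 2)
      moreover have "(1 - \<mu>) * (d n * w ^ n) + (of_nat n * d n) * w ^ n = pochhammer (\<nu> + 1) n * pochhammer (- \<nu>) n / fact n * rGamma (1 - \<mu> + of_nat n) * w ^ n" for n
      proof -
        have "1 - (\<mu> - 1) + of_nat n = (1 - \<mu> + of_nat n) + 1" by simp
        then have r: "(1 - \<mu> + of_nat n) * rGamma (1 - (\<mu> - 1) + of_nat n) = rGamma (1 - \<mu> + of_nat n)"
          by (simp only: rGamma_plus1)
        have "(1 - \<mu>) * (d n * w ^ n) + (of_nat n * d n) * w ^ n = (1 - \<mu> + of_nat n) * d n * w ^ n" by (simp add: algebra_simps)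
        also have "(1 - \<mu> + of_nat n) * d n = pochhammer (\<nu> + 1) n * pochhammer (- \<nu>) n / fact n * ((1 - \<mu> + of_nat n) * rGamma (1 - (\<mu> - 1) + of_nat n))"
          unfolding d_def by (simp only: mult_ac)
        finally show ?thesis unfolding r .
      qed
      ultimately have "(\<lambda>n. pochhammer (\<nu> + 1) n * pochhammer (- \<nu>) n / fact n * rGamma (1 - \<mu> + of_nat n) * w ^ n) sums ((1 - \<mu>) * F w + w * deriv F w)"
        by (simp only:)
      then show "(1 - \<mu>) * F w + w * deriv F w = hyp2F1_reg_series (\<nu> + 1) (- \<nu>) (1 - \<mu>) w"
        unfolding hyp2F1_reg_series_def by (rule sums_unique)
    qed
  qed
  moreover obtain k :: nat where "real k \<ge> Re \<mu>" using real_arch_simple by blast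
  then have "Re \<mu> < 1/2 + real k" by linarith
  ultimately show ?thesis by blast
qed

lemma hyp2F1_reg_props:
  assumes \<nu>: "2 * \<nu> + 1 \<noteq> 0"
  shows "hyp2F1_reg (\<nu> + 1) (- \<nu>) (1 - \<mu>) holomorphic_on slit_plane"
    and "norm w < 1 \<Longrightarrow> hyp2F1_reg (\<nu> + 1) (- \<nu>) (1 - \<mu>) w = hyp2F1_reg_series (\<nu> + 1) (- \<nu>) (1 - \<mu>) w"
  using someI_ex[OF hyp_continuation_exists[OF \<nu>, of \<mu>]] unfolding hyp2F1_reg_def by blast+

lemma contour_fun_imaginary:
  assumes "cos \<eta> - cos b > 0"
  shows "contour_fun b m \<nu> (\<i> * of_real \<eta>) = exp (\<i> * ((\<nu> + 1/2) * of_real \<eta>)) * of_real ((cos \<eta> - cos b) powr (- m - 1/2))"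
proof -
  have "cosh (\<i> * complex_of_real \<eta>) = of_real (cos \<eta>)"
    using cosh_conv_cos[of "\<i> * complex_of_real \<eta>"] by (simp add: mult.assoc[symmetric] cos_of_real)
  then have "cosh (\<i> * complex_of_real \<eta>) - of_real (cos b) = of_real (cos \<eta> - cos b)" by simp
  moreover have "complex_of_real (cos \<eta> - cos b) powr of_real (- m - 1/2) = of_real ((cos \<eta> - cos b) powr (- m - 1/2))"
    by (rule powr_of_real) (use assms in simp)
  ultimately show ?thesis unfolding contour_fun_def by (simp add: mult_ac)
qed

lemma cos_gt_cos_abs: "0 < b \<Longrightarrow> b < pi \<Longrightarrow> \<bar>\<eta>\<bar> < b \<Longrightarrow> cos \<eta> - cos b > 0"
  using cos_monotone_0_pi[of "\<bar>\<eta>\<bar>" b] by simp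

lemma contour_fun_imaginary_integrable:
  assumes m: "\<bar>m\<bar> < 1/2" and b: "0 < b" "b < pi"
  shows "set_integrable lborel {-b<..<b} (\<lambda>\<eta>. contour_fun b m \<nu> (\<i> * of_real \<eta>))"
proof (rule set_integrable_bound_continuous)
  show "set_integrable lborel {-b<..<b} (\<lambda>\<eta>. exp (\<bar>Im \<nu>\<bar> * b) * (cos \<eta> - cos b) powr (- m - 1/2))"
    by (intro set_integrable_mult_right cos_minus_cos_powr_integrable b) (use m in auto)
  show "continuous_on {-b<..<b} (\<lambda>\<eta>. contour_fun b m \<nu> (\<i> * of_real \<eta>))"
  proof (rule continuous_on_compose2[OF contour_fun_continuous[OF b]])
    show "continuous_on {-b<..<b} (\<lambda>\<eta>. \<i> * complex_of_real \<eta>)" by (intro continuous_intros)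
    show "(\<lambda>\<eta>. \<i> * complex_of_real \<eta>) ` {-b<..<b} \<subseteq> (\<lambda>\<eta>. \<i> * complex_of_real \<eta>) ` {-b<..<b}" ..
    show "\<bar>Im t\<bar> \<le> b \<and> (Re t \<noteq> 0 \<or> \<bar>Im t\<bar> < b)" if "t \<in> (\<lambda>\<eta>. \<i> * complex_of_real \<eta>) ` {-b<..<b}" for t
      using that by auto
  qed
  fix \<eta> assume e: "\<eta> \<in> {-b<..<b}"
  have cp: "cos \<eta> - cos b > 0" by (rule cos_gt_cos_abs[OF b]) (use e in auto)
  have "norm (contour_fun b m \<nu> (\<i> * of_real \<eta>)) \<le> exp (\<bar>Im \<nu>\<bar> * b) * (exp ((Re \<nu> + 1/2) * Re (\<i> * complex_of_real \<eta>)) * (cos \<eta> - cos b) powr (- m - 1/2))"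
    using norm_cosh_minus_cos_ge_cos[of "\<i> * complex_of_real \<eta>" b] cp e m
    by (intro norm_contour_fun_le) auto
  then show "norm (contour_fun b m \<nu> (\<i> * of_real \<eta>)) \<le> exp (\<bar>Im \<nu>\<bar> * b) * (cos \<eta> - cos b) powr (- m - 1/2)" by simp
qed auto

text \<open>The weight is even in \<open>\<eta>\<close>, so reflection pairs the exponential with
  its reciprocal and leaves twice the cosine.\<close>

lemma contour_fun_imaginary_integral:
  assumes m: "\<bar>m\<bar> < 1/2" and b: "0 < b" "b < pi"
  shows "(LINT \<eta>:{-b<..<b}|lborel. contour_fun b m \<nu> (\<i> * of_real \<eta>)) =
    2 * (LINT \<eta>:{0<..<b}|lborel. cos ((\<nu> + 1/2) * of_real \<eta>) * of_real ((cos \<eta> - cos b) powr (- m - 1/2)))"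
proof -
  let ?F = "\<lambda>\<eta>. contour_fun b m \<nu> (\<i> * complex_of_real \<eta>)"
  note int = contour_fun_imaginary_integrable[OF m b, of \<nu>]
  have i1: "set_integrable lborel {-b<..<0} ?F" and i2: "set_integrable lborel {0<..<b} ?F"
    by (rule set_integrable_subset[OF int]; use b in auto)+
  have r: "(LINT \<eta>:{-b<..<0}|lborel. ?F \<eta>) = (LINT \<eta>:{0<..<b}|lborel. ?F (- \<eta>))"
  proof -
    have "{x. - x \<in> {-b<..<0}} = {0<..<b}" by auto
    then show ?thesis using set_integral_reflect[of "{-b<..<0}" ?F] by simp
  qed
  have i3: "set_integrable lborel {0<..<b} (\<lambda>\<eta>. ?F (- \<eta>))"
  proof -
    have "integrable lborel (\<lambda>x. indicator {-b<..<0} (0 + (-1) * x) *\<^sub>R ?F (0 + (-1) * x))"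
      using i1 unfolding set_integrable_def by (rule lborel_integrable_real_affine) simp
    moreover have "(\<lambda>x. indicator {-b<..<0} (0 + (-1) * x) *\<^sub>R ?F (0 + (-1) * x)) = (\<lambda>x. indicator {0<..<b} x *\<^sub>R ?F (- x))"
      by (auto simp: indicator_def fun_eq_iff)
    ultimately show ?thesis unfolding set_integrable_def by simp
  qed
  have "(LINT \<eta>:{-b<..<b}|lborel. ?F \<eta>) = (LINT \<eta>:{-b<..<0} \<union> {0<..<b}|lborel. ?F \<eta>)"
    by (rule set_integral_discrete_difference[of "{0}"]) auto
  also have "\<dots> = (LINT \<eta>:{-b<..<0}|lborel. ?F \<eta>) + (LINT \<eta>:{0<..<b}|lborel. ?F \<eta>)"
    by (rule set_integral_Un[OF _ i1 i2]) auto
  also have "\<dots> = (LINT \<eta>:{0<..<b}|lborel. ?F (- \<eta>) + ?F \<eta>)"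
    unfolding r by (rule set_integral_add(2)[OF i3 i2, symmetric])
  also have "\<dots> = (LINT \<eta>:{0<..<b}|lborel. 2 * (cos ((\<nu> + 1/2) * of_real \<eta>) * of_real ((cos \<eta> - cos b) powr (- m - 1/2))))"
  proof (rule set_lebesgue_integral_cong, simp, intro allI impI)
    fix \<eta> assume e: "\<eta> \<in> {0<..<b}"
    have c: "cos \<eta> - cos b > 0" by (rule cos_gt_cos_abs[OF b]) (use e in auto)
    then have c': "cos (- \<eta>) - cos b > 0" by simp
    have "?F (- \<eta>) + ?F \<eta> = (exp (\<i> * ((\<nu> + 1/2) * of_real \<eta>)) + exp (- (\<i> * ((\<nu> + 1/2) * of_real \<eta>)))) * of_real ((cos \<eta> - cos b) powr (- m - 1/2))"
      unfolding contour_fun_imaginary[OF c] contour_fun_imaginary[OF c'] by (simp add: algebra_simps)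
    also have "exp (\<i> * ((\<nu> + 1/2) * of_real \<eta>)) + exp (- (\<i> * ((\<nu> + 1/2) * of_real \<eta>))) = 2 * cos ((\<nu> + 1/2) * of_real \<eta>)"
      unfolding cos_exp_eq by simp
    finally show "?F (- \<eta>) + ?F \<eta> = 2 * (cos ((\<nu> + 1/2) * of_real \<eta>) * of_real ((cos \<eta> - cos b) powr (- m - 1/2)))"
      by (simp only: mult.assoc)
  qed
  also have "\<dots> = 2 * (LINT \<eta>:{0<..<b}|lborel. cos ((\<nu> + 1/2) * of_real \<eta>) * of_real ((cos \<eta> - cos b) powr (- m - 1/2)))"
    by (rule set_integral_mult_right)
  finally show ?thesis .
qed

text \<open>Substituting \<open>r = (sin (\<eta>/2))\<^sup>2 / (sin (b/2))\<^sup>2\<close> turns the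
  argument of \<open>cheb_ext\<close> into \<open>(sin (\<eta>/2))\<^sup>2\<close>, where
  \<open>cheb_series_cos\<close> at \<open>z = \<eta>/2\<close> applies; its denominator
  \<open>cos (\<eta>/2)\<close> cancels against the Jacobian. The condition
  \<open>b / 2 < \<delta>\<close> keeps all these \<open>z\<close> in the ball.\<close>

lemma mehler_angle:
  assumes \<nu>: "2 * \<nu> + 1 \<noteq> 0" and m: "\<bar>m\<bar> < 1/2" and b: "0 < b" "b < pi" "b / 2 < \<delta>"
    and \<delta>: "\<And>z :: complex. z \<in> ball 0 \<delta> \<Longrightarrow> norm (sin z) < 1"
  shows "mehler_integral \<nu> (of_real m) (of_real ((sin (b/2))\<^sup>2)) =
    of_real (2 powr (m + 1/2) * sin (b/2) powr (2 * m)) *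
    (LINT \<eta>:{0<..<b}|lborel. cos ((\<nu> + 1/2) * of_real \<eta>) * of_real ((cos \<eta> - cos b) powr (- m - 1/2)))"
proof -
  define B where "B = sin (b/2)"
  have bz: "complex_of_real (b/2) \<in> ball 0 \<delta>" using b by (simp add: norm_divide)
  have B0: "B > 0" unfolding B_def using b by (intro sin_gt_zero) auto
  have B1: "B < 1" using \<delta>[OF bz] B0 by (simp add: B_def sin_of_real[symmetric] norm_of_real[symmetric] del: norm_of_real)
      (metis abs_of_pos norm_of_real sin_of_real of_real_divide of_real_numeral)
  let ?w = "complex_of_real (B\<^sup>2)"
  let ?f = "\<lambda>r. of_real (r powr (- 1/2)) * of_real (1 - r) powr (- of_real m - 1/2) * cheb_ext \<nu> (?w * of_real r)"
  have nw: "norm ?w < 1" using B0 B1 by (simp add: norm_power abs_square_less_1)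
  then have ws: "?w \<in> slit_plane" using ball_subset_slit_plane by (auto simp: subset_iff)
  obtain e C where eC: "e > 0" "\<And>v r. v \<in> ball ?w e \<Longrightarrow> r \<in> {0<..<1} \<Longrightarrow> norm (cheb_ext \<nu> (v * of_real r)) \<le> C"
    by (rule cheb_ext_locally_bounded[OF \<nu> ws]) blast
  have m': "m < 1/2" using m by simp
  have cf: "continuous_on {0<..<1} ?f" by (rule mehler_integrand_continuous[OF \<nu> ws])
  have int: "set_integrable lborel {0<..<1} ?f"
  proof (rule set_integrable_bound_continuous[OF _ cf set_integrable_mult_right[OF mehler_weight_integrable[OF m']]])
    fix r :: real assume r: "r \<in> {0<..<1}"
    have "norm (cheb_ext \<nu> (?w * of_real r)) \<le> C" by (rule eC(2)[OF _ r]) (use eC(1) in simp)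
    from norm_mehler_integrand[OF r this, of "of_real m"]
    show "norm (?f r) \<le> C * (r powr (- 1/2) * (1 - r) powr (- m - 1/2))" by simp
  qed simp
  have "mehler_integral \<nu> (of_real m) ?w = (LINT \<eta>:{0<..<b}|lborel. \<bar>sin (\<eta>/2) * cos (\<eta>/2) / (sin (b/2))\<^sup>2\<bar> *\<^sub>R ?f ((sin (\<eta>/2))\<^sup>2 / (sin (b/2))\<^sup>2))"
    unfolding mehler_integral_def
    by (rule set_integral_substitution(2)[OF _ _ sin_half_subst(1)[OF b(1,2)] cf sin_half_subst(4)[OF b(1,2)]
          sin_half_subst(3)[OF b(1,2)] sin_half_subst(2)[OF b(1,2)] int, symmetric]) auto
  also have "\<dots> = (LINT \<eta>:{0<..<b}|lborel. of_real (2 powr (m + 1/2) * B powr (2 * m)) * (cos ((\<nu> + 1/2) * of_real \<eta>) * of_real ((cos \<eta> - cos b) powr (- m - 1/2))))"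
  proof (rule set_lebesgue_integral_cong, simp, intro allI impI)
    fix \<eta> assume "\<eta> \<in> {0<..<b}"
    then have e: "0 < \<eta>" "\<eta> < b" by auto
    note v = sin_half_subst_values[OF b(1,2) e]
    define S Cs where "S = sin (\<eta>/2)" and "Cs = cos (\<eta>/2)"
    have pos: "S > 0" "Cs > 0" using v by (auto simp: S_def Cs_def)
    define p where "p = (cos \<eta> - cos b) powr (- m - 1/2)"
    have X: "1 - S\<^sup>2 / B\<^sup>2 > 0"
    proof -
      have "0 < 2 * B\<^sup>2 * (1 - S\<^sup>2 / B\<^sup>2)" using v(1,6) by (simp add: S_def B_def)
      then show ?thesis using B0 by (simp add: zero_less_mult_iff)
    qed
    have pe: "p = (2 * B\<^sup>2) powr (- m - 1/2) * (1 - S\<^sup>2 / B\<^sup>2) powr (- m - 1/2)"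
      unfolding p_def v(1) S_def B_def by (rule powr_mult)
    have t: "(S\<^sup>2 / B\<^sup>2) powr (- 1/2) = B / S"
    proof -
      have "(S\<^sup>2 / B\<^sup>2) powr (- 1/2) = ((S / B)\<^sup>2) powr (- (1/2))" by (simp add: power_divide)
      also have "\<dots> = inverse (((S / B)\<^sup>2) powr (1/2))" by (rule powr_minus)
      also have "((S / B)\<^sup>2) powr (1/2) = S / B" using pos B0 by (subst powr_half_sqrt) auto
      finally show ?thesis by simp
    qed
    have q: "(1 - S\<^sup>2 / B\<^sup>2) powr (- m - 1/2) = 2 powr (m + 1/2) * B powr (2 * m + 1) * p"
    proof -
      have "(B\<^sup>2) powr (m + 1/2) = (B powr 2) powr (m + 1/2)" using B0 by (simp add: powr_numeral)
      also have "\<dots> = B powr (2 * m + 1)" by (simp add: powr_powr algebra_simps)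
      finally have B2: "(B\<^sup>2) powr (m + 1/2) = B powr (2 * m + 1)" .
      have "(2 * B\<^sup>2) powr (m + 1/2) * p = ((2 * B\<^sup>2) powr (m + 1/2) * (2 * B\<^sup>2) powr (- (m + 1/2))) * (1 - S\<^sup>2 / B\<^sup>2) powr (- m - 1/2)"
        unfolding pe by (simp add: minus_diff_commute)
      also have "(2 * B\<^sup>2) powr (m + 1/2) * (2 * B\<^sup>2) powr (- (m + 1/2)) = 1"
        unfolding powr_add[symmetric] using B0 by simp
      finally have "(2 * B\<^sup>2) powr (m + 1/2) * p = (1 - S\<^sup>2 / B\<^sup>2) powr (- m - 1/2)" by simp
      moreover have "(2 * B\<^sup>2) powr (m + 1/2) = 2 powr (m + 1/2) * B powr (2 * m + 1)"
        unfolding B2[symmetric] by (rule powr_mult)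
      ultimately show ?thesis by simp
    qed
    have B21: "B powr (2 * m + 1) = B * B powr (2 * m)" using B0 by (simp add: powr_add)
    have cx: "complex_of_real (1 - S\<^sup>2 / B\<^sup>2) powr (- of_real m - 1/2) = of_real ((1 - S\<^sup>2 / B\<^sup>2) powr (- m - 1/2))"
      using powr_of_real[of "1 - S\<^sup>2 / B\<^sup>2" "- m - 1/2"] X by simp
    have ch: "cheb_ext \<nu> (?w * of_real (S\<^sup>2 / B\<^sup>2)) = cos ((\<nu> + 1/2) * of_real \<eta>) / of_real Cs"
    proof -
      have z: "complex_of_real (\<eta>/2) \<in> ball 0 \<delta>" using e b by (simp add: norm_divide)
      have "B\<^sup>2 * (S\<^sup>2 / B\<^sup>2) = S\<^sup>2" using B0 by simp
      then have w: "?w * of_real (S\<^sup>2 / B\<^sup>2) = of_real (S\<^sup>2)" by (metis of_real_mult)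
      have sz: "sin (complex_of_real (\<eta>/2)) = of_real S" "cos (complex_of_real (\<eta>/2)) = of_real Cs"
        unfolding S_def Cs_def by (simp_all only: sin_of_real cos_of_real)
      have "norm (complex_of_real S) < 1" using \<delta>[OF z] unfolding sz .
      then have "of_real (S\<^sup>2) \<in> ball (0::complex) 1" by (simp add: norm_power abs_square_less_1)
      then have "cheb_ext \<nu> (of_real (S\<^sup>2)) = cheb_series \<nu> ((of_real S)\<^sup>2)" by (simp add: cheb_ext_def)
      moreover have "of_real Cs * cheb_series \<nu> ((of_real S)\<^sup>2) = cos ((2 * \<nu> + 1) * of_real (\<eta>/2))"
        using cheb_series_cos[OF \<nu> \<delta> z] unfolding sz .
      moreover have "(2 * \<nu> + 1) * of_real (\<eta>/2) = (\<nu> + 1/2) * of_real \<eta>" by (simp add: algebra_simps)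
      moreover have "complex_of_real Cs \<noteq> 0" using pos by simp
      ultimately show ?thesis unfolding w by (metis nonzero_mult_div_cancel_left)
    qed
    let ?c = "cos ((\<nu> + 1/2) * of_real \<eta>)"
    have "\<bar>sin (\<eta>/2) * cos (\<eta>/2) / (sin (b/2))\<^sup>2\<bar> *\<^sub>R ?f ((sin (\<eta>/2))\<^sup>2 / (sin (b/2))\<^sup>2) =
       of_real (S * Cs / B\<^sup>2) * (of_real (B / S) * of_real (2 powr (m + 1/2) * (B * B powr (2 * m)) * p) * (?c / of_real Cs))"
      unfolding S_def[symmetric] Cs_def[symmetric] B_def[symmetric] t cx ch q B21 scaleR_conv_of_real using pos B0 by simp
    also have "\<dots> = of_real (S * Cs / B\<^sup>2 * (B / S) * (2 powr (m + 1/2) * (B * B powr (2 * m)) * p) / Cs) * ?c"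
      by simp
    also have "S * Cs / B\<^sup>2 * (B / S) * (2 powr (m + 1/2) * (B * B powr (2 * m)) * p) / Cs = 2 powr (m + 1/2) * B powr (2 * m) * p"
      using pos B0 by (simp add: power2_eq_square)
    finally show "\<bar>sin (\<eta>/2) * cos (\<eta>/2) / (sin (b/2))\<^sup>2\<bar> *\<^sub>R ?f ((sin (\<eta>/2))\<^sup>2 / (sin (b/2))\<^sup>2) =
       of_real (2 powr (m + 1/2) * B powr (2 * m)) * (?c * of_real ((cos \<eta> - cos b) powr (- m - 1/2)))"
      unfolding p_def by simp
  qed
  also have "\<dots> = of_real (2 powr (m + 1/2) * B powr (2 * m)) *
    (LINT \<eta>:{0<..<b}|lborel. cos ((\<nu> + 1/2) * of_real \<eta>) * of_real ((cos \<eta> - cos b) powr (- m - 1/2)))"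
    by (rule set_integral_mult_right)
  finally show ?thesis unfolding B_def .
qed

section \<open>The expansion off the real axis\<close>

lemma imaginary_powr:
  assumes "s > 0"
  shows "(\<i> * complex_of_real s) powr a = of_real s powr a * exp (\<i> * of_real (pi/2) * a)"
    and "(- \<i> * complex_of_real s) powr a = of_real s powr a * exp (- (\<i> * of_real (pi/2) * a))"
proof -
  have "Ln (of_real s * \<i>) = of_real (ln s) + Ln \<i>" "Ln (of_real s * (-\<i>)) = of_real (ln s) + Ln (-\<i>)"
    unfolding Ln_times_of_real[OF assms complex_i_not_zero] Ln_times_of_real[OF assms, of "- \<i>", simplified neg_equal_0_iff_equal, OF complex_i_not_zero]
    using assms by (simp_all add: Ln_of_real)
  then have L: "Ln (\<i> * of_real s) = of_real (ln s) + \<i> * of_real (pi/2)" "Ln (- \<i> * of_real s) = of_real (ln s) - \<i> * of_real (pi/2)"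
    by (simp_all add: mult.commute)
  have s: "complex_of_real s \<noteq> 0" "Ln (of_real s) = of_real (ln s)" using assms by (simp_all add: Ln_of_real)
  have nz: "\<i> * complex_of_real s \<noteq> 0" "- \<i> * complex_of_real s \<noteq> 0" using s by simp_all
  show "(\<i> * complex_of_real s) powr a = of_real s powr a * exp (\<i> * of_real (pi/2) * a)"
    unfolding powr_def L s(2) if_not_P[OF nz(1)] if_not_P[OF s(1)] exp_add[symmetric]
    by (rule arg_cong[of _ _ exp]) (simp only: distrib_left mult_ac)
  show "(- \<i> * complex_of_real s) powr a = of_real s powr a * exp (- (\<i> * of_real (pi/2) * a))"
    unfolding powr_def L s(2) if_not_P[OF nz(2)] if_not_P[OF s(1)] exp_add[symmetric]
    by (rule arg_cong[of _ _ exp]) (simp add: algebra_simps)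
qed

lemma sinh_cosh_imaginary:
  "sinh (\<i> * complex_of_real c) = \<i> * of_real (sin c)"
  "cosh (\<i> * complex_of_real c) = of_real (cos c)"
  using sinh_conv_sin[of "\<i> * complex_of_real c"] cosh_conv_cos[of "\<i> * complex_of_real c"]
  by (simp_all add: mult.assoc[symmetric] sin_of_real cos_of_real)

text \<open>Links the points \<open>1 \<plusminus> \<i> * cot c\<close> produced by the edges of the
  strip with the two arguments of the expansion at \<open>\<xi> = \<i> * c\<close>.\<close>

lemma legendre_arguments_imaginary:
  assumes "sin c \<noteq> 0"
  shows "- exp (- (\<i> * complex_of_real c)) / sinh (\<i> * of_real c) = 1 + \<i> * of_real (cot c)"
    and "exp (\<i> * complex_of_real c) / sinh (\<i> * of_real c) = 1 - \<i> * of_real (cot c)"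
proof -
  have s: "complex_of_real (sin c) \<noteq> 0" using assms by simp
  have e: "exp (\<i> * complex_of_real c) = of_real (cos c) + \<i> * of_real (sin c)"
    "exp (- (\<i> * complex_of_real c)) = of_real (cos c) - \<i> * of_real (sin c)"
    using cis_conv_exp[of c] cis_conv_exp[of "-c"] by (simp_all add: complex_eq_iff)
  show "- exp (- (\<i> * complex_of_real c)) / sinh (\<i> * of_real c) = 1 + \<i> * of_real (cot c)"
    unfolding e sinh_cosh_imaginary cot_def of_real_divide using s by (simp add: field_simps)
  show "exp (\<i> * complex_of_real c) / sinh (\<i> * of_real c) = 1 - \<i> * of_real (cot c)"
    unfolding e sinh_cosh_imaginary cot_def of_real_divide using s by (simp add: field_simps)
qed

text \<open>The left side comes from Mehler's integral over the segment, the right side from the two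
  edges of the strip, rewritten through \<open>legendre_rem_0_euler\<close>. The phases
  \<open>q * p\<close> and its inverse are those of \<open>(- \<i>) powr (- m - 1/2)\<close> and
  \<open>\<i> powr (- m - 1/2)\<close>. Written with \<open>b > 0\<close> and real roots, the
  identity serves both \<open>\<xi> = \<i> * b\<close> and
  \<open>\<xi> = - \<i> * b\<close>.\<close>

lemma hyp_series_legendre_rem_imaginary:
  fixes m b :: real
  assumes m: "- 1/2 < m" "m < 0" and \<nu>: "Re \<nu> > - 1/2" and b: "0 < b" "b < pi" "b / 2 < \<delta>"
    and \<delta>: "\<And>z :: complex. z \<in> ball 0 \<delta> \<Longrightarrow> norm (sin z) < 1"
  defines "p \<equiv> exp (\<i> * of_real (pi/4))" and "q \<equiv> exp (\<i> * of_real (pi * m / 2))"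
  shows "Gamma (\<nu> - of_real m + 1) * of_real (sqrt (2 * pi * sin b) * (cos (b/2) / sin (b/2)) powr m) *
      hyp2F1_reg_series (\<nu> + 1) (- \<nu>) (1 - of_real m) (of_real ((sin (b/2))\<^sup>2)) =
      - \<i> * (exp (\<i> * (\<nu> + 1/2) * of_real b) * (q * p) * legendre_rem 0 (1 + \<i> * of_real (cot b)) (of_real m) \<nu> -
        exp (- (\<i> * (\<nu> + 1/2) * of_real b)) * inverse (q * p) * legendre_rem 0 (1 - \<i> * of_real (cot b)) (of_real m) \<nu>)"
proof -
  have ma: "\<bar>m\<bar> < 1/2" using m by simp
  have \<nu>1: "2 * \<nu> + 1 \<noteq> 0" using \<nu> by (auto simp: complex_eq_iff)
  define G where "G = Gamma (\<nu> + 1 - complex_of_real m)"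
  define g where "g = Gamma (1/2 - m)"
  have g0: "g > 0" unfolding g_def using m by (intro Gamma_real_pos) auto
  have "\<nu> + 1 - complex_of_real m \<notin> \<int>\<^sub>\<le>\<^sub>0" using \<nu> m by (intro notI) (auto elim!: nonpos_Ints_cases simp: complex_eq_iff)
  then have G0: "G \<noteq> 0" unfolding G_def by (simp add: Gamma_eq_zero_iff)
  have Sp: "sin b > 0" using b by (intro sin_gt_zero)
  have Bp: "sin (b/2) > 0" using b by (intro sin_gt_zero) auto
  have Kp: "cos (b/2) > 0" using b by (intro cos_gt_zero) auto
  have S: "sin b = 2 * sin (b/2) * cos (b/2)" using sin_double[of "b/2"] by simp
  define I0 where "I0 = (LINT \<eta>:{-b<..<b}|lborel. contour_fun b m \<nu> (\<i> * of_real \<eta>))"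
  let ?s = "sin b powr (- m - 1/2)"
  let ?Rp = "legendre_rem 0 (1 + \<i> * of_real (cot b)) (of_real m) \<nu>"
  let ?Rm = "legendre_rem 0 (1 - \<i> * of_real (cot b)) (of_real m) \<nu>"
  let ?e = "exp (\<i> * (\<nu> + 1/2) * of_real b)"
  let ?f = "exp (- (\<i> * (\<nu> + 1/2) * of_real b))"
  have E: "euler_integral m \<nu> x = of_real g / G * legendre_rem 0 x (of_real m) \<nu>" if "Re x > 0" for x
    unfolding legendre_rem_0_euler[OF ma \<nu> notin_nonpos_Reals_Re[OF that]] G_def[symmetric] g_def[symmetric]
    using g0 G0 by simp
  have pq: "exp (- (\<i> * of_real (pi/2) * complex_of_real (- m - 1/2))) = q * p"
    "exp (\<i> * of_real (pi/2) * complex_of_real (- m - 1/2)) = inverse (q * p)"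
    unfolding p_def q_def exp_add[symmetric] exp_minus[symmetric]
    by (rule arg_cong[of _ _ exp]; simp add: field_simps)+
  have sp: "complex_of_real (sin b) powr of_real (- m - 1/2) = of_real ?s" using Sp by (intro powr_of_real) simp
  have D1: "(LINT \<theta>:{..<0}|lborel. contour_fun b m \<nu> (of_real \<theta> + \<i> * of_real b)) = ?e * (of_real ?s * (q * p)) * (of_real g / G * ?Rp)"
    unfolding contour_fun_ray_integral[OF ma \<nu> b(1,2), of b, OF abs_of_pos[OF b(1)]] imaginary_powr(2)[OF Sp] pq sp
    by (subst E) simp_all
  have si: "- \<i> * complex_of_real (sin (- b)) = \<i> * of_real (sin b)" by simp
  have D2: "(LINT \<theta>:{..<0}|lborel. contour_fun b m \<nu> (of_real \<theta> + \<i> * of_real (- b))) = ?f * (of_real ?s * inverse (q * p)) * (of_real g / G * ?Rm)"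
  proof -
    have ab: "\<bar>- b\<bar> = b" using b by simp
    have x: "1 + \<i> * complex_of_real (cot (- b)) = 1 - \<i> * of_real (cot b)" by simp
    have y: "exp (\<i> * (\<nu> + 1/2) * of_real (- b)) = ?f" by simp
    show ?thesis
      unfolding contour_fun_ray_integral[OF ma \<nu> b(1,2) ab] si imaginary_powr(1)[OF Sp] pq sp x y
      by (subst E) simp_all
  qed
  define Br where "Br = ?e * (q * p) * ?Rp - ?f * inverse (q * p) * ?Rm"
  have "(LINT \<eta>:{-b<..<b}|lborel. \<i> * contour_fun b m \<nu> (\<i> * of_real \<eta>)) = \<i> * I0" unfolding I0_def by (rule set_integral_mult_right)
  then have "\<i> * I0 = of_real ?s * (of_real g / G) * Br"
    using contour_identity[OF m \<nu> b(1,2)] unfolding D1 D2 Br_def by (simp add: algebra_simps)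
  then have "- \<i> * (\<i> * I0) = - \<i> * (of_real ?s * (of_real g / G) * Br)" by (rule arg_cong)
  then have I: "I0 = - \<i> * (of_real ?s * (of_real g / G) * Br)" by simp
  define J where "J = (LINT \<eta>:{0<..<b}|lborel. cos ((\<nu> + 1/2) * of_real \<eta>) * of_real ((cos \<eta> - cos b) powr (- m - 1/2)))"
  have J: "I0 = 2 * J" unfolding I0_def J_def by (rule contour_fun_imaginary_integral[OF ma b(1,2)])
  have B1: "norm (complex_of_real ((sin (b/2))\<^sup>2)) < 1"
  proof -
    have "(cos (b/2))\<^sup>2 > 0" using Kp by simp
    then have "(sin (b/2))\<^sup>2 < 1" using sin_cos_squared_add[of "b/2"] by linarith
    then show ?thesis by (simp add: norm_power)
  qed
  have rg: "rGamma (1/2 - complex_of_real m) = of_real (inverse g)"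
  proof -
    have "rGamma (1/2 - complex_of_real m) = of_real (rGamma (1/2 - m))" by (subst rGamma_complex_of_real[symmetric]) simp
    then show ?thesis by (simp only: g_def rGamma_inverse_Gamma)
  qed
  have Mu: "Re (complex_of_real m) < 1/2" using m by simp
  have F: "hyp2F1_reg_series (\<nu> + 1) (- \<nu>) (1 - of_real m) (of_real ((sin (b/2))\<^sup>2)) =
     of_real (inverse g) / of_real (sqrt pi) * (of_real (2 powr (m + 1/2) * sin (b/2) powr (2 * m)) * J)"
    unfolding mehler_eq_series[OF \<nu>1 Mu B1, symmetric] rg J_def
    by (subst mehler_angle[OF \<nu>1 ma b]) (use \<delta> in auto)
  have Ge: "\<nu> - complex_of_real m + 1 = \<nu> + 1 - of_real m" by simp
  let ?A = "sqrt (2 * pi * sin b) * (cos (b/2) / sin (b/2)) powr m"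
  let ?H = "2 powr (m + 1/2) * sin (b/2) powr (2 * m)"
  have real: "?A * (inverse g / sqrt pi * ?H) * (?s * g / 2) = 1"
  proof -
    have a: "sqrt (2 * pi * sin b) = sqrt pi * (2 * sin b) powr (1/2)"
      using Sp by (simp add: powr_half_sqrt real_sqrt_mult)
    have "?A * (inverse g / sqrt pi * ?H) * (?s * g / 2) = (2 * sin b) powr (1/2) * (cos (b/2) / sin (b/2)) powr m * ?H * ?s / 2"
      unfolding a using g0 by simp
    also have "\<dots> = 1"
    proof -
      \<comment> \<open>All factors left are powers of \<open>2\<close>, \<open>sin (b/2)\<close>
        and \<open>cos (b/2)\<close>, so the cancellation is a linear identity between three
        logarithms.\<close>
      define L2 LB LK where "L2 = ln (2::real)" "LB = ln (sin (b/2))" "LK = ln (cos (b/2))"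
      note Ld = L2_LB_LK_def
      have LS: "ln (sin b) = L2 + LB + LK" unfolding S Ld using Bp Kp by (simp add: ln_mult)
      have L2S: "ln (2 * sin b) = L2 + (L2 + LB + LK)" using Sp by (simp add: ln_mult LS[symmetric]) (simp add: Ld)
      have LKB: "ln (cos (b/2) / sin (b/2)) = LK - LB" unfolding Ld using Bp Kp by (simp add: ln_div)
      have e2: "2 = exp L2" unfolding Ld by simp
      have "(2 * sin b) powr (1/2) * (cos (b/2) / sin (b/2)) powr m * ?H * ?s =
        exp (1/2 * (L2 + (L2 + LB + LK))) * exp (m * (LK - LB)) * (exp ((m + 1/2) * L2) * exp (2 * m * LB)) * exp ((- m - 1/2) * (L2 + LB + LK))"
        unfolding powr_def L2S LKB LS Ld[symmetric] using Sp Bp Kp by simp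
      also have "\<dots> = exp L2" unfolding exp_add[symmetric] by (rule arg_cong[of _ _ exp]) (simp add: field_simps)
      finally show ?thesis using e2 by simp
    qed
    finally show ?thesis .
  qed
  have J2: "J = - \<i> * (of_real (?s * g / 2) / G * Br)" 
  proof -
    have "J = I0 / 2" using J by simp
    also have "\<dots> = - \<i> * (of_real (?s * g / 2) / G * Br)" unfolding I by simp
    finally show ?thesis .
  qed
  have "Gamma (\<nu> - of_real m + 1) * of_real ?A *
      hyp2F1_reg_series (\<nu> + 1) (- \<nu>) (1 - of_real m) (of_real ((sin (b/2))\<^sup>2)) =
      (G / G) * of_real (?A * (inverse g / sqrt pi * ?H) * (?s * g / 2)) * (- \<i> * Br)"
    unfolding F J2 Ge G_def[symmetric] of_real_mult of_real_divide by (simp only: times_divide_eq_left times_divide_eq_right divide_divide_eq_left mult_ac)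
  also have "\<dots> = - \<i> * Br" unfolding real using G0 by simp
  finally show ?thesis unfolding Br_def .
qed

text \<open>The common identity is multiplied by the phases of the square root and of the power of
  \<open>coth (\<xi>/2)\<close>, that is by \<open>p / q\<close> for \<open>\<sigma> = 1\<close> and
  by \<open>q / p\<close> for \<open>\<sigma> = - 1\<close>. This removes the phase of the term with
  \<open>exp ((\<nu> + 1/2) * \<xi>)\<close> and leaves the connection coefficient on the other
  one.\<close>

lemma hyp_series_legendre_rem_0:
  fixes m b c :: real
  assumes m: "- 1/2 < m" "m < 0" and \<nu>: "Re \<nu> > - 1/2" and b: "0 < b" "b < pi" "b / 2 < \<delta>"
    and \<delta>: "\<And>z :: complex. z \<in> ball 0 \<delta> \<Longrightarrow> norm (sin z) < 1"
    and \<sigma>: "\<sigma> = 1 \<or> \<sigma> = (- 1 :: real)" and \<xi>: "\<xi> = \<i> * complex_of_real (\<sigma> * b)"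
  shows "Gamma (\<nu> - of_real m + 1) * csqrt (2 * of_real pi * sinh \<xi>) * (cosh (\<xi>/2) / sinh (\<xi>/2)) powr of_real m *
      hyp2F1_reg_series (\<nu> + 1) (- \<nu>) (1 - of_real m) ((1 - cosh \<xi>) / 2) =
      exp ((\<nu> + 1/2) * \<xi>) * legendre_rem 0 (- exp (- \<xi>) / sinh \<xi>) (of_real m) \<nu> +
      of_real \<sigma> * \<i> * exp (- (of_real (\<sigma> * pi) * \<i> * of_real m)) * exp (- (\<nu> + 1/2) * \<xi>) *
        legendre_rem 0 (exp \<xi> / sinh \<xi>) (of_real m) \<nu>"
proof -
  define p q where "p = exp (\<i> * of_real (pi/4))" "q = exp (\<i> * complex_of_real (pi * m / 2))"
  note pqd = p_q_def
  note base = hyp_series_legendre_rem_imaginary[OF m \<nu> b \<delta>, folded pqd]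
  have pq0: "p \<noteq> 0" "q \<noteq> 0" unfolding pqd by simp_all
  have pp: "p * p = \<i>"
    unfolding pqd exp_add[symmetric] using cis_conv_exp[of "pi/2"] by (simp add: field_simps)
  have qq: "exp (of_real pi * \<i> * of_real m) = q * q" "exp (- (of_real pi * \<i> * of_real m)) = inverse (q * q)"
    unfolding pqd exp_add[symmetric] exp_minus[symmetric] by (rule arg_cong[of _ _ exp]; simp add: field_simps)+
  have Sp: "sin b > 0" using b by (intro sin_gt_zero)
  have Bp: "sin (b/2) > 0" using b by (intro sin_gt_zero) auto
  have Kp: "cos (b/2) > 0" using b by (intro cos_gt_zero) auto
  have S2: "2 * pi * sin b > 0" and KB: "cos (b/2) / sin (b/2) > 0" using Sp Bp Kp by simp_all
  have sc: "sin (\<sigma> * b) \<noteq> 0" using \<sigma> Sp by auto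
  have half: "\<xi> / 2 = \<i> * complex_of_real (\<sigma> * b / 2)" unfolding \<xi> by simp
  have w: "(1 - cosh \<xi>) / 2 = of_real ((sin (b/2))\<^sup>2)"
  proof -
    have "cos (\<sigma> * b) = cos b" using \<sigma> by auto
    moreover have "cos b = 1 - 2 * (sin (b/2))\<^sup>2" using cos_double_sin[of "b/2"] by simp
    ultimately show ?thesis unfolding \<xi> sinh_cosh_imaginary by simp
  qed
  have sq: "csqrt (2 * of_real pi * (\<i> * of_real (sin b))) = of_real (sqrt (2 * pi * sin b)) * p"
    "csqrt (2 * of_real pi * (- \<i> * of_real (sin b))) = of_real (sqrt (2 * pi * sin b)) * inverse p"
  proof -
    have r: "complex_of_real (2 * pi * sin b) powr (1/2) = of_real (sqrt (2 * pi * sin b))"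
      using powr_of_real[of "2 * pi * sin b" "1/2"] S2 by (simp add: powr_half_sqrt)
    have e: "2 * of_real pi * (\<i> * of_real (sin b)) = \<i> * complex_of_real (2 * pi * sin b)"
      "2 * of_real pi * (- \<i> * of_real (sin b)) = - \<i> * complex_of_real (2 * pi * sin b)" by simp_all
    have f: "exp (\<i> * of_real (pi/2) * (1/2)) = p" "exp (- (\<i> * of_real (pi/2) * (1/2))) = inverse p"
      unfolding pqd exp_minus[symmetric] by (rule arg_cong[of _ _ exp]; simp)+
    show "csqrt (2 * of_real pi * (\<i> * of_real (sin b))) = of_real (sqrt (2 * pi * sin b)) * p"
      unfolding csqrt_conv_powr e imaginary_powr[OF S2] r f ..
    show "csqrt (2 * of_real pi * (- \<i> * of_real (sin b))) = of_real (sqrt (2 * pi * sin b)) * inverse p"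
      unfolding csqrt_conv_powr e imaginary_powr[OF S2] r f ..
  qed
  have co: "(\<i> * complex_of_real (cos (b/2) / sin (b/2))) powr of_real m = of_real ((cos (b/2) / sin (b/2)) powr m) * q"
    "(- \<i> * complex_of_real (cos (b/2) / sin (b/2))) powr of_real m = of_real ((cos (b/2) / sin (b/2)) powr m) * inverse q"
  proof -
    have r: "complex_of_real (cos (b/2) / sin (b/2)) powr of_real m = of_real ((cos (b/2) / sin (b/2)) powr m)"
      using KB by (intro powr_of_real) simp
    have f: "exp (\<i> * of_real (pi/2) * complex_of_real m) = q" "exp (- (\<i> * of_real (pi/2) * complex_of_real m)) = inverse q"
      unfolding pqd exp_minus[symmetric] by (rule arg_cong[of _ _ exp]; simp)+
    show "(\<i> * complex_of_real (cos (b/2) / sin (b/2))) powr of_real m = of_real ((cos (b/2) / sin (b/2)) powr m) * q"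
      unfolding imaginary_powr[OF KB] r f ..
    show "(- \<i> * complex_of_real (cos (b/2) / sin (b/2))) powr of_real m = of_real ((cos (b/2) / sin (b/2)) powr m) * inverse q"
      unfolding imaginary_powr[OF KB] r f ..
  qed
  define G where "G = Gamma (\<nu> - complex_of_real m + 1)"
  define H where "H = hyp2F1_reg_series (\<nu> + 1) (- \<nu>) (1 - of_real m) (of_real ((sin (b/2))\<^sup>2))"
  define Rp where "Rp = legendre_rem 0 (1 + \<i> * of_real (cot b)) (of_real m) \<nu>"
  define Rm where "Rm = legendre_rem 0 (1 - \<i> * of_real (cot b)) (of_real m) \<nu>"
  define e where "e = exp (\<i> * (\<nu> + 1/2) * of_real b)"
  define f where "f = exp (- (\<i> * (\<nu> + 1/2) * of_real b))"
  define A where "A = complex_of_real (sqrt (2 * pi * sin b))"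
  define T where "T = complex_of_real ((cos (b/2) / sin (b/2)) powr m)"
  have base': "G * (A * T) * H = - \<i> * (e * (q * p) * Rp - f * inverse (q * p) * Rm)"
    using base unfolding of_real_mult G_def[symmetric] H_def[symmetric] Rp_def[symmetric] Rm_def[symmetric] e_def[symmetric] f_def[symmetric] A_def[symmetric] T_def[symmetric] .
  from \<sigma> show ?thesis
  proof
    assume s: "\<sigma> = 1"
    have cth: "cosh (\<xi>/2) / sinh (\<xi>/2) = - \<i> * complex_of_real (cos (b/2) / sin (b/2))"
      unfolding half sinh_cosh_imaginary s using Bp by (simp add: field_simps)
    have sh: "sinh \<xi> = \<i> * of_real (sin b)" unfolding \<xi> sinh_cosh_imaginary s by simp
    have X: "- exp (- \<xi>) / sinh \<xi> = 1 + \<i> * of_real (cot b)" "exp \<xi> / sinh \<xi> = 1 - \<i> * of_real (cot b)"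
      using legendre_arguments_imaginary[OF sc] unfolding \<xi> s by simp_all
    have ee: "exp ((\<nu> + 1/2) * \<xi>) = e" "exp (- (\<nu> + 1/2) * \<xi>) = f" unfolding e_def f_def \<xi> s
      by (rule arg_cong[of _ _ exp]; simp add: algebra_simps)+
    have "G * (A * p) * (T * inverse q) * H = (G * (A * T) * H) * (p * inverse q)" by (simp only: mult_ac)
    also have "\<dots> = - \<i> * (e * (p * p) * Rp - f * inverse (q * q) * Rm)" unfolding base' using pq0 by (simp add: field_simps)
    also have "\<dots> = e * Rp + \<i> * inverse (q * q) * f * Rm" unfolding pp by (simp add: algebra_simps)
    finally have "G * (A * p) * (T * inverse q) * H = e * Rp + \<i> * inverse (q * q) * f * Rm" .
    then show ?thesis
      unfolding w X ee unfolding sh cth sq co s G_def[symmetric] H_def[symmetric] Rp_def[symmetric] Rm_def[symmetric] A_def[symmetric] T_def[symmetric]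
      unfolding mult_1 of_real_1 qq .
  next
    assume s: "\<sigma> = - 1"
    have cth: "cosh (\<xi>/2) / sinh (\<xi>/2) = \<i> * complex_of_real (cos (b/2) / sin (b/2))"
      unfolding half sinh_cosh_imaginary s using Bp by (simp add: field_simps)
    have sh: "sinh \<xi> = - \<i> * of_real (sin b)" unfolding \<xi> sinh_cosh_imaginary s by simp
    have X: "- exp (- \<xi>) / sinh \<xi> = 1 - \<i> * of_real (cot b)" "exp \<xi> / sinh \<xi> = 1 + \<i> * of_real (cot b)"
      using legendre_arguments_imaginary[OF sc] unfolding \<xi> s by simp_all
    have ee: "exp ((\<nu> + 1/2) * \<xi>) = f" "exp (- (\<nu> + 1/2) * \<xi>) = e" unfolding e_def f_def \<xi> s
      by (rule arg_cong[of _ _ exp]; simp add: algebra_simps)+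
    have C: "exp (- (of_real (- 1 * pi) * \<i> * of_real m)) = q * q" unfolding qq(1)[symmetric] by simp
    have pinv: "inverse (p * p) = - \<i>" unfolding pp by simp
    have "G * (A * inverse p) * (T * q) * H = (G * (A * T) * H) * (inverse p * q)" by (simp only: mult_ac)
    also have "\<dots> = - \<i> * (e * (q * q) * Rp - f * inverse (p * p) * Rm)" unfolding base' using pq0 by (simp add: field_simps)
    also have "\<dots> = f * Rm + of_real (- 1) * \<i> * (q * q) * e * Rp" unfolding pinv by (simp add: algebra_simps)
    finally have "G * (A * inverse p) * (T * q) * H = f * Rm + of_real (- 1) * \<i> * (q * q) * e * Rp" .
    then show ?thesis
      unfolding w X ee unfolding sh cth sq co s C G_def[symmetric] H_def[symmetric] Rp_def[symmetric] Rm_def[symmetric] A_def[symmetric] T_def[symmetric] .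
  qed
qed

section \<open>Position of the arguments relative to the cut\<close>

lemma Re_sinh_complex: "Re (sinh t) = sinh (Re t) * cos (Im t)"
  and Im_sinh_complex: "Im (sinh t) = cosh (Re t) * sin (Im t)"
  by (simp_all add: sinh_def cosh_def Re_exp Im_exp algebra_simps)

text \<open>The reciprocals of the two arguments are affine in \<open>exp (- 2 * \<xi>)\<close> and
  \<open>exp (2 * \<xi>)\<close>. Inversion preserves the right half plane and the cut, so the
  position of the arguments can be read off from the reciprocals.\<close>

lemma inverse_exp_div_sinh: "inverse (exp \<xi> / sinh \<xi>) = (1 - exp (- 2 * \<xi>)) / (2 :: complex)"
proof -
  have "inverse (exp \<xi> / sinh \<xi>) = exp (- \<xi>) * sinh \<xi>" by (simp add: exp_minus field_simps)
  also have "\<dots> = (1 - exp (- \<xi>) * exp (- \<xi>)) / 2" unfolding sinh_field_def by (simp add: exp_minus field_simps)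
  also have "exp (- \<xi>) * exp (- \<xi>) = exp (- 2 * \<xi>)" unfolding exp_add[symmetric] by simp
  finally show ?thesis .
qed

lemma Re_inverse_pos:
  assumes "Re (inverse z) > 0"
  shows "Re z > 0"
proof -
  have "Re (1 * cnj z) > 0"
    unfolding Re_complex_div_gt_0[symmetric] inverse_eq_divide[symmetric] by (rule assms)
  then show ?thesis by simp
qed

text \<open>\<open>norm (exp (- 2 * \<xi>)) < 1\<close> puts the reciprocal in the right half plane.
  This is why the second remainder has a bound with factor 1 throughout \<open>D1\<close> and stays
  off the cut even on the positive axis.\<close>

lemma Re_exp_div_sinh_pos:
  assumes "Re \<xi> > 0"
  shows "Re (exp \<xi> / sinh \<xi>) > 0"
proof (rule Re_inverse_pos)
  have "Re (exp (- 2 * \<xi>)) \<le> norm (exp (- 2 * \<xi>))" by (rule complex_Re_le_cmod)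
  also have "\<dots> < 1" using assms by simp
  finally show "Re (inverse (exp \<xi> / sinh \<xi>)) > 0" unfolding inverse_exp_div_sinh by simp
qed

lemma sin_nonzero_strip: "0 < \<bar>y\<bar> \<Longrightarrow> \<bar>y\<bar> < pi \<Longrightarrow> sin y \<noteq> (0::real)"
  using sin_gt_zero[of "\<bar>y\<bar>"] by (auto simp: abs_if split: if_splits)

lemma exp_div_sinh_notin_nonpos_Reals:
  assumes y: "0 < \<bar>Im \<xi>\<bar>" "\<bar>Im \<xi>\<bar> < pi"
  shows "exp \<xi> / sinh \<xi> \<notin> \<real>\<^sub>\<le>\<^sub>0"
proof
  assume "exp \<xi> / sinh \<xi> \<in> \<real>\<^sub>\<le>\<^sub>0"
  then have "inverse (exp \<xi> / sinh \<xi>) \<in> \<real>\<^sub>\<le>\<^sub>0" by (simp only: nonpos_Reals_inverse_iff)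
  then have a: "Re (exp (- 2 * \<xi>)) \<ge> 1" "Im (exp (- 2 * \<xi>)) = 0"
    unfolding inverse_exp_div_sinh by (simp_all add: complex_nonpos_Reals_iff)
  have "sin (2 * Im \<xi>) = 0" using a(2) by (simp add: Im_exp)
  then have "cos (Im \<xi>) = 0" using sin_nonzero_strip[OF y] by (simp add: sin_double)
  then have "cos (2 * Im \<xi>) \<le> 0" by (simp add: cos_double)
  then have "Re (exp (- 2 * \<xi>)) \<le> 0" by (simp add: Re_exp mult_nonneg_nonpos)
  then show False using a(1) by linarith
qed

lemma minus_exp_div_sinh_notin_nonpos_Reals:
  assumes y: "0 < \<bar>Im \<xi>\<bar>" "\<bar>Im \<xi>\<bar> < pi"
  shows "- exp (- \<xi>) / sinh \<xi> \<notin> \<real>\<^sub>\<le>\<^sub>0"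
  using exp_div_sinh_notin_nonpos_Reals[of "- \<xi>"] y by simp

text \<open>A square root of \<open>(z + 1) / (z - 1)\<close> at \<open>z = cosh \<xi>\<close>. On
  \<open>D1\<close> its principal power is the power in \<open>legendre_P\<close>; in the half
  strips it stays off the cut also at imaginary \<open>\<xi>\<close>, where the quotient itself is
  negative.\<close>

definition coth_half :: "complex \<Rightarrow> complex" where
  "coth_half \<xi> = cosh (\<xi>/2) / sinh (\<xi>/2)"

lemma coth_half_Re_Im:
  "Re (coth_half \<xi>) = sinh (Re \<xi> / 2) * cosh (Re \<xi> / 2) / (norm (sinh (\<xi>/2)))\<^sup>2"
  "Im (coth_half \<xi>) = - (sin (Im \<xi> / 2) * cos (Im \<xi> / 2)) / (norm (sinh (\<xi>/2)))\<^sup>2"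
proof -
  let ?s = "sinh (\<xi>/2)" and ?c = "cosh (\<xi>/2)"
  define x y where "x = Re \<xi> / 2" "y = Im \<xi> / 2"
  note d = x_y_def
  have xy: "Re (\<xi>/2) = x" "Im (\<xi>/2) = y" unfolding d by simp_all
  have h: "(cosh x)\<^sup>2 = 1 + (sinh x)\<^sup>2" using cosh_square_eq[of x] by simp
  have e: "coth_half \<xi> = ?c * cnj ?s / of_real ((norm ?s)\<^sup>2)"
    unfolding coth_half_def using complex_div_cnj[of ?c ?s] by (simp only: of_real_power)
  have "Re (?c * cnj ?s) = Re ?c * Re ?s + Im ?c * Im ?s" by simp
  also have "\<dots> = sinh x * cosh x * ((cos y)\<^sup>2 + (sin y)\<^sup>2)"
    unfolding Re_cosh_complex Im_cosh_complex Re_sinh_complex Im_sinh_complex xy by algebra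
  also have "\<dots> = sinh x * cosh x" by simp
  finally have R: "Re (?c * cnj ?s) = sinh x * cosh x" .
  have "Im (?c * cnj ?s) = Im ?c * Re ?s - Re ?c * Im ?s" by simp
  also have "\<dots> = - (sin y * cos y) * ((cosh x)\<^sup>2 - (sinh x)\<^sup>2)"
    unfolding Re_cosh_complex Im_cosh_complex Re_sinh_complex Im_sinh_complex xy by algebra
  also have "\<dots> = - (sin y * cos y)" unfolding h by simp
  finally have I: "Im (?c * cnj ?s) = - (sin y * cos y)" .
  show "Re (coth_half \<xi>) = sinh (Re \<xi> / 2) * cosh (Re \<xi> / 2) / (norm (sinh (\<xi>/2)))\<^sup>2"
    unfolding e Re_divide_of_real R d ..
  show "Im (coth_half \<xi>) = - (sin (Im \<xi> / 2) * cos (Im \<xi> / 2)) / (norm (sinh (\<xi>/2)))\<^sup>2"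
    unfolding e Im_divide_of_real I d ..
qed

lemma sinh_nonzero_strip:
  assumes "0 < \<bar>Im \<xi>\<bar>" "\<bar>Im \<xi>\<bar> < pi"
  shows "Im (sinh \<xi>) \<noteq> 0" "sinh \<xi> \<noteq> 0" "sinh (\<xi>/2) \<noteq> 0"
proof -
  show 1: "Im (sinh \<xi>) \<noteq> 0" unfolding Im_sinh_complex using sin_nonzero_strip[OF assms] cosh_real_pos[of "Re \<xi>"] by simp
  then show "sinh \<xi> \<noteq> 0" by auto
  have "sinh (2 * (\<xi>/2)) = 2 * sinh (\<xi>/2) * cosh (\<xi>/2)" by (rule sinh_double)
  then have "sinh \<xi> = 2 * sinh (\<xi>/2) * cosh (\<xi>/2)" by simp
  with \<open>sinh \<xi> \<noteq> 0\<close> show "sinh (\<xi>/2) \<noteq> 0" by auto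
qed

lemma coth_half_notin_nonpos_Reals:
  assumes "0 < \<bar>Im \<xi>\<bar>" "\<bar>Im \<xi>\<bar> < pi"
  shows "coth_half \<xi> \<notin> \<real>\<^sub>\<le>\<^sub>0"
proof -
  have "2 * sin (Im \<xi> / 2) * cos (Im \<xi> / 2) = sin (Im \<xi>)" using sin_double[of "Im \<xi> / 2"] by simp
  then have "sin (Im \<xi> / 2) * cos (Im \<xi> / 2) \<noteq> 0" using sin_nonzero_strip[OF assms] by auto
  then have "Im (coth_half \<xi>) \<noteq> 0" unfolding coth_half_Re_Im using sinh_nonzero_strip(3)[OF assms] by simp
  then show ?thesis by (auto simp: complex_nonpos_Reals_iff)
qed

lemma cosh_arg_slit_plane:
  assumes "Re \<xi> > 0 \<or> 0 < \<bar>Im \<xi>\<bar>" "\<bar>Im \<xi>\<bar> < pi"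
  shows "(1 - cosh \<xi>) / 2 \<in> slit_plane"
proof (rule ccontr)
  assume "(1 - cosh \<xi>) / 2 \<notin> slit_plane"
  then obtain r where r: "r \<ge> 1" "(1 - cosh \<xi>) / 2 = of_real r" by (auto simp: slit_plane_def)
  then have "cosh \<xi> = of_real (1 - 2 * r)" by (simp add: field_simps)
  then have "Re (cosh \<xi>) = 1 - 2 * r" "Im (cosh \<xi>) = 0" by simp_all
  then have c: "cosh (Re \<xi>) * cos (Im \<xi>) \<le> - 1" "sinh (Re \<xi>) * sin (Im \<xi>) = 0" using r by (simp_all add: Re_cosh_complex Im_cosh_complex)
  show False
  proof (cases "Im \<xi> = 0")
    case True
    then show False using c(1) cosh_real_pos[of "Re \<xi>"] by simp
  next
    case False
    then have "sin (Im \<xi>) \<noteq> 0" using assms(2) by (intro sin_nonzero_strip) auto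
    then have "Re \<xi> = 0" using c(2) by simp
    then have "cos \<bar>Im \<xi>\<bar> \<le> cos pi" using c(1) by simp
    moreover have "cos pi < cos \<bar>Im \<xi>\<bar>" using assms(2) by (intro cos_monotone_0_pi) auto
    ultimately show False by linarith
  qed
qed

text \<open>\<open>Re (coth_half \<xi>) > 0\<close> keeps the argument below a right angle, so
  doubling it stays in the principal range and
  \<open>(c * c) powr (\<mu>/2) = c powr \<mu>\<close>.\<close>

lemma legendre_P_cosh:
  assumes "\<xi> \<in> D1"
  shows "legendre_P \<nu> \<mu> (cosh \<xi>) = coth_half \<xi> powr \<mu> * hyp2F1_reg (\<nu> + 1) (- \<nu>) (1 - \<mu>) ((1 - cosh \<xi>) / 2)"
    and "Re (coth_half \<xi>) > 0"
proof -
  have x: "Re \<xi> > 0" using assms by (simp add: D1_def)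
  have "Re (sinh (\<xi>/2)) \<noteq> 0 \<or> Im (sinh (\<xi>/2)) \<noteq> 0"
  proof (rule ccontr)
    assume "\<not> (Re (sinh (\<xi>/2)) \<noteq> 0 \<or> Im (sinh (\<xi>/2)) \<noteq> 0)"
    then have "cos (Im \<xi> / 2) = 0" "sin (Im \<xi> / 2) = 0" using x cosh_real_pos[of "Re \<xi> / 2"] by (auto simp: Re_sinh_complex Im_sinh_complex)
    then show False using sin_cos_squared_add[of "Im \<xi> / 2"] by simp
  qed
  then have s: "sinh (\<xi>/2) \<noteq> 0" by auto
  then show c: "Re (coth_half \<xi>) > 0" unfolding coth_half_Re_Im using x by (intro divide_pos_pos mult_pos_pos) auto
  then have c0: "coth_half \<xi> \<noteq> 0" by auto
  have C: "cosh \<xi> = 2 * (cosh (\<xi>/2))\<^sup>2 - 1" using cosh_double_cosh[of "\<xi>/2"] by simp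
  have h: "(cosh (\<xi>/2))\<^sup>2 = (sinh (\<xi>/2))\<^sup>2 + 1" by (rule cosh_square_eq)
  have num: "cosh \<xi> + 1 = 2 * (cosh (\<xi>/2))\<^sup>2" unfolding C by simp
  have den: "cosh \<xi> - 1 = 2 * (sinh (\<xi>/2))\<^sup>2" unfolding C h by simp
  have b: "(cosh \<xi> + 1) / (cosh \<xi> - 1) = coth_half \<xi> * coth_half \<xi>"
    unfolding num den coth_half_def by (simp add: power2_eq_square)
  have "\<bar>Im (Ln (coth_half \<xi>))\<bar> < pi / 2" using Re_Ln_pos_lt[OF c0] c by simp
  then have "Ln (coth_half \<xi> * coth_half \<xi>) = Ln (coth_half \<xi>) + Ln (coth_half \<xi>)"
    by (intro Ln_times_simple c0) auto
  then have "(coth_half \<xi> * coth_half \<xi>) powr (\<mu>/2) = coth_half \<xi> powr \<mu>"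
    using c0 by (simp add: powr_def)
  then show "legendre_P \<nu> \<mu> (cosh \<xi>) = coth_half \<xi> powr \<mu> * hyp2F1_reg (\<nu> + 1) (- \<nu>) (1 - \<mu>) ((1 - cosh \<xi>) / 2)"
    unfolding legendre_P_def b by simp
qed

lemma a_coeff_holomorphic: "(\<lambda>\<mu>. a_coeff n \<mu> :: complex) holomorphic_on A"
  unfolding a_coeff_def by (intro holomorphic_intros) auto

text \<open>\<open>\<sigma>\<close> stands for the sign of \<open>Im \<xi>\<close>; as a parameter,
  instead of a case distinction on \<open>\<xi>\<close>, it leaves an expression that is visibly
  holomorphic in \<open>\<xi>\<close> on each half strip.\<close>

definition legendre_expansion :: "real \<Rightarrow> nat \<Rightarrow> nat \<Rightarrow> complex \<Rightarrow> complex \<Rightarrow> complex \<Rightarrow> complex" where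
  "legendre_expansion \<sigma> N M \<xi> \<mu> \<nu> =
    exp ((\<nu> + 1/2) * \<xi>) * ((\<Sum>n<N. P1_term n \<xi> \<mu> \<nu>) + legendre_rem N (- exp (- \<xi>) / sinh \<xi>) \<mu> \<nu>) +
    of_real \<sigma> * \<i> * exp (- (of_real (\<sigma> * pi) * \<i> * \<mu>)) * exp (- (\<nu> + 1/2) * \<xi>) *
      ((\<Sum>n<M. P2_term n \<xi> \<mu> \<nu>) + legendre_rem M (exp \<xi> / sinh \<xi>) \<mu> \<nu>)"

lemma Gamma_arg_notin_nonpos_Ints: "Re z > 0 \<Longrightarrow> z \<notin> \<int>\<^sub>\<le>\<^sub>0"
  by (auto elim!: nonpos_Ints_cases)

text \<open>Continuation in \<open>\<mu>\<close> at a fixed point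
  \<open>\<plusminus>\<i> * b\<close>, from the interval \<open>-1/2 < \<mu> < 0\<close> to the
  whole strip. On the interval \<open>legendre_rem_0_expand\<close> replaces the two remainders of
  index 0 by sum plus remainder, with \<open>N\<close> and \<open>M\<close> chosen independently.
  The argument \<open>(sin (b/2))\<^sup>2\<close> lies in the unit disc, so the power series can be
  used.\<close>

lemma hyp_series_legendre_expansion:
  assumes \<mu>: "\<bar>Re \<mu>\<bar> < min (real N) (real M) + 1/2" and \<nu>: "Re \<nu> > max (real N) (real M) - 1/2"
    and b: "0 < b" "b < pi" "b / 2 < \<delta>"
    and \<delta>: "\<And>z :: complex. z \<in> ball 0 \<delta> \<Longrightarrow> norm (sin z) < 1"
    and \<sigma>: "\<sigma> = 1 \<or> \<sigma> = (- 1 :: real)" and \<xi>: "\<xi> = \<i> * complex_of_real (\<sigma> * b)"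
  shows "Gamma (\<nu> - \<mu> + 1) * csqrt (2 * of_real pi * sinh \<xi>) * coth_half \<xi> powr \<mu> *
      hyp2F1_reg_series (\<nu> + 1) (- \<nu>) (1 - \<mu>) ((1 - cosh \<xi>) / 2) = legendre_expansion \<sigma> N M \<xi> \<mu> \<nu>"
    and "norm ((1 - cosh \<xi>) / 2) < 1"
proof -
  let ?U = "{\<mu>. \<bar>Re \<mu>\<bar> < min (real N) (real M) + 1/2}"
  let ?L = "\<lambda>\<mu>. Gamma (\<nu> - \<mu> + 1) * csqrt (2 * of_real pi * sinh \<xi>) * coth_half \<xi> powr \<mu> *
      hyp2F1_reg_series (\<nu> + 1) (- \<nu>) (1 - \<mu>) ((1 - cosh \<xi>) / 2)"
  let ?h = "\<lambda>\<mu>. ?L \<mu> - legendre_expansion \<sigma> N M \<xi> \<mu> \<nu>"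
  have y: "0 < \<bar>Im \<xi>\<bar>" "\<bar>Im \<xi>\<bar> < pi" using \<sigma> b unfolding \<xi> by auto
  note X1 = minus_exp_div_sinh_notin_nonpos_Reals[OF y] and X2 = exp_div_sinh_notin_nonpos_Reals[OF y]
  have \<nu>N: "Re \<nu> > real N - 1/2" and \<nu>M: "Re \<nu> > real M - 1/2" using \<nu> by auto
  then have \<nu>0: "Re \<nu> > - 1/2" by linarith
  show w: "norm ((1 - cosh \<xi>) / 2) < 1"
  proof -
    have "cos (\<sigma> * b) = cos b" using \<sigma> by auto
    then have "(1 - cosh \<xi>) / 2 = of_real ((1 - cos b) / 2)" unfolding \<xi> sinh_cosh_imaginary by simp
    moreover have "cos pi < cos b" using b by (intro cos_monotone_0_pi) auto
    then have "\<bar>(1 - cos b) / 2\<bar> < 1" using cos_le_one[of b] by simp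
    ultimately show ?thesis by (simp only: norm_of_real)
  qed
  have "?h \<mu> = 0"
  proof (rule analytic_continuation[where S = ?U and U = "of_real ` {- 1/2<..<0}" and \<xi> = "of_real (- 1/4)" and f = ?h])
    show "?h holomorphic_on ?U"
      unfolding legendre_expansion_def P1_term_def P2_term_def
    proof (intro holomorphic_intros a_coeff_holomorphic)
      show "(\<lambda>\<mu>. hyp2F1_reg_series (\<nu> + 1) (- \<nu>) (1 - \<mu>) ((1 - cosh \<xi>) / 2)) holomorphic_on ?U"
        by (rule holomorphic_on_subset[OF hyp_series_sums_holomorphic_mu(2)[OF w]]) auto
      show "(\<lambda>\<mu>. legendre_rem N (- exp (- \<xi>) / sinh \<xi>) \<mu> \<nu>) holomorphic_on ?U"
        by (rule holomorphic_on_subset[OF legendre_rem_holomorphic_mu[OF X1 \<nu>N]]) auto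
      show "(\<lambda>\<mu>. legendre_rem M (exp \<xi> / sinh \<xi>) \<mu> \<nu>) holomorphic_on ?U"
        by (rule holomorphic_on_subset[OF legendre_rem_holomorphic_mu[OF X2 \<nu>M]]) auto
      show "\<nu> - z + 1 \<notin> \<int>\<^sub>\<le>\<^sub>0" if "z \<in> ?U" for z
        by (rule Gamma_arg_notin_nonpos_Ints) (use that \<nu>N \<nu>M in auto)
    qed
    show "open ?U" by (rule open_Re_strip)
    show "connected ?U" by (intro convex_connected convex_Re_strip)
    show "complex_of_real (- 1/4) islimpt of_real ` {- 1/2<..<0}" by (rule islimpt_of_real_Ioo) auto
    show "complex_of_real ` {- 1/2<..<0} \<subseteq> ?U" by auto
    fix z assume "z \<in> complex_of_real ` {- 1/2<..<0}"
    then obtain m where m: "- 1/2 < m" "m < 0" "z = of_real m" by auto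
    have ma: "\<bar>m\<bar> < 1/2" using m by simp
    have "?L z = legendre_expansion \<sigma> N M \<xi> z \<nu>"
      unfolding m(3) coth_half_def legendre_expansion_def P1_term_def P2_term_def
        legendre_rem_0_expand[OF ma X1 \<nu>N, symmetric] legendre_rem_0_expand[OF ma X2 \<nu>M, symmetric]
      by (rule hyp_series_legendre_rem_0[OF m(1,2) \<nu>0 b \<delta> \<sigma> \<xi>])
    then show "?h z = 0" by simp
  qed (use \<mu> in auto)
  then show "?L \<mu> = legendre_expansion \<sigma> N M \<xi> \<mu> \<nu>" by simp
qed

lemma holomorphic_on_sinh_cosh:
  "f holomorphic_on A \<Longrightarrow> (\<lambda>\<xi>. sinh (f \<xi>) :: complex) holomorphic_on A"
  "f holomorphic_on A \<Longrightarrow> (\<lambda>\<xi>. cosh (f \<xi>) :: complex) holomorphic_on A"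
  unfolding sinh_field_def cosh_field_def by (intro holomorphic_intros; simp)+

text \<open>Continuation in \<open>\<xi>\<close> over the strip on one side of the real axis,
  starting from the part of the imaginary segment on which \<open>b / 2 < \<delta>\<close>. The
  right half of this strip is the corresponding half of \<open>D1\<close>.\<close>

lemma legendre_expansion_strip:
  assumes \<mu>: "\<bar>Re \<mu>\<bar> < min (real N) (real M) + 1/2" and \<nu>: "Re \<nu> > max (real N) (real M) - 1/2"
    and \<sigma>: "\<sigma> = 1 \<or> \<sigma> = (- 1 :: real)" and y: "0 < \<sigma> * Im \<xi>" "\<sigma> * Im \<xi> < pi"
  shows "Gamma (\<nu> - \<mu> + 1) * csqrt (2 * of_real pi * sinh \<xi>) * coth_half \<xi> powr \<mu> *
      hyp2F1_reg (\<nu> + 1) (- \<nu>) (1 - \<mu>) ((1 - cosh \<xi>) / 2) = legendre_expansion \<sigma> N M \<xi> \<mu> \<nu>"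
proof -
  let ?V = "{\<xi>. 0 < \<sigma> * Im \<xi> \<and> \<sigma> * Im \<xi> < pi}"
  let ?T = "{t. 0 < Re t \<and> Re t < pi}"
  let ?L = "\<lambda>\<xi>. Gamma (\<nu> - \<mu> + 1) * csqrt (2 * of_real pi * sinh \<xi>) * coth_half \<xi> powr \<mu> *
      hyp2F1_reg (\<nu> + 1) (- \<nu>) (1 - \<mu>) ((1 - cosh \<xi>) / 2)"
  let ?h = "\<lambda>\<xi>. ?L \<xi> - legendre_expansion \<sigma> N M \<xi> \<mu> \<nu>"
  \<comment> \<open>Rotation by a right angle: the imaginary segment becomes an interval of real
    \<open>t\<close>, to which \<open>islimpt_of_real_Ioo\<close> applies.\<close>
  let ?k = "\<lambda>t. \<i> * complex_of_real \<sigma> * t"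
  have \<nu>N: "Re \<nu> > real N - 1/2" and \<nu>M: "Re \<nu> > real M - 1/2" using \<nu> by auto
  have \<mu>N: "\<bar>Re \<mu>\<bar> < real N + 1/2" and \<mu>M: "\<bar>Re \<mu>\<bar> < real M + 1/2" using \<mu> by auto
  have "Re \<nu> > - 1/2" using \<nu>N by linarith
  then have \<nu>1: "2 * \<nu> + 1 \<noteq> 0" by (auto simp: complex_eq_iff)
  have yV: "0 < \<bar>Im \<xi>\<bar> \<and> \<bar>Im \<xi>\<bar> < pi" if "\<xi> \<in> ?V" for \<xi> using that \<sigma> by auto
  have nz: "sinh (\<xi>/2) \<noteq> 0" "sinh \<xi> \<noteq> 0" if "\<xi> \<in> ?V" for \<xi>
    using sinh_nonzero_strip[of \<xi>] yV[OF that] by blast+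
  obtain \<delta> :: real where \<delta>: "\<delta> > 0" "\<And>z :: complex. z \<in> ball 0 \<delta> \<Longrightarrow> norm (sin z) < 1"
    by (rule sin_lt_1_ball) blast
  define b1 where "b1 = min pi (2 * \<delta>)"
  have b1: "b1 > 0" "b1 \<le> pi" "b1 / 2 \<le> \<delta>" using \<delta>(1) pi_gt_zero by (auto simp: b1_def)
  have hV: "?h holomorphic_on ?V"
    unfolding legendre_expansion_def P1_term_def P2_term_def
  proof (intro holomorphic_intros holomorphic_on_sinh_cosh)
    show "coth_half holomorphic_on ?V"
      unfolding coth_half_def by (intro holomorphic_intros holomorphic_on_sinh_cosh) ((rule nz, assumption) | simp)+
    show "coth_half z \<notin> \<real>\<^sub>\<le>\<^sub>0" if "z \<in> ?V" for z using yV[OF that] by (intro coth_half_notin_nonpos_Reals) auto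
    show "2 * of_real pi * sinh z \<notin> \<real>\<^sub>\<le>\<^sub>0" if "z \<in> ?V" for z
      using sinh_nonzero_strip(1)[of z] yV[OF that] by (auto simp: complex_nonpos_Reals_iff)
    show "sinh z \<noteq> 0" if "z \<in> ?V" for z using sinh_nonzero_strip(2)[of z] yV[OF that] by blast
    show "sinh z \<noteq> 0" if "z \<in> ?V" for z using sinh_nonzero_strip(2)[of z] yV[OF that] by blast
    show "(\<lambda>\<xi>. hyp2F1_reg (\<nu> + 1) (- \<nu>) (1 - \<mu>) ((1 - cosh \<xi>) / 2)) holomorphic_on ?V"
    proof (rule holomorphic_on_compose_gen[OF _ hyp2F1_reg_props(1)[OF \<nu>1], unfolded o_def])
      show "(\<lambda>\<xi>. (1 - cosh \<xi>) / 2) holomorphic_on ?V" by (intro holomorphic_intros holomorphic_on_sinh_cosh) auto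
      show "(\<lambda>\<xi>. (1 - cosh \<xi>) / 2) ` ?V \<subseteq> slit_plane"
        by (rule image_subsetI, rule cosh_arg_slit_plane) (use yV in auto)
    qed
    show "(\<lambda>\<xi>. legendre_rem N (- exp (- \<xi>) / sinh \<xi>) \<mu> \<nu>) holomorphic_on ?V"
    proof (rule holomorphic_on_compose_gen[OF _ legendre_rem_holomorphic[OF \<mu>N \<nu>N], unfolded o_def])
      show "(\<lambda>\<xi>. - exp (- \<xi>) / sinh \<xi>) holomorphic_on ?V"
        by (intro holomorphic_intros holomorphic_on_sinh_cosh) ((rule nz, assumption) | simp)+
      show "(\<lambda>\<xi>. - exp (- \<xi>) / sinh \<xi>) ` ?V \<subseteq> - \<real>\<^sub>\<le>\<^sub>0"
        by (rule image_subsetI, rule ComplI, rule minus_exp_div_sinh_notin_nonpos_Reals[THEN notE]) (use yV in auto)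
    qed
    show "(\<lambda>\<xi>. legendre_rem M (exp \<xi> / sinh \<xi>) \<mu> \<nu>) holomorphic_on ?V"
    proof (rule holomorphic_on_compose_gen[OF _ legendre_rem_holomorphic[OF \<mu>M \<nu>M], unfolded o_def])
      show "(\<lambda>\<xi>. exp \<xi> / sinh \<xi>) holomorphic_on ?V"
        by (intro holomorphic_intros holomorphic_on_sinh_cosh) ((rule nz, assumption) | simp)+
      show "(\<lambda>\<xi>. exp \<xi> / sinh \<xi>) ` ?V \<subseteq> - \<real>\<^sub>\<le>\<^sub>0"
        by (rule image_subsetI, rule ComplI, rule exp_div_sinh_notin_nonpos_Reals[THEN notE]) (use yV in auto)
    qed
  qed
  have ss: "\<sigma> * (\<sigma> * r) = r" for r using \<sigma> by auto
  have h0: "?h (?k t) = 0" if t: "t \<in> ?T" for t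
  proof (rule analytic_continuation[where S = ?T and U = "of_real ` {0<..<b1}" and \<xi> = "of_real (b1/2)" and f = "\<lambda>t. ?h (?k t)"])
    show "(\<lambda>t. ?h (?k t)) holomorphic_on ?T"
    proof (rule holomorphic_on_compose_gen[OF _ hV, unfolded o_def])
      show "?k holomorphic_on ?T" by (intro holomorphic_intros)
      show "?k ` ?T \<subseteq> ?V" by (auto simp: ss)
    qed
    have T: "?T = {t. 0 < Re t} \<inter> {t. Re t < pi}" by auto
    show "open ?T" unfolding T by (intro open_Int open_halfspace_Re_gt open_halfspace_Re_lt)
    show "connected ?T" unfolding T by (intro convex_connected convex_Int convex_halfspace_Re_gt convex_halfspace_Re_lt)
    show "complex_of_real ` {0<..<b1} \<subseteq> ?T" using b1 by auto
    show "complex_of_real (b1/2) \<in> ?T" using b1 by auto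
    show "complex_of_real (b1/2) islimpt of_real ` {0<..<b1}" by (rule islimpt_of_real_Ioo) (use b1 in auto)
    fix z assume "z \<in> complex_of_real ` {0<..<b1}"
    then obtain b where b: "0 < b" "b < b1" "z = of_real b" by auto
    have b': "0 < b" "b < pi" "b / 2 < \<delta>" using b b1 by auto
    have k: "?k z = \<i> * complex_of_real (\<sigma> * b)" unfolding b(3) by simp
    note ex = hyp_series_legendre_expansion[OF \<mu> \<nu> b' \<delta>(2) \<sigma> k]
    have "norm ((1 - cosh (?k z)) / 2) < 1" by (rule ex(2))
    from hyp2F1_reg_props(2)[OF \<nu>1 this]
    have "?L (?k z) = legendre_expansion \<sigma> N M (?k z) \<mu> \<nu>" using ex(1) by simp
    then show "?h (?k z) = 0" by simp
  qed (use t in auto)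
  define t where "t = - \<i> * complex_of_real \<sigma> * \<xi>"
  have kt: "?k t = \<xi>" using \<sigma> unfolding t_def by auto
  have "t \<in> ?T" using y unfolding t_def by simp
  from h0[OF this] have "?h \<xi> = 0" unfolding kt .
  then show ?thesis by simp
qed

section \<open>Error bounds and boundary values\<close>

text \<open>If the integral vanished, the positive integrand would be zero almost everywhere, but a
  nonempty open set is not negligible. The existential form passes realness and positivity together
  through the three nested integrals.\<close>

lemma set_integral_of_real_pos:
  fixes f :: "real \<Rightarrow> complex"
  assumes int: "set_integrable lborel A f" and A: "open A" "A \<noteq> {}"
    and f: "\<And>x. x \<in> A \<Longrightarrow> \<exists>r>0. f x = complex_of_real r"
  shows "\<exists>r>0. (LINT x:A|lborel. f x) = complex_of_real r"
proof (intro exI conjI)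
  let ?g = "\<lambda>x::real. indicator A x * Re (f x)"
  have m: "A \<in> sets lborel" using A by auto
  have "integrable lborel (\<lambda>x. Re (indicator A x *\<^sub>R f x))"
    using int unfolding set_integrable_def by (rule integrable_Re)
  then have g: "integrable lborel ?g" by simp
  have pos: "Re (f x) > 0" "f x = of_real (Re (f x))" if "x \<in> A" for x using f[OF that] by auto
  have nn: "?g x \<ge> 0" for x using pos(1)[of x] by (auto simp: indicator_def)
  have "(LINT x|lborel. ?g x) \<noteq> 0"
  proof
    assume "(LINT x|lborel. ?g x) = 0"
    then have "AE x in lborel. ?g x = 0" using integral_nonneg_eq_0_iff_AE[OF g] nn by simp
    then have "AE x in lborel. x \<notin> A"
      by (rule AE_mp) (rule AE_I2, use pos(1) in \<open>force simp: indicator_def\<close>)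
    then have "A \<in> null_sets lborel" using AE_iff_null_sets[OF m] by simp
    then have "negligible A" unfolding negligible_iff_null_sets by (rule null_sets_completionI)
    then show False using open_not_negligible[OF A] by simp
  qed
  moreover have "(LINT x|lborel. ?g x) \<ge> 0" by (intro integral_nonneg_AE AE_I2 nn)
  ultimately have "(LINT x|lborel. ?g x) > 0" by simp
  then show "(LINT x:A|lborel. Re (f x)) > 0" by (simp add: set_lebesgue_integral_def)
  show "(LINT x:A|lborel. f x) = complex_of_real (LINT x:A|lborel. Re (f x))"
    unfolding set_integral_complex_of_real[symmetric] using m pos(2) by (intro set_lebesgue_integral_cong) auto
qed

lemma terminant_pos:
  assumes "q > 0"
  shows "\<exists>r>0. terminant N (of_real q) = complex_of_real r"
  unfolding terminant_def
proof (rule set_integral_of_real_pos)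
  show "set_integrable lborel {0<..} (\<lambda>u. complex_of_real (u powr (real N - 1/2) * exp (- u)) / (1 + of_real u * of_real q))"
    by (rule terminant_integrable) (use assms in simp)
  fix u :: real assume u: "u \<in> {0<..}"
  show "\<exists>r>0. complex_of_real (u powr (real N - 1/2) * exp (- u)) / (1 + of_real u * of_real q) = complex_of_real r"
    by (rule exI[of _ "u powr (real N - 1/2) * exp (- u) / (1 + u * q)"])
      (use u assms in \<open>auto intro!: divide_pos_pos mult_pos_pos add_pos_pos\<close>)
qed auto

lemma terminant_beta_pos:
  fixes m y :: real
  assumes m: "\<bar>m\<bar> < real N + 1/2" and y: "y > 0"
  shows "\<exists>r>0. terminant_beta N (of_real m) (of_real y) = complex_of_real r"
  unfolding terminant_beta_def
proof (rule set_integral_of_real_pos)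
  show "set_integrable lborel {0<..<1} (\<lambda>r. of_real r powr (of_nat N + complex_of_real m - 1/2) *
     of_real (1 - r) powr (of_nat N - complex_of_real m - 1/2) * terminant N (of_real (2 * r * (1 - r)) * complex_of_real y))"
    by (rule terminant_beta_integrable) (use m y in auto)
  fix r :: real assume r: "r \<in> {0<..<1}"
  have "2 * r * (1 - r) * y > 0" using r y by simp
  then obtain t where t: "t > 0" "terminant N (of_real (2 * r * (1 - r) * y)) = complex_of_real t" using terminant_pos by blast
  have e: "of_nat N + complex_of_real m - 1/2 = of_real (real N + m - 1/2)" "of_nat N - complex_of_real m - 1/2 = of_real (real N - m - 1/2)" by simp_all
  have p1: "complex_of_real r powr (of_nat N + complex_of_real m - 1/2) = of_real (r powr (real N + m - 1/2))"
    unfolding e by (rule powr_of_real) (use r in auto)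
  have p2: "complex_of_real (1 - r) powr (of_nat N - complex_of_real m - 1/2) = of_real ((1 - r) powr (real N - m - 1/2))"
    unfolding e by (rule powr_of_real) (use r in auto)
  show "\<exists>s>0. complex_of_real r powr (of_nat N + complex_of_real m - 1/2) *
     of_real (1 - r) powr (of_nat N - complex_of_real m - 1/2) * terminant N (of_real (2 * r * (1 - r)) * complex_of_real y) = complex_of_real s"
    unfolding p1 p2 of_real_mult[symmetric] t(2)
    by (rule exI[of _ "r powr (real N + m - 1/2) * (1 - r) powr (real N - m - 1/2) * t"]) (use r t in simp)
qed auto

text \<open>All kernels are positive for real parameters and positive \<open>x\<close>, so the sign
  comes from the prefactor alone; by \<open>a_coeff_Gamma_real\<close> the coefficient
  \<open>a_coeff N m\<close> has the same sign factor.\<close>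

lemma legendre_rem_sign:
  fixes m n x :: real
  assumes m: "\<bar>m\<bar> < real N + 1/2" and n: "n > real N - 1/2" and x: "x > 0"
  shows "\<exists>r>0. legendre_rem N (of_real x) (of_real m) (of_real n) = complex_of_real ((-1) ^ N * cos (pi * m) * r)"
proof -
  have "\<exists>r>0. (LINT t:{0<..}|lborel. of_real t powr (complex_of_real n - of_nat N - 1/2) * of_real (exp (- t)) * terminant_beta N (of_real m) (of_real x / of_real t)) = complex_of_real r"
  proof (rule set_integral_of_real_pos)
    show "set_integrable lborel {0<..} (\<lambda>t. of_real t powr (complex_of_real n - of_nat N - 1/2) * of_real (exp (- t)) * terminant_beta N (of_real m) (of_real x / of_real t))"
      by (rule legendre_rem_integrable) (use m n x in auto)
    fix t :: real assume t: "t \<in> {0<..}"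
    then have "x / t > 0" using x by simp
    then obtain s where s: "s > 0" "terminant_beta N (of_real m) (of_real (x / t)) = complex_of_real s" using terminant_beta_pos[OF m] by blast
    have e: "complex_of_real n - of_nat N - 1/2 = of_real (n - real N - 1/2)" by simp
    have p: "complex_of_real t powr (complex_of_real n - of_nat N - 1/2) = of_real (t powr (n - real N - 1/2))"
      unfolding e by (rule powr_of_real) (use t in auto)
    show "\<exists>r>0. of_real t powr (complex_of_real n - of_nat N - 1/2) * of_real (exp (- t)) * terminant_beta N (of_real m) (of_real x / of_real t) = complex_of_real r"
      unfolding p of_real_divide[symmetric] s(2) of_real_mult[symmetric]
      by (rule exI[of _ "t powr (n - real N - 1/2) * exp (- t) * s"]) (use t s in simp)
  qed auto
  then obtain r where r: "r > 0" "(LINT t:{0<..}|lborel. of_real t powr (complex_of_real n - of_nat N - 1/2) * of_real (exp (- t)) * terminant_beta N (of_real m) (of_real x / of_real t)) = complex_of_real r" by blast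
  have "legendre_rem N (of_real x) (of_real m) (of_real n) = complex_of_real ((-1) ^ N * cos (pi * m) * (2 ^ N / pi powr (3/2) * x ^ N * r))"
    unfolding legendre_rem_def r(2) of_real_cos_pi by simp
  moreover have "2 ^ N / pi powr (3/2) * x ^ N * r > 0" using r x by simp
  ultimately show ?thesis by blast
qed

lemma norm_legendre_rem_le_1:
  assumes \<mu>: "\<bar>Re \<mu>\<bar> < real N + 1/2" and \<nu>: "Re \<nu> > real N - 1/2" and x: "Re x \<ge> 0"
  shows "norm (legendre_rem N x \<mu> \<nu>) \<le> norm (cos (of_real pi * \<mu>)) * a_cos_ratio N (Re \<mu>) *
           Gamma (Re \<nu> - real N + 1/2) * norm x ^ N"
proof -
  have "norm (terminant N (of_real c * x)) \<le> Gamma (real N + 1/2) * 1" if "c > 0" for c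
    using norm_terminant_le_Re[of "of_real c * x" N] that x by simp
  from norm_legendre_rem_le[OF \<mu> \<nu> this] show ?thesis by simp
qed

lemma norm_legendre_rem_le_chi:
  assumes \<mu>: "\<bar>Re \<mu>\<bar> < real N + 1/2" and \<nu>: "Re \<nu> > real N - 1/2" and x: "x \<notin> \<real>\<^sub>\<le>\<^sub>0"
  shows "norm (legendre_rem N x \<mu> \<nu>) \<le> norm (cos (of_real pi * \<mu>)) * a_cos_ratio N (Re \<mu>) *
           Gamma (Re \<nu> - real N + 1/2) * norm x ^ N * (1 + chi (real N + 1/2))"
  by (rule norm_legendre_rem_le[OF \<mu> \<nu>], rule norm_terminant_le_chi, rule of_real_mult_notin_nonpos_Reals[OF x])

lemma norm_legendre_rem_le_Im:
  assumes \<mu>: "\<bar>Re \<mu>\<bar> < real N + 1/2" and \<nu>: "Re \<nu> > real N - 1/2" and x: "Im x \<noteq> 0"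
  shows "norm (legendre_rem N x \<mu> \<nu>) \<le> norm (cos (of_real pi * \<mu>)) * a_cos_ratio N (Re \<mu>) *
           Gamma (Re \<nu> - real N + 1/2) * norm x ^ N * (norm x / \<bar>Im x\<bar>)"
proof (rule norm_legendre_rem_le[OF \<mu> \<nu>])
  fix c :: real assume c: "c > 0"
  have "norm (of_real c * x) / \<bar>Im (of_real c * x)\<bar> = norm x / \<bar>Im x\<bar>" using c by (simp add: norm_mult abs_mult)
  moreover have "Im (of_real c * x) \<noteq> 0" using c x by simp
  ultimately show "norm (terminant N (of_real c * x)) \<le> Gamma (real N + 1/2) * (norm x / \<bar>Im x\<bar>)"
    using norm_terminant_le_Im[of "of_real c * x" N] by simp
qed

lemma inverse_minus_exp_div_sinh: "inverse (- exp (- \<xi>) / sinh \<xi>) = (1 - exp (2 * \<xi>)) / (2 :: complex)"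
  using inverse_exp_div_sinh[of "- \<xi>"] by simp

lemma norm_over_Im_inverse: "norm (inverse u) / \<bar>Im (inverse u)\<bar> = norm u / \<bar>Im u\<bar>"
proof (cases "u = 0")
  case False
  have "Im (inverse u) = - Im u / (norm u)\<^sup>2" by (simp add: cmod_power2)
  then have "\<bar>Im (inverse u)\<bar> = \<bar>Im u\<bar> / (norm u * norm u)" by (simp only: abs_divide abs_minus_cancel power2_eq_square abs_mult abs_norm_cancel)
  then show ?thesis unfolding norm_inverse using False by (simp add: inverse_eq_divide)
qed simp

text \<open>The quotient \<open>norm x / \<bar>Im x\<bar>\<close> is invariant under inversion, and
  \<open>1 / x = (1 - exp (2 * \<xi>)) / 2\<close>; cancelling \<open>exp (2 * Re \<xi>)\<close>
  between numerator and denominator gives the form with the cosecant.\<close>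

lemma norm_over_Im_minus_exp_div_sinh:
  "norm (- exp (- \<xi>) / sinh \<xi>) / \<bar>Im (- exp (- \<xi>) / sinh \<xi>)\<bar> = norm (1 - exp (- 2 * \<xi>)) * \<bar>1 / sin (2 * Im \<xi>)\<bar>"
proof -
  define E where "E = exp (2 * Re \<xi>)"
  have E0: "E > 0" by (simp add: E_def)
  have i: "Im (exp (2 * \<xi>)) = E * sin (2 * Im \<xi>)" by (simp add: Im_exp E_def)
  have "1 - exp (2 * \<xi>) = - (exp (2 * \<xi>) * (1 - exp (- 2 * \<xi>)))" by (simp add: algebra_simps exp_minus)
  then have n: "norm (1 - exp (2 * \<xi>)) = E * norm (1 - exp (- 2 * \<xi>))" by (simp only: norm_minus_cancel norm_mult norm_exp_eq_Re) (simp add: E_def)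
  have "norm (- exp (- \<xi>) / sinh \<xi>) / \<bar>Im (- exp (- \<xi>) / sinh \<xi>)\<bar> = norm ((1 - exp (2 * \<xi>)) / 2) / \<bar>Im ((1 - exp (2 * \<xi>)) / 2)\<bar>"
    unfolding inverse_minus_exp_div_sinh[symmetric] by (rule norm_over_Im_inverse[symmetric])
  also have "\<dots> = norm (1 - exp (2 * \<xi>)) / \<bar>Im (exp (2 * \<xi>))\<bar>" by (simp add: norm_divide)
  also have "\<dots> = norm (1 - exp (- 2 * \<xi>)) * \<bar>1 / sin (2 * Im \<xi>)\<bar>"
    unfolding n i using E0 by (simp add: abs_mult)
  finally show ?thesis .
qed

text \<open>The case distinction in \<open>P1_factor\<close> describes the position of the argument
  \<open>x\<close>: \<open>Re (exp (2 * \<xi>)) \<le> 1\<close> means that \<open>1 / x\<close>,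
  hence \<open>x\<close>, lies in the closed right half plane, where the kernel is at most 1 in
  modulus. Otherwise the angle bound and the bound uniform up to the cut compete.\<close>

lemma norm_legendre_rem_P1:
  assumes \<mu>: "\<bar>Re \<mu>\<bar> < real N + 1/2" and \<nu>: "Re \<nu> > real N - 1/2" and \<xi>: "\<xi> \<in> D1" "Im \<xi> \<noteq> 0"
  shows "norm (legendre_rem N (- exp (- \<xi>) / sinh \<xi>) \<mu> \<nu>) \<le> norm (cos (of_real pi * \<mu>)) * a_cos_ratio N (Re \<mu>) *
           Gamma (Re \<nu> - real N + 1/2) * norm (exp (- \<xi>) / sinh \<xi>) ^ N * P1_factor N \<xi>"
proof -
  let ?x = "- exp (- \<xi>) / sinh \<xi>"
  have nx: "norm (exp (- \<xi>) / sinh \<xi>) = norm ?x" by (simp add: norm_divide)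
  have y: "0 < \<bar>Im \<xi>\<bar>" "\<bar>Im \<xi>\<bar> < pi" using \<xi> by (auto simp: D1_def)
  note c = norm_legendre_rem_le_chi[OF \<mu> \<nu> minus_exp_div_sinh_notin_nonpos_Reals[OF y]]
  show ?thesis
  proof (cases "Re (exp (2 * \<xi>)) \<le> 1")
    case True
    have "Re ?x \<ge> 0"
    proof -
      have "Re (inverse ?x) \<ge> 0" unfolding inverse_minus_exp_div_sinh using True by simp
      then have "Re (1 * cnj ?x) \<ge> 0" unfolding inverse_eq_divide Re_complex_div_ge_0 .
      then show ?thesis unfolding mult_1 cnj.sel .
    qed
    from norm_legendre_rem_le_1[OF \<mu> \<nu> this] show ?thesis unfolding nx P1_factor_def using True by simp
  next
    case False
    show ?thesis
    proof (cases "sin (2 * Im \<xi>) = 0")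
      case True
      then show ?thesis using c False unfolding nx P1_factor_def by simp
    next
      case s: False
      have "Im (inverse ?x) \<noteq> 0" unfolding inverse_minus_exp_div_sinh using s by (simp add: Im_exp)
      then have "Im (1 * cnj ?x) \<noteq> 0" unfolding inverse_eq_divide Im_complex_div_eq_0 .
      then have "Im ?x \<noteq> 0" unfolding mult_1 cnj.sel neg_equal_0_iff_equal .
      from norm_legendre_rem_le_Im[OF \<mu> \<nu> this]
      have d: "norm (legendre_rem N ?x \<mu> \<nu>) \<le> norm (cos (of_real pi * \<mu>)) * a_cos_ratio N (Re \<mu>) *
           Gamma (Re \<nu> - real N + 1/2) * norm ?x ^ N * (norm (1 - exp (- 2 * \<xi>)) * \<bar>1 / sin (2 * Im \<xi>)\<bar>)"
        unfolding norm_over_Im_minus_exp_div_sinh .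
      have P: "P1_factor N \<xi> = min (norm (1 - exp (- 2 * \<xi>)) * \<bar>1 / sin (2 * Im \<xi>)\<bar>) (1 + chi (real N + 1/2))"
        unfolding P1_factor_def using False s by simp
      show ?thesis unfolding nx P min_def using c d by (simp only: split: if_split) blast
    qed
  qed
qed

lemma D1_nonzero:
  assumes "\<xi> \<in> D1"
  shows "sinh \<xi> \<noteq> 0" "sinh (\<xi>/2) \<noteq> 0" "csqrt (2 * of_real pi * sinh \<xi>) \<noteq> 0"
proof -
  show 1: "sinh \<xi> \<noteq> 0" using sinh_D1_notin_nonpos_Reals[OF assms] by auto
  then show "csqrt (2 * of_real pi * sinh \<xi>) \<noteq> 0" by simp
  show "sinh (\<xi>/2) \<noteq> 0" using legendre_P_cosh(2)[OF assms] by (auto simp: coth_half_def)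
qed

lemma legendre_P_expansion:
  assumes \<mu>: "\<bar>Re \<mu>\<bar> < min (real N) (real M) + 1/2" and \<nu>: "Re \<nu> > max (real N) (real M) - 1/2"
    and \<sigma>: "\<sigma> = 1 \<or> \<sigma> = (- 1 :: real)" and \<xi>: "\<xi> \<in> D1" "0 < \<sigma> * Im \<xi>"
  shows "Gamma (\<nu> - \<mu> + 1) * csqrt (2 * of_real pi * sinh \<xi>) * legendre_P \<nu> \<mu> (cosh \<xi>) = legendre_expansion \<sigma> N M \<xi> \<mu> \<nu>"
proof -
  have "\<sigma> * Im \<xi> < pi" using \<sigma> \<xi> by (auto simp: D1_def)
  from legendre_expansion_strip[OF \<mu> \<nu> \<sigma> \<xi>(2) this] show ?thesis
    unfolding legendre_P_cosh(1)[OF \<xi>(1)] by (simp only: mult.assoc)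
qed

section \<open>Boundary values on the positive axis\<close>

lemma open_D1: "open D1"
proof -
  have eq: "D1 = {\<xi>. 0 < Re \<xi>} \<inter> ({\<xi>. Im \<xi> < pi} \<inter> {\<xi>. - pi < Im \<xi>})" by (auto simp: D1_def)
  show ?thesis unfolding eq by (intro open_Int open_halfspace_Re_gt open_halfspace_Im_lt open_halfspace_Im_gt)
qed

text \<open>The offsets satisfy \<open>1 / (n + 1) \<le> 1 < pi\<close>, so the sequence stays in
  \<open>D1\<close>. Only \<open>N\<close> is referred to, although the existence of the limit is
  derived from the expansion containing both \<open>N\<close> and \<open>M\<close>.\<close>

definition legendre_R1_side :: "real \<Rightarrow> nat \<Rightarrow> complex \<Rightarrow> complex \<Rightarrow> complex \<Rightarrow> complex" where
  "legendre_R1_side \<sigma> N \<xi> \<mu> \<nu> = lim (\<lambda>n. legendre_rem N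
     (- exp (- (\<xi> + \<i> * of_real (\<sigma> / (real n + 1)))) / sinh (\<xi> + \<i> * of_real (\<sigma> / (real n + 1)))) \<mu> \<nu>)"

text \<open>On the positive axis the argument of the remainder lies on the cut, and averaging the two
  boundary values turns the two connection coefficients into their mean, which is the sine.\<close>

definition legendre_R1 :: "nat \<Rightarrow> complex \<Rightarrow> complex \<Rightarrow> complex \<Rightarrow> complex" where
  "legendre_R1 N \<xi> \<mu> \<nu> = (if Im \<xi> = 0 then (legendre_R1_side 1 N \<xi> \<mu> \<nu> + legendre_R1_side (- 1) N \<xi> \<mu> \<nu>) / 2
     else legendre_rem N (- exp (- \<xi>) / sinh \<xi>) \<mu> \<nu>)"

definition legendre_R2 :: "nat \<Rightarrow> complex \<Rightarrow> complex \<Rightarrow> complex \<Rightarrow> complex" where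
  "legendre_R2 M \<xi> \<mu> \<nu> = legendre_rem M (exp \<xi> / sinh \<xi>) \<mu> \<nu>"

text \<open>Solving the expansion for the first remainder gives \<open>\<Phi>\<close>, all of whose
  ingredients are holomorphic on the whole of \<open>D1\<close>; the boundary values of the
  remainder therefore exist and are values of \<open>\<Phi>\<close>. The bound survives the limit
  because \<open>1 + chi\<close> is uniform up to the cut.\<close>

lemma legendre_R1_side:
  assumes \<mu>: "\<bar>Re \<mu>\<bar> < min (real N) (real M) + 1/2" and \<nu>: "Re \<nu> > max (real N) (real M) - 1/2"
    and \<sigma>: "\<sigma> = 1 \<or> \<sigma> = (- 1 :: real)" and \<xi>: "\<xi> \<in> D1" "Im \<xi> = 0"
  shows "Gamma (\<nu> - \<mu> + 1) * csqrt (2 * of_real pi * sinh \<xi>) * legendre_P \<nu> \<mu> (cosh \<xi>) =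
     exp ((\<nu> + 1/2) * \<xi>) * ((\<Sum>n<N. P1_term n \<xi> \<mu> \<nu>) + legendre_R1_side \<sigma> N \<xi> \<mu> \<nu>) +
     of_real \<sigma> * \<i> * exp (- (of_real (\<sigma> * pi) * \<i> * \<mu>)) * exp (- (\<nu> + 1/2) * \<xi>) *
       ((\<Sum>n<M. P2_term n \<xi> \<mu> \<nu>) + legendre_R2 M \<xi> \<mu> \<nu>)" (is ?id)
    and "norm (legendre_R1_side \<sigma> N \<xi> \<mu> \<nu>) \<le> norm (cos (of_real pi * \<mu>)) * a_cos_ratio N (Re \<mu>) *
           Gamma (Re \<nu> - real N + 1/2) * norm (exp (- \<xi>) / sinh \<xi>) ^ N * (1 + chi (real N + 1/2))" (is ?bound)
proof -
  have \<nu>N: "Re \<nu> > real N - 1/2" and \<nu>M: "Re \<nu> > real M - 1/2" using \<nu> by auto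
  have \<mu>N: "\<bar>Re \<mu>\<bar> < real N + 1/2" and \<mu>M: "\<bar>Re \<mu>\<bar> < real M + 1/2" using \<mu> by auto
  have "Re \<nu> > - 1/2" using \<nu>N by linarith
  then have \<nu>1: "2 * \<nu> + 1 \<noteq> 0" by (auto simp: complex_eq_iff)
  define X where "X = (\<lambda>\<xi>. - exp (- \<xi>) / sinh (\<xi> :: complex))"
  define G where "G = Gamma (\<nu> - \<mu> + 1)"
  define C where "C = of_real \<sigma> * \<i> * exp (- (of_real (\<sigma> * pi) * \<i> * \<mu>))"
  define \<Phi> where "\<Phi> \<xi> = (G * csqrt (2 * of_real pi * sinh \<xi>) * (coth_half \<xi> powr \<mu> * hyp2F1_reg (\<nu> + 1) (- \<nu>) (1 - \<mu>) ((1 - cosh \<xi>) / 2)) -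
     C * exp (- (\<nu> + 1/2) * \<xi>) * ((\<Sum>n<M. P2_term n \<xi> \<mu> \<nu>) + legendre_rem M (exp \<xi> / sinh \<xi>) \<mu> \<nu>)) / exp ((\<nu> + 1/2) * \<xi>) -
     (\<Sum>n<N. P1_term n \<xi> \<mu> \<nu>)" for \<xi>
  have XD: "X holomorphic_on D1"
    unfolding X_def by (intro holomorphic_intros holomorphic_on_sinh_cosh) (rule D1_nonzero)
  have hol: "\<Phi> holomorphic_on D1"
    unfolding \<Phi>_def P1_term_def P2_term_def
  proof (intro holomorphic_intros holomorphic_on_sinh_cosh)
    show "coth_half holomorphic_on D1"
      unfolding coth_half_def by (intro holomorphic_intros holomorphic_on_sinh_cosh) ((rule D1_nonzero, assumption) | simp)+
    show "coth_half z \<notin> \<real>\<^sub>\<le>\<^sub>0" if "z \<in> D1" for z using legendre_P_cosh(2)[OF that] by (rule notin_nonpos_Reals_Re)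
    show "2 * of_real pi * sinh z \<notin> \<real>\<^sub>\<le>\<^sub>0" if "z \<in> D1" for z using that by (rule sinh_D1_notin_nonpos_Reals)
    show "sinh z \<noteq> 0" if "z \<in> D1" for z using that by (rule D1_nonzero)
    show "sinh z \<noteq> 0" if "z \<in> D1" for z using that by (rule D1_nonzero)
    show "exp ((\<nu> + 1/2) * z) \<noteq> 0" if "z \<in> D1" for z by simp
    show "(\<lambda>\<xi>. hyp2F1_reg (\<nu> + 1) (- \<nu>) (1 - \<mu>) ((1 - cosh \<xi>) / 2)) holomorphic_on D1"
    proof (rule holomorphic_on_compose_gen[OF _ hyp2F1_reg_props(1)[OF \<nu>1], unfolded o_def])
      show "(\<lambda>\<xi>. (1 - cosh \<xi>) / 2) holomorphic_on D1" by (intro holomorphic_intros holomorphic_on_sinh_cosh) auto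
      show "(\<lambda>\<xi>. (1 - cosh \<xi>) / 2) ` D1 \<subseteq> slit_plane"
        by (rule image_subsetI, rule cosh_arg_slit_plane) (auto simp: D1_def)
    qed
    show "(\<lambda>\<xi>. legendre_rem M (exp \<xi> / sinh \<xi>) \<mu> \<nu>) holomorphic_on D1"
    proof (rule holomorphic_on_compose_gen[OF _ legendre_rem_holomorphic[OF \<mu>M \<nu>M], unfolded o_def])
      show "(\<lambda>\<xi>. exp \<xi> / sinh \<xi>) holomorphic_on D1"
        by (intro holomorphic_intros holomorphic_on_sinh_cosh) (rule D1_nonzero)
      show "(\<lambda>\<xi>. exp \<xi> / sinh \<xi>) ` D1 \<subseteq> - \<real>\<^sub>\<le>\<^sub>0"
      proof (rule image_subsetI)
        fix z assume "z \<in> D1"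
        then have "Re (exp z / sinh z) > 0" by (intro Re_exp_div_sinh_pos) (simp add: D1_def)
        then have "exp z / sinh z \<notin> \<real>\<^sub>\<le>\<^sub>0" by (rule notin_nonpos_Reals_Re)
        then show "exp z / sinh z \<in> - \<real>\<^sub>\<le>\<^sub>0" by blast
      qed
    qed
  qed
  define s where "s n = \<xi> + \<i> * complex_of_real (\<sigma> / (real n + 1))" for n
  have ims: "Im (s n) = \<sigma> / (real n + 1)" "Re (s n) = Re \<xi>" for n using \<xi> by (simp_all add: s_def)
  have sD: "s n \<in> D1" "0 < \<sigma> * Im (s n)" for n
  proof -
    have "\<bar>1 / (real n + 1)\<bar> \<le> 1" by simp
    then have "\<bar>1 / (real n + 1)\<bar> < pi" using pi_gt3 by linarith
    then show "s n \<in> D1" "0 < \<sigma> * Im (s n)" using \<xi> \<sigma> unfolding D1_def mem_Collect_eq ims by auto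
  qed
  have "(\<lambda>n. 1 / (real n + 1)) \<longlonglongrightarrow> 0"
    using LIMSEQ_inverse_real_of_nat by (simp add: inverse_eq_divide add.commute)
  then have "(\<lambda>n. \<xi> + \<i> * complex_of_real (\<sigma> * (1 / (real n + 1)))) \<longlonglongrightarrow> \<xi> + \<i> * complex_of_real (\<sigma> * 0)" by (intro tendsto_intros)
  then have sl: "s \<longlonglongrightarrow> \<xi>" unfolding s_def by simp
  have rem: "legendre_rem N (X (s n)) \<mu> \<nu> = \<Phi> (s n)" for n
  proof -
    have "G * csqrt (2 * of_real pi * sinh (s n)) * (coth_half (s n) powr \<mu> * hyp2F1_reg (\<nu> + 1) (- \<nu>) (1 - \<mu>) ((1 - cosh (s n)) / 2)) =
      exp ((\<nu> + 1/2) * s n) * ((\<Sum>k<N. P1_term k (s n) \<mu> \<nu>) + legendre_rem N (X (s n)) \<mu> \<nu>) +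
      C * exp (- (\<nu> + 1/2) * s n) * ((\<Sum>k<M. P2_term k (s n) \<mu> \<nu>) + legendre_rem M (exp (s n) / sinh (s n)) \<mu> \<nu>)"
      using legendre_P_expansion[OF \<mu> \<nu> \<sigma> sD] unfolding legendre_P_cosh(1)[OF sD(1)] legendre_expansion_def G_def C_def X_def .
    then show ?thesis unfolding \<Phi>_def by simp
  qed
  have iso: "isCont \<Phi> \<xi>" "isCont X \<xi>"
    using continuous_on_interior[OF holomorphic_on_imp_continuous_on[OF hol]] continuous_on_interior[OF holomorphic_on_imp_continuous_on[OF XD]]
      \<xi>(1) open_D1 by (simp_all add: interior_open)
  have lim\<Phi>: "(\<lambda>n. legendre_rem N (X (s n)) \<mu> \<nu>) \<longlonglongrightarrow> \<Phi> \<xi>"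
    unfolding rem using isCont_tendsto_compose[OF iso(1) sl] .
  then have side: "legendre_R1_side \<sigma> N \<xi> \<mu> \<nu> = \<Phi> \<xi>"
    unfolding legendre_R1_side_def X_def s_def by (rule limI)
  have e0: "exp ((\<nu> + 1/2) * \<xi>) * (a / exp ((\<nu> + 1/2) * \<xi>)) = a" for a by simp
  have aux: "S + (a / exp ((\<nu> + 1/2) * \<xi>) - S) = a / exp ((\<nu> + 1/2) * \<xi>)" for S a by simp
  show ?id
    unfolding side G_def[symmetric] C_def[symmetric] legendre_R2_def legendre_P_cosh(1)[OF \<xi>(1)] \<Phi>_def aux e0 by simp
  show ?bound
  proof (rule LIMSEQ_le)
    show "(\<lambda>n. norm (legendre_rem N (X (s n)) \<mu> \<nu>)) \<longlonglongrightarrow> norm (legendre_R1_side \<sigma> N \<xi> \<mu> \<nu>)"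
      unfolding side by (intro tendsto_norm lim\<Phi>)
    have "norm (exp (- \<xi>) / sinh \<xi>) = norm (X \<xi>)" unfolding X_def by (simp add: norm_divide)
    then show "(\<lambda>n. norm (cos (of_real pi * \<mu>)) * a_cos_ratio N (Re \<mu>) * Gamma (Re \<nu> - real N + 1/2) *
        norm (X (s n)) ^ N * (1 + chi (real N + 1/2))) \<longlonglongrightarrow>
       norm (cos (of_real pi * \<mu>)) * a_cos_ratio N (Re \<mu>) *
           Gamma (Re \<nu> - real N + 1/2) * norm (exp (- \<xi>) / sinh \<xi>) ^ N * (1 + chi (real N + 1/2))"
      by (simp only:) (intro tendsto_mult tendsto_power tendsto_norm tendsto_const isCont_tendsto_compose[OF iso(2) sl])
    show "\<exists>n0. \<forall>n\<ge>n0. norm (legendre_rem N (X (s n)) \<mu> \<nu>) \<le> norm (cos (of_real pi * \<mu>)) * a_cos_ratio N (Re \<mu>) *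
        Gamma (Re \<nu> - real N + 1/2) * norm (X (s n)) ^ N * (1 + chi (real N + 1/2))"
    proof (intro exI allI impI norm_legendre_rem_le_chi \<mu>N \<nu>N)
      fix n
      have "0 < \<bar>Im (s n)\<bar>" "\<bar>Im (s n)\<bar> < pi" using sD[of n] by (auto simp: D1_def)
      then show "X (s n) \<notin> \<real>\<^sub>\<le>\<^sub>0" unfolding X_def by (rule minus_exp_div_sinh_notin_nonpos_Reals)
    qed
  qed
qed

lemma legendre_P_R1_R2:
  assumes \<mu>: "\<bar>Re \<mu>\<bar> < min (real N) (real M) + 1/2" and \<nu>: "Re \<nu> > max (real N) (real M) - 1/2" and \<xi>: "\<xi> \<in> D1"
  shows "Gamma (\<nu> - \<mu> + 1) * csqrt (2 * of_real pi * sinh \<xi>) * legendre_P \<nu> \<mu> (cosh \<xi>) =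
     exp ((\<nu> + 1/2) * \<xi>) * ((\<Sum>n<N. P1_term n \<xi> \<mu> \<nu>) + legendre_R1 N \<xi> \<mu> \<nu>) +
     C_coeff \<xi> \<mu> * exp (- (\<nu> + 1/2) * \<xi>) * ((\<Sum>n<M. P2_term n \<xi> \<mu> \<nu>) + legendre_R2 M \<xi> \<mu> \<nu>)"
proof (cases "Im \<xi> = 0")
  case True
  define L where "L = Gamma (\<nu> - \<mu> + 1) * csqrt (2 * of_real pi * sinh \<xi>) * legendre_P \<nu> \<mu> (cosh \<xi>)"
  define e f where "e = exp ((\<nu> + 1/2) * \<xi>)" "f = exp (- (\<nu> + 1/2) * \<xi>)"
  note ef = e_f_def
  define S1 where "S1 = (\<Sum>n<N. P1_term n \<xi> \<mu> \<nu>)"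
  define S2 where "S2 = (\<Sum>n<M. P2_term n \<xi> \<mu> \<nu>) + legendre_R2 M \<xi> \<mu> \<nu>"
  define p q where "p = legendre_R1_side 1 N \<xi> \<mu> \<nu>" "q = legendre_R1_side (- 1) N \<xi> \<mu> \<nu>"
  note pq = p_q_def
  define a b where "a = exp (- (of_real pi * \<i> * \<mu>))" "b = exp (of_real pi * \<i> * \<mu>)"
  note ab = a_b_def
  have b': "exp (- (of_real (- 1 * pi) * \<i> * \<mu>)) = b" unfolding ab by simp
  have 1: "L = e * (S1 + p) + \<i> * a * f * S2"
    using legendre_R1_side(1)[OF \<mu> \<nu> _ \<xi> True, of 1] unfolding L_def[symmetric] ef[symmetric] S1_def[symmetric] S2_def[symmetric] pq[symmetric] mult_1 of_real_1 ab[symmetric] by simp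
  have 2: "L = e * (S1 + q) + - \<i> * b * f * S2"
    using legendre_R1_side(1)[OF \<mu> \<nu> _ \<xi> True, of "- 1"] unfolding L_def[symmetric] ef[symmetric] S1_def[symmetric] S2_def[symmetric] pq[symmetric] b' by simp
  have s: "sin (of_real pi * \<mu>) = \<i> * (a - b) / 2"
  proof -
    have "sin (of_real pi * \<mu>) = (b - a) / (2 * \<i>)" unfolding sin_exp_eq ab by (simp add: mult_ac)
    then have "b - a = \<i> * (2 * sin (of_real pi * \<mu>))" by simp
    then have "a - b = - (\<i> * (2 * sin (of_real pi * \<mu>)))" by (metis minus_diff_eq)
    then show ?thesis by simp
  qed
  have "L = (L + L) / 2" by simp
  also have "\<dots> = (e * (S1 + p) + \<i> * a * f * S2 + (e * (S1 + q) + - \<i> * b * f * S2)) / 2"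
    by (subst 1, subst 2) (rule refl)
  also have "\<dots> = e * (S1 + (p + q) / 2) + \<i> * (a - b) / 2 * f * S2" by (simp add: field_simps)
  finally show ?thesis using True unfolding legendre_R1_def C_coeff_def L_def ef S1_def S2_def pq s by simp
next
  case False
  define \<sigma> :: real where "\<sigma> = (if Im \<xi> > 0 then 1 else - 1)"
  have \<sigma>: "\<sigma> = 1 \<or> \<sigma> = - 1" "0 < \<sigma> * Im \<xi>" using False by (auto simp: \<sigma>_def)
  have C: "of_real \<sigma> * \<i> * exp (- (of_real (\<sigma> * pi) * \<i> * \<mu>)) = C_coeff \<xi> \<mu>"
    using False by (simp add: \<sigma>_def C_coeff_def)
  have "legendre_R1 N \<xi> \<mu> \<nu> = legendre_rem N (- exp (- \<xi>) / sinh \<xi>) \<mu> \<nu>" using False by (simp add: legendre_R1_def)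
  then show ?thesis
    using legendre_P_expansion[OF \<mu> \<nu> \<sigma>(1) \<xi> \<sigma>(2)] unfolding legendre_expansion_def C legendre_R2_def by (simp only:)
qed

lemma norm_legendre_R1_le:
  assumes \<mu>: "\<bar>Re \<mu>\<bar> < real N + 1/2" and \<nu>: "Re \<nu> > real N - 1/2" and \<xi>: "\<xi> \<in> D1"
  shows "norm (legendre_R1 N \<xi> \<mu> \<nu>) \<le> norm (cos (of_real pi * \<mu>)) * a_cos_ratio N (Re \<mu>) *
           Gamma (Re \<nu> - real N + 1/2) * norm (exp (- \<xi>) / sinh \<xi>) ^ N * P1_factor N \<xi>"
proof (cases "Im \<xi> = 0")
  case True
  have "Re (exp (2 * \<xi>)) > 1" using True \<xi> by (simp add: Re_exp D1_def)
  \<comment> \<open>On the positive axis \<open>sin (2 * Im \<xi>) = 0\<close> selects the branch in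
    which the cosecant counts as infinite.\<close>
  then have P: "P1_factor N \<xi> = 1 + chi (real N + 1/2)" using True by (simp add: P1_factor_def)
  let ?p = "legendre_R1_side 1 N \<xi> \<mu> \<nu>" and ?q = "legendre_R1_side (- 1) N \<xi> \<mu> \<nu>"
  \<comment> \<open>The estimate in \<open>legendre_R1_side\<close> is stated along with the full
    expansion; the choice \<open>M = N\<close> turns its conditions into those on \<open>N\<close>
    alone.\<close>
  have \<mu>': "\<bar>Re \<mu>\<bar> < min (real N) (real N) + 1/2" and \<nu>': "Re \<nu> > max (real N) (real N) - 1/2" using \<mu> \<nu> by simp_all
  note b = legendre_R1_side(2)[OF \<mu>' \<nu>' _ \<xi> True]
  have "norm (legendre_R1 N \<xi> \<mu> \<nu>) = norm (?p + ?q) / 2" using True by (simp add: legendre_R1_def norm_divide)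
  also have "\<dots> \<le> (norm ?p + norm ?q) / 2" using norm_triangle_ineq[of ?p ?q] by simp
  finally show ?thesis using b[of 1] b[of "- 1"] unfolding P by simp
next
  case False
  then show ?thesis using norm_legendre_rem_P1[OF \<mu> \<nu> \<xi> False] by (simp add: legendre_R1_def)
qed

lemma norm_legendre_R2_le:
  assumes \<mu>: "\<bar>Re \<mu>\<bar> < real M + 1/2" and \<nu>: "Re \<nu> > real M - 1/2" and \<xi>: "Re \<xi> > 0"
  shows "norm (legendre_R2 M \<xi> \<mu> \<nu>) \<le> norm (cos (of_real pi * \<mu>)) * a_cos_ratio M (Re \<mu>) *
           Gamma (Re \<nu> - real M + 1/2) * norm (exp \<xi> / sinh \<xi>) ^ M"
  unfolding legendre_R2_def by (rule norm_legendre_rem_le_1[OF \<mu> \<nu> less_imp_le[OF Re_exp_div_sinh_pos[OF \<xi>]]])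

text \<open>Remainder and first neglected term are both \<open>(-1) ^ M * cos (pi * m)\<close> times
  a positive number, which settles the sign also when the cosine vanishes. For real parameters the
  general bound is exactly the modulus of that term.\<close>

lemma legendre_R2_real:
  fixes x m n :: real
  assumes x: "x > 0" and m: "\<bar>m\<bar> < real M + 1/2" and n: "n > real M - 1/2"
  shows "legendre_R2 M (of_real x) (of_real m) (of_real n) \<in> \<real>"
    and "norm (legendre_R2 M (of_real x) (of_real m) (of_real n)) \<le> norm (P2_term M (of_real x) (of_real m) (of_real n))"
    and "sgn (Re (legendre_R2 M (of_real x) (of_real m) (of_real n))) = sgn (Re (P2_term M (of_real x) (of_real m) (of_real n)))"
proof -
  define X where "X = exp x / sinh x"
  define K where "K = Gamma (real M + 1/2 + m) * Gamma (real M + 1/2 - m) / (pi * 2 ^ M * fact M)"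
  define G where "G = Gamma (n - real M + 1/2)"
  have X: "X > 0" using x by (simp add: X_def)
  have K: "K > 0" unfolding K_def using m by (intro divide_pos_pos mult_pos_pos Gamma_real_pos) auto
  have G: "G > 0" unfolding G_def using n by (intro Gamma_real_pos) auto
  have cX: "exp (complex_of_real x) / sinh (of_real x) = of_real X"
    unfolding X_def sinh_of_real_complex by (simp add: exp_of_real)
  obtain r where r: "r > 0" "legendre_R2 M (of_real x) (of_real m) (of_real n) = complex_of_real ((-1) ^ M * cos (pi * m) * r)"
    using legendre_rem_sign[OF m n X] unfolding legendre_R2_def cX by blast
  have a: "a_coeff M m = (-1) ^ M * cos (pi * m) * K" unfolding K_def a_coeff_Gamma_real[OF m] by simp
  have cG: "Gamma (complex_of_real n - of_nat M + 1/2) = of_real G"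
    unfolding G_def by (subst Gamma_complex_of_real[symmetric]) simp
  have P: "P2_term M (of_real x) (of_real m) (of_real n) = complex_of_real ((-1) ^ M * cos (pi * m) * (K * G * X ^ M))"
    unfolding P2_term_def cX cG of_real_a_coeff[symmetric] a by simp
  show "legendre_R2 M (of_real x) (of_real m) (of_real n) \<in> \<real>" unfolding r(2) by (rule Reals_of_real)
  have KGX: "K * G * X ^ M > 0" using K G X by simp
  show "sgn (Re (legendre_R2 M (of_real x) (of_real m) (of_real n))) = sgn (Re (P2_term M (of_real x) (of_real m) (of_real n)))"
    unfolding r(2) P Re_complex_of_real sgn_mult[of _ r] sgn_mult[of _ "K * G * X ^ M"] sgn_pos[OF r(1)] sgn_pos[OF KGX] ..
  have "norm (legendre_R2 M (of_real x) (of_real m) (of_real n)) \<le> norm (cos (of_real pi * complex_of_real m)) * a_cos_ratio M (Re (complex_of_real m)) *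
           Gamma (Re (complex_of_real n) - real M + 1/2) * norm (exp (complex_of_real x) / sinh (of_real x)) ^ M"
    by (rule norm_legendre_R2_le) (use m n x in auto)
  also have "\<dots> = \<bar>cos (pi * m)\<bar> * K * G * X ^ M"
    unfolding cX of_real_cos_pi Re_complex_of_real a_cos_ratio_Gamma[OF m] K_def[symmetric] G_def[symmetric] norm_of_real using X by simp
  also have "\<dots> = norm (P2_term M (of_real x) (of_real m) (of_real n))"
    unfolding P norm_of_real abs_mult using K G X by (simp add: abs_power_minus power_abs)
  finally show "norm (legendre_R2 M (of_real x) (of_real m) (of_real n)) \<le> norm (P2_term M (of_real x) (of_real m) (of_real n))" .
qed

text \<open>The witnesses are chosen once for all parameters, the first independent of
  \<open>M\<close> and the second of \<open>N\<close>; this allows the sign statement to be made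
  about the second one with conditions on \<open>M\<close> alone.\<close>

theorem theorem3p1:
  shows "\<exists>R1 R2 :: nat \<Rightarrow> complex \<Rightarrow> complex \<Rightarrow> complex \<Rightarrow> complex.
    (\<forall>\<xi>\<in>D1. \<forall>N M. \<forall>\<mu> \<nu>.
       \<bar>Re \<mu>\<bar> < min (real N + 1/2) (real M + 1/2) \<longrightarrow>
       Re \<nu> > max (real N - 1/2) (real M - 1/2) \<longrightarrow>
         legendre_P \<nu> \<mu> (cosh \<xi>) =
           exp ((\<nu> + 1/2) * \<xi>) / (Gamma (\<nu> - \<mu> + 1) * csqrt (2 * of_real pi * sinh \<xi>)) *
             ((\<Sum>n<N. P1_term n \<xi> \<mu> \<nu>) + R1 N \<xi> \<mu> \<nu>) +
           C_coeff \<xi> \<mu> * exp (- (\<nu> + 1/2) * \<xi>) /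
               (Gamma (\<nu> - \<mu> + 1) * csqrt (2 * of_real pi * sinh \<xi>)) *
             ((\<Sum>m<M. P2_term m \<xi> \<mu> \<nu>) + R2 M \<xi> \<mu> \<nu>) \<and>
         norm (R1 N \<xi> \<mu> \<nu>) \<le>
           norm (cos (of_real pi * \<mu>)) * a_cos_ratio N (Re \<mu>) * Gamma (Re \<nu> - real N + 1/2) *
             norm (exp (- \<xi>) / sinh \<xi>) ^ N * P1_factor N \<xi> \<and>
         norm (R2 M \<xi> \<mu> \<nu>) \<le>
           norm (cos (of_real pi * \<mu>)) * a_cos_ratio M (Re \<mu>) * Gamma (Re \<nu> - real M + 1/2) *
             norm (exp \<xi> / sinh \<xi>) ^ M) \<and>
    (\<forall>M. \<forall>x \<mu> \<nu> :: real.
       x > 0 \<longrightarrow> \<bar>\<mu>\<bar> < real M + 1/2 \<longrightarrow> \<nu> > real M - 1/2 \<longrightarrow>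
         R2 M (of_real x) (of_real \<mu>) (of_real \<nu>) \<in> \<real> \<and>
         norm (R2 M (of_real x) (of_real \<mu>) (of_real \<nu>)) \<le>
           norm (P2_term M (of_real x) (of_real \<mu>) (of_real \<nu>)) \<and>
         sgn (Re (R2 M (of_real x) (of_real \<mu>) (of_real \<nu>))) =
           sgn (Re (P2_term M (of_real x) (of_real \<mu>) (of_real \<nu>))))"
proof (rule exI[of _ legendre_R1], rule exI[of _ legendre_R2], rule conjI; intro ballI allI impI)
  fix \<xi> N M \<mu> \<nu>
  assume \<xi>: "\<xi> \<in> D1" and \<mu>: "\<bar>Re \<mu>\<bar> < min (real N + 1/2) (real M + 1/2)" and \<nu>: "Re \<nu> > max (real N - 1/2) (real M - 1/2)"
  have \<mu>': "\<bar>Re \<mu>\<bar> < min (real N) (real M) + 1/2" and \<nu>': "Re \<nu> > max (real N) (real M) - 1/2" using \<mu> \<nu> by auto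
  define L where "L = Gamma (\<nu> - \<mu> + 1) * csqrt (2 * of_real pi * sinh \<xi>)"
  \<comment> \<open>The two conditions together give \<open>Re (\<nu> - \<mu> + 1) > 0\<close>, so
    the gamma factor is away from its poles and nonzero, and one may divide by
    \<open>L\<close>.\<close>
  have "\<nu> - \<mu> + 1 \<notin> \<int>\<^sub>\<le>\<^sub>0" by (rule Gamma_arg_notin_nonpos_Ints) (use \<mu> \<nu> in auto)
  then have "Gamma (\<nu> - \<mu> + 1) \<noteq> 0" by (simp add: Gamma_eq_zero_iff)
  then have L: "L \<noteq> 0" unfolding L_def using D1_nonzero(3)[OF \<xi>] by (rule no_zero_divisors)
  have div: "p = a / L * A + b / L * B" if "L * p = a * A + b * B" for p a A b B
  proof -
    have "p = (L * p) / L" using L by simp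
    then show ?thesis unfolding that by (simp add: add_divide_distrib)
  qed
  show "legendre_P \<nu> \<mu> (cosh \<xi>) =
           exp ((\<nu> + 1/2) * \<xi>) / (Gamma (\<nu> - \<mu> + 1) * csqrt (2 * of_real pi * sinh \<xi>)) *
             ((\<Sum>n<N. P1_term n \<xi> \<mu> \<nu>) + legendre_R1 N \<xi> \<mu> \<nu>) +
           C_coeff \<xi> \<mu> * exp (- (\<nu> + 1/2) * \<xi>) /
               (Gamma (\<nu> - \<mu> + 1) * csqrt (2 * of_real pi * sinh \<xi>)) *
             ((\<Sum>m<M. P2_term m \<xi> \<mu> \<nu>) + legendre_R2 M \<xi> \<mu> \<nu>) \<and>
         norm (legendre_R1 N \<xi> \<mu> \<nu>) \<le>
           norm (cos (of_real pi * \<mu>)) * a_cos_ratio N (Re \<mu>) * Gamma (Re \<nu> - real N + 1/2) *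
             norm (exp (- \<xi>) / sinh \<xi>) ^ N * P1_factor N \<xi> \<and>
         norm (legendre_R2 M \<xi> \<mu> \<nu>) \<le>
           norm (cos (of_real pi * \<mu>)) * a_cos_ratio M (Re \<mu>) * Gamma (Re \<nu> - real M + 1/2) *
             norm (exp \<xi> / sinh \<xi>) ^ M"
    unfolding L_def[symmetric]
  proof (intro conjI div norm_legendre_R1_le norm_legendre_R2_le \<xi>)
    show "L * legendre_P \<nu> \<mu> (cosh \<xi>) = exp ((\<nu> + 1/2) * \<xi>) * ((\<Sum>n<N. P1_term n \<xi> \<mu> \<nu>) + legendre_R1 N \<xi> \<mu> \<nu>) +
      C_coeff \<xi> \<mu> * exp (- (\<nu> + 1/2) * \<xi>) * ((\<Sum>m<M. P2_term m \<xi> \<mu> \<nu>) + legendre_R2 M \<xi> \<mu> \<nu>)"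
      unfolding L_def by (rule legendre_P_R1_R2[OF \<mu>' \<nu>' \<xi>])
  qed (use \<mu> \<nu> \<xi> in \<open>auto simp: D1_def\<close>)
qed (intro conjI legendre_R2_real; assumption)+

end
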